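(* Let $A$ be a Dedekind domain whose fraction field $K$ has characteristic $0$, let $\mathfrak p$ be a non-zero prime ideal of $A$, and assume that the residue field $k=A/\mathfrak p$ has characteristic $p>0$. Let $F(x,y)\in A[x,y]$ be a polynomial of degree $d\ge1$, monic in $y$ and indecomposable in $\overline K[x,y]$. Let $\Delta_0(\lambda),\Delta_F(\lambda)\in A[\lambda]$ be the polynomials attached to $F$ as defined in the context. Assume that the reduced polynomial $\widetilde\Delta_0(\lambda)\,\widetilde\Delta_F(\lambda)$ is non-zero in $k[\lambda]$ and that $p>\deg_y(F)$. Then $\widetilde F(x,y)$ is indecomposable in $\overline k[x,y]$.
   Context: A tilde denotes reduction modulo $\mathfrak p$, i.e. the image under $A\to k=A/\mathfrak p$ (applied to coefficients for polynomials). $\overline K$ and $\overline k$ are algebraic closures. For an algebraically closed field $\Omega$, a non-constant polynomial $F\in\Omega[x,y]$ is indecomposable in $\Omega[x,y]$ if it is not of the form $u(H(x,y))$ with $H\in\Omega[x,y]$, $u\in\Omega[t]$, $\deg u\ge2$. Let $\lambda$ be an indeterminate. Define: - $\Delta_F(x,\lambda)=\mathrm{disc}_y(F(x,y)-\lambda)\in A[x,\lambda]$, the discriminant with respect to $y$. - $\Delta_F^{\rm red}(x,\lambda)$, the product of all distinct irreducible factors of $\Delta_F(x,\lambda)$ in $K(\lambda)[x]$, normalized as follows: $$\Delta_F^{\rm red}(x,\lambda)=c(\lambda)\,\frac{\Delta_F(x,\lambda)}{\gcd\bigl(\Delta_F(x,\lambda),(\Delta_F)'_x(x,\lambda)\bigr)},$$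 where $(\Delta_F)'_x$ is the derivative with respect to $x$, the gcd is calculated in $K(\lambda)[x]$, and $c(\lambda)\in K(\lambda)$ is the rational function, defined up to an invertible element of $A$, that makes $\Delta_F^{\rm red}(x,\lambda)$ a primitive polynomial in $A[\lambda][x]$. - $\Delta_F(\lambda)=\mathrm{disc}_x(\Delta_F^{\rm red}(x,\lambda))$, a non-zero element of $A[\lambda]$. - $\Delta_0(\lambda)\in A[\lambda]$, the coefficient of the highest-degree monomial in $x$ of $\Delta_F(x,\lambda)$, viewed as an element of $A[\lambda][x]$. *)

theory Defs
  imports
    "Berlekamp_Zassenhaus.Unique_Factorization_Poly"
    "Subresultants.Resultant_Prelim"
    "HOL-Algebra.Algebraic_Closure_Type"
begin

(* The theories on rings with explicit carriers define constants of the same names. *)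
hide_const (open) module.smult UnivPoly.coeff UnivPoly.monom Polynomials.degree Polynomials.lead_coeff

text \<open>
  Bivariate polynomials in \<open>x\<close>, \<open>y\<close> are elements of \<^typ>\<open>'a poly poly\<close>: the outer variable is
  \<open>y\<close>, so that the coefficients are polynomials in \<open>x\<close>.
\<close>

section \<open>Dedekind domains\<close>

text \<open>
  Fields are not excluded, but they have no non-zero prime ideal.
\<close>

definition integrally_closed :: "'a::idom itself \<Rightarrow> bool" where
  "integrally_closed _ \<longleftrightarrow>
     (\<forall>z :: 'a fract.
        (\<exists>q :: 'a poly. lead_coeff q = 1 \<and> poly (map_poly to_fract q) z = 0) \<longrightarrow>
        z \<in> range to_fract)"

definition dedekind_domain :: "'a::idom itself \<Rightarrow> bool" where
  "dedekind_domain T \<longleftrightarrow>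
     noetherian_domain (ring_of_type_algebra :: 'a ring) \<and>
     integrally_closed T \<and>
     (\<forall>Q. primeideal Q (ring_of_type_algebra :: 'a ring) \<and> Q \<noteq> {0} \<longrightarrow>
          maximalideal Q (ring_of_type_algebra :: 'a ring))"

text \<open>
  The field \<^typ>\<open>'k\<close> together with \<open>\<pi>\<close> is the quotient of \<^typ>\<open>'a\<close> by \<open>P\<close>.
\<close>

definition residue_map :: "'a::idom set \<Rightarrow> ('a \<Rightarrow> 'k::field) \<Rightarrow> bool" where
  "residue_map P \<pi> \<longleftrightarrow>
     \<pi> \<in> Ring.ring_hom (ring_of_type_algebra :: 'a ring) (ring_of_type_algebra :: 'k ring) \<and>
     surj \<pi> \<and>
     a_kernel (ring_of_type_algebra :: 'a ring) (ring_of_type_algebra :: 'k ring) \<pi> = P"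


section \<open>Bivariate polynomials\<close>

definition total_degree :: "'a::zero poly poly \<Rightarrow> nat" where
  "total_degree F = Max (insert 0 {i + j | i j. coeff (coeff F j) i \<noteq> 0})"

definition indecomposable :: "'b::alg_closed_field poly poly \<Rightarrow> bool" where
  "indecomposable F \<longleftrightarrow>
     total_degree F > 0 \<and>
     \<not> (\<exists>(u :: 'b poly) (H :: 'b poly poly).
           degree u \<ge> 2 \<and> F = pcompose (map_poly (\<lambda>c. [:c:]) u) H)"


section \<open>Discriminants\<close>

text \<open>
  This is \<open>disc f = (-1)^(n(n-1)/2) Res(f, f') / lc(f)\<close> for \<open>n = degree f > 0\<close>, where \<open>f'\<close> is
  given the formal degree \<open>n - 1\<close> in the Sylvester matrix (its actual degree in characteristic 0).
  The quotient exists in the coefficient ring and is unique by \<open>discriminant_eq\<close> below.  The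
  discriminant of a constant is 1 by convention.
\<close>

definition discriminant :: "'a::idom poly \<Rightarrow> 'a" where
  "discriminant f = (let n = degree f in
     if n = 0 then 1
     else THE D. lead_coeff f * D =
            (-1) ^ (n * (n - 1) div 2) * resultant_sub n (n - 1) f (pderiv f))"

lemma lead_coeff_dvd_resultant_pderiv:
  fixes f :: "'a::idom poly"
  assumes "degree f = n" and "n > 0"
  shows "lead_coeff f dvd resultant_sub n (n - 1) f (pderiv f)"
proof -
  define S where "S = sylvester_mat_sub n (n - 1) f (pderiv f)"
  have S: "S \<in> carrier_mat (n + (n - 1)) (n + (n - 1))"
    by (auto simp: S_def sylvester_mat_sub_def)
  have col: "lead_coeff f dvd S $$ (i, 0)" if "i < n + (n - 1)" for i
  proof -
    consider "i = 0" "n > 1" | "0 < i" "i < n - 1" | "i = n - 1" | "i > n - 1"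
      using \<open>n > 0\<close> by linarith
    then show ?thesis
    proof cases
      case 3
      have "coeff (pderiv f) (n - 1) = of_nat n * coeff f n"
        using \<open>n > 0\<close> by (simp add: coeff_pderiv)
      moreover have "S $$ (i, 0) = coeff (pderiv f) (n - 1)"
        using that 3 \<open>n > 0\<close> by (simp add: S_def sylvester_mat_sub_def)
      ultimately show ?thesis using assms by simp
    qed (use that assms in \<open>auto simp: S_def sylvester_mat_sub_def\<close>)
  qed
  have "det S = (\<Sum>i<n + (n - 1). S $$ (i, 0) * cofactor S i 0)"
    using laplace_expansion_column[OF S, of 0] \<open>n > 0\<close> by simp
  also have "lead_coeff f dvd \<dots>"
    by (intro dvd_sum dvd_mult2 col) auto
  finally show ?thesis by (simp add: resultant_sub_def S_def)
qed

lemma discriminant_eq: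
  fixes f :: "'a::idom poly"
  assumes "degree f = n" and "n > 0"
  shows "lead_coeff f * discriminant f =
           (-1) ^ (n * (n - 1) div 2) * resultant_sub n (n - 1) f (pderiv f)"
proof -
  let ?r = "(-1) ^ (n * (n - 1) div 2) * resultant_sub n (n - 1) f (pderiv f)"
  have "lead_coeff f dvd ?r"
    using lead_coeff_dvd_resultant_pderiv[OF assms] by (rule dvd_mult)
  then obtain D where D: "lead_coeff f * D = ?r" by (metis dvdE)
  have "lead_coeff f \<noteq> 0" using assms by auto
  then have "\<exists>!D. lead_coeff f * D = ?r"
    using D by (metis mult_left_cancel)
  from theI'[OF this] show ?thesis
    using assms by (simp add: discriminant_def Let_def)
qed


section \<open>The polynomials attached to \<open>F\<close>\<close>

text \<open>
  \<open>minus_lambda F\<close> is \<open>F(x,y) - \<lambda>\<close> in \<open>A[\<lambda>][x][y]\<close>; hence \<open>Delta F\<close> is \<open>disc\<^sub>y(F(x,y) - \<lambda>)\<close>, as an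
  element of \<open>A[\<lambda>][x]\<close>: here \<open>x\<close> is the outer variable and \<open>\<lambda>\<close> the inner one.
\<close>

definition minus_lambda :: "'a::idom poly poly \<Rightarrow> 'a poly poly poly" where
  "minus_lambda F = map_poly (map_poly (\<lambda>a. [:a:])) F - [:[:[:0, 1:]:]:]"

definition Delta :: "'a::idom poly poly \<Rightarrow> 'a poly poly" where
  "Delta F = discriminant (minus_lambda F)"

definition Delta0 :: "'a::idom poly poly \<Rightarrow> 'a poly" where
  "Delta0 F = lead_coeff (Delta F)"

text \<open>
  \<open>R\<close> is one of the admissible normalisations of the reduced discriminant. The field \<open>K(\<lambda>)\<close> is
  taken as the fraction field of \<open>A[\<lambda>]\<close>. A polynomial in \<open>A[\<lambda>][x]\<close> is \<^const>\<open>primitive\<close> if all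
  common divisors in \<open>A[\<lambda>]\<close> of its coefficients are units. If \<open>A\<close> is not a principal ideal domain,
  then \<open>R\<close> need not be unique up to units, so this is a predicate and not a function.
\<close>

definition is_Delta_red :: "'a::idom poly poly \<Rightarrow> 'a poly poly \<Rightarrow> bool" where
  "is_Delta_red F R \<longleftrightarrow>
     primitive R \<and>
     (\<exists>c :: 'a poly fract.
        let D = map_poly to_fract (Delta F)
        in map_poly to_fract R = smult c (D div gcd D (pderiv D)))"

end

theory Submission
  imports Defs "HOL-Computational_Algebra.Formal_Laurent_Series"
begin

text \<open>
  Suppose that the reduction of \<open>F\<close> is \<open>u(H)\<close> with \<open>deg u \<ge>
  2\<close>. If \<open>u(t) = \<lambda>\<close>, then \<open>H - t\<close> divides \<open>u(H) -
  \<lambda>\<close>, so the generic fibre of the reduction is reducible over an algebraic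
  closure \<open>Q\<close> of \<open>k(\<lambda>)\<close>; and since \<open>u'(t) \<noteq>
  0\<close>, its coordinate ring contains a nontrivial idempotent. The proof lifts this
  idempotent to the generic fibre \<open>F = \<lambda>\<close> in characteristic 0 and extracts
  a decomposition of \<open>F\<close> from the lift. (Below, \<open>k\<close> and
  \<open>K\<close> stand for the residue field and the fraction field of \<open>A\<close>.)

  The two sides are related by a place \<open>\<phi>\<close> from an algebraic closure
  \<open>L\<close> of \<open>K(\<lambda>)\<close> onto \<open>Q\<close> that extends the
  reduction \<open>A[\<lambda>] \<rightarrow> k[\<lambda>]\<close>; it exists by Chevalley's
  theorem (\<open>place_extension\<close>). Its valuation ring \<open>T\<close> is separated:
  only 0 is divisible by all powers of an element of the maximal ideal. This is where the
  Dedekind property enters, as the local ring of \<open>A\<close> at \<open>P\<close> is a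
  discrete valuation ring (\<open>uniformizer_exists\<close>).

  An idempotent modulo the maximal ideal of \<open>T\<close> can be improved by Newton's
  iteration modulo every power of an element \<open>\<delta>\<close> of that ideal. In general
  the limit is only a power series in \<open>x\<close>. What bounds its degree is the behaviour
  at \<open>x = \<infinity>\<close>. By \<open>p > deg\<^sub>y F\<close> and Puiseux's theorem,
  \<open>F - \<lambda>\<close> and its reduction split over Laurent series in \<open>s =
  x\<^sup>-\<^sup>1\<^sup>/\<^sup>N\<close>. The discriminant of \<open>F - \<lambda>\<close>
  with respect to \<open>y\<close> is a polynomial in \<open>x\<close> with the leading
  coefficient \<open>\<Delta>\<^sub>0(\<lambda>)\<close>, which is a unit of \<open>T\<close>
  because its reduction does not vanish. So it is a power of \<open>s\<close> times a power
  series over \<open>T\<close> with a unit as constant term, and as in the theorem of Abhyankar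
  and Jung, the roots have coefficients in \<open>T\<close> (\<open>roots_closed\<close>). At
  these roots an idempotent takes the values 0 and 1. The polynomial in \<open>y\<close> that
  interpolates these values is approximated modulo all powers of \<open>\<delta>\<close> by
  polynomials in \<open>x\<close> and \<open>y\<close>; by separatedness it is itself one of
  them (\<open>idempotent_lifting\<close>).

  Let \<open>e\<close> be the lifted idempotent. A derivation kills idempotents, so the Jacobian
  derivation \<open>w \<mapsto> F\<^sub>y w\<^sub>x - F\<^sub>x w\<^sub>y\<close> kills
  \<open>e\<close> modulo \<open>F - \<lambda>\<close>. A linear functional on \<open>L\<close>
  over \<open>K(\<lambda>)\<close> followed by clearing denominators moves the coefficients of
  \<open>e\<close> to \<open>K[\<lambda>]\<close>, and the substitution \<open>\<lambda> :=
  F\<close> produces an element of \<open>K[x,y]\<close> that is killed by the derivation but is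
  not a polynomial in \<open>F\<close>. In characteristic 0 and for \<open>F\<close> monic in
  \<open>y\<close>, the kernel of the derivation is \<open>K[\<theta>]\<close> for a single
  \<open>\<theta>\<close> (\<open>kernel_of_jacobian\<close>). Hence \<open>F =
  u(\<theta>)\<close> with \<open>deg u \<ge> 2\<close>, so \<open>F\<close> is decomposable.
\<close>

section \<open>Ring homomorphisms defined on subrings\<close>

lemma map_poly_pCons_zero:
  "f 0 = 0 \<Longrightarrow> map_poly f (pCons c p) = pCons (f c) (map_poly f p)"
  by (intro poly_eqI) (simp add: coeff_map_poly coeff_pCons split: nat.split)

text \<open>
  A place is a ring homomorphism on a valuation ring of a field, and its behaviour outside that
  ring is irrelevant; so the domain \<open>S\<close> of a homomorphism is a set here. The
  constructions below transport such a homomorphism to polynomials and Laurent series, and it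
  then commutes with determinants and resultants.
\<close>

locale subring_hom =
  fixes S :: "'a::comm_ring_1 set" and h :: "'a \<Rightarrow> 'b::comm_ring_1"
  assumes one_closed [simp, intro]: "1 \<in> S"
    and add_closed [simp, intro]: "a \<in> S \<Longrightarrow> b \<in> S \<Longrightarrow> a + b \<in> S"
    and uminus_closed [simp, intro]: "a \<in> S \<Longrightarrow> - a \<in> S"
    and mult_closed [simp, intro]: "a \<in> S \<Longrightarrow> b \<in> S \<Longrightarrow> a * b \<in> S"
    and h_one [simp]: "h 1 = 1"
    and h_add: "a \<in> S \<Longrightarrow> b \<in> S \<Longrightarrow> h (a + b) = h a + h b"
    and h_mult: "a \<in> S \<Longrightarrow> b \<in> S \<Longrightarrow> h (a * b) = h a * h b"
begin

lemma zero_closed [simp, intro]: "0 \<in> S"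
  using add_closed[OF one_closed uminus_closed[OF one_closed]] by simp

lemma h_zero [simp]: "h 0 = 0"
  using h_add[OF zero_closed zero_closed] by simp

lemma h_uminus: "a \<in> S \<Longrightarrow> h (- a) = - h a"
  using h_add[of a "- a"] by (simp add: eq_neg_iff_add_eq_0 add.commute)

lemma minus_closed [simp, intro]: "a \<in> S \<Longrightarrow> b \<in> S \<Longrightarrow> a - b \<in> S"
  using add_closed[of a "- b"] by simp

lemma h_minus: "a \<in> S \<Longrightarrow> b \<in> S \<Longrightarrow> h (a - b) = h a - h b"
  using h_add[of a "- b"] by (simp add: h_uminus)

lemma power_closed [simp, intro]: "a \<in> S \<Longrightarrow> a ^ n \<in> S"
  by (induction n) auto

lemma h_power: "a \<in> S \<Longrightarrow> h (a ^ n) = h a ^ n"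
  by (induction n) (auto simp: h_mult)

lemma sum_closed: "(\<And>x. x \<in> A \<Longrightarrow> f x \<in> S) \<Longrightarrow> sum f A \<in> S"
  by (induction A rule: infinite_finite_induct) auto

lemma h_sum: "(\<And>x. x \<in> A \<Longrightarrow> f x \<in> S) \<Longrightarrow> h (sum f A) = (\<Sum>x\<in>A. h (f x))"
  by (induction A rule: infinite_finite_induct) (auto simp: h_add sum_closed)

lemma prod_closed: "(\<And>x. x \<in> A \<Longrightarrow> f x \<in> S) \<Longrightarrow> prod f A \<in> S"
  by (induction A rule: infinite_finite_induct) auto

lemma h_prod: "(\<And>x. x \<in> A \<Longrightarrow> f x \<in> S) \<Longrightarrow> h (prod f A) = (\<Prod>x\<in>A. h (f x))"
  by (induction A rule: infinite_finite_induct) (auto simp: h_mult prod_closed)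

lemma of_nat_closed [simp, intro]: "of_nat n \<in> S"
  by (induction n) auto

lemma h_of_nat [simp]: "h (of_nat n) = of_nat n"
  by (induction n) (auto simp: h_add)

lemma sign_closed [simp, intro]: "signof p \<in> S"
  by (auto simp: sign_def)

lemma h_sign [simp]: "h (signof p) = signof p"
  by (auto simp: sign_def h_uminus)

lemma det_closed:
  assumes "A \<in> carrier_mat n n" "\<And>i j. i < n \<Longrightarrow> j < n \<Longrightarrow> A $$ (i, j) \<in> S"
  shows "det A \<in> S"
proof -
  have "(\<Prod>i = 0..<n. A $$ (i, p i)) \<in> S" if "p permutes {0..<n}" for p
    using that by (intro prod_closed assms(2)) (auto simp: permutes_in_image)
  then show ?thesis
    unfolding det_def'[OF assms(1)] by (intro sum_closed mult_closed sign_closed) auto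
qed

lemma h_det:
  assumes A: "A \<in> carrier_mat n n" and S: "\<And>i j. i < n \<Longrightarrow> j < n \<Longrightarrow> A $$ (i, j) \<in> S"
  shows "h (det A) = det (map_mat h A)"
proof -
  have p: "(\<Prod>i = 0..<n. A $$ (i, p i)) \<in> S" if "p permutes {0..<n}" for p
    using that by (intro prod_closed S) (auto simp: permutes_in_image)
  have e: "h (\<Prod>i = 0..<n. A $$ (i, p i)) = (\<Prod>i = 0..<n. map_mat h A $$ (i, p i))"
    if "p permutes {0..<n}" for p
  proof -
    have q: "p i < n" if "i < n" for i
      using that \<open>p permutes {0..<n}\<close> permutes_in_image[of p "{0..<n}" i] by auto
    have "h (\<Prod>i = 0..<n. A $$ (i, p i)) = (\<Prod>i = 0..<n. h (A $$ (i, p i)))"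
      using q by (intro h_prod S) auto
    also have "\<dots> = (\<Prod>i = 0..<n. map_mat h A $$ (i, p i))"
      using q A by (intro prod.cong) auto
    finally show ?thesis .
  qed
  have "h (det A) = (\<Sum>p | p permutes {0..<n}. h (signof p * (\<Prod>i = 0..<n. A $$ (i, p i))))"
    unfolding det_def'[OF A] using p by (intro h_sum mult_closed) auto
  also have "\<dots> = (\<Sum>p | p permutes {0..<n}. signof p * (\<Prod>i = 0..<n. map_mat h A $$ (i, p i)))"
    using p e by (intro sum.cong refl) (auto simp: h_mult)
  also have "\<dots> = det (map_mat h A)"
    by (rule det_def'[symmetric]) (use A in auto)
  finally show ?thesis .
qed

end

definition polys_over :: "'a::zero set \<Rightarrow> 'a poly set" where
  "polys_over S = {p. \<forall>i. coeff p i \<in> S}"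

lemma polys_overD: "p \<in> polys_over S \<Longrightarrow> coeff p i \<in> S"
  by (simp add: polys_over_def)

context subring_hom
begin

lemma coeff_map_h [simp]: "coeff (map_poly h p) i = h (coeff p i)"
  by (simp add: coeff_map_poly)

lemma subring_hom_poly: "subring_hom (polys_over S) (map_poly h)"
proof
  fix p q assume pq: "p \<in> polys_over S" "q \<in> polys_over S"
  then have *: "\<And>i. coeff p i \<in> S" "\<And>i. coeff q i \<in> S" by (auto simp: polys_over_def)
  show "p + q \<in> polys_over S" "- p \<in> polys_over S" "p * q \<in> polys_over S"
    using * by (auto simp: polys_over_def coeff_mult intro!: sum_closed)
  show "map_poly h (p + q) = map_poly h p + map_poly h q"
    using * by (intro poly_eqI) (auto simp: h_add)
  show "map_poly h (p * q) = map_poly h p * map_poly h q"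
    using * by (intro poly_eqI) (auto simp: coeff_mult h_sum h_mult)
qed (auto simp: polys_over_def)

lemma const_in_polys_over [simp]: "[:c:] \<in> polys_over S \<longleftrightarrow> c \<in> S"
proof
  assume "c \<in> S" then show "[:c:] \<in> polys_over S"
    by (auto simp: polys_over_def coeff_pCons split: nat.split)
qed (auto simp: polys_over_def coeff_pCons split: nat.splits dest: spec[of _ 0])

lemma pCons_in_polys_over [simp]: "pCons c p \<in> polys_over S \<longleftrightarrow> c \<in> S \<and> p \<in> polys_over S"
  by (force simp: polys_over_def coeff_pCons split: nat.splits)

lemma poly_closed: "p \<in> polys_over S \<Longrightarrow> a \<in> S \<Longrightarrow> poly p a \<in> S"
  by (auto simp: poly_altdef polys_over_def intro!: sum_closed)

lemma h_poly: "p \<in> polys_over S \<Longrightarrow> a \<in> S \<Longrightarrow> h (poly p a) = poly (map_poly h p) (h a)"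
proof (induction p)
  case (pCons c p)
  then show ?case by (simp add: h_add h_mult poly_closed map_poly_pCons)
qed simp

lemma polys_over_surj:
  assumes "h ` S = UNIV"
  shows "map_poly h ` polys_over S = UNIV"
proof -
  define g where "g q = (if q = 0 then 0 else SOME x. x \<in> S \<and> h x = q)" for q
  have g: "g q \<in> S \<and> h (g q) = q" for q
  proof (cases "q = 0")
    case False
    have "\<exists>x. x \<in> S \<and> h x = q" using assms by (metis UNIV_I imageE)
    then have "(SOME x. x \<in> S \<and> h x = q) \<in> S \<and> h (SOME x. x \<in> S \<and> h x = q) = q" by (rule someI_ex)
    then show ?thesis using False by (simp add: g_def)
  qed (simp add: g_def)
  have g0: "g 0 = 0" by (simp add: g_def)
  have "map_poly h (map_poly g q) = q" "map_poly g q \<in> polys_over S" for q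
    using g g0 by (auto simp: polys_over_def coeff_map_poly intro!: poly_eqI)
  then show ?thesis by (auto intro!: image_eqI[where x = "map_poly g q" for q])
qed

lemma prod_linear_closed:
  assumes "\<And>j. j \<in> J \<Longrightarrow> a j \<in> S"
  shows "(\<Prod>j\<in>J. [:- a j, 1:]) \<in> polys_over S"
proof -
  interpret P: subring_hom "polys_over S" "map_poly h" by (rule subring_hom_poly)
  show ?thesis using assms by (intro P.prod_closed) (simp add: uminus_closed)
qed

lemma h_prod_linear:
  assumes "\<And>j. j \<in> J \<Longrightarrow> a j \<in> S"
  shows "map_poly h (\<Prod>j\<in>J. [:- a j, 1:]) = (\<Prod>j\<in>J. [:- h (a j), 1:])"
proof -
  interpret P: subring_hom "polys_over S" "map_poly h" by (rule subring_hom_poly)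
  have "map_poly h (\<Prod>j\<in>J. [:- a j, 1:]) = (\<Prod>j\<in>J. map_poly h [:- a j, 1:])"
    using assms by (intro P.h_prod) (simp add: uminus_closed)
  also have "\<dots> = (\<Prod>j\<in>J. [:- h (a j), 1:])"
    using assms by (intro prod.cong) (simp_all add: map_poly_pCons_zero map_poly_1 h_uminus)
  finally show ?thesis .
qed

lemma resultant_sub_closed:
  assumes "f \<in> polys_over S" "g \<in> polys_over S"
  shows "resultant_sub m k f g \<in> S"
  unfolding resultant_sub_def
  by (rule det_closed[OF sylvester_mat_sub_carrier])
    (use assms in \<open>auto simp: sylvester_mat_sub_index polys_over_def\<close>)

lemma h_resultant_sub:
  assumes "f \<in> polys_over S" "g \<in> polys_over S"
  shows "h (resultant_sub m k f g) = resultant_sub m k (map_poly h f) (map_poly h g)"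
proof -
  have "h (resultant_sub m k f g) = det (map_mat h (sylvester_mat_sub m k f g))"
    unfolding resultant_sub_def
    by (rule h_det[OF sylvester_mat_sub_carrier])
      (use assms in \<open>auto simp: sylvester_mat_sub_index polys_over_def\<close>)
  also have "map_mat h (sylvester_mat_sub m k f g) =
      sylvester_mat_sub m k (map_poly h f) (map_poly h g)"
    by (rule eq_matI) (auto simp: sylvester_mat_sub_index)
  finally show ?thesis by (simp add: resultant_sub_def)
qed

end

lemma fls_times_nth_bounds:
  fixes f g :: "'a::comm_ring_1 fls"
  assumes "\<And>i. i < a \<Longrightarrow> fls_nth f i = 0" "\<And>i. i < b \<Longrightarrow> fls_nth g i = 0"
  shows "fls_nth (f * g) n = (\<Sum>i\<in>{a..n - b}. fls_nth f i * fls_nth g (n - i))"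
proof -
  have "fls_nth (f * g) n = (\<Sum>i=fls_subdegree f..n - fls_subdegree g. fls_nth f i * fls_nth g (n - i))"
    by (rule fls_times_nth(2))
  also have "\<dots> = (\<Sum>i\<in>{min a (fls_subdegree f)..n - min b (fls_subdegree g)}. fls_nth f i * fls_nth g (n - i))"
    by (rule sum.mono_neutral_left) auto
  also have "\<dots> = (\<Sum>i\<in>{a..n - b}. fls_nth f i * fls_nth g (n - i))"
    by (rule sum.mono_neutral_right) (use assms in auto)
  finally show ?thesis .
qed

definition laurent_over :: "'a::zero set \<Rightarrow> 'a fls set" where
  "laurent_over S = {a. \<forall>i. fls_nth a i \<in> S}"

text \<open>
  For \<open>h 0 = 0\<close> the new coefficient sequence vanishes below the old subdegree, so
  \<^const>\<open>Abs_fls\<close> is harmless.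
\<close>

definition map_fls :: "('a::zero \<Rightarrow> 'b::zero) \<Rightarrow> 'a fls \<Rightarrow> 'b fls" where
  "map_fls h a = Abs_fls (\<lambda>i. h (fls_nth a i))"

lemma map_fls_nth [simp]: "h 0 = 0 \<Longrightarrow> fls_nth (map_fls h a) i = h (fls_nth a i)"
  unfolding map_fls_def
  by (rule nth_Abs_fls_lower_bound[of "fls_subdegree a"]) auto

context subring_hom
begin

lemma subring_hom_fls: "subring_hom (laurent_over S) (map_fls h)"
proof
  fix p q assume pq: "p \<in> laurent_over S" "q \<in> laurent_over S"
  then have *: "\<And>i. fls_nth p i \<in> S" "\<And>i. fls_nth q i \<in> S" by (auto simp: laurent_over_def)
  show "p + q \<in> laurent_over S" "- p \<in> laurent_over S" "p * q \<in> laurent_over S"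
    using * by (auto simp: laurent_over_def fls_times_nth(2) intro!: sum_closed)
  show "map_fls h (p + q) = map_fls h p + map_fls h q"
    using * by (intro fls_eqI) (auto simp: h_add)
  show "map_fls h (p * q) = map_fls h p * map_fls h q"
  proof (rule fls_eqI)
    fix n
    have "fls_nth (map_fls h p * map_fls h q) n = (\<Sum>i\<in>{fls_subdegree p..n - fls_subdegree q}. h (fls_nth p i) * h (fls_nth q (n - i)))"
      by (subst fls_times_nth_bounds[of "fls_subdegree p" _ "fls_subdegree q"]) auto
    then show "fls_nth (map_fls h (p * q)) n = fls_nth (map_fls h p * map_fls h q) n"
      using * by (simp add: fls_times_nth(2) h_sum h_mult)
  qed
qed (auto simp: laurent_over_def intro!: fls_eqI)

end

section \<open>Places and Chevalley's extension theorem\<close>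

text \<open>
  \<open>T\<close> is a valuation ring and \<open>\<phi>\<close> its residue map: an element
  outside \<open>T\<close> has its inverse in the maximal ideal, the kernel of
  \<open>\<phi>\<close>. Values are compared by divisibility in \<open>T\<close>, without a
  value group.
\<close>

locale place = subring_hom T \<phi> for T :: "'l::field set" and \<phi> :: "'l \<Rightarrow> 'q::field" +
  assumes unit_closed: "x \<in> T \<Longrightarrow> \<phi> x \<noteq> 0 \<Longrightarrow> inverse x \<in> T"
    and valuation: "x \<notin> T \<Longrightarrow> inverse x \<in> T \<and> \<phi> (inverse x) = 0"

text \<open>
  Zorn's lemma is applied to graphs of homomorphisms, which are ordered by inclusion. The
  functions themselves would not do, as they take arbitrary values outside of their domain.
\<close>

definition hom_graph :: "('l::comm_ring_1 \<times> 'q::comm_ring_1) set \<Rightarrow> bool" where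
  "hom_graph G \<longleftrightarrow> (1, 1) \<in> G \<and>
     (\<forall>a b c d. (a, b) \<in> G \<longrightarrow> (c, d) \<in> G \<longrightarrow> (a + c, b + d) \<in> G \<and> (a * c, b * d) \<in> G) \<and>
     (\<forall>a b. (a, b) \<in> G \<longrightarrow> (- a, - b) \<in> G) \<and>
     (\<forall>a b c. (a, b) \<in> G \<longrightarrow> (a, c) \<in> G \<longrightarrow> b = c)"

lemma hom_graphD:
  assumes "hom_graph G"
  shows "(1, 1) \<in> G"
    and "(a, b) \<in> G \<Longrightarrow> (c, d) \<in> G \<Longrightarrow> (a + c, b + d) \<in> G"
    and "(a, b) \<in> G \<Longrightarrow> (c, d) \<in> G \<Longrightarrow> (a * c, b * d) \<in> G"
    and "(a, b) \<in> G \<Longrightarrow> (- a, - b) \<in> G"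
    and "(a, b) \<in> G \<Longrightarrow> (a, b') \<in> G \<Longrightarrow> b = b'"
  using assms unfolding hom_graph_def by simp_all

lemma (in subring_hom) hom_graph: "hom_graph ((\<lambda>a. (a, h a)) ` S)"
  unfolding hom_graph_def by (auto simp: image_iff h_add h_mult h_uminus)

lemma hom_graph_subring_hom:
  assumes "hom_graph G"
  obtains S h where "subring_hom S h" "G = (\<lambda>a. (a, h a)) ` S"
proof -
  define S where "S = fst ` G"
  define h where "h a = (SOME b. (a, b) \<in> G)" for a
  have 1: "(a, h a) \<in> G" if "a \<in> S" for a
    using that unfolding S_def h_def by (auto intro: someI)
  have 2: "a \<in> S \<and> h a = b" if "(a, b) \<in> G" for a b
  proof -
    have "a \<in> S" using that by (force simp: S_def)
    then show ?thesis using hom_graphD(5)[OF assms 1 that] by simp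
  qed
  have "subring_hom S h"
  proof
    show "1 \<in> S" "h 1 = 1" using 2[OF hom_graphD(1)[OF assms]] by simp_all
    fix a b assume "a \<in> S" "b \<in> S"
    then have ab: "(a, h a) \<in> G" "(b, h b) \<in> G" using 1 by auto
    then have "(a + b, h a + h b) \<in> G" "(a * b, h a * h b) \<in> G" "(- a, - h a) \<in> G"
      using hom_graphD[OF assms] by simp_all
    then show "a + b \<in> S" "a * b \<in> S" "- a \<in> S" "h (a + b) = h a + h b" "h (a * b) = h a * h b"
      using 2 by blast+
  qed
  moreover have "G = (\<lambda>a. (a, h a)) ` S" using 1 2 by auto
  ultimately show ?thesis using that by blast
qed

lemma maximal_subring_hom:
  assumes "subring_hom S0 h0"
  obtains T \<phi> where "subring_hom T \<phi>" "S0 \<subseteq> T" "\<And>a. a \<in> S0 \<Longrightarrow> \<phi> a = h0 a"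
    "\<And>S h. subring_hom S h \<Longrightarrow> T \<subseteq> S \<Longrightarrow> (\<And>a. a \<in> T \<Longrightarrow> h a = \<phi> a) \<Longrightarrow> S = T"
proof -
  let ?G0 = "(\<lambda>a. (a, h0 a)) ` S0"
  let ?A = "{G. hom_graph G \<and> ?G0 \<subseteq> G}"
  have "\<exists>M\<in>?A. \<forall>W\<in>?A. M \<subseteq> W \<longrightarrow> W = M"
  proof (rule subset_Zorn_nonempty)
    show "?A \<noteq> {}" using subring_hom.hom_graph[OF assms] by blast
    fix C assume C: "C \<noteq> {}" "subset.chain ?A C"
    have two: "\<exists>G\<in>C. x \<in> G \<and> y \<in> G" if "x \<in> \<Union>C" "y \<in> \<Union>C" for x y
      using that C(2) unfolding subset_chain_def by blast
    have hg: "hom_graph G" "?G0 \<subseteq> G" if "G \<in> C" for G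
      using that C(2) unfolding subset_chain_def by blast+
    have "hom_graph (\<Union>C)" unfolding hom_graph_def
    proof (intro conjI allI impI)
      show "(1, 1) \<in> \<Union>C" using C(1) hom_graphD(1)[OF hg(1)] by blast
    next
      fix a b c d assume "(a, b) \<in> \<Union>C" "(c, d) \<in> \<Union>C"
      then obtain G where G: "G \<in> C" "(a, b) \<in> G" "(c, d) \<in> G" using two by blast
      show "(a + c, b + d) \<in> \<Union>C" by (rule UnionI[OF G(1) hom_graphD(2)[OF hg(1)[OF G(1)] G(2,3)]])
      show "(a * c, b * d) \<in> \<Union>C" by (rule UnionI[OF G(1) hom_graphD(3)[OF hg(1)[OF G(1)] G(2,3)]])
    next
      fix a b assume "(a, b) \<in> \<Union>C"
      then obtain G where G: "G \<in> C" "(a, b) \<in> G" by blast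
      show "(- a, - b) \<in> \<Union>C" by (rule UnionI[OF G(1) hom_graphD(4)[OF hg(1)[OF G(1)] G(2)]])
    next
      fix a b c assume "(a, b) \<in> \<Union>C" "(a, c) \<in> \<Union>C"
      then obtain G where G: "G \<in> C" "(a, b) \<in> G" "(a, c) \<in> G" using two by blast
      show "b = c" by (rule hom_graphD(5)[OF hg(1)[OF G(1)] G(2,3)])
    qed
    moreover have "?G0 \<subseteq> \<Union>C" using C(1) hg(2) by blast
    ultimately show "\<Union>C \<in> ?A" by blast
  qed
  then obtain M where M0: "M \<in> ?A" and max0: "\<forall>W\<in>?A. M \<subseteq> W \<longrightarrow> W = M" by (elim bexE)
  have M: "hom_graph M" "?G0 \<subseteq> M" using M0 by simp_all
  have max: "W = M" if "hom_graph W" "?G0 \<subseteq> W" "M \<subseteq> W" for W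
    using bspec[OF max0, of W] that by simp
  obtain T \<phi> where T: "subring_hom T \<phi>" "M = (\<lambda>a. (a, \<phi> a)) ` T" by (rule hom_graph_subring_hom[OF M(1)])
  show ?thesis
  proof (rule that[OF T(1)])
    show "S0 \<subseteq> T" "\<And>a. a \<in> S0 \<Longrightarrow> \<phi> a = h0 a" using M(2) T(2) by auto
    fix S h assume S: "subring_hom S h" "T \<subseteq> S" "\<And>a. a \<in> T \<Longrightarrow> h a = \<phi> a"
    let ?W = "(\<lambda>a. (a, h a)) ` S"
    have "M \<subseteq> ?W" using S T(2) by auto
    then have "?W = M" using max[OF subring_hom.hom_graph[OF S(1)] subset_trans[OF M(2)]] by simp
    then have "fst ` ?W = fst ` M" by (rule arg_cong)
    then show "S = T" by (simp add: T(2) image_image)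
  qed
qed

text \<open>
  A homomorphism from a subring of a field to an algebraically closed field that cannot be
  extended to a larger subring is a place. The proof exhibits an extension whenever an axiom of
  a place fails.
\<close>

locale maximal_hom = subring_hom T \<phi> for T :: "'l::field set" and \<phi> :: "'l \<Rightarrow> 'q::alg_closed_field" +
  assumes maximal: "\<And>S h. subring_hom S h \<Longrightarrow> T \<subseteq> S \<Longrightarrow> (\<And>a. a \<in> T \<Longrightarrow> h a = \<phi> a) \<Longrightarrow> S = T"
begin

sublocale polys: subring_hom "polys_over T" "map_poly \<phi>" by (rule subring_hom_poly)

lemma graph_extension:
  assumes "hom_graph G" "\<And>a. a \<in> T \<Longrightarrow> (a, \<phi> a) \<in> G" "(x, y) \<in> G"
  shows "x \<in> T"
proof -
  obtain S h where S: "subring_hom S h" "G = (\<lambda>a. (a, h a)) ` S" by (rule hom_graph_subring_hom[OF assms(1)])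
  have *: "a \<in> S \<and> h a = \<phi> a" if "a \<in> T" for a using assms(2)[OF that] S(2) by auto
  have "S = T" by (rule maximal[OF S(1)]) (use * in auto)
  then show ?thesis using assms(3) S(2) by auto
qed

text \<open>
  Otherwise \<open>\<phi>\<close> would extend to the localisation \<open>T[1/b]\<close>.
\<close>

lemma local: assumes b: "b \<in> T" "\<phi> b \<noteq> 0" shows "inverse b \<in> T"
proof (rule graph_extension[where y = "inverse (\<phi> b)"])
  have b0: "b \<noteq> 0" using b by auto
  let ?G = "{(a / b ^ n, \<phi> a / \<phi> b ^ n) | a n. a \<in> T}"
  show "hom_graph ?G" unfolding hom_graph_def
  proof (intro conjI allI impI)
    show "(1, 1) \<in> ?G" by (rule CollectI, rule exI[of _ 1], rule exI[of _ "0::nat"]) simp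
  next
    fix x y x' y' assume "(x, y) \<in> ?G" "(x', y') \<in> ?G"
    then obtain a n a' n' where a: "a \<in> T" "a' \<in> T" "x = a / b ^ n" "y = \<phi> a / \<phi> b ^ n"
      "x' = a' / b ^ n'" "y' = \<phi> a' / \<phi> b ^ n'" by auto
    have "x + x' = (a * b ^ n' + a' * b ^ n) / b ^ (n + n')"
      "y + y' = \<phi> (a * b ^ n' + a' * b ^ n) / \<phi> b ^ (n + n')"
      using b b0 by (simp_all add: a field_simps power_add h_add h_mult h_power)
    then show "(x + x', y + y') \<in> ?G" using a b by blast
    have "x * x' = (a * a') / b ^ (n + n')" "y * y' = \<phi> (a * a') / \<phi> b ^ (n + n')"
      using b b0 by (simp_all add: a field_simps power_add h_mult)
    then show "(x * x', y * y') \<in> ?G" using a b by blast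
  next
    fix x y assume "(x, y) \<in> ?G"
    then obtain a n where "a \<in> T" "x = a / b ^ n" "y = \<phi> a / \<phi> b ^ n" by auto
    then have "- x = (- a) / b ^ n" "- y = \<phi> (- a) / \<phi> b ^ n" "- a \<in> T" by (simp_all add: h_uminus)
    then show "(- x, - y) \<in> ?G" by blast
  next
    fix x y y' assume "(x, y) \<in> ?G"
    then obtain a n where a: "a \<in> T" "x = a / b ^ n" "y = \<phi> a / \<phi> b ^ n" by auto
    assume "(x, y') \<in> ?G"
    then obtain a' n' where a': "a' \<in> T" "x = a' / b ^ n'" "y' = \<phi> a' / \<phi> b ^ n'" by auto
    have "a / b ^ n = a' / b ^ n'" using a a' by simp
    then have "a * b ^ n' = a' * b ^ n" using b0 by (simp add: field_simps)
    then have "\<phi> a * \<phi> b ^ n' = \<phi> a' * \<phi> b ^ n" using a(1) a'(1) b by (metis h_mult h_power power_closed)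
    then show "y = y'" unfolding a(3) a'(3) using b by (simp add: field_simps)
  qed
  show "(a, \<phi> a) \<in> ?G" if "a \<in> T" for a using that by (intro CollectI exI[of _ a] exI[of _ "0::nat"]) simp
  show "(inverse b, inverse (\<phi> b)) \<in> ?G"
    by (rule CollectI, rule exI[of _ 1], rule exI[of _ "1::nat"]) (simp add: field_simps)
qed

text \<open>
  Such a \<open>p\<close> shows that the kernel of \<open>\<phi>\<close> generates the unit
  ideal of \<open>T[x]\<close>, which is the obstruction to extending \<open>\<phi>\<close> to
  \<open>T[x]\<close>.
\<close>

definition relation :: "'l \<Rightarrow> 'l poly \<Rightarrow> bool" where
  "relation x p \<longleftrightarrow> p \<in> polys_over T \<and> poly p x = 0 \<and> (\<exists>c. c \<noteq> 0 \<and> map_poly \<phi> p = [:c:])"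

text \<open>
  The extension to \<open>T[x]\<close> that maps \<open>x\<close> to \<open>\<xi>\<close> is
  well defined.
\<close>

lemma common_root_extension:
  assumes "\<And>p. p \<in> polys_over T \<Longrightarrow> poly p x = 0 \<Longrightarrow> poly (map_poly \<phi> p) \<xi> = 0"
  shows "x \<in> T"
proof (rule graph_extension[where y = \<xi>])
  let ?G = "(\<lambda>p. (poly p x, poly (map_poly \<phi> p) \<xi>)) ` polys_over T"
  show "hom_graph ?G" unfolding hom_graph_def
  proof (intro conjI allI impI)
    show "(1, 1) \<in> ?G" by (rule image_eqI[of _ _ 1]) (auto simp: map_poly_1)
  next
    fix a b c d assume "(a, b) \<in> ?G" "(c, d) \<in> ?G"
    then obtain p q where pq: "p \<in> polys_over T" "q \<in> polys_over T" "a = poly p x" "b = poly (map_poly \<phi> p) \<xi>"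
      "c = poly q x" "d = poly (map_poly \<phi> q) \<xi>" by auto
    show "(a + c, b + d) \<in> ?G" by (rule image_eqI[of _ _ "p + q"]) (use pq in \<open>auto simp: polys.h_add\<close>)
    show "(a * c, b * d) \<in> ?G" by (rule image_eqI[of _ _ "p * q"]) (use pq in \<open>auto simp: polys.h_mult\<close>)
  next
    fix a b assume "(a, b) \<in> ?G"
    then obtain p where p: "p \<in> polys_over T" "a = poly p x" "b = poly (map_poly \<phi> p) \<xi>" by auto
    show "(- a, - b) \<in> ?G" by (rule image_eqI[of _ _ "- p"]) (use p in \<open>auto simp: polys.h_uminus\<close>)
  next
    fix a b c assume "(a, b) \<in> ?G" "(a, c) \<in> ?G"
    then obtain p q where pq: "p \<in> polys_over T" "q \<in> polys_over T" "a = poly p x" "b = poly (map_poly \<phi> p) \<xi>"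
      "a = poly q x" "c = poly (map_poly \<phi> q) \<xi>" by auto
    then show "b = c" using assms[of "p - q"] by (simp add: polys.h_minus polys.minus_closed)
  qed
  show "(a, \<phi> a) \<in> ?G" if "a \<in> T" for a
    by (rule image_eqI[of _ _ "[:a:]"]) (use that in \<open>auto simp: map_poly_pCons_zero\<close>)
  show "(x, \<xi>) \<in> ?G"
    by (rule image_eqI[of _ _ "[:0, 1:]"]) (auto simp: map_poly_pCons_zero map_poly_1)
qed

text \<open>
  Without such a relation, the reductions of the polynomials that vanish at \<open>x\<close>
  have a common root: any root of a reduction \<open>\<phi>(q)\<close> of least degree, because
  pseudo-division by \<open>q\<close> stays inside the ideal of polynomials vanishing at
  \<open>x\<close>.
\<close>

lemma relation_exists:
  assumes "x \<notin> T"
  shows "\<exists>p. relation x p"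
proof (rule ccontr)
  assume no: "\<not> ?thesis"
  let ?I = "{p. p \<in> polys_over T \<and> poly p x = 0}"
  let ?\<phi> = "map_poly \<phi>"
  show False
  proof (cases "\<exists>p\<in>?I. ?\<phi> p \<noteq> 0")
    case False
    then have "x \<in> T" by (intro common_root_extension[of x 0]) auto
    then show False using assms by simp
  next
    case True
    then obtain p0 where "p0 \<in> ?I \<and> ?\<phi> p0 \<noteq> 0" by blast
    then obtain q where q: "q \<in> ?I \<and> ?\<phi> q \<noteq> 0"
      and min: "\<And>p. p \<in> ?I \<and> ?\<phi> p \<noteq> 0 \<Longrightarrow> degree (?\<phi> q) \<le> degree (?\<phi> p)"
      using ex_has_least_nat[of "\<lambda>p. p \<in> ?I \<and> ?\<phi> p \<noteq> 0" p0 "\<lambda>p. degree (?\<phi> p)"] by blast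
    have "degree (?\<phi> q) > 0"
    proof (rule ccontr)
      assume "\<not> degree (?\<phi> q) > 0"
      then obtain c where "?\<phi> q = [:c:]" by (auto elim: degree_eq_zeroE)
      then show False using no q unfolding relation_def by auto
    qed
    then obtain \<xi> where \<xi>: "poly (?\<phi> q) \<xi> = 0" using alg_closed_imp_poly_has_root by blast
    have "poly (?\<phi> p) \<xi> = 0" if "p \<in> ?I" for p
      using that
    proof (induction "degree (?\<phi> p)" arbitrary: p rule: less_induct)
      case less
      show ?case
      proof (cases "?\<phi> p = 0")
        case False
        then have le: "degree (?\<phi> q) \<le> degree (?\<phi> p)" using min less.prems by blast
        define m k where "m = degree (?\<phi> q)" and "k = degree (?\<phi> p)"
        define p' where "p' = [:coeff q m:] * p - monom (coeff p k) (k - m) * q"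
        have mon: "monom (coeff p k) (k - m) \<in> polys_over T" "[:coeff q m:] \<in> polys_over T"
          using less.prems q by (auto simp: polys_over_def coeff_pCons split: nat.split)
        have phi: "?\<phi> p' = [:coeff (?\<phi> q) m:] * ?\<phi> p - monom (coeff (?\<phi> p) k) (k - m) * ?\<phi> q"
        proof -
          have p: "p \<in> polys_over T" "q \<in> polys_over T" using less.prems q by auto
          have "?\<phi> [:coeff q m:] = [:coeff (?\<phi> q) m:]" by (simp add: map_poly_pCons_zero)
          moreover have "?\<phi> (monom (coeff p k) (k - m)) = monom (coeff (?\<phi> p) k) (k - m)"
            by (simp add: map_poly_monom)
          ultimately show ?thesis
            unfolding p'_def by (simp only: polys.h_minus polys.h_mult polys.mult_closed mon p)
        qed
        have "coeff (?\<phi> p') k = 0" unfolding phi using le by (simp add: coeff_monom_mult k_def m_def)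
        moreover have "degree (?\<phi> p') \<le> k" unfolding phi
        proof (rule degree_diff_le)
          show "degree ([:coeff (?\<phi> q) m:] * ?\<phi> p) \<le> k" by (simp add: degree_smult_le k_def)
          show "degree (monom (coeff (?\<phi> p) k) (k - m) * ?\<phi> q) \<le> k"
            using degree_mult_le[of "monom (coeff (?\<phi> p) k) (k - m)" "?\<phi> q"] degree_monom_le[of "coeff (?\<phi> p) k" "k - m"] le
            by (simp add: m_def k_def)
        qed
        ultimately have lt: "?\<phi> p' = 0 \<or> degree (?\<phi> p') < degree (?\<phi> p)"
          by (metis k_def le_neq_implies_less leading_coeff_0_iff)
        have "p' \<in> polys_over T"
          unfolding p'_def using less.prems q mon by (intro polys.minus_closed polys.mult_closed) auto
        moreover have "poly p' x = 0" using less.prems q by (simp add: p'_def)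
        ultimately have "p' \<in> ?I" by simp
        then have "poly (?\<phi> p') \<xi> = 0" using less.hyps lt by auto
        then have "coeff (?\<phi> q) m * poly (?\<phi> p) \<xi> = 0" unfolding phi using \<xi> by simp
        then show ?thesis using q by (simp add: m_def del: coeff_map_h)
      qed simp
    qed
    then have "x \<in> T" by (intro common_root_extension[of x \<xi>]) auto
    then show False using assms by simp
  qed
qed

lemma relationD:
  assumes "relation x p"
  shows "coeff p i \<in> T" "\<phi> (coeff p 0) \<noteq> 0" "i > 0 \<Longrightarrow> \<phi> (coeff p i) = 0" "degree p > 0" "poly p x = 0"
proof -
  obtain c where c: "c \<noteq> 0" "map_poly \<phi> p = [:c:]" and p: "p \<in> polys_over T" "poly p x = 0"
    using assms unfolding relation_def by blast
  have *: "\<phi> (coeff p i) = coeff [:c:] i" for i using c(2) coeff_map_h[of p i] by simp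
  show "coeff p i \<in> T" "poly p x = 0" using p by (simp_all add: polys_over_def)
  show 0: "\<phi> (coeff p 0) \<noteq> 0" using c(1) *[of 0] by simp
  show "i > 0 \<Longrightarrow> \<phi> (coeff p i) = 0" using *[of i] by (cases i) auto
  show "degree p > 0"
  proof (rule ccontr)
    assume "\<not> degree p > 0"
    then obtain a where "p = [:a:]" by (auto elim: degree_eq_zeroE)
    then show False using p 0 by simp
  qed
qed

lemma relationI:
  assumes "\<And>i. coeff p i \<in> T" "\<phi> (coeff p 0) \<noteq> 0" "\<And>i. i > 0 \<Longrightarrow> \<phi> (coeff p i) = 0" "poly p x = 0"
  shows "relation x p"
proof -
  have "map_poly \<phi> p = [:\<phi> (coeff p 0):]"
    by (rule poly_eqI) (use assms in \<open>auto simp: coeff_pCons split: nat.split\<close>)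
  then show ?thesis using assms unfolding relation_def polys_over_def by blast
qed

text \<open>
  Reversing \<open>q\<close> gives a polynomial that vanishes at \<open>x\<close>; a multiple of
  it cancels the leading term of the suitably scaled \<open>p\<close>. The leading coefficient
  of \<open>p\<close> lies in the kernel of \<open>\<phi>\<close>, so the constant term remains
  a unit.
\<close>

lemma relation_reduce:
  assumes p: "relation x p" and q: "relation (inverse x) q" and x: "x \<noteq> 0" and le: "degree q \<le> degree p"
  shows "\<exists>p'. relation x p' \<and> degree p' < degree p"
proof -
  define a b where "a = degree p" and "b = degree q"
  note P = relationD[OF p] and Q = relationD[OF q]
  define r where "r = monom (coeff p a) (a - b) * reflect_poly q"
  define p' where "p' = smult (coeff q 0) p - r"
  have q0: "coeff q 0 \<noteq> 0" using Q(2) by auto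
  have degr: "degree (reflect_poly q) = b" using q0 by (simp add: b_def)
  have ab: "a > 0" "b \<le> a" using P(4) le by (simp_all add: a_def b_def)
  have cr: "coeff (reflect_poly q) i = (if i \<le> b then coeff q (b - i) else 0)" for i
    by (simp add: coeff_reflect_poly b_def)
  have cr': "coeff r i = (if i < a - b then 0 else coeff p a * coeff (reflect_poly q) (i - (a - b)))" for i
    by (simp add: r_def coeff_monom_mult)
  have rT: "coeff r i \<in> T" "\<phi> (coeff r i) = 0" for i
  proof -
    have *: "coeff (reflect_poly q) j \<in> T" for j using Q(1) by (simp add: cr)
    show "coeff r i \<in> T" using * P(1) by (simp add: cr')
    show "\<phi> (coeff r i) = 0" using * P(1) P(3)[OF ab(1)] by (simp add: cr' h_mult)
  qed
  have "relation x p'"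
  proof (rule relationI)
    show "coeff p' i \<in> T" for i using rT P Q by (simp add: p'_def minus_closed)
    show "\<phi> (coeff p' 0) \<noteq> 0" using rT P Q by (simp add: p'_def h_minus h_mult)
    show "\<phi> (coeff p' i) = 0" if "i > 0" for i using rT P(1) P(3)[OF that] Q by (simp add: p'_def h_minus h_mult)
    have "poly (reflect_poly q) x = 0"
      using Q(5) x by (simp add: poly_reflect_poly_nz)
    then show "poly p' x = 0" using P(5) by (simp add: p'_def r_def)
  qed
  moreover have "degree p' < a"
  proof -
    have "coeff p' a = 0" using ab by (simp add: p'_def cr' cr mult.commute)
    moreover have "degree p' \<le> a" unfolding p'_def
    proof (rule degree_diff_le)
      show "degree (smult (coeff q 0) p) \<le> a" by (simp add: degree_smult_le a_def)
      show "degree r \<le> a"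
        using degree_mult_le[of "monom (coeff p a) (a - b)" "reflect_poly q"] degree_monom_le[of "coeff p a" "a - b"] ab degr
        unfolding r_def by linarith
    qed
    ultimately show ?thesis using ab by (metis le_neq_implies_less leading_coeff_0_iff degree_0)
  qed
  ultimately show ?thesis unfolding a_def by blast
qed

text \<open>
  Relations of least degree for \<open>x\<close> and for its inverse would shorten one another.
\<close>

lemma valuation_ring: assumes "x \<notin> T" shows "inverse x \<in> T"
proof (rule ccontr)
  assume "inverse x \<notin> T"
  have x: "x \<noteq> 0" using assms by auto
  obtain p where p: "relation x p" and minp: "\<And>p'. relation x p' \<Longrightarrow> degree p \<le> degree p'"
    using ex_has_least_nat[of "relation x" _ degree] relation_exists[OF assms] by blast
  obtain q where q: "relation (inverse x) q" and minq: "\<And>q'. relation (inverse x) q' \<Longrightarrow> degree q \<le> degree q'"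
    using ex_has_least_nat[of "relation (inverse x)" _ degree] relation_exists[OF \<open>inverse x \<notin> T\<close>] by blast
  show False
  proof (cases "degree q \<le> degree p")
    case True
    then show False using relation_reduce[OF p q x] minp by (meson linorder_not_le)
  next
    case False
    then have le: "degree p \<le> degree q" by simp
    have p': "relation (inverse (inverse x)) p" using p by simp
    show False using relation_reduce[OF q p' _ le] x minq by (meson linorder_not_le nonzero_imp_inverse_nonzero)
  qed
qed

lemma place: "place T \<phi>"
proof unfold_locales
  show "inverse x \<in> T" if "x \<in> T" "\<phi> x \<noteq> 0" for x using local that by blast
  fix x assume x: "x \<notin> T"
  then have "inverse x \<in> T" by (rule valuation_ring)
  moreover have "\<phi> (inverse x) = 0" using local[OF calculation] x by auto
  ultimately show "inverse x \<in> T \<and> \<phi> (inverse x) = 0" by blast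
qed

end

theorem place_extension:
  fixes h0 :: "'l::field \<Rightarrow> 'q::alg_closed_field"
  assumes "subring_hom S0 h0"
  obtains T \<phi> where "place T \<phi>" "S0 \<subseteq> T" "\<And>a. a \<in> S0 \<Longrightarrow> \<phi> a = h0 a"
proof -
  obtain T \<phi> where T: "subring_hom T \<phi>" "S0 \<subseteq> T" "\<And>a. a \<in> S0 \<Longrightarrow> \<phi> a = h0 a"
    and max: "\<And>S h. subring_hom S h \<Longrightarrow> T \<subseteq> S \<Longrightarrow> (\<And>a. a \<in> T \<Longrightarrow> h a = \<phi> a) \<Longrightarrow> S = T"
    by (rule maximal_subring_hom[OF assms]) blast
  have "maximal_hom T \<phi>"
    by (intro maximal_hom.intro T(1) maximal_hom_axioms.intro) (use max in blast)
  then show ?thesis using that maximal_hom.place T by blast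
qed

context place
begin

text \<open>
  If \<open>x\<close> were outside \<open>T\<close>, the reversed polynomial would vanish at
  \<open>1/x\<close>, whose residue is 0; but its constant term is 1.
\<close>

lemma integrally_closed:
  assumes p: "p \<in> polys_over T" "lead_coeff p = 1" "poly p x = 0"
  shows "x \<in> T"
proof (rule ccontr)
  assume x: "x \<notin> T"
  then have ix: "inverse x \<in> T" "\<phi> (inverse x) = 0" using valuation by auto
  have "x \<noteq> 0" using x by auto
  then have "poly (reflect_poly p) (inverse x) = 0"
    using p(3) by (simp add: poly_reflect_poly_nz)
  moreover have "reflect_poly p \<in> polys_over T"
    using p(1) by (auto simp: polys_over_def coeff_reflect_poly)
  ultimately have "poly (map_poly \<phi> (reflect_poly p)) 0 = 0"
    using h_poly[OF _ ix(1)] ix(2) by (metis h_zero)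
  then show False using p(2) by (simp add: poly_0_coeff_0)
qed

end

lemma alg_closed_splits:
  fixes p :: "'a::alg_closed_field poly"
  assumes "lead_coeff p = 1"
  obtains rs where "p = (\<Prod>r\<leftarrow>rs. [:- r, 1:])"
  using assms
proof (induction "degree p" arbitrary: p thesis)
  case 0
  then have "p = 1" using monic_degree_0[of p] by auto
  then show ?case using 0(2)[of "[]"] by simp
next
  case (Suc d)
  obtain r where "poly p r = 0" using alg_closed_imp_poly_has_root[of p] Suc by auto
  then obtain q where q: "p = [:- r, 1:] * q" by (metis dvdE poly_eq_0_iff_dvd)
  have "q \<noteq> 0" using q Suc.prems by auto
  have "lead_coeff q = 1" using Suc.prems(2) unfolding q lead_coeff_mult by simp
  have "degree q = d"
    using Suc.hyps(2) \<open>q \<noteq> 0\<close> unfolding q by (subst (asm) degree_mult_eq) auto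
  note * = this \<open>lead_coeff q = 1\<close>
  then obtain rs where "q = (\<Prod>r\<leftarrow>rs. [:- r, 1:])" using Suc.hyps(1)[of q] * by blast
  then show ?case using Suc.prems(1)[of "r # rs"] q by simp
qed

text \<open>
  A monic polynomial over the residue field lifts to a monic polynomial over \<open>T\<close>;
  this splits in the field, and its roots lie in \<open>T\<close> because valuation rings are
  integrally closed.
\<close>

lemma image_algebraically_closed:
  fixes \<phi> :: "'l::alg_closed_field \<Rightarrow> 'q::field"
  assumes "place T \<phi>"
    and q: "\<And>i. coeff q i \<in> \<phi> ` T" "lead_coeff q = 1" "poly q c = 0"
  shows "c \<in> \<phi> ` T"
proof -
  interpret place T \<phi> by fact
  interpret P: subring_hom "polys_over T" "map_poly \<phi>" by (rule subring_hom_poly)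
  define t where "t i = (SOME x. x \<in> T \<and> \<phi> x = coeff q i)" for i
  have "t i \<in> T \<and> \<phi> (t i) = coeff q i" for i
    unfolding t_def by (rule someI_ex) (use q(1)[of i] in auto)
  then have t: "\<And>i. t i \<in> T" "\<And>i. \<phi> (t i) = coeff q i" by simp_all
  define n where "n = degree q"
  define p where "p = monom 1 n + (\<Sum>i<n. monom (t i) i)"
  have cp: "coeff p i = (if i = n then 1 else if i < n then t i else 0)" for i
    by (simp add: p_def coeff_sum sum.delta)
  have "degree p = n" by (intro antisym degree_le le_degree) (auto simp: cp)
  then have lp: "lead_coeff p = 1" by (simp add: cp)
  have pT: "p \<in> polys_over T" using t by (auto simp: polys_over_def cp)
  have mp: "map_poly \<phi> p = q"
    using q(2) t by (intro poly_eqI) (auto simp: cp n_def coeff_eq_0)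
  obtain rs where rs: "p = (\<Prod>r\<leftarrow>rs. [:- r, 1:])" by (rule alg_closed_splits[OF lp])
  have rT: "r \<in> T" if "r \<in> set rs" for r
  proof (rule integrally_closed[OF pT lp])
    show "poly p r = 0" unfolding rs using that by (induction rs) auto
  qed
  have "map_poly \<phi> (\<Prod>r\<leftarrow>rs. [:- r, 1:]) = (\<Prod>r\<leftarrow>map \<phi> rs. [:- r, 1:]) \<and> (\<Prod>r\<leftarrow>rs. [:- r, 1:]) \<in> polys_over T"
    if "set rs \<subseteq> T" for rs
    using that
  proof (induction rs)
    case Nil
    show ?case by (simp add: map_poly_1 pCons_one)
  next
    case (Cons r rs)
    have r: "[:- r, 1:] \<in> polys_over T" "map_poly \<phi> [:- r, 1:] = [:- \<phi> r, 1:]"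
      using Cons.prems by (auto simp: map_poly_pCons_zero h_uminus map_poly_1 pCons_one)
    have ih: "map_poly \<phi> (\<Prod>r\<leftarrow>rs. [:- r, 1:]) = (\<Prod>r\<leftarrow>map \<phi> rs. [:- r, 1:])"
      "(\<Prod>r\<leftarrow>rs. [:- r, 1:]) \<in> polys_over T" using Cons by auto
    show ?case
      by (simp only: list.map prod_list.Cons P.h_mult[OF r(1) ih(2)] r(2) ih(1) P.mult_closed[OF r(1) ih(2)] simp_thms)
  qed
  then have "q = (\<Prod>r\<leftarrow>map \<phi> rs. [:- r, 1:])" using mp rs rT by auto
  then have "poly (\<Prod>r\<leftarrow>map \<phi> rs. [:- r, 1:]) c = 0" using q(3) by simp
  then have "c \<in> \<phi> ` set rs" by (induction rs) auto
  then show ?thesis using rT by blast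
qed

section \<open>Puiseux series\<close>

definition comaximal :: "'a::comm_ring_1 \<Rightarrow> 'a \<Rightarrow> bool" where
  "comaximal a b \<longleftrightarrow> (\<exists>u v. u * a + v * b = 1)"

lemma comaximal_mult:
  assumes "comaximal a c" "comaximal b c"
  shows "comaximal (a * b) c"
proof -
  obtain u v u' v' where "u * a + v * c = 1" "u' * b + v' * c = 1"
    using assms by (auto simp: comaximal_def)
  moreover have "(u * u') * (a * b) + (u * a * v' + v * u' * b + v * v' * c) * c =
      (u * a + v * c) * (u' * b + v' * c)" by (simp add: algebra_simps)
  ultimately have "(u * u') * (a * b) + (u * a * v' + v * u' * b + v * v' * c) * c = 1" by simp
  then show ?thesis unfolding comaximal_def by blast
qed

lemma comaximal_power: "comaximal a b \<Longrightarrow> comaximal (a ^ k) b"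
proof (induction k)
  case 0
  have "(1 :: 'a) * 1 + 0 * b = 1" by simp
  then show ?case unfolding comaximal_def by (metis power_0)
qed (simp add: comaximal_mult)

lemma comaximal_linear:
  fixes h :: "'a::field poly"
  assumes "poly h c \<noteq> 0"
  shows "comaximal [:- c, 1:] h"
proof -
  have "poly (h - [:poly h c:]) c = 0" by simp
  then obtain q where q: "h - [:poly h c:] = [:- c, 1:] * q" by (metis dvdE poly_eq_0_iff_dvd)
  have gen: "k * (h - l * q) = 1 \<Longrightarrow> (- (k * q)) * l + k * h = 1" for k h l q :: "'a poly"
    by (simp add: algebra_simps)
  have "[:1 / poly h c:] * [:poly h c:] = 1" using assms by (simp add: pCons_one)
  then have "[:1 / poly h c:] * (h - [:- c, 1:] * q) = 1" by (simp only: q[symmetric] diff_diff_eq2 add_diff_cancel_left')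
  then have "(- ([:1 / poly h c:] * q)) * [:- c, 1:] + [:1 / poly h c:] * h = 1"
    by (rule gen)
  then show ?thesis unfolding comaximal_def by blast
qed

lemma bezout_degree_bounded:
  fixes g h c :: "'a::field poly"
  assumes "comaximal g h" "g \<noteq> 0" "h \<noteq> 0" "c = 0 \<or> degree c < degree g + degree h"
  shows "\<exists>a b. g * b + h * a = c \<and> (a = 0 \<or> degree a < degree g) \<and> (b = 0 \<or> degree b < degree h)"
proof (cases "c = 0")
  case True
  then show ?thesis by (intro exI[of _ 0]) simp
next
  case c0: False
  obtain u v where uv: "u * g + v * h = 1" using assms(1) by (auto simp: comaximal_def)
  define a where "a = (v * c) mod g"
  have a: "a = 0 \<or> degree a < degree g" unfolding a_def using degree_mod_less[OF assms(2)] by blast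
  have c: "c = g * (u * c) + h * (v * c)"
  proof -
    have "c = (u * g + v * h) * c" using uv by simp
    then show ?thesis by (simp add: algebra_simps)
  qed
  have d: "v * c = g * ((v * c) div g) + a" by (simp add: a_def)
  have "c - h * a = g * (u * c) + h * (g * ((v * c) div g) + a) - h * a"
    using c d by metis
  then have "c - h * a = g * (u * c + h * ((v * c) div g))" by (simp add: algebra_simps)
  then obtain b where b: "c - h * a = g * b" by blast
  have "b = 0 \<or> degree b < degree h"
  proof (cases "b = 0")
    case False
    have "degree (h * a) < degree g + degree h \<or> h * a = 0"
      using a degree_mult_le[of h a] by (cases "a = 0") auto
    then have "degree (c - h * a) < degree g + degree h"
      using assms(4) c0 degree_diff_le_max[of c "h * a"] by (cases "h * a = 0") auto
    then show ?thesis using b False assms(2) by (simp add: degree_mult_eq)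
  qed simp
  then show ?thesis using a b by (intro exI[of _ a] exI[of _ b]) (simp add: algebra_simps)
qed

definition fps_poly_coeff :: "'a::comm_ring_1 fps poly \<Rightarrow> nat \<Rightarrow> 'a poly" where
  "fps_poly_coeff f k = map_poly (\<lambda>a. fps_nth a k) f"

lemma coeff_fps_poly_coeff [simp]: "coeff (fps_poly_coeff f k) j = fps_nth (coeff f j) k"
  by (simp add: fps_poly_coeff_def coeff_map_poly)

text \<open>
  The equation for the coefficient of \<open>s\<^sup>k\<close> in \<open>G H = f\<close> is
  \<open>g\<^sub>0 H\<^sub>k + h\<^sub>0 G\<^sub>k = c\<^sub>k\<close>, where
  \<open>c\<^sub>k\<close> depends on earlier terms only. It has a solution of bounded degree
  because \<open>g\<^sub>0\<close> and \<open>h\<^sub>0\<close> are comaximal, and the bounds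
  keep both factors monic.
\<close>

lemma hensel_sequences:
  fixes f :: "'a::field fps poly"
  assumes f: "lead_coeff f = 1" "fps_poly_coeff f 0 = g0 * h0"
    and g0: "lead_coeff g0 = 1" and h0: "lead_coeff h0 = 1" and co: "comaximal g0 h0"
  obtains G H where "G 0 = g0" "H 0 = h0"
    "\<And>k. k > 0 \<Longrightarrow> G k = 0 \<or> degree (G k) < degree g0"
    "\<And>k. k > 0 \<Longrightarrow> H k = 0 \<or> degree (H k) < degree h0"
    "\<And>k. (\<Sum>i\<le>k. G i * H (k - i)) = fps_poly_coeff f k"
proof -
  define n where "n = degree f"
  have nz: "g0 \<noteq> 0" "h0 \<noteq> 0" using g0 h0 by auto
  have "degree (g0 * h0) = n"
  proof -
    have "degree (fps_poly_coeff f 0) \<le> n" unfolding fps_poly_coeff_def n_def by (rule degree_map_poly_le)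
    moreover have "coeff (fps_poly_coeff f 0) n = 1" using f(1) by (simp add: n_def)
    ultimately show ?thesis using f(2) by (metis le_antisym le_degree zero_neq_one)
  qed
  then have n: "n = degree g0 + degree h0" using nz by (simp add: degree_mult_eq)
  define step where "step = (\<lambda>(GH :: nat \<Rightarrow> 'a poly \<times> 'a poly) k. SOME ab :: 'a poly \<times> 'a poly.
     g0 * snd ab + h0 * fst ab = fps_poly_coeff f k - (\<Sum>i\<in>{0<..<k}. fst (GH i) * snd (GH (k - i)))
     \<and> (fst ab = 0 \<or> degree (fst ab) < degree g0) \<and> (snd ab = 0 \<or> degree (snd ab) < degree h0))"
  define W where "W = rec_nat (\<lambda>_ :: nat. (g0, h0)) (\<lambda>k GH. GH(Suc k := step GH (Suc k)))"
  have W0: "W 0 = (\<lambda>_. (g0, h0))" and WS: "W (Suc k) = (W k)(Suc k := step (W k) (Suc k))" for k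
    by (simp_all add: W_def)
  define GH where "GH k = W k k" for k
  have Wk: "W (k + d) k = GH k" for k d
    by (induction d) (simp_all add: WS GH_def)
  have Wi: "W k i = GH i" if "i \<le> k" for i k
    using Wk[of i "k - i"] that by simp
  define G H where "G k = fst (GH k)" and "H k = snd (GH k)" for k
  have G0: "G 0 = g0" "H 0 = h0" by (simp_all add: G_def H_def GH_def W0)
  have main: "k > 0 \<longrightarrow> g0 * H k + h0 * G k = fps_poly_coeff f k - (\<Sum>i\<in>{0<..<k}. G i * H (k - i))
     \<and> (G k = 0 \<or> degree (G k) < degree g0) \<and> (H k = 0 \<or> degree (H k) < degree h0)" for k
  proof (induction k rule: less_induct)
    case (less k)
    show ?case
    proof
      assume k: "k > 0"
      then obtain m where m: "k = Suc m" by (cases k) auto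
      have GHk: "GH k = step (W m) k" by (simp add: GH_def m WS)
      let ?c = "fps_poly_coeff f k - (\<Sum>i\<in>{0<..<k}. G i * H (k - i))"
      have sum_eq: "(\<Sum>i\<in>{0<..<k}. fst (W m i) * snd (W m (k - i))) = (\<Sum>i\<in>{0<..<k}. G i * H (k - i))"
        using m by (intro sum.cong refl) (auto simp: Wi G_def H_def)
      have "coeff ?c j = 0" if "j \<ge> n" for j
      proof -
        have "coeff (fps_poly_coeff f k) j = 0"
          using that f(1) k by (cases "j = n") (auto simp: n_def coeff_eq_0)
        moreover have "coeff (G i * H (k - i)) j = 0" if i: "i \<in> {0<..<k}" for i
        proof (cases "G i * H (k - i) = 0")
          case True
          then show ?thesis by (simp only: coeff_0)
        next
          case False
          then have "degree (G i) < degree g0" "degree (H (k - i)) < degree h0"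
            using less.IH[of i] less.IH[of "k - i"] i by auto
          then have "degree (G i * H (k - i)) < j"
            using degree_mult_le[of "G i" "H (k - i)"] that \<open>j \<ge> n\<close> n by linarith
          then show ?thesis by (rule coeff_eq_0)
        qed
        ultimately show ?thesis by (simp add: coeff_sum)
      qed
      then have c: "?c = 0 \<or> degree ?c < degree g0 + degree h0"
        unfolding n[symmetric] using leading_coeff_0_iff[of ?c] linorder_not_le by blast
      obtain a b where "g0 * b + h0 * a = ?c" "a = 0 \<or> degree a < degree g0" "b = 0 \<or> degree b < degree h0"
        using bezout_degree_bounded[OF co nz c] by blast
      then have "\<exists>ab. g0 * snd ab + h0 * fst ab = ?c
         \<and> (fst ab = 0 \<or> degree (fst ab) < degree g0) \<and> (snd ab = 0 \<or> degree (snd ab) < degree h0)"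
        by (intro exI[of _ "(a, b)"]) simp
      from someI_ex[OF this]
      show "g0 * H k + h0 * G k = ?c \<and> (G k = 0 \<or> degree (G k) < degree g0) \<and> (H k = 0 \<or> degree (H k) < degree h0)"
        unfolding G_def[of k] H_def[of k] GHk step_def sum_eq .
    qed
  qed
  have "(\<Sum>i\<le>k. G i * H (k - i)) = fps_poly_coeff f k" for k
  proof (cases "k = 0")
    case True
    then show ?thesis using G0 f(2) by simp
  next
    case False
    have "{..k} = insert 0 (insert k {0<..<k})" using False by auto
    then have "(\<Sum>i\<le>k. G i * H (k - i)) = g0 * H k + h0 * G k + (\<Sum>i\<in>{0<..<k}. G i * H (k - i))"
      using False G0 by (simp add: algebra_simps)
    then show ?thesis using main[of k] False by simp
  qed
  then show ?thesis using that[of G H] G0 main by blast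
qed

lemma hensel_factorization:
  fixes f :: "'a::field fps poly"
  assumes f: "lead_coeff f = 1" "fps_poly_coeff f 0 = g0 * h0"
    and g0: "lead_coeff g0 = 1" and h0: "lead_coeff h0 = 1" and co: "comaximal g0 h0"
  obtains g h where "f = g * h" "lead_coeff g = 1" "degree g = degree g0"
    "lead_coeff h = 1" "degree h = degree h0"
proof -
  obtain G H where G: "G 0 = g0" "\<And>k. k > 0 \<Longrightarrow> G k = 0 \<or> degree (G k) < degree g0"
    and H: "H 0 = h0" "\<And>k. k > 0 \<Longrightarrow> H k = 0 \<or> degree (H k) < degree h0"
    and GH: "\<And>k. (\<Sum>i\<le>k. G i * H (k - i)) = fps_poly_coeff f k"
    by (rule hensel_sequences[OF assms]) blast
  define asm where "asm = (\<lambda>(W :: nat \<Rightarrow> 'a poly) m. (\<Sum>j\<le>m. monom (Abs_fps (\<lambda>k. coeff (W k) j)) j))"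
  have asm: "lead_coeff (asm W (degree w)) = 1 \<and> degree (asm W (degree w)) = degree w \<and>
      (\<forall>j k. fps_nth (coeff (asm W (degree w)) j) k = coeff (W k) j)"
    if W: "W 0 = w" "\<And>k. k > 0 \<Longrightarrow> W k = 0 \<or> degree (W k) < degree w" and w: "lead_coeff w = 1" for W w
  proof -
    have le: "j > degree w \<Longrightarrow> coeff (W k) j = 0" for j k
      using W(1) W(2)[of k] by (cases "k = 0") (auto simp: coeff_eq_0)
    have c: "coeff (asm W (degree w)) j = (if j \<le> degree w then Abs_fps (\<lambda>k. coeff (W k) j) else 0)" for j
      by (simp add: asm_def coeff_sum sum.delta)
    have top: "coeff (asm W (degree w)) (degree w) = 1"
    proof (rule fps_ext)
      fix k
      show "fps_nth (coeff (asm W (degree w)) (degree w)) k = fps_nth 1 k"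
        using W(1) W(2)[of k] w by (cases "k = 0") (auto simp: c coeff_eq_0)
    qed
    have "degree (asm W (degree w)) = degree w"
      using top by (intro antisym degree_le le_degree) (auto simp: c)
    then show ?thesis using top c le by (auto simp: )
  qed
  define g h where "g = asm G (degree g0)" and "h = asm H (degree h0)"
  have g: "lead_coeff g = 1" "degree g = degree g0" "\<And>j k. fps_nth (coeff g j) k = coeff (G k) j"
    using asm[of G g0] G g0 by (auto simp: g_def)
  have h: "lead_coeff h = 1" "degree h = degree h0" "\<And>j k. fps_nth (coeff h j) k = coeff (H k) j"
    using asm[of H h0] H h0 by (auto simp: h_def)
  have "f = g * h"
  proof (rule poly_eqI, rule fps_ext)
    fix j k
    have "fps_nth (coeff (g * h) j) k = (\<Sum>a\<le>j. \<Sum>i\<le>k. coeff (G i) a * coeff (H (k - i)) (j - a))"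
      by (simp add: coeff_mult fps_sum_nth fps_mult_nth g h atMost_atLeast0)
    also have "\<dots> = (\<Sum>i\<le>k. \<Sum>a\<le>j. coeff (G i) a * coeff (H (k - i)) (j - a))"
      by (rule sum.swap)
    also have "\<dots> = coeff (fps_poly_coeff f k) j"
      unfolding GH[symmetric] by (simp add: coeff_sum coeff_mult)
    finally show "fps_nth (coeff f j) k = fps_nth (coeff (g * h) j) k" by simp
  qed
  then show ?thesis using that g h by blast
qed

text \<open>
  Adjoining an \<open>N\<close>-th root of the variable \<open>s\<close> is the same as
  substituting \<open>s\<^sup>N\<close> for \<open>s\<close>; with this encoding, ramified
  extensions of the field of Laurent series need no new type.
\<close>

definition fls_subst_power :: "nat \<Rightarrow> 'a::zero fls \<Rightarrow> 'a fls" where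
  "fls_subst_power N a = Abs_fls (\<lambda>i. if int N dvd i then fls_nth a (i div int N) else 0)"

lemma fls_subst_power_nth:
  assumes "N > 0"
  shows "fls_nth (fls_subst_power N a) i = (if int N dvd i then fls_nth a (i div int N) else 0)"
  unfolding fls_subst_power_def
proof (rule nth_Abs_fls_lower_bound[of "int N * fls_subdegree a"], intro allI impI)
  fix k assume k: "k < int N * fls_subdegree a"
  show "(if int N dvd k then fls_nth a (k div int N) else 0) = 0"
  proof (cases "int N dvd k")
    case True
    then obtain l where l: "k = int N * l" by (elim dvdE)
    then have "l < fls_subdegree a" using k assms by simp
    then show ?thesis using l assms by simp
  qed simp
qed

lemma comm_ring_hom_fls_subst_power:
  assumes N: "N > 0"
  shows "comm_ring_hom (fls_subst_power N :: 'a::comm_ring_1 fls \<Rightarrow> 'a fls)"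
proof
  note [simp] = fls_subst_power_nth[OF N]
  show "fls_subst_power N 0 = (0 :: 'a fls)" by (rule fls_eqI) simp
  show "fls_subst_power N 1 = (1 :: 'a fls)" using N by (intro fls_eqI) (auto elim!: dvdE)
  fix f g :: "'a fls"
  show "fls_subst_power N (f + g) = fls_subst_power N f + fls_subst_power N g"
    by (rule fls_eqI) simp
  show "fls_subst_power N (f * g) = fls_subst_power N f * fls_subst_power N g"
  proof (rule fls_eqI)
    fix n
    let ?N = "int N" and ?a = "fls_subdegree f" and ?b = "fls_subdegree g"
    have 0: "fls_nth (fls_subst_power N h) i = 0" if "i < ?N * fls_subdegree h" for h :: "'a fls" and i
    proof (cases "?N dvd i")
      case True
      then obtain l where "i = ?N * l" by (elim dvdE)
      then show ?thesis using that N by simp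
    qed simp
    have "fls_nth (fls_subst_power N f * fls_subst_power N g) n =
       (\<Sum>i\<in>{?N * ?a..n - ?N * ?b}. fls_nth (fls_subst_power N f) i * fls_nth (fls_subst_power N g) (n - i))"
      by (rule fls_times_nth_bounds) (use 0 in auto)
    also have "\<dots> = fls_nth (fls_subst_power N (f * g)) n"
    proof (cases "?N dvd n")
      case True
      then obtain l where l: "n = ?N * l" by (elim dvdE)
      have "(\<Sum>i\<in>{?N * ?a..n - ?N * ?b}. fls_nth (fls_subst_power N f) i * fls_nth (fls_subst_power N g) (n - i)) =
          (\<Sum>i\<in>(*) ?N ` {?a..l - ?b}. fls_nth (fls_subst_power N f) i * fls_nth (fls_subst_power N g) (n - i))"
      proof (rule sum.mono_neutral_right)
        show "(*) ?N ` {?a..l - ?b} \<subseteq> {?N * ?a..n - ?N * ?b}"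
          using N by (auto simp: l right_diff_distrib[symmetric])
        show "\<forall>i\<in>{?N * ?a..n - ?N * ?b} - (*) ?N ` {?a..l - ?b}.
            fls_nth (fls_subst_power N f) i * fls_nth (fls_subst_power N g) (n - i) = 0"
        proof
          fix i assume i: "i \<in> {?N * ?a..n - ?N * ?b} - (*) ?N ` {?a..l - ?b}"
          have "\<not> ?N dvd i"
          proof
            assume "?N dvd i"
            then obtain j where j: "i = ?N * j" by (elim dvdE)
            then have "j \<in> {?a..l - ?b}" using i N by (auto simp: l right_diff_distrib[symmetric])
            then show False using i j by blast
          qed
          then show "fls_nth (fls_subst_power N f) i * fls_nth (fls_subst_power N g) (n - i) = 0" by simp
        qed
      qed simp
      also have "\<dots> = (\<Sum>j\<in>{?a..l - ?b}. fls_nth f j * fls_nth g (l - j))"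
      proof (subst sum.reindex)
        show "inj_on ((*) ?N) {?a..l - ?b}" using N by (auto intro: inj_onI)
        show "sum ((\<lambda>i. fls_nth (fls_subst_power N f) i * fls_nth (fls_subst_power N g) (n - i)) \<circ> (*) ?N) {?a..l - ?b} =
            (\<Sum>j\<in>{?a..l - ?b}. fls_nth f j * fls_nth g (l - j))"
          using N by (intro sum.cong) (simp_all add: l right_diff_distrib[symmetric])
      qed
      also have "\<dots> = fls_nth (f * g) l" by (rule fls_times_nth(2)[symmetric])
      finally show ?thesis using l N by simp
    next
      case False
      have "fls_nth (fls_subst_power N f) i * fls_nth (fls_subst_power N g) (n - i) = 0" for i
      proof -
        have "\<not> (?N dvd i \<and> ?N dvd n - i)" using False by (metis diff_add_cancel dvd_add)
        then show ?thesis by auto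
      qed
      then show ?thesis using False by simp
    qed
    finally show "fls_nth (fls_subst_power N (f * g)) n = fls_nth (fls_subst_power N f * fls_subst_power N g) n" by simp
  qed
qed

lemma fls_subst_power_zero [simp]: "fls_subst_power N 0 = 0"
  by (simp add: fls_subst_power_def zero_fls.abs_eq[symmetric] cong: if_cong)

lemma fls_subst_power_mult:
  assumes "N > 0" "M > 0"
  shows "fls_subst_power (N * M) a = fls_subst_power M (fls_subst_power N a)"
proof (rule fls_eqI)
  fix i
  have "int N * int M dvd i \<longleftrightarrow> int M dvd i \<and> int N dvd i div int M"
    using assms by (auto simp: dvd_div_iff_mult mult.commute elim: dvd_mult_left dvd_mult_right)
  moreover have "i div (int N * int M) = i div int M div int N"
    using assms by (simp add: zdiv_zmult2_eq mult.commute)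
  ultimately show "fls_nth (fls_subst_power (N * M) a) i = fls_nth (fls_subst_power M (fls_subst_power N a)) i"
    using assms by (simp add: fls_subst_power_nth)
qed

definition splits :: "'a::comm_ring_1 poly \<Rightarrow> bool" where
  "splits p \<longleftrightarrow> (\<exists>ys. p = (\<Prod>y\<leftarrow>ys. [:- y, 1:]))"

lemma splits_mult: "splits p \<Longrightarrow> splits q \<Longrightarrow> splits (p * q)"
  unfolding splits_def by (metis map_append prod_list.append)

lemma splits_hom:
  assumes "comm_ring_hom h" "splits p"
  shows "splits (map_poly h p)"
proof -
  interpret comm_ring_hom h by fact
  interpret m: map_poly_comm_ring_hom h ..
  obtain ys where "p = (\<Prod>y\<leftarrow>ys. [:- y, 1:])" using assms by (auto simp: splits_def)
  moreover have "map_poly h (\<Prod>y\<leftarrow>ys. [:- y, 1:]) = (\<Prod>y\<leftarrow>map h ys. [:- y, 1:])"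
    by (induction ys) (simp_all only: list.map prod_list.Nil prod_list.Cons m.hom_one m.hom_mult, simp_all add: hom_uminus)
  ultimately show ?thesis unfolding splits_def by blast
qed

lemma splits_shift:
  assumes "splits p"
  shows "splits (pcompose p [:a, 1:])"
proof -
  obtain ys where "p = (\<Prod>y\<leftarrow>ys. [:- y, 1:])" using assms by (auto simp: splits_def)
  moreover have "pcompose (\<Prod>y\<leftarrow>ys. [:- y, 1:]) [:a, 1:] = (\<Prod>y\<leftarrow>map (\<lambda>y. y - a) ys. [:- y, 1:])"
    by (induction ys) (simp_all only: list.map prod_list.Nil prod_list.Cons pcompose_1 pcompose_mult, simp_all add: pcompose_pCons)
  ultimately show ?thesis unfolding splits_def by blast
qed

lemma splits_scale:
  fixes p :: "'a::field poly"
  assumes "splits p" "u \<noteq> 0"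
  shows "splits (smult ((1 / u) ^ degree p) (pcompose p [:0, u:]))"
proof -
  obtain ys where ys: "p = (\<Prod>y\<leftarrow>ys. [:- y, 1:])" using assms by (auto simp: splits_def)
  have deg: "degree (\<Prod>y\<leftarrow>ys. [:- y, 1:]) = length ys" for ys :: "'a list"
    by (induction ys) (simp_all add: degree_mult_eq prod_list_zero_iff image_iff del: mult_pCons_left)
  have "smult ((1 / u) ^ length ys) (pcompose (\<Prod>y\<leftarrow>ys. [:- y, 1:]) [:0, u:]) = (\<Prod>y\<leftarrow>map (\<lambda>y. y / u) ys. [:- y, 1:])"
  proof (induction ys)
    case (Cons y ys)
    have "smult (1 / u) (pcompose [:- y, 1:] [:0, u:]) = [:- (y / u), 1:]"
      using assms(2) by (simp add: pcompose_pCons)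
    note eq = this
    have "[:- (y / u), 1:] * smult ((1 / u) ^ length ys) (pcompose (\<Prod>y\<leftarrow>ys. [:- y, 1:]) [:0, u:])
        = smult ((1 / u) ^ Suc (length ys)) (pcompose [:- y, 1:] [:0, u:] * pcompose (\<Prod>y\<leftarrow>ys. [:- y, 1:]) [:0, u:])"
      unfolding eq[symmetric] by (simp only: mult_smult_left mult_smult_right smult_smult power_Suc mult.commute)
    then show ?case using Cons by (simp only: list.map prod_list.Cons pcompose_mult list.size add_0_right add_0_left add_Suc_right Suc_eq_plus1)
  qed simp
  then show ?thesis unfolding splits_def using ys deg[of ys] by metis
qed

text \<open>
  One ramification index that serves all polynomials of degree \<open>n\<close>. A Newton
  polygon step in degree \<open>n\<close> meets slopes with denominators at most
  \<open>n\<close>.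
\<close>

primrec puiseux_exponent :: "nat \<Rightarrow> nat" where
  "puiseux_exponent 0 = 1"
| "puiseux_exponent (Suc n) = fact (Suc n) * puiseux_exponent n"

lemma puiseux_exponent_pos: "puiseux_exponent n > 0"
  by (induction n) auto

lemma puiseux_exponent_dvd: "k \<le> n \<Longrightarrow> puiseux_exponent k dvd puiseux_exponent n"
  by (induction n) (auto simp: le_Suc_eq)

lemma splits_subst_dvd:
  fixes p :: "'a::comm_ring_1 fls poly"
  assumes "splits (map_poly (fls_subst_power N) p)" "N dvd M" "M > 0"
  shows "splits (map_poly (fls_subst_power M) p)"
proof -
  obtain K where K: "M = N * K" using assms(2) by (elim dvdE)
  then have pos: "N > 0" "K > 0" using assms(3) by auto
  interpret N: comm_ring_hom "fls_subst_power N :: 'a fls \<Rightarrow> _" by (rule comm_ring_hom_fls_subst_power[OF pos(1)])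
  interpret K: comm_ring_hom "fls_subst_power K :: 'a fls \<Rightarrow> _" by (rule comm_ring_hom_fls_subst_power[OF pos(2)])
  have "map_poly (fls_subst_power M) p = map_poly (fls_subst_power K) (map_poly (fls_subst_power N) p)"
    unfolding K by (subst map_poly_map_poly) (simp_all add: o_def fls_subst_power_mult[OF pos, abs_def])
  then show ?thesis
    using splits_hom[OF comm_ring_hom_fls_subst_power[OF pos(2)] assms(1)] by simp
qed

lemma coeff_linear_power_pred:
  "coeff ([:a, 1:] ^ Suc m) m = of_nat (Suc m) * (a :: 'a::comm_ring_1)"
proof (induction m)
  case (Suc m)
  have "coeff ([:a, 1:] ^ Suc (Suc m)) (Suc m) = a * coeff ([:a, 1:] ^ Suc m) (Suc m) + coeff ([:a, 1:] ^ Suc m) m"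
    unfolding power_Suc[of _ "Suc m"] by (simp add: coeff_pCons)
  then show ?case unfolding Suc coeff_linear_power by (simp add: algebra_simps)
qed simp

text \<open>
  The translation that removes the second highest coefficient divides by the degree.
\<close>

lemma depressed_form:
  fixes f :: "'a::field poly"
  assumes f: "lead_coeff f = 1" "degree f = Suc m" and nz: "of_nat (Suc m) \<noteq> (0 :: 'a)"
  obtains a r where "f = pcompose (monom 1 (Suc m) + r) [:a, 1:]" "r = 0 \<or> degree r < m"
proof -
  define a where "a = coeff f m / of_nat (Suc m)"
  define q where "q = f - [:a, 1:] ^ Suc m"
  have deg: "degree ([:a, 1:] ^ Suc m) = Suc m" by (rule degree_linear_power)
  have "coeff q i = 0" if "i \<ge> m" for i
  proof -
    consider "i = m" | "i = Suc m" | "i > Suc m" using \<open>i \<ge> m\<close> by linarith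
    then show ?thesis
    proof cases
      case 1
      then show ?thesis using nz unfolding q_def coeff_diff coeff_linear_power_pred 1 by (simp add: a_def del: of_nat_Suc)
    next
      case 2
      then show ?thesis using f unfolding q_def coeff_diff 2 coeff_linear_power by simp
    next
      case 3
      then show ?thesis using f deg unfolding q_def coeff_diff by (simp add: coeff_eq_0 del: power_Suc)
    qed
  qed
  then have q: "q = 0 \<or> degree q < m" by (metis leading_coeff_0_iff linorder_not_le)
  define r where "r = pcompose q [:- a, 1:]"
  have x: "pcompose [:0, 1:] [:a, 1:] = [:a, 1:]" by (simp add: pcompose_pCons)
  have "monom 1 (Suc m) = ([:0, 1:] :: 'a poly) ^ Suc m" by (simp only: monom_altdef smult_1_left)
  then have "pcompose (monom 1 (Suc m) + r) [:a, 1:] = [:a, 1:] ^ Suc m + pcompose r [:a, 1:]"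
    by (simp only: pcompose_add pcompose_hom.hom_power x)
  also have "pcompose r [:a, 1:] = pcompose q (pcompose [:- a, 1:] [:a, 1:])"
    unfolding r_def by (rule pcompose_assoc[symmetric])
  also have "pcompose [:- a, 1:] [:a, 1:] = [:0, 1:]" by (simp add: pcompose_pCons)
  also have "pcompose q [:0, 1:] = q" by (rule pcompose_idR)
  also have "[:a, 1:] ^ Suc m + q = f" by (simp add: q_def)
  finally have "f = pcompose (monom 1 (Suc m) + r) [:a, 1:]" by simp
  moreover have "r = 0 \<or> degree r < m"
    using q by (auto simp: r_def degree_pcompose)
  ultimately show ?thesis using that by blast
qed

text \<open>
  If \<open>g\<close> were a power of a linear factor \<open>t - c\<close>, its second highest
  coefficient would be \<open>-(m+1)c\<close>, so that \<open>c = 0\<close>.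
\<close>

lemma root_factor_alg_closed:
  fixes g :: "'a::alg_closed_field poly"
  assumes g: "lead_coeff g = 1" "degree g = Suc m" "coeff g m = 0" and nz: "of_nat (Suc m) \<noteq> (0 :: 'a)"
    and ne: "g \<noteq> monom 1 (Suc m)"
  obtains g0 h0 where "g = g0 * h0" "lead_coeff g0 = 1" "lead_coeff h0 = 1" "comaximal g0 h0"
    "degree g0 > 0" "degree h0 > 0"
proof -
  obtain c where c: "poly g c = 0" using alg_closed_imp_poly_has_root[of g] g by auto
  have g0: "g \<noteq> 0" using g by auto
  obtain h where h: "g = [:- c, 1:] ^ Polynomial.order c g * h" "\<not> [:- c, 1:] dvd h"
    using order_decomp[OF g0] by blast
  have k: "Polynomial.order c g > 0" using c g0 by (simp add: order_gt_0_iff)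
  have hc: "poly h c \<noteq> 0" using h(2) by (simp add: poly_eq_0_iff_dvd)
  have lc: "lead_coeff ([:- c, 1:] ^ Polynomial.order c g) = 1"
    by (simp only: lead_coeff_power) simp
  have lh: "lead_coeff h = 1" using g(1) lc h(1) by (metis lead_coeff_mult mult_1)
  have "degree h > 0"
  proof (rule ccontr)
    assume "\<not> degree h > 0"
    then have "h = 1" using lh monic_degree_0[of h] by auto
    then have gk: "g = [:- c, 1:] ^ Polynomial.order c g" using h(1) by simp
    then have "Polynomial.order c g = Suc m" using g(2) degree_linear_power by metis
    then have g': "g = [:- c, 1:] ^ Suc m" using gk by simp
    then have "of_nat (Suc m) * (- c) = 0" using g(3) coeff_linear_power_pred by metis
    then have "c = 0" using nz by simp
    then have "g = monom 1 (Suc m)" using g' by (simp only: monom_altdef smult_1_left neg_0_equal_iff_equal minus_zero)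
    then show False using ne by simp
  qed
  moreover have "degree ([:- c, 1:] ^ Polynomial.order c g) > 0" using k degree_linear_power[of "- c"] by simp
  ultimately show ?thesis
    using that h(1) lc lh comaximal_power[OF comaximal_linear[OF hc]] by blast
qed

definition integral_series :: "'a::zero fls \<Rightarrow> bool" where
  "integral_series a \<longleftrightarrow> (\<forall>i<0. fls_nth a i = 0)"

lemma integral_series_regpart: "integral_series a \<Longrightarrow> fps_to_fls (fls_regpart a) = a"
  by (intro fls_eqI) (auto simp: integral_series_def)

lemma comm_ring_hom_fps_to_fls: "comm_ring_hom (fps_to_fls :: 'a::comm_ring_1 fps \<Rightarrow> 'a fls)"
  by unfold_locales (simp_all add: fls_times_fps_to_fls)

text \<open>
  The substitution makes the least slope of the Newton polygon an integer \<open>e\<close>.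
  Scaling the roots by \<open>s\<^sup>e\<close> makes the polynomial integral with a constant
  term in \<open>s\<close> that is not a power of the unknown. As the polynomial is depressed,
  that constant term has two coprime factors, which lift by Hensel's lemma.
\<close>

lemma newton_step:
  fixes r :: "'a::alg_closed_field fls poly"
  assumes r: "r \<noteq> 0" "degree r < m" and nz: "of_nat (Suc m) \<noteq> (0 :: 'a)"
  defines "g \<equiv> map_poly (fls_subst_power (fact (Suc m))) (monom 1 (Suc m) + r)"
  obtains e G H where
    "lead_coeff G = 1" "lead_coeff H = 1" "degree G < Suc m" "degree H < Suc m"
    "\<And>i. coeff (G * H) i = fls_shift (int (Suc m) * e - int i * e) (coeff g i)"
proof -
  define n where "n = Suc m"
  define K where "K = (fact n :: nat)"
  let ?S = "fls_subst_power K :: 'a fls \<Rightarrow> 'a fls"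
  have K: "K > 0" by (simp add: K_def)
  interpret S: comm_ring_hom ?S by (rule comm_ring_hom_fls_subst_power[OF K])
  have cg: "coeff g i = (if i = n then 1 else ?S (coeff r i))" for i
    using r(2) unfolding g_def n_def[symmetric] K_def[symmetric]
    by (auto simp: coeff_map_poly coeff_eq_0 n_def)
  define A where "A = {i. coeff r i \<noteq> 0}"
  have A: "finite A" "A \<noteq> {}" and Am: "\<And>i. i \<in> A \<Longrightarrow> i < m"
  proof -
    show *: "i < m" if "i \<in> A" for i using that r(2) le_degree[of r i] by (auto simp: A_def)
    then show "finite A" by (meson bounded_nat_set_is_finite)
    show "A \<noteq> {}" using r(1) leading_coeff_0_iff[of r] by (metis (mono_tags, lifting) A_def empty_iff leading_coeff_0_iff mem_Collect_eq)
  qed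
  define w where "w i = int (K div (n - i)) * fls_subdegree (coeff r i)" for i
  define e where "e = Min (w ` A)"
  have dv: "int K = int (n - i) * int (K div (n - i))" if "i < m" for i
  proof -
    have "(n - i) dvd K" using that unfolding K_def by (intro dvd_fact) (auto simp: n_def)
    then have "K = (n - i) * (K div (n - i))" by simp
    then show ?thesis by (metis of_nat_mult)
  qed
  define c where "c i = fls_shift (int n * e - int i * e) (coeff g i)" for i
  have c_nth: "fls_nth (c i) j = fls_nth (?S (coeff r i)) (j + int (n - i) * e)" if "i < m" for i j
    using that by (simp add: c_def cg algebra_simps of_nat_diff n_def)
  have ci: "i > m \<Longrightarrow> c i = (if i = n then 1 else 0)" for i
    using r(2) by (auto simp: c_def cg coeff_eq_0 n_def)
  have cm: "c m = 0"
    using r(2) by (auto simp: c_def cg coeff_eq_0 n_def)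
  have cn: "c n = 1" and cgt: "i > n \<Longrightarrow> c i = 0" for i
    using ci[of n] ci[of i] by (auto simp: n_def)
  have int: "integral_series (c i)" for i
  proof (cases "i \<in> A")
    case True
    then have im: "i < m" by (rule Am)
    have "e \<le> w i" unfolding e_def using A True by (intro Min_le) auto
    show ?thesis unfolding integral_series_def
    proof (intro allI impI)
      fix j :: int assume j: "j < 0"
      let ?l = "j + int (n - i) * e"
      have "?l < int (n - i) * w i"
        using j mult_left_mono[OF \<open>e \<le> w i\<close>, of "int (n - i)"] by linarith
      also have "\<dots> = int K * fls_subdegree (coeff r i)"
        unfolding w_def by (simp only: dv[OF im] mult.assoc)
      finally have lt: "?l < int K * fls_subdegree (coeff r i)" .
      show "fls_nth (c i) j = 0"
      proof (cases "int K dvd ?l")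
        case True
        then obtain q where q: "?l = int K * q" by (elim dvdE)
        then have "q < fls_subdegree (coeff r i)" using lt by (simp only: q mult_less_cancel_left_pos of_nat_0_less_iff K)
        then show ?thesis unfolding c_nth[OF im] fls_subst_power_nth[OF K] q using K by simp
      next
        case False
        then show ?thesis unfolding c_nth[OF im] fls_subst_power_nth[OF K] by simp
      qed
    qed
  next
    case False
    then have "coeff r i = 0" by (simp add: A_def)
    then have "c i = (if i = n then 1 else 0)" by (auto simp: c_def cg)
    then show ?thesis by (simp add: integral_series_def)
  qed
  obtain i0 where i0: "i0 \<in> A" "e = w i0"
    using Min_in[OF finite_imageI[OF A(1)], of w] A(2) unfolding e_def by (meson imageE image_is_empty)
  have c0: "fls_nth (c i0) 0 \<noteq> 0"
  proof -
    have im: "i0 < m" using i0 by (intro Am)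
    have "0 + int (n - i0) * e = int K * fls_subdegree (coeff r i0)"
      unfolding i0(2) w_def by (simp only: dv[OF im] mult.assoc add_0)
    then show ?thesis
      using i0(1) unfolding c_nth[OF im] fls_subst_power_nth[OF K] using K by (simp add: A_def)
  qed
  define fp where "fp = (\<Sum>i\<le>n. monom (fls_regpart (c i)) i)"
  have cfp: "coeff fp i = fls_regpart (c i)" for i
    using cgt[of i] by (auto simp: fp_def coeff_sum sum.delta)
  have deg: "degree fp = n"
    by (intro antisym degree_le le_degree) (auto simp: cfp cn cgt)
  have lc: "lead_coeff fp = 1" by (simp add: deg cfp cn)
  define g0 where "g0 = fps_poly_coeff fp 0"
  have cg0: "coeff g0 i = fls_nth (c i) 0" for i by (simp add: g0_def cfp)
  have deg0: "degree g0 = n"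
    by (intro antisym degree_le le_degree) (auto simp: cg0 cn cgt)
  have "g0 \<noteq> monom 1 n"
  proof
    assume "g0 = monom 1 n"
    then have "coeff g0 i0 = 0" using Am[OF i0(1)] by (simp add: n_def)
    then show False using c0 cg0 by simp
  qed
  moreover have "coeff g0 m = 0" "lead_coeff g0 = 1" using cm cn by (simp_all add: cg0 deg0)
  ultimately obtain u v where uv: "g0 = u * v" "lead_coeff u = 1" "lead_coeff v = 1" "comaximal u v"
    "degree u > 0" "degree v > 0"
    using root_factor_alg_closed[of g0 m] nz deg0 unfolding n_def by metis
  have duv: "degree u + degree v = n"
    using uv deg0 by (metis degree_mult_eq leading_coeff_0_iff zero_neq_one)
  obtain G H where GH: "fp = G * H" "lead_coeff G = 1" "degree G = degree u" "lead_coeff H = 1" "degree H = degree v"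
    by (rule hensel_factorization[OF lc uv(1)[unfolded g0_def] uv(2,3,4)])
  interpret F: map_poly_comm_ring_hom "fps_to_fls :: 'a fps \<Rightarrow> 'a fls"
    by (intro map_poly_comm_ring_hom.intro comm_ring_hom_fps_to_fls)
  let ?F = "map_poly (fps_to_fls :: 'a fps \<Rightarrow> 'a fls)"
  have dF: "degree (?F p) = degree p" for p by (intro degree_map_poly) auto
  have "coeff (?F G * ?F H) i = c i" for i
    unfolding F.hom_mult[symmetric] GH(1)[symmetric]
    by (simp add: coeff_map_poly cfp integral_series_regpart int)
  then have "coeff (?F G * ?F H) i = fls_shift (int n * e - int i * e) (coeff g i)" for i
    by (simp add: c_def)
  moreover have "lead_coeff (?F G) = 1" "lead_coeff (?F H) = 1"
    using GH by (simp_all add: dF coeff_map_poly)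
  moreover have "degree (?F G) < n" "degree (?F H) < n" using dF GH duv uv by simp_all
  ultimately show ?thesis using that unfolding n_def by blast
qed

theorem puiseux:
  fixes f :: "'a::alg_closed_field fls poly"
  assumes "lead_coeff f = 1" "\<And>i. 0 < i \<Longrightarrow> i \<le> degree f \<Longrightarrow> of_nat i \<noteq> (0 :: 'a)"
  shows "splits (map_poly (fls_subst_power (puiseux_exponent (degree f))) f)"
  using assms
proof (induction "degree f" arbitrary: f rule: less_induct)
  case less
  show ?case
  proof (cases "degree f")
    case 0
    then have "f = 1" using less.prems(1) monic_degree_0 by metis
    moreover have "fls_subst_power 1 (1 :: 'a fls) = 1"
      by (intro fls_eqI) (simp add: fls_subst_power_nth)
    ultimately have "map_poly (fls_subst_power (puiseux_exponent (degree f))) f = (\<Prod>y\<leftarrow>[]. [:- y, 1:])"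
      by (simp add: map_poly_1 pCons_one)
    then show ?thesis unfolding splits_def by blast
  next
    case (Suc m)
    have nz: "of_nat (Suc m) \<noteq> (0 :: 'a)" using less.prems(2)[OF zero_less_Suc] Suc by (metis order_refl)
    then have "of_nat (Suc m) \<noteq> (0 :: 'a fls)" by (metis fls_const_eq_0_iff fls_of_nat)
    then obtain a r where f: "f = pcompose (monom 1 (Suc m) + r) [:a, 1:]" "r = 0 \<or> degree r < m"
      using depressed_form[OF less.prems(1) Suc] by blast
    let ?K = "fact (Suc m) :: nat" and ?P = "puiseux_exponent m"
    let ?E = "puiseux_exponent (Suc m)"
    have E: "?E = ?K * ?P" by simp
    have pos: "?E > 0" "?K > 0" "?P > 0" by (simp_all only: puiseux_exponent_pos fact_gt_zero)
    interpret SE: comm_ring_hom "fls_subst_power ?E :: 'a fls \<Rightarrow> _" by (rule comm_ring_hom_fls_subst_power[OF pos(1)])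
    interpret SP: comm_ring_hom "fls_subst_power ?P :: 'a fls \<Rightarrow> _" by (rule comm_ring_hom_fls_subst_power[OF pos(3)])
    let ?g = "monom 1 (Suc m) + r"
    have "splits (map_poly (fls_subst_power ?E) ?g)"
    proof (cases "r = 0")
      case True
      have x: "splits ([:0, 1:] ^ k :: 'a fls poly)" for k
      proof (induction k)
        case 0
        have "(1 :: 'a fls poly) = (\<Prod>y\<leftarrow>[]. [:- y, 1:])" by simp
        then show ?case unfolding splits_def power_0 by blast
      next
        case (Suc k)
        have "[:0, 1:] = (\<Prod>y\<leftarrow>[0 :: 'a fls]. [:- y, 1:])" by simp
        then have "splits ([:0, 1:] :: 'a fls poly)" unfolding splits_def by blast
        then show ?case using Suc unfolding power_Suc by (rule splits_mult)
      qed
      have "?g = [:0, 1:] ^ Suc m" using True by (simp only: monom_altdef smult_1_left add_0_right)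
      then show ?thesis using splits_hom[OF SE.comm_ring_hom_axioms x[of "Suc m"]] by simp
    next
      case False
      then have "degree r < m" using f(2) by blast
      let ?g1 = "map_poly (fls_subst_power ?K) ?g"
      obtain e G H where GH: "lead_coeff G = 1" "lead_coeff H = 1" "degree G < Suc m" "degree H < Suc m"
        and c: "\<And>i. coeff (G * H) i = fls_shift (int (Suc m) * e - int i * e) (coeff ?g1 i)"
        by (rule newton_step[OF False \<open>degree r < m\<close> nz]) blast
      have sp: "splits (map_poly (fls_subst_power ?P) W)" if "lead_coeff W = 1" "degree W < Suc m" for W :: "'a fls poly"
        using splits_subst_dvd[OF less.hyps[of W] puiseux_exponent_dvd[of "degree W" m] pos(3)] that less.prems(2) Suc
        by auto
      interpret MP: map_poly_comm_ring_hom "fls_subst_power ?P :: 'a fls \<Rightarrow> _" ..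
      define p where "p = map_poly (fls_subst_power ?P) (G * H)"
      have sp: "splits p"
        unfolding p_def MP.hom_mult by (rule splits_mult[OF sp[OF GH(1,3)] sp[OF GH(2,4)]])
      define n where "n = Suc m"
      define w v :: "'a fls" where "w = fls_shift e 1" and "v = fls_shift (- e) 1"
      have wv: "w * v = 1" by (simp add: w_def v_def fls_shifted_times_simps)
      define u where "u = fls_subst_power ?P w"
      have u: "u \<noteq> 0"
        using arg_cong[OF wv, of "fls_subst_power ?P"] by (auto simp: u_def SP.hom_mult)
      have g1: "coeff ?g1 i = (if i = n then 1 else if i < n then coeff ?g1 i else 0)" for i
      proof -
        interpret SK: comm_ring_hom "fls_subst_power ?K :: 'a fls \<Rightarrow> _" by (rule comm_ring_hom_fls_subst_power[OF pos(2)])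
        show ?thesis
          using \<open>degree r < m\<close> unfolding n_def
          by (simp only: coeff_map_poly SK.hom_zero coeff_add coeff_monom) (auto simp: coeff_eq_0 simp del: fact_Suc)
      qed
      have wpow: "fls_shift (int n * e - int i * e) a = w ^ (n - i) * a" if "i \<le> n" for i and a :: "'a fls"
        using that by (simp add: w_def fls_shifted_pow fls_shifted_times_simps of_nat_diff left_diff_distrib)
      have cp: "coeff p i = u ^ (n - i) * fls_subst_power ?P (coeff ?g1 i)" if "i \<le> n" for i
        using that unfolding p_def by (simp add: coeff_map_poly c n_def[symmetric] wpow SP.hom_mult SP.hom_power u_def)
      have cp0: "coeff p i = 0" if "i > n" for i
        using that g1[of i] unfolding p_def by (simp add: coeff_map_poly c)
      have "degree p = n"
        using cp[of n] g1[of n] by (intro antisym degree_le le_degree) (auto simp: cp0)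
      have "smult ((1 / u) ^ n) (pcompose p [:0, u:]) = map_poly (fls_subst_power ?E) ?g"
      proof (rule poly_eqI)
        fix i
        have "coeff (map_poly (fls_subst_power ?E) ?g) i = fls_subst_power ?P (coeff ?g1 i)"
          unfolding E by (simp only: coeff_map_poly SE.hom_zero[unfolded E] fls_subst_power_mult[OF pos(2,3)] fls_subst_power_zero)
        moreover have "coeff (smult ((1 / u) ^ n) (pcompose p [:0, u:])) i = fls_subst_power ?P (coeff ?g1 i)"
        proof (cases "i \<le> n")
          case True
          then have "u ^ n = u ^ i * u ^ (n - i)" by (simp add: power_add[symmetric])
          then show ?thesis using u True by (simp add: coeff_pcompose_linear cp power_divide)
        next
          case False
          then show ?thesis using g1[of i] by (simp add: coeff_pcompose_linear cp0)
        qed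
        ultimately show "coeff (smult ((1 / u) ^ n) (pcompose p [:0, u:])) i = coeff (map_poly (fls_subst_power ?E) ?g) i"
          by simp
      qed
      then show ?thesis using splits_scale[OF sp u] \<open>degree p = n\<close> by simp
    qed
    note spg = this
    have "map_poly (fls_subst_power ?E) f = pcompose (map_poly (fls_subst_power ?E) ?g) [:fls_subst_power ?E a, 1:]"
      by (subst f(1), subst SE.map_poly_pcompose) (simp only: SE.map_poly_pCons_hom SE.hom_one map_poly_0 map_poly_1 pCons_one)
    then show ?thesis unfolding Suc using splits_shift[OF spg] by simp
  qed
qed

section \<open>Resultants of split polynomials\<close>

definition vandermonde :: "nat \<Rightarrow> (nat \<Rightarrow> 'a::comm_ring_1) \<Rightarrow> 'a mat" where
  "vandermonde n y = mat n n (\<lambda>(i, j). y j ^ i)"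

lemma vandermonde_carrier [simp]: "vandermonde n y \<in> carrier_mat n n"
  by (simp add: vandermonde_def)

lemma vandermonde_dim [simp]: "dim_row (vandermonde n y) = n" "dim_col (vandermonde n y) = n"
  by (simp_all add: vandermonde_def)

lemma poly_eq_0_of_roots:
  fixes p :: "'a::idom poly"
  assumes "inj_on y {..<n}" "\<And>j. j < n \<Longrightarrow> poly p (y j) = 0" "degree p < n"
  shows "p = 0"
proof (rule ccontr)
  assume p: "p \<noteq> 0"
  have "card (y ` {..<n}) \<le> card {x. poly p x = 0}"
    by (intro card_mono poly_roots_finite p) (use assms in auto)
  also have "\<dots> \<le> degree p" by (rule card_poly_roots_bound[OF p])
  finally show False using assms by (simp add: card_image)
qed

lemma det_power_matrix_nonzero:
  fixes y :: "nat \<Rightarrow> 'a::idom"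
  assumes inj: "inj_on y {..<n}" and e: "inj_on e {..<n}" "\<And>i. i < n \<Longrightarrow> e i < n"
  shows "det (mat n n (\<lambda>(i, j). y j ^ e i)) \<noteq> 0"
proof
  let ?V = "mat n n (\<lambda>(i, j). y j ^ e i)"
  assume "det ?V = 0"
  then have "det (transpose_mat ?V) = 0" by (simp add: det_transpose[of _ n])
  then obtain v where v: "v \<in> carrier_vec n" "v \<noteq> 0\<^sub>v n" "transpose_mat ?V *\<^sub>v v = 0\<^sub>v n"
    using det_0_iff_vec_prod_zero[of "transpose_mat ?V" n] by auto
  define p where "p = (\<Sum>i<n. monom (vec_index v i) (e i))"
  have cp: "coeff p (e i) = vec_index v i" if "i < n" for i
  proof -
    have "coeff p (e i) = (\<Sum>k<n. if k = i then vec_index v k else 0)"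
      unfolding p_def coeff_sum coeff_monom using that e(1) by (intro sum.cong) (auto dest: inj_onD)
    then show ?thesis using that by (simp add: sum.delta)
  qed
  have n: "n > 0" using v by (cases n) auto
  have "degree p \<le> n - 1"
    unfolding p_def
  proof (rule degree_sum_le)
    fix i assume "i \<in> {..<n}"
    then show "degree (monom (vec_index v i) (e i)) \<le> n - 1"
      using e(2)[of i] degree_monom_le[of "vec_index v i" "e i"] by simp
  qed simp
  then have "degree p < n" using n by simp
  moreover have "poly p (y j) = 0" if "j < n" for j
  proof -
    have "0 = vec_index (transpose_mat ?V *\<^sub>v v) j" using v(3) that by simp
    also have "\<dots> = (\<Sum>i<n. vec_index v i * y j ^ e i)"
      using that v(1) by (simp add: scalar_prod_def atLeast0LessThan mult.commute)
    also have "\<dots> = poly p (y j)" by (simp add: p_def poly_sum poly_monom)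
    finally show ?thesis by simp
  qed
  ultimately have "p = 0" by (intro poly_eq_0_of_roots[OF inj]) auto
  then have "vec_index v i = 0" if "i < n" for i using cp[OF that] by simp
  then have "v = 0\<^sub>v n" using v(1) by (intro eq_vecI) auto
  then show False using v(2) by simp
qed

lemma sum_coeff_rev:
  fixes p :: "'a::comm_ring_1 poly"
  assumes "degree p < m"
  shows "(\<Sum>j<m. coeff p (m - 1 - j) * x ^ (m - 1 - j)) = poly p x"
proof -
  have "(\<Sum>j<m. coeff p (m - 1 - j) * x ^ (m - 1 - j)) = (\<Sum>j<m. coeff p j * x ^ j)"
    using sum.nat_diff_reindex[of "\<lambda>j. coeff p j * x ^ j" m] by simp
  also have "\<dots> = poly p x"
    unfolding poly_altdef by (rule sum.mono_neutral_right) (use assms in \<open>auto simp: coeff_eq_0\<close>)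
  finally show ?thesis .
qed

lemma det_diagonal:
  fixes c :: "nat \<Rightarrow> 'a::idom"
  shows "det (mat n n (\<lambda>(i, j). if i = j then c i else 0)) = (\<Prod>i<n. c i)"
proof -
  let ?D = "mat n n (\<lambda>(i, j). if i = j then c i else 0)"
  have "det ?D = prod_list (diag_mat ?D)"
    by (rule det_upper_triangular[of _ n]) (auto simp: upper_triangular_def)
  also have "\<dots> = (\<Prod>i<n. c i)"
    by (simp add: diag_mat_def prod.list_conv_set_nth atLeast0LessThan)
  finally show ?thesis .
qed

lemma sylvester_upper_row:
  fixes f g :: "'a::comm_ring_1 poly"
  assumes f: "degree f = n" and ij: "i < d" "j < d + n"
  shows "sylvester_mat_sub n d f g $$ (i, j) = coeff (monom 1 (d - 1 - i) * f) (d + n - 1 - j)"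
proof -
  have "sylvester_mat_sub n d f g $$ (i, j) = (if i \<le> j \<and> j - i \<le> n then coeff f (n + i - j) else 0)"
    using ij by (simp add: sylvester_mat_sub_index)
  also have "\<dots> = coeff (monom 1 (d - 1 - i) * f) (d + n - 1 - j)"
  proof (cases "i \<le> j \<and> j - i \<le> n")
    case True
    then have "\<not> d + n - 1 - j < d - 1 - i" "d + n - 1 - j - (d - 1 - i) = n + i - j" using ij by auto
    then show ?thesis using True by (simp add: coeff_monom_mult)
  next
    case False
    then consider "j < i" | "j > i + n" by linarith
    then show ?thesis
    proof cases
      case 1
      then have "\<not> d + n - 1 - j < d - 1 - i" "d + n - 1 - j - (d - 1 - i) > n" using ij by auto
      then show ?thesis using 1 f by (simp add: coeff_monom_mult coeff_eq_0)
    next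
      case 2
      then have "d + n - 1 - j < d - 1 - i" using ij by auto
      then show ?thesis using False by (simp only: coeff_monom_mult) simp
    qed
  qed
  finally show ?thesis .
qed

lemma sylvester_lower_row:
  fixes f g :: "'a::comm_ring_1 poly"
  assumes g: "degree g \<le> d" and ij: "d \<le> i" "i < d + n" "j < d + n"
  shows "sylvester_mat_sub n d f g $$ (i, j) = coeff (monom 1 (d + n - 1 - i) * g) (d + n - 1 - j)"
proof -
  have "sylvester_mat_sub n d f g $$ (i, j) = (if i - d \<le> j \<and> j \<le> i then coeff g (i - j) else 0)"
    using ij by (simp add: sylvester_mat_sub_index)
  also have "\<dots> = coeff (monom 1 (d + n - 1 - i) * g) (d + n - 1 - j)"
  proof (cases "j \<le> i")
    case True
    then have "\<not> d + n - 1 - j < d + n - 1 - i" "d + n - 1 - j - (d + n - 1 - i) = i - j" using ij by auto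
    moreover have "coeff g (i - j) = 0" if "\<not> i - d \<le> j" using that g by (intro coeff_eq_0) simp
    ultimately show ?thesis using True by (simp add: coeff_monom_mult)
  next
    case False
    then have "d + n - 1 - j < d + n - 1 - i" using ij by auto
    then show ?thesis using False by (simp only: coeff_monom_mult) simp
  qed
  finally show ?thesis .
qed

text \<open>
  The vector of the powers of the common root lies in the kernel of the Sylvester matrix.
\<close>

lemma resultant_sub_common_root:
  fixes f g :: "'a::idom poly"
  assumes f: "degree f = n" "poly f a = 0" and g: "degree g \<le> d" "poly g a = 0" and pos: "d + n > 0"
  shows "resultant_sub n d f g = 0"
proof -
  let ?S = "sylvester_mat_sub n d f g"
  define v where "v = vec (d + n) (\<lambda>j. a ^ (d + n - 1 - j))"
  have S: "?S \<in> carrier_mat (d + n) (d + n)" by (simp add: add.commute sylvester_mat_sub_def)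
  have "(?S *\<^sub>v v) = 0\<^sub>v (d + n)"
  proof (rule eq_vecI)
    fix i assume "i < dim_vec (0\<^sub>v (d + n) :: 'a vec)"
    then have i: "i < d + n" by simp
    have row: "vec_index (?S *\<^sub>v v) i = (\<Sum>j<d + n. ?S $$ (i, j) * a ^ (d + n - 1 - j))"
      using i S by (simp add: v_def scalar_prod_def atLeast0LessThan)
    show "vec_index (?S *\<^sub>v v) i = vec_index (0\<^sub>v (d + n)) i"
    proof (cases "i < d")
      case True
      let ?p = "monom 1 (d - 1 - i) * f"
      have "degree ?p < d + n" using True f(1) by (intro le_less_trans[OF degree_mult_le]) (simp add: degree_monom_eq)
      then show ?thesis using True i f sum_coeff_rev[of ?p "d + n" a]
        unfolding row by (simp add: sylvester_upper_row)
    next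
      case False
      let ?p = "monom 1 (d + n - 1 - i) * g"
      have "degree ?p < d + n" using False i g(1) by (intro le_less_trans[OF degree_mult_le]) (simp add: degree_monom_eq)
      then show ?thesis using False i g sum_coeff_rev[of ?p "d + n" a]
        unfolding row by (simp add: sylvester_lower_row)
    qed
  qed (use S in auto)
  moreover have "v \<noteq> 0\<^sub>v (d + n)"
  proof
    assume "v = 0\<^sub>v (d + n)"
    then have "vec_index v (d + n - 1) = 0" using pos by simp
    then show False using pos by (simp add: v_def)
  qed
  moreover have "v \<in> carrier_vec (d + n)" by (simp add: v_def)
  ultimately show ?thesis unfolding resultant_sub_def using det_0_iff_vec_prod_zero[OF S] by blast
qed

text \<open>
  Replacing the last \<open>n\<close> columns of the unit matrix by the powers of the roots
  gives a matrix \<open>W\<close> for which \<open>S W\<close> is block triangular: the rows of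
  \<open>f\<close> vanish on those columns, and the rows of \<open>g\<close> become multiples of
  the values \<open>g(y\<^sub>j)\<close>.
\<close>

lemma resultant_sub_split:
  fixes y :: "nat \<Rightarrow> 'a::idom"
  assumes inj: "inj_on y {..<n}" and f: "lead_coeff f = 1" "degree f = n" "\<And>j. j < n \<Longrightarrow> poly f (y j) = 0"
    and g: "degree g \<le> d"
  shows "resultant_sub n d f g = (\<Prod>j<n. poly g (y j))"
proof -
  define N where "N = d + n"
  define S where "S = sylvester_mat_sub n d f g"
  define R where "R = mat n n (\<lambda>(i, j). y j ^ (n - 1 - i))"
  define W where "W = mat N N (\<lambda>(j, k). if k < d then (if j = k then 1 else 0) else y (k - d) ^ (N - 1 - j))"
  define D where "D = mat n n (\<lambda>(i, j). if i = j then poly g (y i) else 0)"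
  have S: "S \<in> carrier_mat N N" and W: "W \<in> carrier_mat N N" and R: "R \<in> carrier_mat n n" and D: "D \<in> carrier_mat n n"
    by (simp_all add: S_def N_def W_def R_def D_def add.commute sylvester_mat_sub_def)
  have S1: "S $$ (i, j) = coeff (monom 1 (d - 1 - i) * f) (N - 1 - j)" if "i < d" "j < N" for i j
    using that sylvester_upper_row[OF f(2)] by (simp add: S_def N_def)
  have S2: "S $$ (i, j) = coeff (monom 1 (N - 1 - i) * g) (N - 1 - j)" if "d \<le> i" "i < N" "j < N" for i j
    using that sylvester_lower_row[OF g] by (simp add: S_def N_def)
  have SW: "(S * W) $$ (i, k) = (\<Sum>j<N. S $$ (i, j) * W $$ (j, k))" if "i < N" "k < N" for i k
    using that S W by (simp add: scalar_prod_def atLeast0LessThan)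
  have left: "(S * W) $$ (i, k) = S $$ (i, k)" if "i < N" "k < d" for i k
  proof -
    have "(S * W) $$ (i, k) = (\<Sum>j<N. if j = k then S $$ (i, j) else 0)"
      using that by (subst SW) (auto simp: N_def W_def if_distrib[of "\<lambda>x. _ * x"] intro!: sum.cong cong: if_cong)
    also have "\<dots> = S $$ (i, k)" using that by (simp add: sum.delta N_def)
    finally show ?thesis .
  qed
  have right1: "(S * W) $$ (i, k) = 0" if "i < d" "d \<le> k" "k < N" for i k
  proof -
    have "(S * W) $$ (i, k) = (\<Sum>j<N. coeff (monom 1 (d - 1 - i) * f) (N - 1 - j) * y (k - d) ^ (N - 1 - j))"
      using that by (subst SW) (auto simp: N_def S1 W_def intro!: sum.cong)
    also have "\<dots> = poly (monom 1 (d - 1 - i) * f) (y (k - d))"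
      by (rule sum_coeff_rev) (use that f in \<open>auto simp: N_def degree_monom_eq intro!: le_less_trans[OF degree_mult_le]\<close>)
    finally show ?thesis using that f(3)[of "k - d"] by (simp add: N_def less_diff_conv2)
  qed
  have right2: "(S * W) $$ (i, k) = y (k - d) ^ (N - 1 - i) * poly g (y (k - d))" if "d \<le> i" "i < N" "d \<le> k" "k < N" for i k
  proof -
    have "(S * W) $$ (i, k) = (\<Sum>j<N. coeff (monom 1 (N - 1 - i) * g) (N - 1 - j) * y (k - d) ^ (N - 1 - j))"
      using that by (subst SW) (auto simp: N_def S2 W_def intro!: sum.cong)
    also have "\<dots> = poly (monom 1 (N - 1 - i) * g) (y (k - d))"
      by (rule sum_coeff_rev) (use that g in \<open>auto simp: N_def degree_monom_eq intro!: le_less_trans[OF degree_mult_le]\<close>)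
    finally show ?thesis by (simp add: poly_monom)
  qed
  let ?U = "mat d d (\<lambda>(i, k). S $$ (i, k))" and ?L = "mat n d (\<lambda>(i, k). S $$ (i + d, k))"
  have RD: "(R * D) $$ (i, k) = y k ^ (n - 1 - i) * poly g (y k)" if "i < n" "k < n" for i k
  proof -
    have "(R * D) $$ (i, k) = (\<Sum>j<n. if j = k then y k ^ (n - 1 - i) * poly g (y k) else 0)"
      using that R D by (auto simp: scalar_prod_def atLeast0LessThan R_def D_def if_distrib[of "\<lambda>x. _ * x"] intro!: sum.cong cong: if_cong)
    then show ?thesis using that by (simp add: sum.delta)
  qed
  have "S * W = four_block_mat ?U (0\<^sub>m d n) ?L (R * D)"
  proof (rule eq_matI)
    show "dim_row (S * W) = dim_row (four_block_mat ?U (0\<^sub>m d n) ?L (R * D))"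
      "dim_col (S * W) = dim_col (four_block_mat ?U (0\<^sub>m d n) ?L (R * D))"
      using S W R D by (auto simp: N_def)
    fix i k assume "i < dim_row (four_block_mat ?U (0\<^sub>m d n) ?L (R * D))"
      "k < dim_col (four_block_mat ?U (0\<^sub>m d n) ?L (R * D))"
    then have ik: "i < N" "k < N" using R D by (auto simp: N_def)
    have "N - 1 - i = n - 1 - (i - d)" if "d \<le> i" using that ik by (simp add: N_def)
    then show "(S * W) $$ (i, k) = four_block_mat ?U (0\<^sub>m d n) ?L (R * D) $$ (i, k)"
      using ik R D left[of i k] right1[of i k] right2[of i k] RD[of "i - d" "k - d"]
      by (auto simp: N_def)
  qed
  then have "det (S * W) = det ?U * det (R * D)"
    using R D by (simp add: det_four_block_mat_upper_right_zero[of _ d _ n])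
  also have "det ?U = 1"
  proof -
    have "det ?U = prod_list (diag_mat ?U)"
      by (rule det_upper_triangular[of _ d])
        (auto simp: upper_triangular_def S_def sylvester_mat_sub_index)
    also have "\<dots> = (\<Prod>i<d. S $$ (i, i))"
      by (simp add: diag_mat_def prod.list_conv_set_nth atLeast0LessThan)
    also have "\<dots> = 1"
      using f by (intro prod.neutral) (auto simp: S_def sylvester_mat_sub_index)
    finally show ?thesis .
  qed
  also have "det (R * D) = det R * det D" by (rule det_mult[OF R D])
  also have "det (S * W) = det S * det W" by (rule det_mult[OF S W])
  also have "det W = det R"
  proof -
    have "W = four_block_mat (1\<^sub>m d) (mat d n (\<lambda>(i, k). W $$ (i, k + d))) (0\<^sub>m n d) R"
      by (rule eq_matI) (auto simp: W_def R_def N_def add.commute)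
    then show ?thesis
      using R by (metis det_four_block_mat_lower_left_zero det_one mat_carrier mult_1 one_carrier_mat)
  qed
  finally have "det S * det R = det R * det D" by simp
  moreover have "det R \<noteq> 0"
    unfolding R_def by (rule det_power_matrix_nonzero[OF inj]) (auto intro: inj_onI)
  ultimately have "det S = det D" by simp
  then show ?thesis unfolding S_def D_def resultant_sub_def det_diagonal .
qed

text \<open>
  The coefficient of \<open>t\<^sup>k\<close> in \<open>f / (t - a)\<close> for a root
  \<open>a\<close> of \<open>f\<close>.
\<close>

definition horner_quotient :: "'a::comm_ring_1 poly \<Rightarrow> 'a \<Rightarrow> nat \<Rightarrow> 'a" where
  "horner_quotient f a k = (\<Sum>i<degree f. coeff f (k + i + 1) * a ^ i)"

lemma horner_quotient:
  fixes f :: "'a::idom poly"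
  assumes "poly f a = 0" "degree f = n"
  shows "f = [:- a, 1:] * (\<Sum>k<n. monom (horner_quotient f a k) k)"
proof -
  define q where "q = (\<Sum>k<n. monom (horner_quotient f a k) k)"
  have h0: "horner_quotient f a k = 0" if "k \<ge> n" for k
    using that assms by (auto simp: horner_quotient_def coeff_eq_0 intro!: sum.neutral)
  have cq: "coeff q k = horner_quotient f a k" for k
    using h0[of k] by (auto simp: q_def coeff_sum sum.delta)
  have tel: "(\<Sum>i<n. coeff f (k + i) * a ^ i) - a * (\<Sum>i<n. coeff f (k + i + 1) * a ^ i) = coeff f k - coeff f (k + n) * a ^ n" for k
  proof -
    have "(\<Sum>i<m. coeff f (k + i) * a ^ i) - a * (\<Sum>i<m. coeff f (k + i + 1) * a ^ i) = coeff f k - coeff f (k + m) * a ^ m" for m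
      by (induction m) (simp_all add: algebra_simps)
    then show ?thesis .
  qed
  have "coeff ([:- a, 1:] * q) k = coeff f k" for k
  proof (cases k)
    case 0
    have "poly f a = (\<Sum>i\<le>n. coeff f i * a ^ i)" using assms(2) by (simp add: poly_altdef)
    also have "\<dots> = (\<Sum>i<n. coeff f i * a ^ i) + coeff f n * a ^ n" by (simp add: lessThan_Suc_atMost[symmetric])
    finally have "(\<Sum>i<n. coeff f i * a ^ i) = - coeff f n * a ^ n" using assms(1) by (simp add: eq_neg_iff_add_eq_0)
    then show ?thesis using 0 tel[of 0] assms(2) by (simp add: cq horner_quotient_def)
  next
    case (Suc m)
    have "coeff f (Suc m + n) = 0" using assms(2) by (intro coeff_eq_0) simp
    then show ?thesis using Suc tel[of "Suc m"] assms(2) by (simp add: cq horner_quotient_def algebra_simps)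
  qed
  then show ?thesis unfolding q_def by (intro poly_eqI) simp
qed

lemma det_exchange_square: "det (mat n n (\<lambda>(i, j). if i + j + 1 = n then 1 else 0) :: 'a::idom mat) ^ 2 = 1"
proof -
  let ?J = "mat n n (\<lambda>(i, j). if i + j + 1 = n then 1 else 0) :: 'a mat"
  have "?J * ?J = 1\<^sub>m n"
  proof (rule eq_matI)
    fix i k assume ik: "i < dim_row (1\<^sub>m n :: 'a mat)" "k < dim_col (1\<^sub>m n :: 'a mat)"
    have "(?J * ?J) $$ (i, k) = (\<Sum>j<n. (if i + j + 1 = n then 1 else 0) * (if j + k + 1 = n then 1 else 0))"
      using ik by (simp add: scalar_prod_def atLeast0LessThan)
    also have "\<dots> = (\<Sum>j<n. if j = n - 1 - i then (if i = k then 1 else 0) else 0)"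
      using ik by (intro sum.cong) auto
    also have "\<dots> = 1\<^sub>m n $$ (i, k)" using ik by (simp add: sum.delta)
    finally show "(?J * ?J) $$ (i, k) = 1\<^sub>m n $$ (i, k)" .
  qed auto
  then have "det ?J * det ?J = 1"
    using det_mult[of ?J n ?J] by simp
  then show ?thesis by (simp add: power2_eq_square)
qed

text \<open>
  Let \<open>H\<close> be the Hankel matrix of the coefficients of \<open>f\<close>, whose
  determinant is 1 or -1. The columns of \<open>H V\<close> are the coefficients of the
  quotients \<open>f / (t - y\<^sub>l)\<close>, so \<open>V\<^sup>T H V\<close> is diagonal with
  the entries \<open>f'(y\<^sub>j)\<close>.
\<close>

lemma vandermonde_square:
  fixes y :: "nat \<Rightarrow> 'a::idom"
  assumes inj: "inj_on y {..<n}" and f: "lead_coeff f = 1" "degree f = n" "\<And>j. j < n \<Longrightarrow> poly f (y j) = 0"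
  shows "det (vandermonde n y) ^ 2 = (\<Prod>j<n. poly (pderiv f) (y j)) \<or>
         det (vandermonde n y) ^ 2 = - (\<Prod>j<n. poly (pderiv f) (y j))"
proof -
  let ?V = "vandermonde n y"
  define H where "H = mat n n (\<lambda>(k, i). coeff f (k + i + 1))"
  define J where "J = (mat n n (\<lambda>(i, j). if i + j + 1 = n then 1 else 0) :: 'a mat)"
  define D where "D = mat n n (\<lambda>(i, j). if i = j then poly (pderiv f) (y i) else 0)"
  have car: "?V \<in> carrier_mat n n" "H \<in> carrier_mat n n" "J \<in> carrier_mat n n" "D \<in> carrier_mat n n"
    by (simp_all add: H_def J_def D_def)
  define q where "q l = (\<Sum>k<n. monom (horner_quotient f (y l) k) k)" for l
  have fq: "f = [:- y l, 1:] * q l" if "l < n" for l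
    unfolding q_def by (rule horner_quotient[OF f(3)[OF that] f(2)])
  have HV: "(H * ?V) $$ (k, l) = horner_quotient f (y l) k" if "k < n" "l < n" for k l
    using that f(2) by (simp add: H_def vandermonde_def scalar_prod_def atLeast0LessThan horner_quotient_def)
  have VHV: "transpose_mat ?V * (H * ?V) = D"
  proof (rule eq_matI)
    fix j l assume "j < dim_row D" "l < dim_col D"
    then have jl: "j < n" "l < n" by (auto simp: D_def)
    have "(transpose_mat ?V * (H * ?V)) $$ (j, l) = (\<Sum>k<n. y j ^ k * (H * ?V) $$ (k, l))"
      using jl car by (simp add: scalar_prod_def atLeast0LessThan vandermonde_def)
    also have "\<dots> = (\<Sum>k<n. y j ^ k * horner_quotient f (y l) k)"
      using jl by (intro sum.cong) (auto simp: HV)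
    also have "\<dots> = poly (q l) (y j)"
      by (simp add: q_def poly_sum poly_monom mult.commute)
    also have "\<dots> = D $$ (j, l)"
    proof (cases "j = l")
      case True
      have p1: "pderiv [:- y l, 1:] = 1" by (simp add: pderiv_pCons)
      have "pderiv f = q l + [:- y l, 1:] * pderiv (q l)"
        using arg_cong[OF fq[OF jl(2)], of pderiv] p1 by (simp only: pderiv_mult mult_1_right add.commute)
      then have "poly (pderiv f) (y l) = poly (q l) (y l)" by simp
      then show ?thesis using True jl by (simp add: D_def)
    next
      case False
      have "poly f (y j) = (y j - y l) * poly (q l) (y j)" by (subst fq[OF jl(2)]) (simp add: algebra_simps)
      moreover have "y j \<noteq> y l" using False jl inj by (auto dest: inj_onD)
      ultimately show ?thesis using f(3)[OF jl(1)] False jl by (simp add: D_def)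
    qed
    finally show "(transpose_mat ?V * (H * ?V)) $$ (j, l) = D $$ (j, l)" .
  qed (use car in auto)
  have "det D = det ?V * (det H * det ?V)"
    unfolding VHV[symmetric] using car by (simp add: det_mult[of _ n] det_transpose[of _ n])
  then have D: "(\<Prod>j<n. poly (pderiv f) (y j)) = det H * det ?V ^ 2"
    unfolding D_def det_diagonal by (simp add: power2_eq_square mult_ac)
  have "det (H * J) = 1"
  proof -
    have HJ: "(H * J) $$ (k, i) = coeff f (k + n - i)" if "k < n" "i < n" for k i
    proof -
      have "(H * J) $$ (k, i) = (\<Sum>j<n. coeff f (k + j + 1) * (if j + i + 1 = n then 1 else 0))"
        using that by (simp add: H_def J_def scalar_prod_def atLeast0LessThan)
      also have "\<dots> = (\<Sum>j<n. if j = n - 1 - i then coeff f (k + j + 1) else 0)"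
        using that by (intro sum.cong) auto
      also have "\<dots> = coeff f (k + (n - 1 - i) + 1)" using that by (simp add: sum.delta)
      also have "k + (n - 1 - i) + 1 = k + n - i" using that by simp
      finally show ?thesis .
    qed
    have dim: "dim_row (H * J) = n" "dim_col (H * J) = n" using car by auto
    have "det (H * J) = prod_list (diag_mat (H * J))"
    proof (rule det_upper_triangular)
      show "H * J \<in> carrier_mat n n" using car by auto
      show "upper_triangular (H * J)"
        unfolding upper_triangular_def using f(2) by (auto simp: dim HJ coeff_eq_0 simp del: index_mult_mat)
    qed
    also have "\<dots> = (\<Prod>i<n. (H * J) $$ (i, i))"
      by (simp add: dim diag_mat_def prod.list_conv_set_nth atLeast0LessThan del: index_mult_mat)
    also have "\<dots> = 1" using f by (intro prod.neutral) (simp add: HJ del: index_mult_mat)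
    finally show ?thesis .
  qed
  then have "det H * det J = 1" using det_mult[OF car(2,3)] by simp
  moreover have "det J ^ 2 = 1" unfolding J_def by (rule det_exchange_square)
  ultimately have "det H ^ 2 = 1" by (metis mult_1_right power_mult_distrib power_one)
  then have "det H = 1 \<or> det H = - 1" by (simp add: power2_eq_1_iff)
  then show ?thesis using D by auto
qed

lemma pderiv_subring_hom:
  fixes S :: "'a::idom set" and h :: "'a \<Rightarrow> 'b::idom"
  assumes "subring_hom S h" "p \<in> polys_over S"
  shows "pderiv p \<in> polys_over S" "map_poly h (pderiv p) = pderiv (map_poly h p)"
proof -
  interpret subring_hom S h by fact
  have c: "coeff p i \<in> S" for i using assms(2) by (simp add: polys_over_def)
  then show "pderiv p \<in> polys_over S" by (simp add: polys_over_def coeff_pderiv mult_closed del: of_nat_Suc)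
  show "map_poly h (pderiv p) = pderiv (map_poly h p)"
    using c by (intro poly_eqI) (simp add: coeff_pderiv h_mult del: of_nat_Suc)
qed

lemma split_monic:
  fixes y :: "nat \<Rightarrow> 'a::idom"
  assumes "f = (\<Prod>j<n. [:- y j, 1:])"
  shows "lead_coeff f = 1" "degree f = n" "\<And>j. j < n \<Longrightarrow> poly f (y j) = 0"
proof -
  show "lead_coeff f = 1" unfolding assms lead_coeff_prod by simp
  show "degree f = n" unfolding assms by (subst degree_prod_eq_sum_degree) auto
  show "poly f (y j) = 0" if "j < n" for j
    unfolding assms poly_prod by (rule prod_zero) (use that in auto)
qed

text \<open>
  The polynomial with the roots \<open>p(z\<^sub>j)\<close> is the resultant of
  \<open>q(t)\<close> and \<open>X - p(t)\<close> with respect to \<open>t\<close>.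
\<close>

lemma norm_polynomial_resultant:
  fixes z :: "nat \<Rightarrow> 'c::idom"
  assumes q: "q = (\<Prod>j<n. [:- z j, 1:])" "inj_on z {..<n}" and p: "degree p \<le> d"
  shows "resultant_sub n d (map_poly (\<lambda>a. [:a:]) q) ([:[:0, 1:]:] - map_poly (\<lambda>a. [:a:]) p) = (\<Prod>j<n. [:- poly p (z j), 1:])"
proof -
  note sm = split_monic[OF q(1)]
  have deg: "degree (map_poly (\<lambda>a. [:a:]) q) = n" using sm(2) by (subst degree_map_poly) auto
  have ev: "poly (map_poly (\<lambda>a. [:a:]) r) [:x:] = [:poly r x:]" for r :: "'c poly" and x
    by (induction r) (simp_all add: map_poly_pCons_zero)
  have "resultant_sub n d (map_poly (\<lambda>a. [:a:]) q) ([:[:0, 1:]:] - map_poly (\<lambda>a. [:a:]) p) =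
      (\<Prod>j<n. poly ([:[:0, 1:]:] - map_poly (\<lambda>a. [:a:]) p) [:z j:])"
  proof (rule resultant_sub_split)
    show "inj_on (\<lambda>j. [:z j:]) {..<n}" using q(2) by (auto simp: inj_on_def)
    show "lead_coeff (map_poly (\<lambda>a. [:a:]) q) = 1" using sm by (simp add: deg coeff_map_poly pCons_one)
    show "degree ([:[:0, 1:]:] - map_poly (\<lambda>a. [:a:]) p) \<le> d"
      using p degree_map_poly_le[of "\<lambda>a. [:a:]" p] by (intro degree_diff_le) auto
  qed (use deg sm ev in auto)
  then show ?thesis by (simp add: ev)
qed

text \<open>
  The roots \<open>y\<^sub>j\<close> need not lie in \<open>S\<close> and have no images under
  \<open>h\<close>; still, the polynomial with the roots \<open>P(y\<^sub>j)\<close> has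
  coefficients in \<open>S\<close> and reduces as expected, because it is a resultant.
\<close>

lemma norm_polynomial:
  fixes S :: "'a::idom set" and h :: "'a \<Rightarrow> 'b::idom" and n :: nat
  assumes "subring_hom S h"
    and f: "f = (\<Prod>j<n. [:- y j, 1:])" "f \<in> polys_over S" "inj_on y {..<n}"
    and f': "map_poly h f = (\<Prod>j<n. [:- y' j, 1:])" "inj_on y' {..<n}"
    and P: "P \<in> polys_over S"
  shows "(\<Prod>j<n. [:- poly P (y j), 1:]) \<in> polys_over S"
    "map_poly h (\<Prod>j<n. [:- poly P (y j), 1:]) = (\<Prod>j<n. [:- poly (map_poly h P) (y' j), 1:])"
proof -
  interpret subring_hom S h by fact
  interpret P: subring_hom "polys_over S" "map_poly h" by (rule subring_hom_poly)
  let ?F = "map_poly (\<lambda>a. [:a:]) f" and ?G = "[:[:0, 1:]:] - map_poly (\<lambda>a. [:a:]) P"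
  have F: "?F \<in> polys_over (polys_over S)"
    using f(2) by (auto simp: polys_over_def coeff_map_poly coeff_pCons split: nat.split)
  have G: "?G \<in> polys_over (polys_over S)"
    using P by (auto simp: polys_over_def coeff_map_poly coeff_pCons split: nat.split)
  have mF: "map_poly (map_poly h) ?F = map_poly (\<lambda>a. [:a:]) (map_poly h f)"
    by (intro poly_eqI) (simp add: coeff_map_poly map_poly_pCons_zero)
  have mG: "map_poly (map_poly h) ?G = [:[:0, 1:]:] - map_poly (\<lambda>a. [:a:]) (map_poly h P)"
  proof (rule poly_eqI)
    fix i
    have "[:coeff P i:] \<in> polys_over S" "coeff [:[:0, 1:]:] i \<in> polys_over S"
      using P by (auto simp: polys_over_def coeff_pCons split: nat.split)
    moreover have "map_poly h (coeff [:[:0, 1:]:] i) = coeff [:[:0, 1:]:] i"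
      by (cases i) (simp_all add: map_poly_pCons_zero map_poly_1)
    ultimately show "coeff (map_poly (map_poly h) ?G) i = coeff ([:[:0, 1:]:] - map_poly (\<lambda>a. [:a:]) (map_poly h P)) i"
      by (simp only: P.coeff_map_h coeff_diff coeff_map_poly pCons_0_0 P.h_minus map_poly_pCons_zero h_zero map_poly_0 coeff_map_h)
  qed
  have eq: "resultant_sub n (degree P) ?F ?G = (\<Prod>j<n. [:- poly P (y j), 1:])"
    by (rule norm_polynomial_resultant) (use f in auto)
  show "(\<Prod>j<n. [:- poly P (y j), 1:]) \<in> polys_over S"
    unfolding eq[symmetric] by (rule P.resultant_sub_closed[OF F G])
  show "map_poly h (\<Prod>j<n. [:- poly P (y j), 1:]) = (\<Prod>j<n. [:- poly (map_poly h P) (y' j), 1:])"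
    unfolding eq[symmetric] P.h_resultant_sub[OF F G] mF mG
    by (rule norm_polynomial_resultant) (use f' degree_map_poly_le[of h P] in auto)
qed

section \<open>Roots of polynomials with a monomial discriminant\<close>

lemma fls_nth_times_low:
  fixes a b :: "'a::comm_ring_1 fls"
  assumes "\<And>i. i < p \<Longrightarrow> fls_nth a i = 0" "\<And>i. i < q \<Longrightarrow> fls_nth b i = 0"
  shows "fls_nth (a * b) (p + q) = fls_nth a p * fls_nth b q" "i < p + q \<Longrightarrow> fls_nth (a * b) i = 0"
  using fls_times_nth_bounds[OF assms, where n = "p + q"] fls_times_nth_bounds[OF assms, where n = i] by simp_all

lemma subring_hom_integral_series:
  "subring_hom {a :: 'a::comm_ring_1 fls. integral_series a} (\<lambda>a. fls_nth a 0)"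
proof
  fix a b :: "'a fls" assume "a \<in> {a. integral_series a}" "b \<in> {a. integral_series a}"
  then have *: "\<And>i. i < 0 \<Longrightarrow> fls_nth a i = 0" "\<And>i. i < 0 \<Longrightarrow> fls_nth b i = 0" by (auto simp: integral_series_def)
  show "a + b \<in> {a. integral_series a}" "- a \<in> {a. integral_series a}" "a * b \<in> {a. integral_series a}"
    "fls_nth (a * b) 0 = fls_nth a 0 * fls_nth b 0"
    using * fls_nth_times_low[of 0 a 0 b] by (auto simp: integral_series_def)
qed (auto simp: integral_series_def)

lemma integral_series_subdegree: "integral_series a \<longleftrightarrow> a = 0 \<or> fls_subdegree a \<ge> 0"
proof
  assume "integral_series a"
  then show "a = 0 \<or> fls_subdegree a \<ge> 0"
    unfolding integral_series_def using nth_fls_subdegree_nonzero[of a] not_le by blast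
qed (auto simp: integral_series_def)

lemma place_integral_series: "place {a :: 'a::field fls. integral_series a} (\<lambda>a. fls_nth a 0)"
proof (intro place.intro subring_hom_integral_series place_axioms.intro)
  fix a :: "'a fls"
  show "inverse a \<in> {a. integral_series a}" if "a \<in> {a. integral_series a}" "fls_nth a 0 \<noteq> 0"
  proof -
    have "fls_subdegree a = 0" using that by (intro fls_subdegree_eqI) (auto simp: integral_series_def)
    then show ?thesis using that by (auto simp: integral_series_subdegree fls_inverse_subdegree)
  qed
  show "inverse a \<in> {a. integral_series a} \<and> fls_nth (inverse a) 0 = 0" if "a \<notin> {a. integral_series a}"
  proof -
    have "fls_subdegree (inverse a) > 0" using that by (auto simp: integral_series_subdegree fls_inverse_subdegree)
    then show ?thesis by (simp add: integral_series_def)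
  qed
qed

context place
begin

text \<open>
  An element of maximal value among finitely many.
\<close>

lemma maximal_value:
  assumes "finite I" "i \<in> I" "v i \<noteq> 0"
  shows "\<exists>i0\<in>I. v i0 \<noteq> 0 \<and> (\<forall>i\<in>I. v i / v i0 \<in> T)"
  using assms
proof (induction I arbitrary: i rule: finite_induct)
  case (insert x I)
  show ?case
  proof (cases "\<exists>i\<in>I. v i \<noteq> 0")
    case True
    then obtain i1 where i1: "i1 \<in> I" "v i1 \<noteq> 0" "\<forall>i\<in>I. v i / v i1 \<in> T" using insert.IH by blast
    show ?thesis
    proof (cases "v x / v i1 \<in> T")
      case True then show ?thesis using i1 by blast
    next
      case False
      then have 1: "v i1 / v x \<in> T" "v x \<noteq> 0" using valuation[OF False] by (auto simp: field_simps)
      have "v i / v x \<in> T" if "i \<in> I" for i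
      proof -
        have "v i / v x = (v i / v i1) * (v i1 / v x)" using i1 1 by simp
        then show ?thesis using i1 1 that by (metis mult_closed)
      qed
      then show ?thesis using 1 by auto
    qed
  next
    case False
    then have "v x \<noteq> 0" using insert by auto
    then show ?thesis using False by (auto intro!: bexI[of _ x])
  qed
qed simp

text \<open>
  The recursion for the coefficients of the inverse divides only by the constant coefficient, a
  unit of \<open>T\<close>.
\<close>

lemma inverse_laurent_closed:
  assumes w: "w \<in> laurent_over T" "integral_series w" "\<phi> (fls_nth w 0) \<noteq> 0"
  shows "inverse w \<in> laurent_over T"
proof -
  interpret I: place "{a :: 'l fls. integral_series a}" "\<lambda>a. fls_nth a 0" by (rule place_integral_series)
  have w0: "fls_nth w 0 \<noteq> 0" using w(3) by auto
  define v where "v = inverse w"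
  have wv: "w * v = 1" using w0 unfolding v_def by (intro right_inverse) auto
  have v: "integral_series v" using I.unit_closed[of w] w w0 by (simp add: v_def)
  have "fls_nth v (int k) \<in> T" for k
  proof (induction k rule: less_induct)
    case (less k)
    have "fls_nth (w * v) (int k) = (\<Sum>i\<in>{0..int k - 0}. fls_nth w i * fls_nth v (int k - i))"
      using w(2) v by (intro fls_times_nth_bounds) (auto simp: integral_series_def)
    also have "{0..int k - 0} = insert 0 {1..int k}" by auto
    finally have "(if k = 0 then 1 else 0) = fls_nth w 0 * fls_nth v (int k) + (\<Sum>i\<in>{1..int k}. fls_nth w i * fls_nth v (int k - i))"
      by (simp add: wv)
    then have "fls_nth v (int k) = inverse (fls_nth w 0) * ((if k = 0 then 1 else 0) - (\<Sum>i\<in>{1..int k}. fls_nth w i * fls_nth v (int k - i)))"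
      using w0 by (simp add: field_simps)
    moreover have "(\<Sum>i\<in>{1..int k}. fls_nth w i * fls_nth v (int k - i)) \<in> T"
    proof (intro sum_closed mult_closed)
      fix i assume i: "i \<in> {1..int k}"
      then have "fls_nth v (int (nat (int k - i))) \<in> T" by (intro less.IH) auto
      then show "fls_nth v (int k - i) \<in> T" using i by simp
      show "fls_nth w i \<in> T" using w(1) by (simp add: laurent_over_def)
    qed
    moreover have "inverse (fls_nth w 0) \<in> T" using w by (intro unit_closed) (auto simp: laurent_over_def)
    moreover have "(if k = 0 then 1 else 0) \<in> T" by simp
    ultimately show ?case by (simp only: mult_closed minus_closed)
  qed
  then have "fls_nth v i \<in> T" for i
    using v by (cases "i < 0") (auto simp: integral_series_def dest: spec[of _ "nat i"] elim: allE[of _ "nat i"] intro: zero_closed, metis nonneg_int_cases not_less)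
  then show ?thesis by (simp add: v_def laurent_over_def)
qed

lemma matrix_inverse_closed:
  assumes B: "B \<in> carrier_mat n n" "\<And>i j. i < n \<Longrightarrow> j < n \<Longrightarrow> B $$ (i, j) \<in> T" "\<phi> (det B) \<noteq> 0"
  obtains C where "C \<in> carrier_mat n n" "\<And>i j. i < n \<Longrightarrow> j < n \<Longrightarrow> C $$ (i, j) \<in> T" "C * B = 1\<^sub>m n"
proof -
  have d: "det B \<in> T" using B by (intro det_closed) auto
  then have id: "inverse (det B) \<in> T" using B(3) by (rule unit_closed)
  define C where "C = inverse (det B) \<cdot>\<^sub>m adj_mat B"
  have car: "C \<in> carrier_mat n n" using adj_mat(1)[OF B(1)] by (simp add: C_def)
  have "cofactor B i j \<in> T" if "i < n" "j < n" for i j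
  proof -
    have "det (mat_delete B i j) \<in> T"
    proof (rule det_closed)
      show "mat_delete B i j \<in> carrier_mat (n - 1) (n - 1)" using B(1) by (rule mat_delete_carrier)
      fix k l assume "k < n - 1" "l < n - 1"
      then have "mat_delete B i j $$ (k, l) = B $$ (if k < i then k else Suc k, if l < j then l else Suc l)"
        using B(1) by (simp add: mat_delete_def)
      moreover have "(if k < i then k else Suc k) < n" "(if l < j then l else Suc l) < n"
        using \<open>k < n - 1\<close> \<open>l < n - 1\<close> by auto
      ultimately show "mat_delete B i j $$ (k, l) \<in> T" by (simp only: B(2))
    qed
    then show ?thesis unfolding cofactor_def by (intro mult_closed power_closed uminus_closed one_closed)
  qed
  then have "C $$ (i, j) \<in> T" if "i < n" "j < n" for i j
    using that B(1) id by (simp add: C_def adj_mat_def)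
  moreover have "C * B = 1\<^sub>m n"
  proof -
    have "C * B = inverse (det B) \<cdot>\<^sub>m (adj_mat B * B)"
      unfolding C_def by (rule mult_smult_assoc_mat[OF adj_mat(1)[OF B(1)] B(1)])
    also have "\<dots> = (inverse (det B) * det B) \<cdot>\<^sub>m 1\<^sub>m n"
      unfolding adj_mat(3)[OF B(1)] by (intro eq_matI) auto
    also have "inverse (det B) * det B = 1" using B(3) by (intro left_inverse) auto
    finally show ?thesis by (auto intro: eq_matI)
  qed
  ultimately show ?thesis using that car by blast
qed

end

text \<open>
  The discriminant of \<open>f\<close> is \<open>s\<^sup>M\<close> times a power series over
  \<open>T\<close> with a unit as constant coefficient, and \<open>f\<close> splits over the
  Laurent series both before and after reduction. As in the theorem of Abhyankar and Jung, this
  forces the roots \<open>y\<^sub>j\<close> to have coefficients in \<open>T\<close>.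

  The proof studies the lattice of the vectors of values \<open>(P(y\<^sub>j))\<^sub>j\<close>
  that are integral in \<open>s\<close>, for polynomials \<open>P\<close> with coefficients in
  \<open>T((s))\<close>. Since the discriminant is a monomial up to a unit, this lattice
  contains a unimodular one. Reduction preserves unimodularity, so some \<open>P\<close> takes
  values with distinct residues at the roots. Such values have coefficients in \<open>T\<close>
  by Hensel's argument, and the roots are recovered from them by interpolation.
\<close>

locale monomial_discriminant = place T \<phi> for T :: "'l::field set" and \<phi> :: "'l \<Rightarrow> 'q::field" +
  fixes n :: nat and f :: "'l fls poly" and y :: "nat \<Rightarrow> 'l fls" and y' :: "nat \<Rightarrow> 'q fls"
    and M :: int and \<theta> :: "'l fls"
  assumes f_over: "f \<in> polys_over (laurent_over T)"
    and f_split: "f = (\<Prod>j<n. [:- y j, 1:])" and inj_y: "inj_on y {..<n}"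
    and f_split': "map_poly (map_fls \<phi>) f = (\<Prod>j<n. [:- y' j, 1:])" and inj_y': "inj_on y' {..<n}"
    and n_pos: "n > 0"
    and \<phi>_surj: "\<phi> ` T = UNIV" and infinite_residue_field: "infinite (UNIV :: 'q set)"
    and disc: "resultant_sub n (n - 1) f (pderiv f) = fls_shift (- M) \<theta>"
    and \<theta>_integral: "integral_series \<theta>" and \<theta>_unit: "\<phi> (fls_nth \<theta> 0) \<noteq> 0"
begin

sublocale L: subring_hom "laurent_over T" "map_fls \<phi>" by (rule subring_hom_fls)
sublocale LP: subring_hom "polys_over (laurent_over T)" "map_poly (map_fls \<phi>)" by (rule L.subring_hom_poly)

abbreviation "V \<equiv> vandermonde n y"
abbreviation "V' \<equiv> vandermonde n y'"

lemma \<theta>_closed: "\<theta> \<in> laurent_over T"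
proof -
  have "fls_shift (- M) \<theta> \<in> laurent_over T"
    unfolding disc[symmetric] by (intro L.resultant_sub_closed f_over pderiv_subring_hom[OF L.subring_hom_axioms])
  then have "fls_nth (fls_shift (- M) \<theta>) (i + M) \<in> T" for i unfolding laurent_over_def by blast
  then have "fls_nth \<theta> i \<in> T" for i by (simp add: add_diff_cancel)
  then show ?thesis by (simp add: laurent_over_def)
qed

lemma map_fls_shift: "map_fls \<phi> (fls_shift k a) = fls_shift k (map_fls \<phi> a)"
  by (intro fls_eqI) simp

lemma prod_pderiv_roots: "(\<Prod>j<n. poly (pderiv f) (y j)) = fls_shift (- M) \<theta>"
proof -
  note sm = split_monic[OF f_split]
  have "degree (pderiv f) \<le> n - 1" using degree_pderiv_le[of f] sm(2) by simp
  from resultant_sub_split[OF inj_y sm this] show ?thesis by (simp only: disc)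
qed

lemma prod_pderiv_roots': "(\<Prod>j<n. poly (pderiv (map_poly (map_fls \<phi>) f)) (y' j)) = fls_shift (- M) (map_fls \<phi> \<theta>)"
proof -
  note sm = split_monic[OF f_split']
  note pd = pderiv_subring_hom[OF L.subring_hom_axioms f_over]
  have "degree (pderiv (map_poly (map_fls \<phi>) f)) \<le> n - 1"
    using degree_pderiv_le[of "map_poly (map_fls \<phi>) f"] sm(2) by simp
  from resultant_sub_split[OF inj_y' sm this, symmetric]
  have "(\<Prod>j<n. poly (pderiv (map_poly (map_fls \<phi>) f)) (y' j)) =
      resultant_sub n (n - 1) (map_poly (map_fls \<phi>) f) (pderiv (map_poly (map_fls \<phi>) f))" .
  also have "\<dots> = map_fls \<phi> (resultant_sub n (n - 1) f (pderiv f))"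
    unfolding pd(2)[symmetric] by (rule L.h_resultant_sub[OF f_over pd(1), symmetric])
  finally show ?thesis by (simp only: disc map_fls_shift)
qed

text \<open>
  The rows of \<open>A\<close> are the coefficients of polynomials with integral values at the
  roots, and \<open>A V\<close> is the matrix of these values. The order in \<open>s\<close> of
  its squared determinant is \<open>2k + M\<close>.
\<close>

definition integral_basis :: "'l fls mat \<Rightarrow> int \<Rightarrow> bool" where
  "integral_basis A k \<longleftrightarrow> A \<in> carrier_mat n n \<and> (\<forall>i<n. \<forall>j<n. A $$ (i, j) \<in> laurent_over T) \<and>
     (\<forall>i<n. \<forall>j<n. integral_series ((A * V) $$ (i, j))) \<and>
     (\<exists>c\<in>T. \<phi> c \<noteq> 0 \<and> det A = fls_shift (- k) (fls_const c))"

lemma det_square: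
  assumes "integral_basis A k"
  obtains u where "u \<in> laurent_over T" "integral_series u" "\<phi> (fls_nth u 0) \<noteq> 0"
    "det (A * V) ^ 2 = fls_shift (- (2 * k + M)) u"
    "det (map_mat (map_fls \<phi>) A * V') ^ 2 = fls_shift (- (2 * k + M)) (map_fls \<phi> u) \<or>
     det (map_mat (map_fls \<phi>) A * V') ^ 2 = - fls_shift (- (2 * k + M)) (map_fls \<phi> u)"
proof -
  from assms obtain c where A: "A \<in> carrier_mat n n" "\<And>i j. i < n \<Longrightarrow> j < n \<Longrightarrow> A $$ (i, j) \<in> laurent_over T"
    and c: "c \<in> T" "\<phi> c \<noteq> 0" "det A = fls_shift (- k) (fls_const c)" by (auto simp: integral_basis_def)
  have c_over: "fls_const c \<in> laurent_over T" using c by (auto simp: laurent_over_def)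
  define u0 where "u0 = fls_const c ^ 2 * \<theta>"
  have u0: "u0 \<in> laurent_over T" unfolding u0_def by (intro L.mult_closed L.power_closed c_over \<theta>_closed)
  have nth_u0: "fls_nth u0 i = c ^ 2 * fls_nth \<theta> i" for i by (simp add: u0_def power2_eq_square fls_const_mult_const)
  have int_u0: "integral_series u0" using \<theta>_integral by (auto simp: integral_series_def nth_u0)
  have \<theta>0: "fls_nth \<theta> 0 \<in> T" using \<theta>_closed by (simp add: laurent_over_def)
  have u00: "\<phi> (fls_nth u0 0) \<noteq> 0" using c \<theta>_unit \<theta>0 by (simp add: nth_u0 h_mult h_power)
  have mu0: "map_fls \<phi> u0 = fls_const (\<phi> c) ^ 2 * map_fls \<phi> \<theta>"
    using c \<theta>_closed by (intro fls_eqI) (simp add: nth_u0 h_mult h_power laurent_over_def power2_eq_square fls_const_mult_const)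
  have sh: "(fls_shift (- k) a) ^ 2 * fls_shift (- M) b = fls_shift (- (2 * k + M)) (a ^ 2 * b)" for a b :: "'z::comm_ring_1 fls"
    by (simp add: power2_eq_square fls_shifted_times_simps algebra_simps)
  have "det (A * V) ^ 2 = det A ^ 2 * det V ^ 2" using A by (simp add: det_mult[of _ n] power_mult_distrib)
  moreover have "det V ^ 2 = fls_shift (- M) \<theta> \<or> det V ^ 2 = - fls_shift (- M) \<theta>"
    using vandermonde_square[OF inj_y split_monic[OF f_split]] unfolding prod_pderiv_roots .
  ultimately have 1: "det (A * V) ^ 2 = fls_shift (- (2 * k + M)) u0 \<or> det (A * V) ^ 2 = - fls_shift (- (2 * k + M)) u0"
    using sh[of "fls_const c" \<theta>] by (auto simp: u0_def c(3))
  have "det (map_mat (map_fls \<phi>) A) = map_fls \<phi> (det A)" using L.h_det[OF A] by simp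
  also have "\<dots> = fls_shift (- k) (fls_const (\<phi> c))"
    unfolding c(3) by (intro fls_eqI) simp
  finally have dA: "det (map_mat (map_fls \<phi>) A) = fls_shift (- k) (fls_const (\<phi> c))" .
  have "det (map_mat (map_fls \<phi>) A * V') ^ 2 = det (map_mat (map_fls \<phi>) A) ^ 2 * det V' ^ 2"
    using A by (simp add: det_mult[of _ n] power_mult_distrib)
  moreover have "det V' ^ 2 = fls_shift (- M) (map_fls \<phi> \<theta>) \<or> det V' ^ 2 = - fls_shift (- M) (map_fls \<phi> \<theta>)"
    using vandermonde_square[OF inj_y' split_monic[OF f_split']] unfolding prod_pderiv_roots' .
  ultimately have 2: "det (map_mat (map_fls \<phi>) A * V') ^ 2 = fls_shift (- (2 * k + M)) (map_fls \<phi> u0) \<or>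
     det (map_mat (map_fls \<phi>) A * V') ^ 2 = - fls_shift (- (2 * k + M)) (map_fls \<phi> u0)"
    using sh[of "fls_const (\<phi> c)" "map_fls \<phi> \<theta>"] by (auto simp: mu0 dA)
  have neg: "map_fls \<phi> (- u0) = - map_fls \<phi> u0" by (rule L.h_uminus[OF u0])
  have sn: "fls_shift i (- a) = - fls_shift i a" for i and a :: "'z::comm_ring_1 fls" by (intro fls_eqI) simp
  from 1 show ?thesis
  proof
    assume "det (A * V) ^ 2 = fls_shift (- (2 * k + M)) u0"
    then show ?thesis using that[OF u0 int_u0 u00] 2 by blast
  next
    assume *: "det (A * V) ^ 2 = - fls_shift (- (2 * k + M)) u0"
    have "integral_series (- u0)" "\<phi> (fls_nth (- u0) 0) \<noteq> 0"
      using int_u0 u00 u0 by (auto simp: integral_series_def h_uminus laurent_over_def)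
    then show ?thesis using that[OF L.uminus_closed[OF u0]] * 2 unfolding neg sn minus_minus by blast
  qed
qed

text \<open>
  Multiply the powers of the unknown by a high power of \<open>s\<close>.
\<close>

lemma integral_basis_exists: "\<exists>A k. integral_basis A k"
proof -
  have "\<exists>m. \<forall>a\<in>S. integral_series (fls_shift (- int m) a)" if "finite S" for S :: "'l fls set"
    using that
  proof (induction S rule: finite_induct)
    case (insert a S)
    then obtain m where m: "\<forall>a\<in>S. integral_series (fls_shift (- int m) a)" by blast
    have "integral_series (fls_shift (- int (max m (nat (- fls_subdegree a)))) b)" if "b \<in> insert a S" for b
    proof (cases "b = a")
      case True
      then show ?thesis by (auto simp: integral_series_def)
    next
      case False
      then have b: "integral_series (fls_shift (- int m) b)" using m that by simp
      have "fls_nth b i = 0" if "i < - int m" for i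
        using b[unfolded integral_series_def, rule_format, of "i + int m"] that by simp
      then show ?thesis by (auto simp: integral_series_def)
    qed
    then show ?case by blast
  qed simp
  from this[of "(\<lambda>(i, j). y j ^ i) ` ({..<n} \<times> {..<n})"]
  obtain m where m: "\<And>i j. i < n \<Longrightarrow> j < n \<Longrightarrow> integral_series (fls_shift (- int m) (y j ^ i))" by auto
  define A where "A = (fls_shift (- int m) 1 :: 'l fls) \<cdot>\<^sub>m 1\<^sub>m n"
  have "A * V = fls_shift (- int m) 1 \<cdot>\<^sub>m V" unfolding A_def by (subst mult_smult_assoc_mat[of _ n n _ n]) auto
  then have AV: "(A * V) $$ (i, j) = fls_shift (- int m) (y j ^ i)" if "i < n" "j < n" for i j
    using that by (simp add: vandermonde_def fls_X_intpow_times_conv_shift)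
  have sp: "(fls_shift (- int m) 1 :: 'l fls) ^ r = fls_shift (- int (r * m)) 1" for r
    by (simp add: fls_X_intpow_power)
  have "det A = fls_shift (- int (n * m)) (fls_const 1)"
    unfolding A_def det_smult by (simp add: sp)
  then have "integral_basis A (int (n * m))"
    using m AV unfolding integral_basis_def
    by (auto simp: A_def laurent_over_def simp del: index_mult_mat(1) intro!: bexI[of _ 1])
  then show ?thesis by blast
qed

text \<open>
  If \<open>2k + M > 0\<close>, the constant terms of \<open>A V\<close> have dependent rows.
  Divide a dependency by an entry of maximal value: its coefficients \<open>a\<^sub>i\<close>
  are then in \<open>T\<close>, and one of them is 1. The combination of the rows with these
  coefficients is divisible by \<open>s\<close>, and replacing a row by the quotient divides the
  determinant by \<open>s\<close>.
\<close>

lemma integral_basis_improve: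
  assumes A: "integral_basis A k" and pos: "2 * k + M > 0"
  shows "\<exists>A'. integral_basis A' (k - 1)"
proof -
  interpret I: place "{a :: 'l fls. integral_series a}" "\<lambda>a. fls_nth a 0" by (rule place_integral_series)
  from A obtain c where car: "A \<in> carrier_mat n n" and over: "\<And>i j. i < n \<Longrightarrow> j < n \<Longrightarrow> A $$ (i, j) \<in> laurent_over T"
    and int: "\<And>i j. i < n \<Longrightarrow> j < n \<Longrightarrow> integral_series ((A * V) $$ (i, j))"
    and c: "c \<in> T" "\<phi> c \<noteq> 0" "det A = fls_shift (- k) (fls_const c)" by (auto simp: integral_basis_def)
  define B where "B = A * V"
  have B: "B \<in> carrier_mat n n" using car by (simp add: B_def)
  define B0 where "B0 = map_mat (\<lambda>a. fls_nth a 0) B"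
  have B0: "B0 \<in> carrier_mat n n" using B by (simp add: B0_def)
  obtain u where u: "integral_series u" "det B ^ 2 = fls_shift (- (2 * k + M)) u"
    using det_square[OF A] unfolding B_def by metis
  have "fls_nth (det B) 0 = det B0"
    unfolding B0_def by (rule I.h_det[OF B]) (use int in \<open>simp add: B_def\<close>)
  moreover have "det B \<in> {a. integral_series a}"
    by (rule I.det_closed[OF B]) (use int in \<open>simp add: B_def\<close>)
  then have "fls_nth (det B ^ 2) 0 = fls_nth (det B) 0 ^ 2" by (rule I.h_power)
  moreover have "fls_nth (det B ^ 2) 0 = 0" unfolding u(2) using u(1) pos by (auto simp: integral_series_def)
  ultimately have "det (transpose_mat B0) = 0" using det_transpose[OF B0] by simp
  then obtain v where v: "v \<in> carrier_vec n" "v \<noteq> 0\<^sub>v n" "transpose_mat B0 *\<^sub>v v = 0\<^sub>v n"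
    using det_0_iff_vec_prod_zero_field[of "transpose_mat B0" n] B0 by auto
  have kern: "(\<Sum>i<n. fls_nth (B $$ (i, j)) 0 * vec_index v i) = 0" if "j < n" for j
  proof -
    have "vec_index (transpose_mat B0 *\<^sub>v v) j = (\<Sum>i<n. fls_nth (B $$ (i, j)) 0 * vec_index v i)"
      using that v(1) B B0 by (auto simp: scalar_prod_def atLeast0LessThan B0_def intro!: sum.cong)
    then show ?thesis using v(3) that by simp
  qed
  obtain i where "i < n" "vec_index v i \<noteq> 0" using v(1,2) by (metis eq_vecI carrier_vecD index_zero_vec)
  then obtain i0 where i0: "i0 < n" "vec_index v i0 \<noteq> 0" "\<And>i. i < n \<Longrightarrow> vec_index v i / vec_index v i0 \<in> T"
    using maximal_value[of "{..<n}" i "vec_index v"] by auto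
  define a where "a i = vec_index v i / vec_index v i0" for i
  have a: "a i0 = 1" "\<And>i. i < n \<Longrightarrow> a i \<in> T" using i0 by (auto simp: a_def)
  have kern_a: "(\<Sum>i<n. a i * fls_nth (B $$ (i, j)) 0) = 0" if "j < n" for j
  proof -
    have "(\<Sum>i<n. a i * fls_nth (B $$ (i, j)) 0) = (\<Sum>i<n. fls_nth (B $$ (i, j)) 0 * vec_index v i) / vec_index v i0"
      by (simp add: a_def sum_divide_distrib mult.commute)
    then show ?thesis using kern[OF that] by simp
  qed
  \<comment> \<open>The elementary matrix that replaces row \<open>i0\<close>; its determinant is the inverse of \<open>s\<close>.\<close>
  define E where "E = mat n n (\<lambda>(i, j). if i = i0 then fls_shift 1 (fls_const (a j)) else if i = j then 1 else 0)"
  have E: "E \<in> carrier_mat n n" by (simp add: E_def)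
  have "det E = (\<Sum>p | p permutes {0..<n}. if p = id then fls_shift 1 1 else 0)"
    unfolding det_def'[OF E]
  proof (intro sum.cong refl)
    fix p assume "p \<in> {p. p permutes {0..<n}}"
    then have p: "p permutes {0..<n}" by simp
    then have pn: "p i < n" if "i < n" for i using that permutes_in_image[of p "{0..<n}" i] by auto
    show "signof p * (\<Prod>i = 0..<n. E $$ (i, p i)) = (if p = id then fls_shift 1 1 else 0)"
    proof (cases "p = id")
      case True
      have "(\<Prod>i = 0..<n. E $$ (i, p i)) = (\<Prod>i = 0..<n. if i = i0 then fls_shift 1 1 else 1)"
        using True a(1) by (intro prod.cong) (auto simp: E_def)
      also have "\<dots> = fls_shift 1 1" using i0(1) by (simp add: prod.delta)
      finally show ?thesis using True by simp
    next
      case False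
      have "\<exists>i<n. i \<noteq> i0 \<and> p i \<noteq> i"
      proof (rule ccontr)
        assume *: "\<not> ?thesis"
        have "p i = i" for i
        proof (cases "i < n \<and> i \<noteq> i0")
          case True then show ?thesis using * by blast
        next
          case False
          show ?thesis
          proof (cases "i < n")
            case True
            then have "i = i0" using False by simp
            show ?thesis
            proof (rule ccontr)
              assume "p i \<noteq> i"
              moreover have "p (p i) = p i" using * pn[OF True] \<open>p i \<noteq> i\<close> \<open>i = i0\<close> by blast
              ultimately show False using permutes_inj[OF p] by (auto dest: injD)
            qed
          qed (use p in \<open>simp add: permutes_def\<close>)
        qed
        then show False using \<open>p \<noteq> id\<close> by auto
      qed
      then obtain i where "i < n" "i \<noteq> i0" "p i \<noteq> i" by blast
      then have "(\<Prod>i = 0..<n. E $$ (i, p i)) = 0"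
        using pn by (intro prod_zero) (auto simp: E_def intro!: bexI[of _ i])
      then show ?thesis using False by simp
    qed
  qed
  also have "\<dots> = fls_shift 1 1" by (simp add: sum.delta permutes_id finite_permutations)
  finally have detE: "det E = fls_shift 1 1" .
  have "det (E * A) = fls_shift 1 1 * fls_shift (- k) (fls_const c)"
    using det_mult[OF E car] detE c(3) by simp
  also have "\<dots> = fls_shift (- (k - 1)) (fls_const c)" by (simp add: fls_shifted_times_simps)
  finally have det: "det (E * A) = fls_shift (- (k - 1)) (fls_const c)" .
  have E_over: "E $$ (i, j) \<in> laurent_over T" if "i < n" "j < n" for i j
    using that a(2) by (auto simp: E_def laurent_over_def)
  have "(E * A) $$ (i, j) \<in> laurent_over T" if "i < n" "j < n" for i j
  proof -
    have "(E * A) $$ (i, j) = (\<Sum>l<n. E $$ (i, l) * A $$ (l, j))"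
      using that E car by (simp add: scalar_prod_def atLeast0LessThan)
    then show ?thesis using that E_over over by (auto intro!: L.sum_closed)
  qed
  moreover have "integral_series ((E * A * V) $$ (i, j))" if ij: "i < n" "j < n" for i j
  proof -
    have "E * A * V = E * B" unfolding B_def using E car by (intro assoc_mult_mat[of _ n n _ n _ n]) auto
    then have eq: "(E * A * V) $$ (i, j) = (\<Sum>l<n. E $$ (i, l) * B $$ (l, j))"
      using ij E B by (simp add: scalar_prod_def atLeast0LessThan)
    have Bint: "integral_series (B $$ (l, j))" if "l < n" for l using int[OF that ij(2)] by (simp add: B_def)
    show ?thesis
    proof (cases "i = i0")
      case True
      have "E $$ (i, l) * B $$ (l, j) = fls_shift 1 (fls_const (a l) * B $$ (l, j))" if "l < n" for l
        using True that ij by (simp add: E_def fls_shifted_times_simps)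
      then have "fls_nth ((E * A * V) $$ (i, j)) r = (\<Sum>l<n. a l * fls_nth (B $$ (l, j)) (r + 1))" for r
        unfolding eq by (simp add: fls_nth_sum)
      moreover have "(\<Sum>l<n. a l * fls_nth (B $$ (l, j)) (r + 1)) = 0" if "r < 0" for r :: int
      proof (cases "r + 1 = 0")
        case True then show ?thesis using kern_a[OF ij(2)] by simp
      next
        case False
        then have "r + 1 < 0" using that by simp
        then show ?thesis using Bint by (auto simp: integral_series_def intro!: sum.neutral)
      qed
      ultimately show ?thesis by (simp add: integral_series_def)
    next
      case False
      have "(\<Sum>l<n. E $$ (i, l) * B $$ (l, j)) = (\<Sum>l<n. if l = i then B $$ (l, j) else 0)"
        using False ij by (intro sum.cong) (auto simp: E_def)
      also have "\<dots> = B $$ (i, j)" using ij by (simp add: sum.delta)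
      finally show ?thesis unfolding eq using Bint ij by simp
    qed
  qed
  ultimately have "integral_basis (E * A) (k - 1)"
    unfolding integral_basis_def using E car c det by (auto simp del: index_mult_mat(1))
  then show ?thesis by blast
qed

text \<open>
  The descent ends, since integral values have a determinant of non-negative order.
\<close>

lemma unimodular_integral_basis: "\<exists>A k. integral_basis A k \<and> 2 * k + M = 0"
proof -
  have nonneg: "2 * k + M \<ge> 0" if A: "integral_basis A k" for A k
  proof (rule ccontr)
    assume neg: "\<not> 2 * k + M \<ge> 0"
    interpret I: place "{a :: 'l fls. integral_series a}" "\<lambda>a. fls_nth a 0" by (rule place_integral_series)
    obtain u where u: "\<phi> (fls_nth u 0) \<noteq> 0" "det (A * V) ^ 2 = fls_shift (- (2 * k + M)) u"
      using det_square[OF A] by metis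
    have "det (A * V) \<in> {a. integral_series a}"
      by (rule I.det_closed[of _ n]) (use A in \<open>auto simp: integral_basis_def simp del: index_mult_mat(1)\<close>)
    then have "det (A * V) ^ 2 \<in> {a. integral_series a}" by (rule I.power_closed)
    then have "fls_nth u 0 = 0" using neg unfolding u(2) by (auto simp: integral_series_def dest: spec[of _ "2 * k + M"])
    then show False using u(1) by simp
  qed
  have "integral_basis A k \<Longrightarrow> ?thesis" for A k
  proof (induction "nat (2 * k + M)" arbitrary: A k rule: less_induct)
    case less
    show ?case
    proof (cases "2 * k + M > 0")
      case True
      obtain A' where "integral_basis A' (k - 1)" using integral_basis_improve[OF less.prems True] by blast
      then show ?thesis using less.hyps[of "k - 1" A'] True by auto
    qed (use nonneg[OF less.prems] less.prems in auto)
  qed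
  then show ?thesis using integral_basis_exists by blast
qed

definition row_poly :: "'z::zero mat \<Rightarrow> nat \<Rightarrow> 'z poly" where
  "row_poly A i = Abs_poly (\<lambda>l. if l < n then A $$ (i, l) else 0)"

lemma coeff_row_poly: "coeff (row_poly A i) l = (if l < n then A $$ (i, l) else 0)"
  unfolding row_poly_def by (subst Abs_poly_inverse) (auto simp: MOST_nat intro!: exI[of _ n])

lemma poly_row_poly:
  fixes A :: "'z::comm_ring_1 mat"
  assumes "A \<in> carrier_mat n n" "i < n" "j < n"
  shows "poly (row_poly A i) (z j) = (A * vandermonde n z) $$ (i, j)"
proof -
  have "degree (row_poly A i) < n" by (intro degree_lessI) (auto simp: coeff_row_poly n_pos)
  then have "(\<Sum>l\<le>degree (row_poly A i). coeff (row_poly A i) l * z j ^ l) = (\<Sum>l<n. coeff (row_poly A i) l * z j ^ l)"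
    by (intro sum.mono_neutral_left) (auto simp: coeff_eq_0)
  then have "poly (row_poly A i) (z j) = (\<Sum>l<n. coeff (row_poly A i) l * z j ^ l)"
    by (simp add: poly_altdef)
  then show ?thesis using assms
    by (simp add: coeff_row_poly scalar_prod_def atLeast0LessThan vandermonde_def)
qed

text \<open>
  The values at the reduced roots are the roots of a reduced integral polynomial.
\<close>

lemma integral_values_reduce:
  assumes P: "P \<in> polys_over (laurent_over T)" "\<And>j. j < n \<Longrightarrow> integral_series (poly P (y j))" and j: "j < n"
  shows "integral_series (poly (map_poly (map_fls \<phi>) P) (y' j))"
proof -
  interpret I: place "{a :: 'l fls. integral_series a}" "\<lambda>a. fls_nth a 0" by (rule place_integral_series)
  interpret J: place "{a :: 'q fls. integral_series a}" "\<lambda>a. fls_nth a 0" by (rule place_integral_series)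
  interpret IP: subring_hom "polys_over {a :: 'l fls. integral_series a}" "map_poly (\<lambda>a. fls_nth a 0)"
    by (rule I.subring_hom_poly)
  let ?c = "\<Prod>j<n. [:- poly P (y j), 1:]"
  let ?c' = "\<Prod>j<n. [:- poly (map_poly (map_fls \<phi>) P) (y' j), 1:]"
  have eq: "map_poly (map_fls \<phi>) ?c = ?c'"
    by (rule norm_polynomial(2)[OF L.subring_hom_axioms f_split f_over inj_y f_split' inj_y' P(1)])
  have "?c \<in> polys_over {a. integral_series a}"
    using P(2) by (intro I.prod_linear_closed) simp
  then have "?c' \<in> polys_over {a. integral_series a}"
    unfolding eq[symmetric] by (auto simp: polys_over_def integral_series_def)
  moreover have "lead_coeff ?c' = 1" unfolding lead_coeff_prod by simp
  moreover have "poly ?c' (poly (map_poly (map_fls \<phi>) P) (y' j)) = 0"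
    unfolding poly_prod by (rule prod_zero) (use j in auto)
  ultimately have "poly (map_poly (map_fls \<phi>) P) (y' j) \<in> {a. integral_series a}"
    by (rule J.integrally_closed)
  then show ?thesis by simp
qed

lemma residue_lift:
  assumes "integral_series r'"
  obtains r where "r \<in> laurent_over T" "integral_series r" "map_fls \<phi> r = r'"
proof -
  define g where "g q = (if q = 0 then 0 else SOME x. x \<in> T \<and> \<phi> x = q)" for q
  have g: "g q \<in> T \<and> \<phi> (g q) = q" for q
  proof (cases "q = 0")
    case False
    have "\<exists>x. x \<in> T \<and> \<phi> x = q" using \<phi>_surj by (metis UNIV_I imageE)
    then have "(SOME x. x \<in> T \<and> \<phi> x = q) \<in> T \<and> \<phi> (SOME x. x \<in> T \<and> \<phi> x = q) = q" by (rule someI_ex)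
    then show ?thesis using False by (simp add: g_def)
  qed (simp add: g_def)
  have g0: "g 0 = 0" by (simp add: g_def)
  show ?thesis
    by (rule that[of "map_fls g r'"]) (use assms g g0 in \<open>auto simp: laurent_over_def integral_series_def intro!: fls_eqI\<close>)
qed

text \<open>
  For a unimodular basis, the matrix of the values of the reduced polynomials at the reduced
  roots is invertible over the power series. Hence a combination with power series coefficients
  takes any prescribed constants as values, here distinct ones, and its coefficients lift to
  \<open>T\<close>.
\<close>

lemma separating_polynomial:
  obtains b c where "b \<in> polys_over (laurent_over T)" "\<And>j. j < n \<Longrightarrow> integral_series (poly b (y j))"
    "\<And>j. j < n \<Longrightarrow> poly (map_poly (map_fls \<phi>) b) (y' j) = fls_const (c j)" "inj_on c {..<n}"
proof -
  interpret J: place "{a :: 'q fls. integral_series a}" "\<lambda>a. fls_nth a 0" by (rule place_integral_series)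
  interpret I: place "{a :: 'l fls. integral_series a}" "\<lambda>a. fls_nth a 0" by (rule place_integral_series)
  obtain A k where A: "integral_basis A k" and k: "2 * k + M = 0" using unimodular_integral_basis by blast
  from A have car: "A \<in> carrier_mat n n" and over: "\<And>i j. i < n \<Longrightarrow> j < n \<Longrightarrow> A $$ (i, j) \<in> laurent_over T"
    and int: "\<And>i j. i < n \<Longrightarrow> j < n \<Longrightarrow> integral_series ((A * V) $$ (i, j))"
    by (auto simp: integral_basis_def)
  let ?A' = "map_mat (map_fls \<phi>) A"
  have car': "?A' \<in> carrier_mat n n" using car by simp
  define B' where "B' = ?A' * V'"
  have B': "B' \<in> carrier_mat n n" using car by (simp add: B'_def)
  have rp_over: "row_poly A i \<in> polys_over (laurent_over T)" if "i < n" for i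
    using that over by (auto simp: polys_over_def coeff_row_poly)
  have rp_map: "map_poly (map_fls \<phi>) (row_poly A i) = row_poly ?A' i" if "i < n" for i
    using that car by (intro poly_eqI) (auto simp: coeff_row_poly)
  have B'_int: "integral_series (B' $$ (i, j))" if "i < n" "j < n" for i j
  proof -
    have "integral_series (poly (map_poly (map_fls \<phi>) (row_poly A i)) (y' j))"
      using that int by (intro integral_values_reduce rp_over) (simp_all add: poly_row_poly[OF car] del: index_mult_mat(1))
    then show ?thesis using that by (simp add: rp_map poly_row_poly[OF car'] B'_def del: index_mult_mat(1))
  qed
  have dB': "det B' \<in> {a. integral_series a}" using B' B'_int by (intro J.det_closed) auto
  have "fls_nth (det B' ^ 2) 0 \<noteq> 0"
  proof -
    obtain u where u: "u \<in> laurent_over T" "\<phi> (fls_nth u 0) \<noteq> 0"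
      "det B' ^ 2 = fls_shift (- (2 * k + M)) (map_fls \<phi> u) \<or> det B' ^ 2 = - fls_shift (- (2 * k + M)) (map_fls \<phi> u)"
      using det_square[OF A] unfolding B'_def by metis
    then show ?thesis using k by auto
  qed
  then have "fls_nth (det B') 0 \<noteq> 0" using J.h_power[OF dB', of 2] by auto
  then obtain C where C: "C \<in> carrier_mat n n" "\<And>i j. i < n \<Longrightarrow> j < n \<Longrightarrow> C $$ (i, j) \<in> {a. integral_series a}" "C * B' = 1\<^sub>m n"
    using J.matrix_inverse_closed[OF B'] B'_int by blast
  obtain c :: "nat \<Rightarrow> 'q" where c: "inj c" using infinite_residue_field infinite_countable_subset by blast
  define r' where "r' i = (\<Sum>l<n. fls_const (c l) * C $$ (l, i))" for i
  have "integral_series (r' i)" if "i < n" for i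
  proof -
    have "fls_const (c l) * C $$ (l, i) \<in> {a. integral_series a}" if "l < n" for l
      using C(2)[OF that \<open>i < n\<close>] by (intro J.mult_closed) (auto simp: integral_series_def)
    then have "r' i \<in> {a. integral_series a}" unfolding r'_def by (intro J.sum_closed) auto
    then show ?thesis by simp
  qed
  then have "\<exists>r. r \<in> laurent_over T \<and> integral_series r \<and> map_fls \<phi> r = r' i" if "i < n" for i
    using that residue_lift by metis
  then obtain r where r: "\<And>i. i < n \<Longrightarrow> r i \<in> laurent_over T" "\<And>i. i < n \<Longrightarrow> integral_series (r i)" "\<And>i. i < n \<Longrightarrow> map_fls \<phi> (r i) = r' i"
    by metis
  have rB': "(\<Sum>i<n. r' i * B' $$ (i, j)) = fls_const (c j)" if j: "j < n" for j
  proof -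
    have "(\<Sum>i<n. r' i * B' $$ (i, j)) = (\<Sum>i<n. \<Sum>l<n. fls_const (c l) * C $$ (l, i) * B' $$ (i, j))"
      by (simp add: r'_def sum_distrib_right)
    also have "\<dots> = (\<Sum>l<n. fls_const (c l) * (\<Sum>i<n. C $$ (l, i) * B' $$ (i, j)))"
      by (subst sum.swap) (simp add: sum_distrib_left mult_ac)
    also have "\<dots> = (\<Sum>l<n. fls_const (c l) * (C * B') $$ (l, j))"
      using C(1) B' j by (intro sum.cong) (auto simp: scalar_prod_def atLeast0LessThan)
    also have "\<dots> = (\<Sum>l<n. if l = j then fls_const (c l) else 0)"
      unfolding C(3) using j by (intro sum.cong) auto
    also have "\<dots> = fls_const (c j)" using j by (simp add: sum.delta)
    finally show ?thesis .
  qed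
  define b where "b = (\<Sum>i<n. [:r i:] * row_poly A i)"
  have b_over: "b \<in> polys_over (laurent_over T)"
    unfolding b_def by (intro LP.sum_closed LP.mult_closed rp_over) (use r in auto)
  have "integral_series (poly b (y j))" if j: "j < n" for j
  proof -
    have "poly b (y j) = (\<Sum>i<n. r i * (A * V) $$ (i, j))"
      unfolding b_def poly_sum using j by (intro sum.cong) (simp_all add: poly_row_poly[OF car] del: index_mult_mat(1))
    also have "\<dots> \<in> {a. integral_series a}"
      using r int j by (intro I.sum_closed I.mult_closed) auto
    finally show ?thesis by simp
  qed
  moreover have "poly (map_poly (map_fls \<phi>) b) (y' j) = fls_const (c j)" if j: "j < n" for j
  proof -
    have "map_poly (map_fls \<phi>) b = (\<Sum>i<n. map_poly (map_fls \<phi>) ([:r i:] * row_poly A i))"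
      unfolding b_def by (intro LP.h_sum LP.mult_closed rp_over) (use r in auto)
    also have "\<dots> = (\<Sum>i<n. [:r' i:] * row_poly ?A' i)"
    proof (intro sum.cong refl)
      fix i assume "i \<in> {..<n}"
      then have i: "i < n" by simp
      have "map_poly (map_fls \<phi>) ([:r i:] * row_poly A i) = map_poly (map_fls \<phi>) [:r i:] * map_poly (map_fls \<phi>) (row_poly A i)"
        by (intro LP.h_mult rp_over) (use r i in auto)
      then show "map_poly (map_fls \<phi>) ([:r i:] * row_poly A i) = [:r' i:] * row_poly ?A' i"
        using r(3) i by (simp add: rp_map map_poly_pCons_zero)
    qed
    finally show ?thesis using rB'[OF j] j
      by (simp add: poly_sum poly_row_poly[OF car'] B'_def del: index_mult_mat(1))
  qed
  ultimately show ?thesis using that[OF b_over] c inj_on_subset[OF c] by blast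
qed

text \<open>
  The constant terms of the \<open>\<beta>\<^sub>j\<close> are integral over \<open>T\<close>,
  hence in \<open>T\<close>, and their residues are the distinct \<open>c\<^sub>j\<close>. If
  \<open>a\<close> is the truncation of \<open>\<beta>\<^sub>j\<close> before
  \<open>s\<^sup>k\<close>, then the coefficient of \<open>s\<^sup>k\<close> in
  \<open>\<chi>(a)\<close> is the next coefficient of \<open>\<beta>\<^sub>j\<close> times a
  unit of \<open>T\<close>.
\<close>

lemma separated_values_closed:
  fixes \<beta> :: "nat \<Rightarrow> 'l fls" and c :: "nat \<Rightarrow> 'q"
  assumes \<chi>: "(\<Prod>j<n. [:- \<beta> j, 1:]) \<in> polys_over (laurent_over T)"
    and \<chi>': "map_poly (map_fls \<phi>) (\<Prod>j<n. [:- \<beta> j, 1:]) = (\<Prod>j<n. [:- fls_const (c j), 1:])"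
    and int: "\<And>j. j < n \<Longrightarrow> integral_series (\<beta> j)" and c: "inj_on c {..<n}"
  shows "\<And>j. j < n \<Longrightarrow> \<beta> j \<in> laurent_over T" "inj_on (\<lambda>j. \<phi> (fls_nth (\<beta> j) 0)) {..<n}"
proof -
  interpret I: place "{a :: 'l fls. integral_series a}" "\<lambda>a. fls_nth a 0" by (rule place_integral_series)
  interpret J: place "{a :: 'q fls. integral_series a}" "\<lambda>a. fls_nth a 0" by (rule place_integral_series)
  interpret IP: subring_hom "polys_over {a :: 'l fls. integral_series a}" "map_poly (\<lambda>a. fls_nth a 0)"
    by (rule I.subring_hom_poly)
  interpret JP: subring_hom "polys_over {a :: 'q fls. integral_series a}" "map_poly (\<lambda>a. fls_nth a 0)"
    by (rule J.subring_hom_poly)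
  interpret TP: subring_hom "polys_over T" "map_poly \<phi>" by (rule subring_hom_poly)
  let ?\<chi> = "\<Prod>j<n. [:- \<beta> j, 1:]"
  define b where "b j = fls_nth (\<beta> j) 0" for j
  have \<chi>0: "map_poly (\<lambda>a. fls_nth a 0) ?\<chi> = (\<Prod>j<n. [:- b j, 1:])"
    using int by (subst I.h_prod_linear) (simp_all add: b_def)
  have over0: "(\<Prod>j<n. [:- b j, 1:]) \<in> polys_over T"
    unfolding \<chi>0[symmetric] using \<chi> by (auto simp: polys_over_def laurent_over_def)
  have "map_poly \<phi> (\<Prod>j<n. [:- b j, 1:]) = map_poly (\<lambda>a. fls_nth a 0) (map_poly (map_fls \<phi>) ?\<chi>)"
    unfolding \<chi>0[symmetric] by (intro poly_eqI) simp
  also have "\<dots> = (\<Prod>j<n. [:- c j, 1:])"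
    unfolding \<chi>' by (subst J.h_prod_linear) (auto simp: integral_series_def)
  finally have map0: "map_poly \<phi> (\<Prod>j<n. [:- b j, 1:]) = (\<Prod>j<n. [:- c j, 1:])" .
  have bT: "b j \<in> T" if "j < n" for j
  proof (rule integrally_closed[OF over0])
    show "lead_coeff (\<Prod>j<n. [:- b j, 1:]) = 1" unfolding lead_coeff_prod by simp
    show "poly (\<Prod>j<n. [:- b j, 1:]) (b j) = 0" unfolding poly_prod by (rule prod_zero) (use that in auto)
  qed
  have "map_poly \<phi> (\<Prod>j<n. [:- b j, 1:]) = (\<Prod>j<n. [:- \<phi> (b j), 1:])"
    using bT by (intro h_prod_linear) simp
  then have eq: "(\<Prod>j<n. [:- \<phi> (b j), 1:]) = (\<Prod>j<n. [:- c j, 1:])" using map0 by simp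
  have roots: "{q. poly (\<Prod>j<n. [:- z j, 1:]) q = 0} = z ` {..<n}" for z :: "nat \<Rightarrow> 'q"
    by (auto simp: poly_prod)
  have "(\<lambda>j. \<phi> (b j)) ` {..<n} = c ` {..<n}"
    using arg_cong[OF eq, of "\<lambda>p. {q. poly p q = 0}"] unfolding roots .
  then have "card ((\<lambda>j. \<phi> (b j)) ` {..<n}) = card {..<n}" using card_image[OF c] by simp
  then have inj: "inj_on (\<lambda>j. \<phi> (b j)) {..<n}" by (intro eq_card_imp_inj_on) auto
  then show "inj_on (\<lambda>j. \<phi> (fls_nth (\<beta> j) 0)) {..<n}" by (simp add: b_def)
  fix j assume j: "j < n"
  define w where "w = (\<Prod>l\<in>{..<n} - {j}. b j - b l)"
  have bl: "b j - b l \<in> T" if "l < n" for l using bT j that by (intro minus_closed)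
  have "w \<in> T" unfolding w_def using bl by (intro prod_closed) auto
  moreover have "\<phi> w = (\<Prod>l\<in>{..<n} - {j}. \<phi> (b j - b l))" unfolding w_def using bl by (intro h_prod) auto
  then have "\<phi> w \<noteq> 0" using bT j inj by (auto simp: h_minus dest: inj_onD)
  ultimately have w: "w \<in> T" "\<phi> w \<noteq> 0" .
  have "fls_nth (\<beta> j) (int k) \<in> T" for k
  proof (induction k rule: less_induct)
    case (less k)
    show ?case
    proof (cases "k = 0")
      case True then show ?thesis using bT[OF j] by (simp add: b_def)
    next
      case k: False
      define a where "a = Abs_fls (\<lambda>i. if i < int k then fls_nth (\<beta> j) i else 0)"
      have a: "fls_nth a i = (if i < int k then fls_nth (\<beta> j) i else 0)" for i
        unfolding a_def by (rule nth_Abs_fls_lower_bound[of "fls_subdegree (\<beta> j)"]) simp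
      have aT: "a \<in> laurent_over T"
      proof -
        have "fls_nth (\<beta> j) i \<in> T" if "i < int k" for i
        proof (cases "i < 0")
          case True then show ?thesis using int[OF j] by (simp add: integral_series_def)
        next
          case False then show ?thesis using less.IH[of "nat i"] that by simp
        qed
        then show ?thesis by (simp add: laurent_over_def a)
      qed
      have a_int: "integral_series a" using int[OF j] by (simp add: integral_series_def a)
      define v where "v = (\<Prod>l\<in>{..<n} - {j}. a - \<beta> l)"
      have al: "a - \<beta> l \<in> {a. integral_series a}" if "l < n" for l
        using a_int int[OF that] by (simp add: integral_series_def)
      have v: "integral_series v" "fls_nth v 0 = w"
      proof -
        have "v \<in> {a. integral_series a}" unfolding v_def using al by (intro I.prod_closed) auto
        then show "integral_series v" by simp
        have "fls_nth v 0 = (\<Prod>l\<in>{..<n} - {j}. fls_nth (a - \<beta> l) 0)"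
          unfolding v_def using al by (intro I.h_prod) auto
        then show "fls_nth v 0 = w" using k by (simp add: w_def a b_def)
      qed
      have "poly ?\<chi> a = (\<Prod>l<n. a - \<beta> l)" by (simp add: poly_prod)
      also have "\<dots> = (a - \<beta> j) * v" unfolding v_def using j by (subst prod.remove[of _ j]) auto
      finally have "fls_nth (poly ?\<chi> a) (int k + 0) = fls_nth (a - \<beta> j) (int k) * fls_nth v 0"
        using v(1) by (simp only:) (rule fls_nth_times_low, auto simp: a integral_series_def)
      then have "fls_nth (\<beta> j) (int k) * w = - fls_nth (poly ?\<chi> a) (int k)"
        using v(2) by (simp add: a)
      moreover have "w \<noteq> 0" using w by auto
      ultimately have "fls_nth (\<beta> j) (int k) = - fls_nth (poly ?\<chi> a) (int k) * inverse w" by (simp add: field_simps)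
      moreover have "fls_nth (poly ?\<chi> a) (int k) \<in> T"
        using L.poly_closed[OF \<chi> aT] unfolding laurent_over_def by blast
      ultimately show ?thesis using unit_closed[OF w] by (simp only: mult_closed uminus_closed)
    qed
  qed
  then have "fls_nth (\<beta> j) i \<in> T" for i
    using int[OF j] by (metis integral_series_def nonneg_int_cases not_less zero_closed)
  then show "\<beta> j \<in> laurent_over T" by (simp add: laurent_over_def)
qed

text \<open>
  The trace is a coefficient of the norm polynomial.
\<close>

lemma sum_values_closed:
  assumes "P \<in> polys_over (laurent_over T)"
  shows "(\<Sum>j<n. poly P (y j)) \<in> laurent_over T"
proof -
  have "coeff (\<Prod>j<m. [:- z j, 1:]) (m - 1) = - (\<Sum>j<m. z j)" if "m > 0" for z :: "nat \<Rightarrow> 'l fls" and m :: nat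
    using that
  proof (induction m)
    case (Suc m)
    have d: "degree (\<Prod>j<m. [:- z j, 1:]) = m" "coeff (\<Prod>j<m. [:- z j, 1:]) m = 1"
      using split_monic(1,2)[where y = z and n = m, OF refl] by simp_all
    have "coeff (\<Prod>j<Suc m. [:- z j, 1:]) m = coeff ([:- z m, 1:] * (\<Prod>j<m. [:- z j, 1:])) m"
      by (simp only: prod.lessThan_Suc mult.commute)
    also have "\<dots> = - z m + (if m = 0 then 0 else coeff (\<Prod>j<m. [:- z j, 1:]) (m - 1))"
      using d by (cases m) simp_all
    finally show ?case using Suc.IH by (cases "m = 0") simp_all
  qed simp
  from this[OF n_pos, of "\<lambda>j. poly P (y j)"]
  have "- (\<Sum>j<n. poly P (y j)) \<in> laurent_over T"
    using norm_polynomial(1)[OF L.subring_hom_axioms f_split f_over inj_y f_split' inj_y' assms]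
    by (metis polys_overD)
  then show ?thesis using L.uminus_closed[of "- (\<Sum>j<n. poly P (y j))"] by simp
qed

text \<open>
  The traces \<open>\<Sum>\<^sub>l y\<^sub>l \<beta>\<^sub>l\<^sup>k\<close> lie in
  \<open>T((s))\<close>, and so do the \<open>\<beta>\<^sub>l\<close>. The combination of the
  traces with the coefficients of \<open>q = \<Prod>\<^sub>l\<^sub>\<noteq>\<^sub>j (t -
  \<beta>\<^sub>l)\<close> leaves \<open>y\<^sub>j q(\<beta>\<^sub>j)\<close>, and
  \<open>q(\<beta>\<^sub>j)\<close> is a unit.
\<close>

theorem roots_closed:
  assumes j: "j < n"
  shows "y j \<in> laurent_over T"
proof -
  interpret I: place "{a :: 'l fls. integral_series a}" "\<lambda>a. fls_nth a 0" by (rule place_integral_series)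
  obtain b c where b: "b \<in> polys_over (laurent_over T)" "\<And>j. j < n \<Longrightarrow> integral_series (poly b (y j))"
    and b': "\<And>j. j < n \<Longrightarrow> poly (map_poly (map_fls \<phi>) b) (y' j) = fls_const (c j)" "inj_on c {..<n}"
    using separating_polynomial by metis
  define \<beta> where "\<beta> l = poly b (y l)" for l
  note np = norm_polynomial[OF L.subring_hom_axioms f_split f_over inj_y f_split' inj_y' b(1)]
  have "(\<Prod>j<n. [:- poly (map_poly (map_fls \<phi>) b) (y' j), 1:]) = (\<Prod>j<n. [:- fls_const (c j), 1:])"
    using b'(1) by (intro prod.cong) auto
  then have eq: "map_poly (map_fls \<phi>) (\<Prod>j<n. [:- \<beta> j, 1:]) = (\<Prod>j<n. [:- fls_const (c j), 1:])"
    using np(2) unfolding \<beta>_def by simp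
  have int: "integral_series (\<beta> l)" if "l < n" for l using b(2)[OF that] by (simp add: \<beta>_def)
  note sep = separated_values_closed[OF np(1)[folded \<beta>_def] eq int b'(2)]
  define q where "q = (\<Prod>l\<in>{..<n} - {j}. [:- \<beta> l, 1:])"
  define w where "w = (\<Prod>l\<in>{..<n} - {j}. \<beta> j - \<beta> l)"
  have q: "q \<in> polys_over (laurent_over T)"
    unfolding q_def using sep(1) by (intro LP.prod_closed) auto
  have qv: "poly q (\<beta> l) = (if l = j then w else 0)" if "l < n" for l
    using that j by (auto simp: q_def w_def poly_prod intro!: prod_zero)
  have t: "(\<Sum>l<n. y l * \<beta> l ^ k) \<in> laurent_over T" for k
  proof -
    have "[:0, 1:] * b ^ k \<in> polys_over (laurent_over T)"
      by (intro LP.mult_closed LP.power_closed b) simp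
    from sum_values_closed[OF this] show ?thesis by (simp add: \<beta>_def)
  qed
  have "(\<Sum>k\<le>degree q. coeff q k * (\<Sum>l<n. y l * \<beta> l ^ k)) = (\<Sum>l<n. y l * poly q (\<beta> l))"
    unfolding sum_distrib_left poly_altdef by (subst sum.swap) (simp add: mult_ac)
  also have "\<dots> = (\<Sum>l<n. if l = j then y l * w else 0)" using qv by (intro sum.cong) auto
  also have "\<dots> = y j * w" using j by (simp add: sum.delta)
  finally have "y j * w \<in> laurent_over T"
    using q t by (metis (no_types, lifting) L.mult_closed L.sum_closed polys_overD)
  moreover have iw: "inverse w \<in> laurent_over T" and w: "w \<noteq> 0"
  proof -
    have d: "\<beta> j - \<beta> l \<in> {a. integral_series a}" if "l < n" for l
      using int[OF j] int[OF that] by (simp add: integral_series_def)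
    have "w \<in> laurent_over T" unfolding w_def using sep(1) j by (intro L.prod_closed L.minus_closed) auto
    moreover have "w \<in> {a. integral_series a}" unfolding w_def using d by (intro I.prod_closed) auto
    moreover have "fls_nth w 0 = (\<Prod>l\<in>{..<n} - {j}. fls_nth (\<beta> j - \<beta> l) 0)"
      unfolding w_def using d by (intro I.h_prod) auto
    then have "\<phi> (fls_nth w 0) = (\<Prod>l\<in>{..<n} - {j}. \<phi> (fls_nth (\<beta> j) 0) - \<phi> (fls_nth (\<beta> l) 0))"
    proof (simp only:, subst h_prod)
      fix l assume "l \<in> {..<n} - {j}"
      then have "\<beta> j - \<beta> l \<in> laurent_over T" using sep(1) j by (intro L.minus_closed) auto
      then show "fls_nth (\<beta> j - \<beta> l) 0 \<in> T" unfolding laurent_over_def by blast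
    qed (use sep(1) j in \<open>auto simp: h_minus laurent_over_def intro!: prod.cong\<close>)
    then have "\<phi> (fls_nth w 0) \<noteq> 0" using sep(2) j by (auto dest: inj_onD)
    ultimately show "inverse w \<in> laurent_over T" "w \<noteq> 0" using inverse_laurent_closed[of w] by auto
  qed
  ultimately have "y j * w * inverse w \<in> laurent_over T" by (metis L.mult_closed)
  then show ?thesis using w by (simp add: mult.assoc)
qed

end

section \<open>Lifting idempotents along a place\<close>

definition multiples :: "'a::times \<Rightarrow> 'a set \<Rightarrow> 'a set" where
  "multiples d S = (*) d ` S"

context subring_hom
begin

lemma multiplesI: "t \<in> S \<Longrightarrow> a = d * t \<Longrightarrow> a \<in> multiples d S"
  by (auto simp: multiples_def)

lemma zero_multiples [simp]: "0 \<in> multiples d S"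
  by (rule multiplesI[of 0]) auto

lemma add_multiples: "a \<in> multiples d S \<Longrightarrow> b \<in> multiples d S \<Longrightarrow> a + b \<in> multiples d S"
  by (auto simp: multiples_def simp flip: distrib_left)

lemma mult_multiples: "a \<in> multiples d S \<Longrightarrow> b \<in> multiples e S \<Longrightarrow> a * b \<in> multiples (d * e) S"
proof -
  assume "a \<in> multiples d S" "b \<in> multiples e S"
  then obtain s t where "s \<in> S" "t \<in> S" "a = d * s" "b = e * t" by (auto simp: multiples_def)
  then show ?thesis by (intro multiplesI[of "s * t"]) (auto simp: mult_ac)
qed

lemma multiples_1 [simp]: "multiples 1 S = S"
  by (auto simp: multiples_def)

lemma uminus_multiples: "a \<in> multiples d S \<Longrightarrow> - a \<in> multiples d S"
  using mult_multiples[of a d "- 1" 1] by simp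

lemma sum_multiples: "(\<And>x. x \<in> A \<Longrightarrow> g x \<in> multiples d S) \<Longrightarrow> sum g A \<in> multiples d S"
  by (induction A rule: infinite_finite_induct) (auto intro: add_multiples)

lemma laurent_multiples_mult:
  assumes "a \<in> laurent_over (multiples d S)" "b \<in> laurent_over (multiples e S)"
  shows "a * b \<in> laurent_over (multiples (d * e) S)"
  using assms by (auto simp: laurent_over_def fls_times_nth(2) intro!: sum_multiples mult_multiples)

lemma laurent_multiples_mult_left:
  assumes "a \<in> laurent_over S" "b \<in> laurent_over (multiples e S)"
  shows "a * b \<in> laurent_over (multiples e S)"
  using laurent_multiples_mult[of a 1 b e] assms by simp

lemma multiples_mono: "e \<in> S \<Longrightarrow> multiples (d * e) S \<subseteq> multiples d S"
  by (auto simp: multiples_def mult.assoc)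

end

text \<open>
  Put \<open>v = b + \<nu>\<close>. Then \<open>\<nu>\<^sup>2 + \<sigma>\<nu>\<close> is
  divisible by \<open>\<delta>\<close> for a sign \<open>\<sigma>\<close>, and all coefficients
  of \<open>\<nu>\<close> lie in the kernel of \<open>\<phi>\<close>. Suppose that some
  coefficients of index at most 0 are not divisible by \<open>\<delta>\<close>, and let
  \<open>\<alpha>\<close> be one of maximal value. In the equation at the index of
  \<open>\<alpha>\<close>, each product in \<open>\<nu>\<^sup>2\<close> has a factor of index at
  most 0 and another one in the kernel; so \<open>\<sigma>\<alpha>\<close> strictly dominates,
  which is impossible. The coefficients of positive index follow by induction.
\<close>

lemma (in place) near_idempotent:
  assumes v: "v \<in> laurent_over T" "v ^ 2 - v \<in> laurent_over (multiples \<delta> T)"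
    and \<delta>: "\<delta> \<in> T" "\<phi> \<delta> = 0" and res: "map_fls \<phi> v = of_bool b"
  shows "v - of_bool b \<in> laurent_over (multiples \<delta> T)"
proof -
  define \<nu> where "\<nu> = v - of_bool b"
  define \<sigma> :: 'l where "\<sigma> = (if b then 1 else - 1)"
  have \<sigma>: "\<sigma> \<in> T" "\<sigma> * \<sigma> = 1" "\<phi> \<sigma> \<noteq> 0" by (auto simp: \<sigma>_def h_uminus)
  have \<nu>_nth: "fls_nth \<nu> i = fls_nth v i - (if i = 0 then of_bool b else 0)" for i by (auto simp: \<nu>_def)
  have vT: "fls_nth v i \<in> T" for i using v(1) by (simp add: laurent_over_def)
  have \<nu>T: "fls_nth \<nu> i \<in> T" for i using vT by (auto simp: \<nu>_nth)
  have "fls_nth (map_fls \<phi> v) i = fls_nth (of_bool b) i" for i by (simp add: res)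
  then have \<phi>v: "\<phi> (fls_nth v i) = (if i = 0 then of_bool b else 0)" for i by (auto split: if_splits)
  have \<phi>\<nu>: "\<phi> (fls_nth \<nu> i) = 0" for i using \<phi>v[of i] vT[of i] by (auto simp: \<nu>_nth h_minus)
  define p where "p = fls_subdegree \<nu>"
  have "v ^ 2 - v = \<nu> * \<nu> + fls_const \<sigma> * \<nu>"
    by (cases b) (simp_all add: \<nu>_def \<sigma>_def power2_eq_square algebra_simps)
  then have "fls_nth (v ^ 2 - v) i = fls_nth (\<nu> * \<nu>) i + \<sigma> * fls_nth \<nu> i" for i by simp
  moreover have "fls_nth (v ^ 2 - v) i \<in> multiples \<delta> T" for i using v(2) by (simp add: laurent_over_def)
  ultimately have eq: "(\<Sum>a\<in>{p..i - p}. fls_nth \<nu> a * fls_nth \<nu> (i - a)) + \<sigma> * fls_nth \<nu> i \<in> multiples \<delta> T" for i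
    by (simp only: fls_times_nth(2)[of \<nu> \<nu>] p_def[symmetric])
  have low: "fls_nth \<nu> i \<in> multiples \<delta> T" if "i \<le> 0" for i
  proof (rule ccontr)
    assume bad: "fls_nth \<nu> i \<notin> multiples \<delta> T"
    then have "fls_nth \<nu> i \<noteq> 0" using zero_multiples[of \<delta>] by metis
    then have i: "i \<in> {p..0}" using that fls_subdegree_leI by (auto simp: p_def)
    obtain i0 where i0: "i0 \<in> {p..0}" "fls_nth \<nu> i0 \<noteq> 0" "\<And>j. j \<in> {p..0} \<Longrightarrow> fls_nth \<nu> j / fls_nth \<nu> i0 \<in> T"
      using maximal_value[OF finite_atLeastAtMost_int i, of "fls_nth \<nu>"] \<open>fls_nth \<nu> i \<noteq> 0\<close> by metis
    define \<alpha> where "\<alpha> = fls_nth \<nu> i0"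
    have \<alpha>0: "\<alpha> \<noteq> 0" using i0 by (simp add: \<alpha>_def)
    have quot: "fls_nth \<nu> j / \<alpha> \<in> T" if "j \<le> 0" for j
    proof (cases "j \<ge> p")
      case False then have "fls_nth \<nu> j = 0" by (simp add: p_def)
      then show ?thesis by simp
    qed (use i0(3) that in \<open>simp add: \<alpha>_def\<close>)
    have "\<alpha> \<notin> multiples \<delta> T"
    proof
      assume "\<alpha> \<in> multiples \<delta> T"
      then have "\<alpha> * (fls_nth \<nu> i / \<alpha>) \<in> multiples (\<delta> * 1) T"
        by (rule mult_multiples) (use quot that in simp)
      then show False using bad \<alpha>0 by simp
    qed
    have \<delta>\<alpha>: "\<delta> / \<alpha> \<in> T \<and> \<phi> (\<delta> / \<alpha>) = 0"
    proof (cases "\<delta> = 0")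
      case False
      have "\<alpha> / \<delta> \<notin> T"
      proof
        assume "\<alpha> / \<delta> \<in> T"
        then have "\<alpha> \<in> multiples \<delta> T" by (rule multiplesI) (use False in simp)
        then show False using \<open>\<alpha> \<notin> multiples \<delta> T\<close> by simp
      qed
      from valuation[OF this] show ?thesis by (simp add: field_simps)
    qed simp
    obtain t where t: "t \<in> T" "(\<Sum>a\<in>{p..i0 - p}. fls_nth \<nu> a * fls_nth \<nu> (i0 - a)) + \<sigma> * \<alpha> = \<delta> * t"
      using eq[of i0] by (auto simp: multiples_def \<alpha>_def)
    define g where "g a = fls_nth \<nu> a * fls_nth \<nu> (i0 - a) / \<alpha>" for a
    have g: "g a \<in> T \<and> \<phi> (g a) = 0" for a
    proof (cases "a \<le> 0")
      case True
      have "g a = (fls_nth \<nu> a / \<alpha>) * fls_nth \<nu> (i0 - a)" by (simp add: g_def)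
      then show ?thesis using quot[OF True] \<nu>T \<phi>\<nu> by (simp only: mult_closed h_mult mult_zero_right simp_thms)
    next
      case False
      then have "i0 - a \<le> 0" using i0 by simp
      moreover have "g a = (fls_nth \<nu> (i0 - a) / \<alpha>) * fls_nth \<nu> a" by (simp add: g_def)
      ultimately show ?thesis using quot[of "i0 - a"] \<nu>T \<phi>\<nu> by (simp only: mult_closed h_mult mult_zero_right simp_thms)
    qed
    have sg: "sum g {p..i0 - p} \<in> T" "\<phi> (sum g {p..i0 - p}) = 0"
      using g by (auto simp: h_sum intro!: sum_closed)
    have "sum g {p..i0 - p} = (\<Sum>a\<in>{p..i0 - p}. fls_nth \<nu> a * fls_nth \<nu> (i0 - a)) / \<alpha>"
      by (simp add: g_def sum_divide_distrib)
    also have "(\<Sum>a\<in>{p..i0 - p}. fls_nth \<nu> a * fls_nth \<nu> (i0 - a)) = \<delta> * t - \<sigma> * \<alpha>" using t(2) by (simp add: algebra_simps)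
    finally have "\<sigma> = (\<delta> / \<alpha>) * t - sum g {p..i0 - p}" using \<alpha>0 by (simp add: field_simps)
    then have "\<phi> \<sigma> = 0" using \<delta>\<alpha> t(1) sg by (simp only: h_minus h_mult mult_closed mult_zero_left diff_self)
    then show False using \<sigma> by simp
  qed
  have "fls_nth \<nu> (int k) \<in> multiples \<delta> T" for k
  proof (induction k rule: less_induct)
    case (less k)
    have "fls_nth \<nu> a * fls_nth \<nu> (int k - a) \<in> multiples \<delta> T" for a
    proof -
      have "fls_nth \<nu> a \<in> multiples \<delta> T \<or> fls_nth \<nu> (int k - a) \<in> multiples \<delta> T"
      proof (cases "a \<le> 0 \<or> int k - a \<le> 0")
        case False
        then have "nat a < k" "int (nat a) = a" by auto
        then show ?thesis using less.IH[of "nat a"] by simp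
      qed (use low in blast)
      then show ?thesis
        using mult_multiples[of "fls_nth \<nu> a" \<delta> "fls_nth \<nu> (int k - a)" 1]
          mult_multiples[of "fls_nth \<nu> a" 1 "fls_nth \<nu> (int k - a)" \<delta>] \<nu>T by auto
    qed
    then have "- (\<Sum>a\<in>{p..int k - p}. fls_nth \<nu> a * fls_nth \<nu> (int k - a)) \<in> multiples \<delta> T"
      by (intro uminus_multiples sum_multiples)
    from add_multiples[OF eq[of "int k"] this] have "\<sigma> * fls_nth \<nu> (int k) \<in> multiples \<delta> T" by simp
    from mult_multiples[OF _ this, of \<sigma> 1] show ?case using \<sigma> by (simp flip: mult.assoc)
  qed
  then have "fls_nth \<nu> i \<in> multiples \<delta> T" for i using low by (metis nonneg_int_cases linear)
  then show ?thesis by (simp add: \<nu>_def laurent_over_def)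
qed

lemma infinite_alg_closed_field: "infinite (UNIV :: 'a::alg_closed_field set)"
proof
  assume fin: "finite (UNIV :: 'a set)"
  define p where "p = (\<Prod>a\<in>(UNIV :: 'a set). [:- a, 1:]) + 1"
  have "degree (\<Prod>a\<in>(UNIV :: 'a set). [:- a, 1:]) = card (UNIV :: 'a set)"
    by (subst degree_prod_eq_sum_degree) auto
  moreover have "card (UNIV :: 'a set) > 0" using fin by (simp add: finite_UNIV_card_ge_0)
  ultimately have "degree p > 0" unfolding p_def by (subst degree_add_eq_left) auto
  then obtain x where "poly p x = 0" using alg_closed_imp_poly_has_root by blast
  moreover have "poly p x = 1" using fin by (auto simp: p_def poly_prod intro!: prod_zero)
  ultimately show False by simp
qed

text \<open>
  The expansion of a polynomial in \<open>x\<close> at infinity, where \<open>x =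
  s\<^sup>-\<^sup>N\<close>.
\<close>

definition expand_at_infinity :: "nat \<Rightarrow> 'a::comm_ring_1 poly \<Rightarrow> 'a fls" where
  "expand_at_infinity N p = fls_subst_power N (poly (map_poly fls_const p) fls_X_inv)"

lemma poly_X_inv_nth:
  fixes p :: "'a::comm_ring_1 poly"
  shows "fls_nth (poly (map_poly fls_const p) fls_X_inv) i = (if i \<le> 0 then coeff p (nat (- i)) else 0)"
proof (induction p arbitrary: i)
  case (pCons c p)
  have "fls_nth (poly (map_poly fls_const (pCons c p)) fls_X_inv) i =
      fls_nth (fls_const c) i + fls_nth (poly (map_poly fls_const p) fls_X_inv) (i + 1)"
    by (simp add: map_poly_pCons_zero fls_X_inv_conv_shift_1 fls_shifted_times_simps fls_mult_one)
  also have "\<dots> = (if i \<le> 0 then coeff (pCons c p) (nat (- i)) else 0)"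
  proof -
    have "nat (- i) = Suc (nat (- (i + 1)))" if "i < 0" using that by simp
    then show ?thesis unfolding pCons.IH by (auto simp: coeff_pCons split: nat.split)
  qed
  finally show ?case .
qed simp

lemma expand_at_infinity_nth:
  assumes "N > 0"
  shows "fls_nth (expand_at_infinity N p) i = (if i \<le> 0 \<and> int N dvd i then coeff p (nat (- i) div N) else 0)"
proof (cases "int N dvd i")
  case True
  then obtain k where k: "i = int N * k" by (elim dvdE)
  have "nat (- (int N * k)) div N = nat (- k)" if "k \<le> 0"
  proof -
    have "nat (- (int N * k)) = N * nat (- k)" using that by (simp add: nat_mult_distrib flip: mult_minus_right)
    then show ?thesis using assms by simp
  qed
  moreover have "int N * k \<le> 0 \<longleftrightarrow> k \<le> 0" using assms by (simp add: mult_le_0_iff)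
  ultimately show ?thesis using assms k
    by (simp add: expand_at_infinity_def fls_subst_power_nth poly_X_inv_nth)
qed (use assms in \<open>simp add: expand_at_infinity_def fls_subst_power_nth\<close>)

lemma subring_hom_expand_at_infinity:
  assumes "N > 0"
  shows "subring_hom (UNIV :: 'a::comm_ring_1 poly set) (expand_at_infinity N)"
proof -
  interpret s: comm_ring_hom "fls_subst_power N :: 'a fls \<Rightarrow> 'a fls" by (rule comm_ring_hom_fls_subst_power[OF assms])
  interpret c: comm_ring_hom "fls_const :: 'a \<Rightarrow> 'a fls" by unfold_locales (simp_all add: fls_const_mult_const fls_plus_const)
  interpret mc: map_poly_comm_ring_hom "fls_const :: 'a \<Rightarrow> 'a fls" ..
  show ?thesis
    by unfold_locales (auto simp: expand_at_infinity_def mc.hom_add mc.hom_mult mc.hom_uminus s.hom_add s.hom_mult)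
qed

lemma expand_at_infinity_inj:
  assumes "N > 0" "expand_at_infinity N p = 0"
  shows "p = 0"
proof (rule poly_eqI)
  fix i
  have "fls_nth (expand_at_infinity N p) (- int (N * i)) = coeff p i"
    using assms(1) by (simp add: expand_at_infinity_nth nat_mult_distrib)
  then show "coeff p i = coeff 0 i" using assms(2) by simp
qed

lemma monic_division:
  fixes g p :: "'a::comm_ring_1 poly"
  assumes g: "lead_coeff g = 1" "degree g > 0"
  obtains q r where "p = q * g + r" "degree r < degree g"
proof -
  have "\<exists>q r. p = q * g + r \<and> degree r < degree g"
  proof (induction "degree p" arbitrary: p rule: less_induct)
    case less
    show ?case
    proof (cases "degree p < degree g")
      case True then show ?thesis by (intro exI[of _ 0] exI[of _ p]) simp
    next
      case False
      then have ge: "degree p - (degree p - degree g) = degree g" by simp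
      define m where "m = monom (lead_coeff p) (degree p - degree g)"
      have "coeff (m * g) i = (if i < degree p - degree g then 0 else lead_coeff p * coeff g (i - (degree p - degree g)))" for i
        by (simp add: m_def coeff_monom_mult)
      then have "degree (p - m * g) < degree p"
        using False g ge by (intro degree_lessI) (auto simp: coeff_eq_0 le_less)
      from less[OF this] obtain q r where "p - m * g = q * g + r" "degree r < degree g" by blast
      then show ?thesis by (intro exI[of _ "m + q"] exI[of _ r]) (simp add: algebra_simps)
    qed
  qed
  then show ?thesis using that by blast
qed

lemma expand_at_infinity_surj:
  assumes N: "N > 0" and a: "\<And>i. i > 0 \<or> \<not> int N dvd i \<Longrightarrow> fls_nth a i = 0"
  obtains p where "expand_at_infinity N p = a"
proof -
  define p where "p = Abs_poly (\<lambda>k. fls_nth a (- int (N * k)))"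
  have "fls_nth a (- int (N * k)) = 0" if "k > nat (- fls_subdegree a)" for k
  proof -
    have "int k \<le> int (N * k)" using N by (simp flip: of_nat_mult)
    then show ?thesis using that by (intro fls_eq0_below_subdegree) linarith
  qed
  then have "\<forall>\<^sub>\<infinity>k. fls_nth a (- int (N * k)) = 0" unfolding MOST_nat by blast
  then have p: "coeff p k = fls_nth a (- int (N * k))" for k by (simp add: p_def Abs_poly_inverse)
  have "fls_nth (expand_at_infinity N p) i = fls_nth a i" for i
  proof (cases "i \<le> 0 \<and> int N dvd i")
    case True
    then have "int N * (- i div int N) = - i" by simp
    moreover have "int (nat (- i) div N) = - i div int N" using True by (simp add: zdiv_int)
    ultimately have "- int (N * (nat (- i) div N)) = i" by simp
    then show ?thesis using True N by (simp add: expand_at_infinity_nth p)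
  next
    case False
    then have "fls_nth a i = 0" by (intro a) auto
    then show ?thesis unfolding expand_at_infinity_nth[OF N] if_not_P[OF False] by simp
  qed
  then show ?thesis using that fls_eqI by blast
qed

lemma expand_at_infinity_const:
  assumes "N > 0" shows "expand_at_infinity N [:c:] = fls_const c"
proof (rule fls_eqI)
  fix i
  have "nat (- i) div N \<noteq> 0" if "i < 0" "int N dvd i"
  proof -
    have "int N \<le> - i" using that by (intro zdvd_imp_le) auto
    then show ?thesis using assms by (simp add: div_eq_0_iff)
  qed
  then show "fls_nth (expand_at_infinity N [:c:]) i = fls_nth (fls_const c) i"
    using assms by (auto simp: expand_at_infinity_nth coeff_pCons split: nat.split)
qed

lemma monic_dvd_iff_roots_at_infinity:
  fixes H p :: "'z::field poly poly"
  assumes N: "N > 0" and H: "lead_coeff H = 1" "degree H = n" "n > 0"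
    and y: "map_poly (expand_at_infinity N) H = (\<Prod>j<n. [:- y j, 1:])" "inj_on y {..<n}"
  shows "H dvd p \<longleftrightarrow> (\<forall>j<n. poly (map_poly (expand_at_infinity N) p) (y j) = 0)"
proof -
  interpret Z: subring_hom "UNIV :: 'z poly set" "expand_at_infinity N"
    by (rule subring_hom_expand_at_infinity[OF N])
  interpret ZP: subring_hom "UNIV :: 'z poly poly set" "map_poly (expand_at_infinity N)"
    using Z.subring_hom_poly by (simp add: polys_over_def)
  have root: "poly (map_poly (expand_at_infinity N) (q * H)) (y j) = 0" if "j < n" for j q
    using split_monic(3)[OF y(1) that] by (simp add: ZP.h_mult)
  show ?thesis
  proof
    assume "H dvd p"
    then show "\<forall>j<n. poly (map_poly (expand_at_infinity N) p) (y j) = 0"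
      using root by (metis dvdE mult.commute)
  next
    assume *: "\<forall>j<n. poly (map_poly (expand_at_infinity N) p) (y j) = 0"
    obtain q r where qr: "p = q * H + r" "degree r < degree H" using monic_division H by metis
    have "poly (map_poly (expand_at_infinity N) r) (y j) = 0" if "j < n" for j
      using spec[OF *, of j] root[OF that, of q] that unfolding qr(1) ZP.h_add[OF UNIV_I UNIV_I] poly_add
      by (simp only: simp_thms add_0_left)
    moreover have "degree (map_poly (expand_at_infinity N) r) < n"
      using qr(2) H(2) degree_map_poly_le[of "expand_at_infinity N" r] by simp
    ultimately have "map_poly (expand_at_infinity N) r = 0"
      using poly_eq_0_of_roots[OF y(2)] by blast
    then have "coeff r i = 0" for i
      using expand_at_infinity_inj[OF N, of "coeff r i"] by (metis Z.coeff_map_h coeff_0)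
    then have "r = 0" by (intro poly_eqI) simp
    then show "H dvd p" using qr(1) by simp
  qed
qed

text \<open>
  In the application \<open>G\<close> is \<open>F - \<lambda>\<close>, and the leading
  coefficient of its discriminant, a polynomial in \<open>x\<close>, is
  \<open>\<plusminus>\<Delta>\<^sub>0(\<lambda>)\<close>. The valuation ring \<open>T\<close> is
  not Noetherian; the assumption \<open>separated\<close> takes the place of Krull's
  intersection theorem.
\<close>

locale good_reduction = place T \<phi> for T :: "'l::alg_closed_field set" and \<phi> :: "'l \<Rightarrow> 'q::alg_closed_field" +
  fixes n :: nat and G :: "'l poly poly"
  assumes G_over: "G \<in> polys_over (polys_over T)" and G_monic: "lead_coeff G = 1" "degree G = n"
    and n_pos: "n > 0"
    and \<phi>_surj: "\<phi> ` T = UNIV"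
    and tame: "\<And>i. 0 < i \<Longrightarrow> i \<le> n \<Longrightarrow> of_nat i \<noteq> (0 :: 'q)"
    and disc_unit: "\<phi> (lead_coeff (resultant_sub n (n - 1) G (pderiv G))) \<noteq> 0"
    and separated: "\<And>\<delta> a. \<delta> \<in> T \<Longrightarrow> \<phi> \<delta> = 0 \<Longrightarrow> (\<And>k. a \<in> multiples (\<delta> ^ k) T) \<Longrightarrow> a = 0"
begin

sublocale P: subring_hom "polys_over T" "map_poly \<phi>" by (rule subring_hom_poly)
sublocale PP: subring_hom "polys_over (polys_over T)" "map_poly (map_poly \<phi>)" by (rule P.subring_hom_poly)
sublocale L: subring_hom "laurent_over T" "map_fls \<phi>" by (rule subring_hom_fls)
sublocale LP: subring_hom "polys_over (laurent_over T)" "map_poly (map_fls \<phi>)" by (rule L.subring_hom_poly)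

definition "N = puiseux_exponent n"

lemma N_pos: "N > 0" unfolding N_def by (rule puiseux_exponent_pos)

sublocale X: subring_hom "UNIV :: 'l poly set" "expand_at_infinity N"
  by (rule subring_hom_expand_at_infinity[OF N_pos])
sublocale XP: subring_hom "UNIV :: 'l poly poly set" "map_poly (expand_at_infinity N)"
  using X.subring_hom_poly by (simp add: polys_over_def)
sublocale X': subring_hom "UNIV :: 'q poly set" "expand_at_infinity N"
  by (rule subring_hom_expand_at_infinity[OF N_pos])
sublocale XP': subring_hom "UNIV :: 'q poly poly set" "map_poly (expand_at_infinity N)"
  using X'.subring_hom_poly by (simp add: polys_over_def)

abbreviation "f \<equiv> map_poly (expand_at_infinity N) G"
abbreviation "G' \<equiv> map_poly (map_poly \<phi>) G"

lemma f_monic: "lead_coeff f = 1" "degree f = n"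
  using G_monic by (auto simp: map_poly_degree_eq coeff_map_poly)

lemma G'_monic: "lead_coeff G' = 1" "degree G' = n"
  using G_monic by (auto simp: map_poly_degree_eq coeff_map_poly)

lemma expand_closed: "p \<in> polys_over T \<Longrightarrow> expand_at_infinity N p \<in> laurent_over T"
  by (auto simp: laurent_over_def expand_at_infinity_nth[OF N_pos] polys_over_def)

lemma map_fls_expand: "map_fls \<phi> (expand_at_infinity N p) = expand_at_infinity N (map_poly \<phi> p)"
  by (intro fls_eqI) (simp add: expand_at_infinity_nth[OF N_pos])

lemma expand_poly_closed:
  "p \<in> polys_over (polys_over T) \<Longrightarrow> map_poly (expand_at_infinity N) p \<in> polys_over (laurent_over T)"
  by (auto simp: polys_over_def intro!: expand_closed)

lemma map_expand_poly:
  "map_poly (map_fls \<phi>) (map_poly (expand_at_infinity N) p) =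
   map_poly (expand_at_infinity N) (map_poly (map_poly \<phi>) p)"
  by (intro poly_eqI) (simp add: map_fls_expand)

lemma split_at_infinity:
  fixes H :: "'z::alg_closed_field poly poly"
  assumes "lead_coeff H = 1" "degree H = n" "\<And>i. 0 < i \<Longrightarrow> i \<le> n \<Longrightarrow> of_nat i \<noteq> (0 :: 'z)"
  obtains y where "map_poly (expand_at_infinity N) H = (\<Prod>j<n. [:- y j, 1:])"
proof -
  let ?H = "map_poly (\<lambda>p. poly (map_poly fls_const p) fls_X_inv) H"
  have *: "poly (map_poly fls_const 1) fls_X_inv = (1 :: 'z fls)" by (simp add: map_poly_1)
  have H: "lead_coeff ?H = 1" "degree ?H = n"
    using assms(1,2) * by (auto simp: map_poly_degree_eq coeff_map_poly)
  have "splits (map_poly (fls_subst_power (puiseux_exponent (degree ?H))) ?H)"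
    by (rule puiseux) (use H assms(3) in auto)
  also have "map_poly (fls_subst_power (puiseux_exponent (degree ?H))) ?H = map_poly (expand_at_infinity N) H"
    unfolding H(2) N_def[symmetric]
    by (intro poly_eqI) (simp add: coeff_map_poly expand_at_infinity_def)
  finally obtain ys where ys: "map_poly (expand_at_infinity N) H = (\<Prod>y\<leftarrow>ys. [:- y, 1:])"
    by (auto simp: splits_def)
  also have "\<dots> = (\<Prod>j<length ys. [:- (ys ! j), 1:])"
    by (simp add: prod.list_conv_set_nth atLeast0LessThan)
  finally have eq: "map_poly (expand_at_infinity N) H = (\<Prod>j<length ys. [:- (ys ! j), 1:])" .
  interpret Z: subring_hom "UNIV :: 'z poly set" "expand_at_infinity N"
    by (rule subring_hom_expand_at_infinity[OF N_pos])
  have "degree (map_poly (expand_at_infinity N) H) = n"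
    using assms(1,2) by (auto simp: map_poly_degree_eq coeff_map_poly)
  then have "length ys = n" using split_monic(2)[OF eq] by simp
  then show ?thesis using that eq by metis
qed

abbreviation "Disc \<equiv> resultant_sub n (n - 1) G (pderiv G)"

lemma resultant_f: "resultant_sub n (n - 1) f (pderiv f) = expand_at_infinity N Disc"
proof -
  note pd = pderiv_subring_hom[OF X.subring_hom_axioms, of G]
  show ?thesis
    using X.h_resultant_sub[of G "pderiv G" n "n - 1"] pd by (simp add: polys_over_def)
qed

lemma Disc_over: "Disc \<in> polys_over T"
  by (intro P.resultant_sub_closed G_over pderiv_subring_hom[OF P.subring_hom_axioms])

lemma resultant_f': "resultant_sub n (n - 1) (map_poly (map_fls \<phi>) f) (pderiv (map_poly (map_fls \<phi>) f)) =
  map_fls \<phi> (expand_at_infinity N Disc)"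
  unfolding resultant_f[symmetric]
  using pderiv_subring_hom[OF L.subring_hom_axioms expand_poly_closed[OF G_over]]
  by (simp only: L.h_resultant_sub expand_poly_closed[OF G_over])

definition "M = - int (N * degree Disc)"
definition "\<theta> = fls_shift M (expand_at_infinity N Disc)"

lemma expand_Disc: "expand_at_infinity N Disc = fls_shift (- M) \<theta>"
  by (simp add: \<theta>_def)

lemma \<theta>_integral: "integral_series \<theta>"
  unfolding integral_series_def
proof (intro allI impI)
  fix i :: int assume "i < 0"
  have "coeff Disc (nat (- (i + M)) div N) = 0" if "i + M \<le> 0" "int N dvd i + M"
  proof (rule coeff_eq_0)
    from that(2) obtain k where k: "i + M = int N * k" by (elim dvdE)
    have "int N * (k + int (degree Disc)) < 0" using k \<open>i < 0\<close> by (simp add: M_def algebra_simps)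
    then have "k + int (degree Disc) < 0" by (simp add: mult_less_0_iff)
    moreover have "nat (- (int N * k)) div N = nat (- k)"
      using that(1) k N_pos nat_mult_distrib[of "int N" "- k"] by simp
    ultimately show "degree Disc < nat (- (i + M)) div N" using k by simp
  qed
  then show "fls_nth \<theta> i = 0" by (simp add: \<theta>_def expand_at_infinity_nth[OF N_pos])
qed

lemma \<theta>_0: "fls_nth \<theta> 0 = lead_coeff Disc"
proof -
  have "nat (int (N * degree Disc)) div N = degree Disc" using N_pos by (simp only: nat_int) simp
  then show ?thesis by (simp add: \<theta>_def M_def expand_at_infinity_nth[OF N_pos])
qed

lemma distinct_roots:
  fixes g :: "'z::idom poly" and y :: "nat \<Rightarrow> 'z"
  assumes g: "g = (\<Prod>j<n. [:- y j, 1:])" and res: "resultant_sub n (n - 1) g (pderiv g) \<noteq> 0"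
  shows "inj_on y {..<n}"
proof (rule inj_onI, rule ccontr)
  fix i j assume ij: "i \<in> {..<n}" "j \<in> {..<n}" "y i = y j" "i \<noteq> j"
  define q where "q = (\<Prod>l\<in>{..<n} - {i} - {j}. [:- y l, 1:])"
  have "g = [:- y i, 1:] * ([:- y i, 1:] * q)"
    unfolding g q_def using ij by (subst prod.remove[of _ i], simp, simp, subst prod.remove[of _ j]) auto
  then have "pderiv g = [:- y i, 1:] * pderiv ([:- y i, 1:] * q) + [:- y i, 1:] * q * pderiv [:- y i, 1:]"
    by (simp only: pderiv_mult)
  then have "poly (pderiv g) (y i) = 0" by (simp only: poly_add poly_mult) simp
  moreover have "degree (pderiv g) \<le> n - 1"
    using degree_pderiv_le[of g] split_monic(2)[OF g] by simp
  ultimately show False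
    using resultant_sub_common_root[of g n "y i" "pderiv g" "n - 1"] split_monic[OF g] ij res n_pos by auto
qed

text \<open>
  In terms of \<open>s\<close>, the discriminant is a monomial times a power series in
  \<open>s\<close> whose constant coefficient is a unit of \<open>T\<close>. By tameness,
  Puiseux's theorem applies both to \<open>G\<close> and to its reduction.
\<close>

lemma roots_at_infinity:
  obtains y where "f = (\<Prod>j<n. [:- y j, 1:])" "inj_on y {..<n}" "\<And>j. j < n \<Longrightarrow> y j \<in> laurent_over T"
    "map_poly (map_fls \<phi>) f = (\<Prod>j<n. [:- map_fls \<phi> (y j), 1:])" "inj_on (\<lambda>j. map_fls \<phi> (y j)) {..<n}"
proof -
  have tame0: "of_nat i \<noteq> (0 :: 'l)" if "0 < i" "i \<le> n" for i
    using tame[OF that] h_of_nat[of i] by (metis h_zero)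
  obtain y where y: "f = (\<Prod>j<n. [:- y j, 1:])" using split_at_infinity[OF G_monic tame0] by blast
  obtain y' where y': "map_poly (map_fls \<phi>) f = (\<Prod>j<n. [:- y' j, 1:])"
    unfolding map_expand_poly using split_at_infinity[OF G'_monic tame] by blast
  have "map_fls \<phi> (expand_at_infinity N Disc) \<noteq> 0"
  proof
    assume "map_fls \<phi> (expand_at_infinity N Disc) = 0"
    then have "\<phi> (fls_nth (fls_shift (- M) \<theta>) M) = fls_nth 0 M" unfolding expand_Disc by (metis h_zero map_fls_nth)
    then show False using disc_unit by (simp add: \<theta>_0)
  qed
  moreover from this have "expand_at_infinity N Disc \<noteq> 0" by auto
  ultimately have inj: "inj_on y {..<n}" "inj_on y' {..<n}"
    using distinct_roots[OF y] distinct_roots[OF y'] resultant_f resultant_f' by metis+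
  interpret monomial_discriminant T \<phi> n f y y' M \<theta>
  proof unfold_locales
    show "f \<in> polys_over (laurent_over T)" by (rule expand_poly_closed[OF G_over])
    show "resultant_sub n (n - 1) f (pderiv f) = fls_shift (- M) \<theta>" by (simp only: resultant_f expand_Disc)
    show "\<phi> (fls_nth \<theta> 0) \<noteq> 0" using disc_unit by (simp add: \<theta>_0)
  qed (use y y' inj n_pos \<phi>_surj infinite_alg_closed_field \<theta>_integral in auto)
  have m: "map_poly (map_fls \<phi>) f = (\<Prod>j<n. [:- map_fls \<phi> (y j), 1:])"
    by (subst y, rule L.h_prod_linear) (use roots_closed in auto)
  have "inj_on (\<lambda>j. map_fls \<phi> (y j)) {..<n}"
    using distinct_roots[OF m] resultant_f' \<open>map_fls \<phi> (expand_at_infinity N Disc) \<noteq> 0\<close> by metis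
  then show ?thesis using that y inj roots_closed m by blast
qed

text \<open>
  Divide by a coefficient of maximal value.
\<close>

lemma common_divisor:
  assumes R: "R \<in> polys_over (polys_over T)" "map_poly (map_poly \<phi>) R = 0"
  obtains \<delta> b where "\<delta> \<in> T" "\<phi> \<delta> = 0" "b \<in> polys_over (polys_over T)" "R = smult [:\<delta>:] b"
proof (cases "R = 0")
  case True
  then show ?thesis using that[of 0 0] by simp
next
  case False
  define I where "I = {(j, i). coeff (coeff R j) i \<noteq> 0}"
  have "I \<subseteq> Sigma {..degree R} (\<lambda>j. {..degree (coeff R j)})"
    by (auto simp: I_def intro!: le_degree)
  then have fin: "finite I" by (rule finite_subset) auto
  obtain j i where "coeff (coeff R j) i \<noteq> 0" using False by (metis leading_coeff_0_iff)
  then have "(j, i) \<in> I" by (simp add: I_def)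
  from maximal_value[OF fin this, of "\<lambda>(j, i). coeff (coeff R j) i"] \<open>coeff (coeff R j) i \<noteq> 0\<close>
  obtain j0 i0 where 0: "coeff (coeff R j0) i0 \<noteq> 0"
    "\<And>j i. (j, i) \<in> I \<Longrightarrow> coeff (coeff R j) i / coeff (coeff R j0) i0 \<in> T" by fastforce
  define \<delta> where "\<delta> = coeff (coeff R j0) i0"
  have "coeff (coeff (map_poly (map_poly \<phi>) R) j0) i0 = 0" by (simp add: R(2))
  then have \<delta>: "\<delta> \<in> T" "\<phi> \<delta> = 0" "\<delta> \<noteq> 0" using R(1) 0 by (auto simp: \<delta>_def polys_over_def)
  define b where "b = map_poly (map_poly (\<lambda>c. c / \<delta>)) R"
  have b: "coeff (coeff b j) i = coeff (coeff R j) i / \<delta>" for i j by (simp add: b_def coeff_map_poly)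
  have "coeff (coeff R j) i / \<delta> \<in> T" for i j
    using 0(2)[of j i] by (cases "(j, i) \<in> I") (auto simp: \<delta>_def I_def)
  then have "b \<in> polys_over (polys_over T)" by (simp add: polys_over_def b)
  moreover have "R = smult [:\<delta>:] b" using \<delta>(3) by (intro poly_eqI) (simp add: b)
  ultimately show ?thesis using that \<delta> by blast
qed

text \<open>
  An idempotent of \<open>Q[x,y]/(G')\<close> takes the values 0 and 1 at the roots of
  \<open>G'\<close> at infinity. Choose constants \<open>\<epsilon>\<^sub>j\<close> accordingly
  and let \<open>E\<close> be the polynomial in \<open>y\<close> of degree less than
  \<open>n\<close> with the values \<open>\<epsilon>\<^sub>j\<close> at the roots of
  \<open>G\<close>; its coefficients are Laurent series in \<open>s\<close>. It remains to see
  that they are expansions of polynomials in \<open>x\<close>.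

  A lift of the idempotent to \<open>T[x,y]\<close> is idempotent modulo \<open>G\<close> and
  some \<open>\<delta>\<close> in the maximal ideal, and Newton's iteration improves it modulo
  every power of \<open>\<delta>\<close>. Hence \<open>E\<close> is congruent modulo every power
  of \<open>\<delta>\<close> to a polynomial in \<open>x\<close> and \<open>y\<close>, because
  the interpolation can be carried out over \<open>T((s))\<close>. The coefficients of
  \<open>E\<close> at the powers of \<open>s\<close> that do not occur in polynomials in
  \<open>x\<close> are therefore divisible by all powers of \<open>\<delta>\<close>, and vanish.
\<close>

theorem idempotent_lifting:
  assumes e': "G' dvd e' ^ 2 - e'" "\<not> G' dvd e'" "\<not> G' dvd e' - 1"
  obtains e where "degree e < n" "G dvd e ^ 2 - e" "\<not> G dvd e" "\<not> G dvd e - 1"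
proof -
  obtain y where y: "f = (\<Prod>j<n. [:- y j, 1:])" "inj_on y {..<n}" "\<And>j. j < n \<Longrightarrow> y j \<in> laurent_over T"
    and y': "map_poly (map_fls \<phi>) f = (\<Prod>j<n. [:- map_fls \<phi> (y j), 1:])" "inj_on (\<lambda>j. map_fls \<phi> (y j)) {..<n}"
    using roots_at_infinity by metis
  define val where "val p j = poly (map_poly (expand_at_infinity N) p) (y j)" for p j
  define val' where "val' p j = poly (map_poly (expand_at_infinity N) p) (map_fls \<phi> (y j))" for p j
  note dvd = monic_dvd_iff_roots_at_infinity[OF N_pos G_monic n_pos y(1,2), folded val_def]
  note dvd' = monic_dvd_iff_roots_at_infinity[OF N_pos G'_monic n_pos y'[unfolded map_expand_poly], folded val'_def]
  have val_hom: "val (p + q) j = val p j + val q j" "val (p * q) j = val p j * val q j"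
    "val (p - q) j = val p j - val q j" "val 1 j = 1" "val (p ^ k) j = val p j ^ k" "val (of_nat k) j = of_nat k" for p q j k
    by (simp_all add: val_def XP.h_add XP.h_mult XP.h_minus XP.h_power)
  have val'_hom: "val' (p - q) j = val' p j - val' q j" "val' 1 j = 1" "val' (p ^ k) j = val' p j ^ k" for p q j k
    by (simp_all add: val'_def XP'.h_minus XP'.h_power)
  have val_closed: "val p j \<in> laurent_over T" and val_red: "map_fls \<phi> (val p j) = val' (map_poly (map_poly \<phi>) p) j"
    if "p \<in> polys_over (polys_over T)" "j < n" for p j
    using L.poly_closed[OF expand_poly_closed[OF that(1)] y(3)[OF that(2)]]
      L.h_poly[OF expand_poly_closed[OF that(1)] y(3)[OF that(2)]]
    by (simp_all add: val_def val'_def map_expand_poly)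
  define \<epsilon> where "\<epsilon> j = (val' e' j = 1)" for j
  have \<epsilon>: "val' e' j = of_bool (\<epsilon> j)" if "j < n" for j
  proof -
    have "val' e' j ^ 2 - val' e' j = 0" using dvd'[of "e' ^ 2 - e'"] e'(1) that by (simp add: val'_hom)
    then have "val' e' j * (val' e' j - 1) = 0" by (simp add: power2_eq_square algebra_simps)
    then show ?thesis by (auto simp: \<epsilon>_def)
  qed

  obtain \<delta> e0 where \<delta>: "\<delta> \<in> T" "\<phi> \<delta> = 0" and e0: "e0 \<in> polys_over (polys_over T)"
    "map_poly (map_poly \<phi>) e0 = e'"
    and start: "\<And>j. j < n \<Longrightarrow> val e0 j ^ 2 - val e0 j \<in> laurent_over (multiples \<delta> T)"
  proof -
    have surj: "map_poly (map_poly \<phi>) ` polys_over (polys_over T) = UNIV"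
      by (intro P.polys_over_surj polys_over_surj \<phi>_surj)
    obtain e0 where e0: "e0 \<in> polys_over (polys_over T)" "map_poly (map_poly \<phi>) e0 = e'"
      using surj by (metis UNIV_I imageE)
    obtain a' where a': "e' ^ 2 - e' = G' * a'" using e'(1) by (elim dvdE)
    obtain a where a: "a \<in> polys_over (polys_over T)" "map_poly (map_poly \<phi>) a = a'"
      using surj by (metis UNIV_I imageE)
    define R where "R = e0 ^ 2 - e0 - G * a"
    have R: "R \<in> polys_over (polys_over T)" unfolding R_def
      by (intro PP.minus_closed PP.power_closed PP.mult_closed e0 a G_over)
    have "map_poly (map_poly \<phi>) R = 0"
      using e0 a a' by (simp add: R_def PP.h_minus PP.h_mult PP.h_power PP.minus_closed PP.mult_closed PP.power_closed G_over)
    with R obtain \<delta> b where b: "\<delta> \<in> T" "\<phi> \<delta> = 0" "b \<in> polys_over (polys_over T)" "R = smult [:\<delta>:] b"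
      using common_divisor by metis
    have "val e0 j ^ 2 - val e0 j \<in> laurent_over (multiples \<delta> T)" if j: "j < n" for j
    proof -
      have "R = [:[:\<delta>:]:] * b" using b(4) by simp
      moreover have "val [:[:\<delta>:]:] j = fls_const \<delta>"
        by (simp add: val_def map_poly_pCons_zero expand_at_infinity_const N_pos)
      ultimately have "val R j = fls_const \<delta> * val b j" by (simp only: val_hom)
      moreover have "val (G * a) j = 0" using dvd[of "G * a"] j by simp
      ultimately have "val e0 j ^ 2 - val e0 j = fls_const \<delta> * val b j"
        unfolding R_def val_hom(3,5) by simp
      moreover have "val b j \<in> laurent_over T" by (rule val_closed[OF b(3) j])
      ultimately show ?thesis by (auto simp: laurent_over_def intro: multiplesI)
    qed
    then show ?thesis using that b e0 by blast
  qed

  have approx: "\<exists>p. p \<in> polys_over (polys_over T) \<and>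
    (\<forall>j<n. val p j ^ 2 - val p j \<in> laurent_over (multiples (\<delta> ^ Suc k) T) \<and> map_fls \<phi> (val p j) = of_bool (\<epsilon> j))" for k
  proof (induction k)
    case 0
    show ?case using e0 start \<epsilon> by (intro exI[of _ e0]) (auto simp: val_red)
  next
    case (Suc k)
    then obtain p where p: "p \<in> polys_over (polys_over T)"
      "\<And>j. j < n \<Longrightarrow> val p j ^ 2 - val p j \<in> laurent_over (multiples (\<delta> ^ Suc k) T)"
      "\<And>j. j < n \<Longrightarrow> map_fls \<phi> (val p j) = of_bool (\<epsilon> j)" by blast
    \<comment> \<open>The polynomial \<open>3t\<^sup>2 - 2t\<^sup>3\<close> fixes 0 and 1 and has critical points there.\<close>
    define q where "q = of_nat 3 * p ^ 2 - of_nat 2 * p ^ 3"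
    have qv: "val q j = of_nat 3 * val p j ^ 2 - of_nat 2 * val p j ^ 3" for j by (simp only: q_def val_hom)
    have "q \<in> polys_over (polys_over T)" unfolding q_def
      by (intro PP.minus_closed PP.mult_closed PP.power_closed PP.of_nat_closed p)
    moreover have "val q j ^ 2 - val q j \<in> laurent_over (multiples (\<delta> ^ Suc (Suc k)) T)"
      "map_fls \<phi> (val q j) = of_bool (\<epsilon> j)" if j: "j < n" for j
    proof -
      let ?v = "val p j"
      have v: "?v \<in> laurent_over T" by (rule val_closed[OF p(1) j])
      have "val q j ^ 2 - val q j = (of_nat 4 * ?v ^ 2 - of_nat 4 * ?v - of_nat 3) * ((?v ^ 2 - ?v) * (?v ^ 2 - ?v))"
        unfolding qv by (simp add: power2_eq_square power3_eq_cube algebra_simps)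
      also have "\<dots> \<in> laurent_over (multiples (\<delta> ^ Suc k * \<delta> ^ Suc k) T)"
        using p(2)[OF j] v by (intro laurent_multiples_mult_left laurent_multiples_mult L.minus_closed L.mult_closed L.power_closed L.of_nat_closed)
      also have "\<delta> ^ Suc k * \<delta> ^ Suc k = \<delta> ^ Suc (Suc k) * \<delta> ^ k" by (simp add: mult_ac)
      also have "laurent_over (multiples (\<delta> ^ Suc (Suc k) * \<delta> ^ k) T) \<subseteq> laurent_over (multiples (\<delta> ^ Suc (Suc k)) T)"
        using multiples_mono[of "\<delta> ^ k" "\<delta> ^ Suc (Suc k)"] \<delta> by (auto simp: laurent_over_def)
      finally show "val q j ^ 2 - val q j \<in> laurent_over (multiples (\<delta> ^ Suc (Suc k)) T)" .
      have "map_fls \<phi> (val q j) = of_nat 3 * map_fls \<phi> ?v ^ 2 - of_nat 2 * map_fls \<phi> ?v ^ 3"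
        unfolding qv using v
        by (simp only: L.h_minus L.h_mult L.h_power L.h_of_nat L.mult_closed L.power_closed L.of_nat_closed)
      then show "map_fls \<phi> (val q j) = of_bool (\<epsilon> j)" unfolding p(3)[OF j] by (cases "\<epsilon> j") simp_all
    qed
    ultimately show ?case by blast
  qed

  \<comment> \<open>Lagrange interpolation; the denominators \<open>d j = f'(y j)\<close> are units, as their product is the discriminant up to sign.\<close>
  define lg where "lg j = (\<Prod>l\<in>{..<n} - {j}. [:- y l, 1:])" for j
  define d where "d j = poly (lg j) (y j)" for j
  have lg_closed: "lg j \<in> polys_over (laurent_over T)" for j
    unfolding lg_def by (rule L.prod_linear_closed) (use y(3) in auto)
  have lg_val: "poly (lg j) (y l) = (if l = j then d j else 0)" if "j < n" "l < n" for j l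
    using that by (auto simp: d_def) (auto simp: lg_def poly_prod intro!: prod_zero)
  have d_closed: "d j \<in> laurent_over T" if "j < n" for j
    unfolding d_def by (rule L.poly_closed[OF lg_closed y(3)[OF that]])
  have prod_d: "(\<Prod>j<n. d j) = fls_shift (- M) \<theta>"
  proof -
    have "poly (pderiv f) (y j) = d j" if "j < n" for j
    proof -
      have p1: "pderiv [:- y j, 1:] = 1" by (simp add: pderiv_pCons)
      have "f = [:- y j, 1:] * lg j" unfolding y(1) lg_def using that by (subst prod.remove[of _ j]) auto
      then have "pderiv f = [:- y j, 1:] * pderiv (lg j) + lg j * pderiv [:- y j, 1:]" by (simp only: pderiv_mult)
      then have "poly (pderiv f) (y j) = poly ([:- y j, 1:] * pderiv (lg j) + lg j * pderiv [:- y j, 1:]) (y j)"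
        by (rule arg_cong)
      then show ?thesis by (simp only: p1 d_def poly_add poly_mult poly_1) simp
    qed
    moreover have "resultant_sub n (n - 1) f (pderiv f) = (\<Prod>j<n. poly (pderiv f) (y j))"
    proof (rule resultant_sub_split[OF y(2) split_monic[OF y(1)]])
      show "degree (pderiv f) \<le> n - 1" using degree_pderiv_le[of f] f_monic by simp
    qed
    ultimately show ?thesis by (simp only: resultant_f expand_Disc) simp
  qed
  have "\<theta> \<in> laurent_over T" using expand_closed[OF Disc_over] by (auto simp: \<theta>_def laurent_over_def)
  then have i\<theta>: "inverse \<theta> \<in> laurent_over T"
    using \<theta>_integral \<theta>_0 disc_unit by (intro inverse_laurent_closed) auto
  have \<theta>0: "\<theta> \<noteq> 0" using \<theta>_0 disc_unit by auto
  define c where "c j = fls_shift M (inverse \<theta>) * (\<Prod>l\<in>{..<n} - {j}. d l)" for j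
  have c_closed: "c j \<in> laurent_over T" if "j < n" for j
  proof -
    have "fls_shift M (inverse \<theta>) \<in> laurent_over T" using i\<theta> by (auto simp: laurent_over_def)
    then show ?thesis unfolding c_def using d_closed by (intro L.mult_closed L.prod_closed) auto
  qed
  have cd: "c j * d j = 1" if "j < n" for j
  proof -
    have "(\<Prod>l<n. d l) = d j * (\<Prod>l\<in>{..<n} - {j}. d l)" using that by (subst prod.remove[of _ j]) auto
    then have "c j * d j = fls_shift M (inverse \<theta>) * fls_shift (- M) \<theta>" by (simp add: c_def prod_d[symmetric] mult_ac)
    also have "\<dots> = inverse \<theta> * \<theta>" by (simp add: fls_shifted_times_simps)
    finally show ?thesis using \<theta>0 by simp
  qed

  define interp where "interp a = (\<Sum>j<n. smult (a j * c j) (lg j))" for a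
  have interp_val: "poly (interp a) (y l) = a l" if "l < n" for a l
  proof -
    have "poly (interp a) (y l) = (\<Sum>j<n. if j = l then a j * c j * d j else 0)"
      unfolding interp_def poly_sum using that lg_val by (intro sum.cong) auto
    then show ?thesis using that cd[OF that] by (simp add: sum.delta mult.assoc)
  qed
  have interp_degree: "degree (interp a) < n" for a
  proof -
    have "degree (lg j) = n - 1" if "j < n" for j
      unfolding lg_def by (subst degree_prod_eq_sum_degree) (use that in auto)
    then have "degree (interp a) \<le> n - 1"
      unfolding interp_def by (intro degree_sum_le) (auto intro: order.trans[OF degree_smult_le])
    then show ?thesis using n_pos by simp
  qed
  have interp_unique: "p = interp a" if "degree p < n" "\<And>j. j < n \<Longrightarrow> poly p (y j) = a j" for p a
  proof -
    have "p - interp a = 0"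
      using that interp_degree[of a] interp_val
      by (intro poly_eq_0_of_roots[OF y(2)]) (auto intro: degree_diff_less)
    then show ?thesis by simp
  qed
  define E where "E = interp (\<lambda>j. of_bool (\<epsilon> j))"
  have coeff_E: "fls_nth (coeff E i) m = 0" if m: "m > 0 \<or> \<not> int N dvd m" for i m
  proof (rule separated[OF \<delta>])
    fix k
    obtain p where p: "p \<in> polys_over (polys_over T)"
      "\<And>j. j < n \<Longrightarrow> val p j ^ 2 - val p j \<in> laurent_over (multiples (\<delta> ^ Suc k) T)"
      "\<And>j. j < n \<Longrightarrow> map_fls \<phi> (val p j) = of_bool (\<epsilon> j)" using approx[of k] by blast
    have near: "val p j - of_bool (\<epsilon> j) \<in> laurent_over (multiples (\<delta> ^ Suc k) T)" if "j < n" for j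
      by (rule near_idempotent[OF val_closed[OF p(1) that] p(2)[OF that] _ _ p(3)[OF that]])
        (use \<delta> in \<open>simp_all add: h_mult\<close>)
    obtain q r where qr: "p = q * G + r" "degree r < degree G"
      using monic_division[of G p] G_monic n_pos by metis
    have rv: "val r j = val p j" if "j < n" for j
      using dvd[of "q * G"] that by (simp add: qr(1) val_hom)
    have "map_poly (expand_at_infinity N) r = interp (val p)"
      using qr(2) G_monic(2) degree_map_poly_le[of "expand_at_infinity N" r] rv
      by (intro interp_unique) (auto simp: val_def)
    then have "coeff (interp (val p)) i = expand_at_infinity N (coeff r i)" by (metis X.coeff_map_h)
    then have z: "fls_nth (coeff (interp (val p)) i) m = 0"
      using m by (auto simp: expand_at_infinity_nth[OF N_pos])
    have "coeff (interp (val p)) i - coeff E i = (\<Sum>j<n. (c j * coeff (lg j) i) * (val p j - of_bool (\<epsilon> j)))"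
      unfolding E_def interp_def coeff_sum sum_subtractf[symmetric] by (intro sum.cong refl) (simp add: algebra_simps)
    also have "fls_nth \<dots> m = (\<Sum>j<n. fls_nth ((c j * coeff (lg j) i) * (val p j - of_bool (\<epsilon> j))) m)"
      by (rule fls_nth_sum)
    also have "\<dots> \<in> multiples (\<delta> ^ Suc k) T"
    proof (rule sum_multiples)
      fix j assume "j \<in> {..<n}"
      then have j: "j < n" by simp
      have "c j * coeff (lg j) i \<in> laurent_over T" by (intro L.mult_closed c_closed[OF j] polys_overD[OF lg_closed])
      from laurent_multiples_mult_left[OF this near[OF j]]
      show "fls_nth ((c j * coeff (lg j) i) * (val p j - of_bool (\<epsilon> j))) m \<in> multiples (\<delta> ^ Suc k) T"
        unfolding laurent_over_def by blast
    qed
    finally have "- fls_nth (coeff E i) m \<in> multiples (\<delta> ^ Suc k) T" using z by simp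
    then have "fls_nth (coeff E i) m \<in> multiples (\<delta> ^ k * \<delta>) T" using uminus_multiples by (fastforce simp: mult.commute)
    then show "fls_nth (coeff E i) m \<in> multiples (\<delta> ^ k) T" using multiples_mono[OF \<delta>(1)] by blast
  qed
  have "\<exists>p. expand_at_infinity N p = coeff E i" for i
    using expand_at_infinity_surj[OF N_pos coeff_E] by metis
  then obtain g where g: "\<And>i. expand_at_infinity N (g i) = coeff E i" by metis
  define e where "e = (\<Sum>i<n. monom (g i) i)"
  have ce: "coeff e i = (if i < n then g i else 0)" for i by (simp add: e_def coeff_sum sum.delta)
  have "map_poly (expand_at_infinity N) e = E"
    using interp_degree[of "\<lambda>j. of_bool (\<epsilon> j)"] by (intro poly_eqI) (auto simp: ce g coeff_eq_0 E_def[symmetric])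
  then have ev: "val e j = of_bool (\<epsilon> j)" if "j < n" for j
    using that by (simp add: val_def E_def interp_val)
  show ?thesis
  proof (rule that)
    show "degree e < n" using n_pos by (intro degree_lessI) (auto simp: ce)
    show "G dvd e ^ 2 - e" unfolding dvd by (auto simp: val_hom ev)
    have "\<exists>j<n. val' e' j \<noteq> 0" using e'(2) unfolding dvd' by blast
    then show "\<not> G dvd e" unfolding dvd using ev \<epsilon> by fastforce
    have "\<exists>j<n. val' e' j \<noteq> 1" using e'(3) unfolding dvd' by (auto simp: val'_hom)
    then show "\<not> G dvd e - 1" unfolding dvd using ev \<epsilon>_def by (auto simp: val_hom)
  qed
qed

end

section \<open>The local ring at a prime ideal of a Dedekind domain\<close>

abbreviation (input) type_ring :: "'a::comm_ring_1 ring" where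
  "type_ring \<equiv> ring_of_type_algebra"

lemma type_ring_simps [simp]:
  fixes x y :: "'a::comm_ring_1"
  shows "carrier (type_ring :: 'a::comm_ring_1 ring) = UNIV" "\<zero>\<^bsub>type_ring\<^esub> = (0 :: 'a)" "\<one>\<^bsub>type_ring\<^esub> = (1 :: 'a)"
  "x \<oplus>\<^bsub>type_ring\<^esub> y = x + y" "x \<otimes>\<^bsub>type_ring\<^esub> y = x * y"
  by (simp_all add: ring_of_type_algebra_def)

lemma ideal_type_ring:
  fixes I :: "'a::comm_ring_1 set"
  shows "ideal I type_ring \<longleftrightarrow> 0 \<in> I \<and> (\<forall>x\<in>I. \<forall>y\<in>I. x + y \<in> I) \<and> (\<forall>x\<in>I. \<forall>r. r * x \<in> I)"
proof -
  interpret R: cring "type_ring :: 'a ring" by (rule cring_from_type_algebra)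
  show ?thesis
  proof
    assume "ideal I type_ring"
    then interpret I: ideal I "type_ring :: 'a ring" .
    show "0 \<in> I \<and> (\<forall>x\<in>I. \<forall>y\<in>I. x + y \<in> I) \<and> (\<forall>x\<in>I. \<forall>r. r * x \<in> I)"
      using I.zero_closed I.a_closed I.I_l_closed by simp
  next
    assume *: "0 \<in> I \<and> (\<forall>x\<in>I. \<forall>y\<in>I. x + y \<in> I) \<and> (\<forall>x\<in>I. \<forall>r. r * x \<in> I)"
    show "ideal I type_ring"
    proof (rule idealI)
      show "subgroup I (add_monoid (type_ring :: 'a ring))"
      proof (rule R.add.subgroupI)
        fix a assume "a \<in> I"
        have "\<ominus>\<^bsub>type_ring\<^esub> a = (\<ominus>\<^bsub>type_ring\<^esub> 1) * a" using R.l_minus[of 1 a] by simp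
        then show "\<ominus>\<^bsub>type_ring\<^esub> a \<in> I" using * \<open>a \<in> I\<close> by metis
      qed (use * in auto)
    qed (use * in \<open>auto simp: mult.commute intro: R.ring_axioms\<close>)
  qed
qed

lemma noetherian_maximal_ideal:
  fixes \<I> :: "'a::idom set set"
  assumes "noetherian_domain (type_ring :: 'a ring)" "\<I> \<noteq> {}" "\<And>I. I \<in> \<I> \<Longrightarrow> ideal I type_ring"
  obtains I where "I \<in> \<I>" "\<And>J. J \<in> \<I> \<Longrightarrow> I \<subseteq> J \<Longrightarrow> J = I"
proof -
  interpret noetherian_domain "type_ring :: 'a ring" by fact
  have "\<exists>M\<in>\<I>. \<forall>W\<in>\<I>. M \<subseteq> W \<longrightarrow> W = M"
  proof (rule subset_Zorn_nonempty)
    fix C assume C: "C \<noteq> {}" "subset.chain \<I> C"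
    have "subset.chain {I. ideal I type_ring} C"
      using C(2) assms(3) unfolding subset_chain_def by blast
    then have "\<Union>C \<in> C" by (rule ideal_chain_is_trivial[OF C(1)])
    then show "\<Union>C \<in> \<I>" using C(2) unfolding subset_chain_def by blast
  qed (use assms in auto)
  then show ?thesis using that by blast
qed

lemma noetherian_ascending_sequence:
  fixes J :: "nat \<Rightarrow> 'a::idom set"
  assumes N: "noetherian_domain (type_ring :: 'a ring)" and J: "\<And>k. ideal (J k) type_ring" "\<And>k. J k \<subseteq> J (Suc k)"
  obtains k where "J (Suc k) = J k"
proof -
  obtain I where I: "I \<in> range J" "\<And>K. K \<in> range J \<Longrightarrow> I \<subseteq> K \<Longrightarrow> K = I"
    by (rule noetherian_maximal_ideal[OF N, of "range J"]) (use J(1) in auto)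
  then obtain k where "I = J k" by blast
  then have "J (Suc k) = J k" using I(2)[of "J (Suc k)"] J(2)[of k] by blast
  then show ?thesis by (rule that)
qed

locale dedekind_prime =
  fixes P :: "'a::idom set" and \<pi> :: "'a \<Rightarrow> 'k::field"
  assumes dedekind: "dedekind_domain TYPE('a)" and prime: "primeideal P type_ring" and P_nonzero: "P \<noteq> {0}"
    and residue: "residue_map P \<pi>"
begin

lemma noetherian: "noetherian_domain (type_ring :: 'a ring)"
  using dedekind by (simp add: dedekind_domain_def)

lemma closed: "integrally_closed TYPE('a)"
  using dedekind by (simp add: dedekind_domain_def)

lemma P_closed: "0 \<in> P" "x \<in> P \<Longrightarrow> y \<in> P \<Longrightarrow> x + y \<in> P" "x \<in> P \<Longrightarrow> r * x \<in> P" "x \<in> P \<Longrightarrow> x * r \<in> P"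
  and P_one: "1 \<notin> P" and P_prime: "x * y \<in> P \<Longrightarrow> x \<in> P \<or> y \<in> P"
proof -
  interpret primeideal P "type_ring :: 'a ring" by (rule prime)
  show "0 \<in> P" "x \<in> P \<Longrightarrow> y \<in> P \<Longrightarrow> x + y \<in> P" "x \<in> P \<Longrightarrow> r * x \<in> P"
    using ideal_axioms by (auto simp: ideal_type_ring)
  then show "x \<in> P \<Longrightarrow> x * r \<in> P" by (simp add: mult.commute)
  show "x * y \<in> P \<Longrightarrow> x \<in> P \<or> y \<in> P" using I_prime[of x y] by simp
  show "1 \<notin> P" using one_imp_carrier I_notcarr by auto
qed

lemma \<pi>_hom: "\<pi> 1 = 1" "\<pi> (x + y) = \<pi> x + \<pi> y" "\<pi> (x * y) = \<pi> x * \<pi> y"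
  and \<pi>_kernel: "\<pi> x = 0 \<longleftrightarrow> x \<in> P" and \<pi>_surj: "surj \<pi>"
proof -
  have h: "\<pi> \<in> Ring.ring_hom (type_ring :: 'a ring) (type_ring :: 'k ring)" and "surj \<pi>"
    and k: "a_kernel (type_ring :: 'a ring) (type_ring :: 'k ring) \<pi> = P"
    using residue by (auto simp: residue_map_def)
  show "\<pi> 1 = 1" "\<pi> (x + y) = \<pi> x + \<pi> y" "\<pi> (x * y) = \<pi> x * \<pi> y"
    using ring_hom_one[OF h] ring_hom_add[OF h, of x y] ring_hom_mult[OF h, of x y] by simp_all
  show "\<pi> x = 0 \<longleftrightarrow> x \<in> P" unfolding k[symmetric] by (simp add: a_kernel_def kernel_def)
  show "surj \<pi>" by fact
qed

text \<open>
  The ideal of all \<open>y\<close> with \<open>y b \<in> a A\<^sub>P\<close>. The localisation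
  \<open>A\<^sub>P\<close> is avoided by writing out the denominators \<open>s\<close>.
\<close>

definition local_quotient :: "'a \<Rightarrow> 'a \<Rightarrow> 'a set" where
  "local_quotient a b = {y. \<exists>s. s \<notin> P \<and> a dvd s * y * b}"

lemma ideal_local_quotient: "ideal (local_quotient a b) type_ring"
  unfolding ideal_type_ring
proof (intro conjI ballI allI)
  show "0 \<in> local_quotient a b" using P_one by (auto simp: local_quotient_def)
  fix x assume "x \<in> local_quotient a b"
  then obtain s where s: "s \<notin> P" "a dvd s * x * b" by (auto simp: local_quotient_def)
  show "r * x \<in> local_quotient a b" for r
    using s dvd_mult[OF s(2), of r] by (auto simp: local_quotient_def mult_ac)
  fix y assume "y \<in> local_quotient a b"
  then obtain t where t: "t \<notin> P" "a dvd t * y * b" by (auto simp: local_quotient_def)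
  have "s * t \<notin> P" using s t P_prime by blast
  moreover have "s * t * (x + y) * b = t * (s * x * b) + s * (t * y * b)" by (simp add: algebra_simps)
  then have "a dvd s * t * (x + y) * b" using s t by (simp add: dvd_add dvd_mult)
  ultimately show "x + y \<in> local_quotient a b" by (auto simp: local_quotient_def)
qed

text \<open>
  Like an associated prime, a proper ideal of this form that is maximal among them is prime. It
  contains \<open>a\<close>, so it is a maximal ideal; and it is contained in \<open>P\<close>.
\<close>

lemma local_quotient_P:
  assumes a: "a \<in> P" "a \<noteq> 0"
  obtains b where "local_quotient a b = P"
proof -
  let ?\<I> = "{local_quotient a b | b. 1 \<notin> local_quotient a b}"
  have "1 \<notin> local_quotient a 1"
  proof
    assume "1 \<in> local_quotient a 1"
    then obtain s where "s \<notin> P" "a dvd s" by (auto simp: local_quotient_def)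
    then show False using a P_closed by (metis dvdE)
  qed
  then have "?\<I> \<noteq> {}" by blast
  then obtain I where I: "I \<in> ?\<I>" "\<And>J. J \<in> ?\<I> \<Longrightarrow> I \<subseteq> J \<Longrightarrow> J = I"
    using noetherian_maximal_ideal[OF noetherian, of ?\<I>] ideal_local_quotient by blast
  from I(1) obtain b where b: "I = local_quotient a b" "1 \<notin> I" by blast
  have "primeideal I type_ring"
  proof (rule primeidealI)
    show "ideal I type_ring" unfolding b by (rule ideal_local_quotient)
    show "cring (type_ring :: 'a ring)" by (rule cring_from_type_algebra)
    show "carrier type_ring \<noteq> I" using b by auto
    fix x y assume "x \<otimes>\<^bsub>type_ring\<^esub> y \<in> I"
    then have xy: "x * y \<in> local_quotient a b" by (simp add: b)
    have "x \<in> I" if y: "y \<notin> I"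
    proof -
      have "1 \<notin> local_quotient a (y * b)" using y by (auto simp: b local_quotient_def mult_ac)
      moreover have "I \<subseteq> local_quotient a (y * b)"
        unfolding b local_quotient_def by (auto simp: mult.left_commute[of _ y] mult.assoc intro: dvd_mult)
      ultimately have "local_quotient a (y * b) = I" using I(2) by blast
      moreover have "x \<in> local_quotient a (y * b)" using xy by (auto simp: local_quotient_def mult_ac)
      ultimately show ?thesis by simp
    qed
    then show "x \<in> I \<or> y \<in> I" by blast
  qed
  moreover have "a \<in> I" unfolding b local_quotient_def using P_one by auto
  then have "I \<noteq> {0}" using a by auto
  ultimately have "maximalideal I type_ring" using dedekind by (simp add: dedekind_domain_def)
  moreover have "I \<subseteq> P"
  proof (rule subsetI, rule ccontr)
    fix y assume "y \<in> I" "y \<notin> P"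
    then obtain s where "s \<notin> P" "a dvd s * y * b" by (auto simp: b local_quotient_def)
    moreover from this have "s * y \<notin> P" using P_prime \<open>y \<notin> P\<close> by blast
    ultimately have "1 \<in> I" unfolding b local_quotient_def by auto
    then show False using b by simp
  qed
  moreover have "ideal P type_ring" using prime by (simp add: primeideal_def)
  ultimately have "P = I \<or> P = UNIV" using maximalideal.I_maximal[of I type_ring P] by simp
  then show ?thesis using that P_one b by blast
qed

text \<open>
  A single denominator suffices, by the ascending chain condition.
\<close>

lemma local_quotient_uniform:
  assumes "local_quotient a b = P"
  obtains s where "s \<notin> P" "\<And>y. y \<in> P \<Longrightarrow> a dvd s * y * b"
proof -
  define D where "D s = {y. a dvd s * y * b}" for s
  have ideal_D: "ideal (D s) type_ring" for s
    unfolding ideal_type_ring D_def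
  proof (intro conjI ballI allI CollectI)
    fix x y r assume "x \<in> {y. a dvd s * y * b}"
    then have x: "a dvd s * x * b" by simp
    show "a dvd s * (r * x) * b" using dvd_mult[OF x, of r] by (simp add: mult_ac)
    assume "y \<in> {y. a dvd s * y * b}"
    then show "a dvd s * (x + y) * b" using x by (simp add: algebra_simps dvd_add)
  qed simp
  have "{D s | s. s \<notin> P} \<noteq> {}" using P_one by blast
  then obtain I where I: "I \<in> {D s | s. s \<notin> P}" "\<And>J. J \<in> {D s | s. s \<notin> P} \<Longrightarrow> I \<subseteq> J \<Longrightarrow> J = I"
    using noetherian_maximal_ideal[OF noetherian, of "{D s | s. s \<notin> P}"] ideal_D by blast
  then obtain s where s: "s \<notin> P" "I = D s" by blast
  have "a dvd s * y * b" if "y \<in> P" for y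
  proof -
    have "y \<in> local_quotient a b" using that assms by simp
    then obtain t where t: "t \<notin> P" "a dvd t * y * b" by (auto simp: local_quotient_def)
    have "s * t \<notin> P" using s t P_prime by blast
    moreover have "a dvd s * t * x * b" if "a dvd s * x * b" for x
      using dvd_mult[OF that, of t] by (simp add: mult_ac)
    then have "I \<subseteq> D (s * t)" unfolding s by (auto simp: D_def)
    ultimately have "D (s * t) = I" using I(2) by blast
    moreover have "y \<in> D (s * t)" using dvd_mult[OF t(2), of s] by (simp add: D_def mult_ac)
    ultimately show ?thesis by (simp add: s D_def)
  qed
  then show ?thesis using that s by blast
qed

text \<open>
  The fraction \<open>z = c/a\<close> maps \<open>P\<close> into itself, so all \<open>z\<^sup>k
  p\<close> lie in \<open>A\<close>. The ideals generated by \<open>p, z p, \<dots>, z\<^sup>k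
  p\<close> become stationary, which gives a monic equation for \<open>z\<close>.
\<close>

lemma stable_fraction_integral:
  assumes a: "a \<noteq> 0" and p: "p \<in> P" "p \<noteq> 0" and stable: "\<And>y. y \<in> P \<Longrightarrow> \<exists>x\<in>P. c * y = a * x"
  shows "a dvd c"
proof -
  define g where "g y = (SOME x. x \<in> P \<and> c * y = a * x)" for y
  have g: "g y \<in> P \<and> c * y = a * g y" if "y \<in> P" for y
    unfolding g_def by (rule someI_ex) (use stable[OF that] in blast)
  define x where "x k = (g ^^ k) p" for k
  have x: "x k \<in> P" "c * x k = a * x (Suc k)" for k
  proof -
    show xP: "x k \<in> P" by (induction k) (use p g in \<open>auto simp: x_def\<close>)
    show "c * x k = a * x (Suc k)" using g[OF xP] by (simp add: x_def)
  qed
  define z where "z = to_fract c / to_fract a"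
  have a0: "to_fract a \<noteq> 0" using a by simp
  have xz: "to_fract (x k) = z ^ k * to_fract p" for k
  proof (induction k)
    case (Suc k)
    have "to_fract c * to_fract (x k) = to_fract a * to_fract (x (Suc k))" using x(2)[of k] by (metis to_fract_mult)
    then have "to_fract (x (Suc k)) = z * to_fract (x k)" using a0 by (simp add: z_def field_simps)
    then show ?case using Suc by simp
  qed (simp add: x_def)
  define J where "J k = {\<Sum>i\<le>k. r i * x i | r. True}" for k
  have idJ: "ideal (J k) type_ring" for k
    unfolding ideal_type_ring J_def
  proof (intro conjI ballI allI)
    show "0 \<in> {\<Sum>i\<le>k. r i * x i | r. True}" by (auto intro!: exI[of _ "\<lambda>_. 0"])
    fix u v w assume "u \<in> {\<Sum>i\<le>k. r i * x i | r. True}"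
    then obtain r where r: "u = (\<Sum>i\<le>k. r i * x i)" by blast
    show "w * u \<in> {\<Sum>i\<le>k. r i * x i | r. True}"
      unfolding r by (auto simp: sum_distrib_left mult.assoc intro!: exI[of _ "\<lambda>i. w * r i"])
    assume "v \<in> {\<Sum>i\<le>k. r i * x i | r. True}"
    then obtain q where q: "v = (\<Sum>i\<le>k. q i * x i)" by blast
    show "u + v \<in> {\<Sum>i\<le>k. r i * x i | r. True}"
      unfolding r q by (auto simp: distrib_right sum.distrib intro!: exI[of _ "\<lambda>i. r i + q i"])
  qed
  have "J k \<subseteq> J (Suc k)" for k
  proof
    fix u assume "u \<in> J k"
    then obtain r where "u = (\<Sum>i\<le>k. r i * x i)" by (auto simp: J_def)
    then have "u = (\<Sum>i\<le>Suc k. (if i \<le> k then r i else 0) * x i)" by simp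
    then show "u \<in> J (Suc k)" unfolding J_def by (intro CollectI exI conjI TrueI)
  qed
  then obtain k where k: "J (Suc k) = J k" using noetherian_ascending_sequence[OF noetherian idJ] by blast
  have "x (Suc k) = (\<Sum>i\<le>Suc k. (if i = Suc k then 1 else 0) * x i)" by simp
  then have "x (Suc k) \<in> J (Suc k)" unfolding J_def by (intro CollectI exI conjI TrueI)
  then obtain r where r: "x (Suc k) = (\<Sum>i\<le>k. r i * x i)" unfolding k by (auto simp: J_def)
  define q where "q = monom 1 (Suc k) - (\<Sum>i\<le>k. monom (r i) i)"
  have cq: "coeff q i = (if i = Suc k then 1 else 0) - (if i \<le> k then r i else 0)" for i
    by (simp add: q_def coeff_sum sum.delta)
  have dq: "degree q = Suc k"
    by (rule antisym) (auto intro!: degree_le le_degree simp: cq)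
  have "poly (map_poly to_fract q) z = (\<Sum>i\<le>Suc k. to_fract (coeff q i) * z ^ i)"
  proof -
    have "degree (map_poly to_fract q) = Suc k" using dq cq[of "Suc k"] by (subst map_poly_degree_eq) auto
    then show ?thesis by (simp only: poly_altdef coeff_map_poly to_fract_0)
  qed
  also have "\<dots> = z ^ Suc k - (\<Sum>i\<le>k. to_fract (r i) * z ^ i)"
    by (simp add: cq sum_negf)
  also have "\<dots> = 0"
  proof -
    have "to_fract (x (Suc k)) = (\<Sum>i\<le>k. to_fract (r i) * to_fract (x i))" by (simp only: r to_fract_sum to_fract_mult)
    then have "z ^ Suc k * to_fract p = (\<Sum>i\<le>k. to_fract (r i) * z ^ i) * to_fract p"
      unfolding xz sum_distrib_right by (simp only: mult.assoc)
    moreover have "to_fract p \<noteq> 0" using p(2) by simp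
    ultimately show ?thesis by simp
  qed
  finally have "poly (map_poly to_fract q) z = 0" .
  moreover have "lead_coeff q = 1" by (simp add: dq cq)
  ultimately have "z \<in> range to_fract" using closed unfolding integrally_closed_def by blast
  then obtain w where "z = to_fract w" by blast
  then have "to_fract c = to_fract (a * w)" using a0 by (simp add: z_def field_simps)
  then have "c = a * w" by (simp only: to_fract_eq_iff)
  then show ?thesis by simp
qed

text \<open>
  With \<open>b\<close> and \<open>s\<close> from the preceding lemmas, \<open>z = s b /
  a\<close> maps \<open>P\<close> into \<open>A\<close>. It does not map \<open>P\<close> into
  \<open>P\<close>, since \<open>z\<close> would then be integral and lie in \<open>A\<close>,
  although \<open>1\<close> is not in the quotient ideal \<open>P\<close>. So
  \<open>z\<tau>\<close> is a unit at \<open>P\<close> for some \<open>\<tau> \<in> P\<close>,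
  and \<open>\<tau>\<close> generates \<open>P A\<^sub>P\<close>.
\<close>

lemma local_uniformizer:
  obtains \<tau> w where "\<tau> \<in> P" "\<tau> \<noteq> 0" "w \<notin> P" "\<And>y. y \<in> P \<Longrightarrow> \<exists>x. w * y = \<tau> * x"
proof -
  obtain a where a: "a \<in> P" "a \<noteq> 0" using P_nonzero P_closed(1) by blast
  obtain b where b: "local_quotient a b = P" using local_quotient_P[OF a] by blast
  obtain s where s: "s \<notin> P" "\<And>y. y \<in> P \<Longrightarrow> a dvd s * y * b" using local_quotient_uniform[OF b] by blast
  have "\<exists>\<tau>\<in>P. \<exists>w. w \<notin> P \<and> s * \<tau> * b = a * w"
  proof (rule ccontr)
    assume *: "\<not> ?thesis"
    have "\<exists>x\<in>P. (s * b) * y = a * x" if "y \<in> P" for y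
    proof -
      obtain x where "s * y * b = a * x" using s(2)[OF \<open>y \<in> P\<close>] by (elim dvdE)
      then show ?thesis using * that by (metis mult.assoc mult.commute)
    qed
    then have "a dvd s * b" by (rule stable_fraction_integral[OF a(2) a])
    then have "1 \<in> local_quotient a b" using s(1) by (auto simp: local_quotient_def)
    then show False using b P_one by simp
  qed
  then obtain \<tau> w where w: "\<tau> \<in> P" "w \<notin> P" "s * \<tau> * b = a * w" by blast
  have "\<exists>x. w * y = \<tau> * x" if y: "y \<in> P" for y
  proof -
    obtain x where x: "s * y * b = a * x" using s(2)[OF y] by (elim dvdE)
    have "a * (w * y) = (s * \<tau> * b) * y" unfolding w(3) by (simp only: mult.assoc)
    also have "\<dots> = (s * y * b) * \<tau>" by (simp only: mult_ac)
    also have "\<dots> = a * (\<tau> * x)" unfolding x by (simp only: mult_ac)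
    finally have "w * y = \<tau> * x" using a(2) by simp
    then show ?thesis by blast
  qed
  moreover have "\<tau> \<noteq> 0" using w a P_closed(1) by auto
  ultimately show ?thesis using that w by blast
qed

end

text \<open>
  The localisation at the kernel of \<open>h\<close> is a discrete valuation ring with
  uniformiser \<open>\<tau>\<close>, as long as \<open>h \<tau> = 0\<close>.
\<close>

definition uniformizes :: "('a::comm_ring_1 \<Rightarrow> 'b::zero) \<Rightarrow> 'a \<Rightarrow> bool" where
  "uniformizes h \<tau> \<longleftrightarrow> (\<forall>a. a \<noteq> 0 \<longrightarrow> (\<exists>l s c. h s \<noteq> 0 \<and> h c \<noteq> 0 \<and> s * a = \<tau> ^ l * c))"

text \<open>
  Division by \<open>\<tau>\<close> terminates: if \<open>a = \<tau>x\<close> up to a unit at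
  \<open>P\<close>, then the ideal \<open>local_quotient x 1\<close> is strictly larger than
  \<open>local_quotient a 1\<close>.
\<close>

lemma (in dedekind_prime) uniformizer_exists:
  obtains \<tau> where "\<pi> \<tau> = 0" "\<tau> \<noteq> 0" "uniformizes \<pi> \<tau>"
proof -
  obtain \<tau> w where \<tau>: "\<tau> \<in> P" "\<tau> \<noteq> 0" and w: "w \<notin> P" "\<And>y. y \<in> P \<Longrightarrow> \<exists>x. w * y = \<tau> * x"
    using local_uniformizer by blast
  define bad where "bad a \<longleftrightarrow> a \<noteq> 0 \<and> \<not> (\<exists>l s c. s \<notin> P \<and> c \<notin> P \<and> s * a = \<tau> ^ l * c)" for a
  have "\<not> bad a" for a
  proof
    assume "bad a"
    let ?\<I> = "{local_quotient a 1 | a. bad a}"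
    have "?\<I> \<noteq> {}" using \<open>bad a\<close> by blast
    then obtain I where I: "I \<in> ?\<I>" "\<And>J. J \<in> ?\<I> \<Longrightarrow> I \<subseteq> J \<Longrightarrow> J = I"
      using noetherian_maximal_ideal[OF noetherian, of ?\<I>] ideal_local_quotient by blast
    then obtain a where a: "bad a" "I = local_quotient a 1" by blast
    have "a \<in> P"
    proof (rule ccontr)
      assume "a \<notin> P"
      then have "1 * a = \<tau> ^ 0 * a \<and> 1 \<notin> P \<and> a \<notin> P" using P_one by simp
      then show False using a(1) unfolding bad_def by metis
    qed
    then obtain x where x: "w * a = \<tau> * x" using w(2) by blast
    have "bad x" unfolding bad_def
    proof (intro conjI notI)
      assume "x = 0"
      then have "w * a = 0" using x by simp
      then show False using a(1) w(1) P_closed(1) by (auto simp: bad_def)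
    next
      assume "\<exists>l s c. s \<notin> P \<and> c \<notin> P \<and> s * x = \<tau> ^ l * c"
      then obtain l s c where *: "s \<notin> P" "c \<notin> P" "s * x = \<tau> ^ l * c" by blast
      have "(s * w) * a = s * (\<tau> * x)" by (simp only: x mult.assoc)
      also have "\<dots> = \<tau> * (s * x)" by (rule mult.left_commute)
      also have "\<dots> = \<tau> ^ Suc l * c" by (simp add: * mult.assoc)
      finally have "(s * w) * a = \<tau> ^ Suc l * c" .
      moreover have "s * w \<notin> P" using * w P_prime by blast
      ultimately show False using a(1) *(2) unfolding bad_def by blast
    qed
    moreover have "I \<subseteq> local_quotient x 1"
    proof
      fix y assume "y \<in> I"
      then obtain s where "s \<notin> P" "a dvd s * y" by (auto simp: a local_quotient_def)
      then obtain t where s: "s \<notin> P" "s * y = a * t" by (elim dvdE)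
      have "(w * s) * y = w * (a * t)" by (simp only: s(2) mult.assoc)
      also have "\<dots> = x * (\<tau> * t)" by (simp only: x mult.assoc[symmetric]) (simp only: mult_ac)
      finally have "x dvd (w * s) * y * 1" by simp
      moreover have "w * s \<notin> P" using s w P_prime by blast
      ultimately show "y \<in> local_quotient x 1" unfolding local_quotient_def by blast
    qed
    ultimately have "local_quotient x 1 = I" using I(2) by blast
    moreover have "x \<in> local_quotient x 1" using P_one by (auto simp: local_quotient_def)
    ultimately have "x \<in> local_quotient a 1" by (simp add: a)
    then obtain s where "s \<notin> P" "a dvd s * x" by (auto simp: local_quotient_def)
    then obtain t where s: "s \<notin> P" "s * x = a * t" by (elim dvdE)
    have "a * (s * w) = s * (w * a)" by (simp only: mult_ac)
    also have "\<dots> = \<tau> * (s * x)" unfolding x by (simp only: mult_ac)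
    also have "\<dots> = a * (\<tau> * t)" unfolding s by (simp only: mult_ac)
    finally have "s * w = \<tau> * t" using a(1) by (simp add: bad_def)
    then have "s * w \<in> P" using \<tau> P_closed by simp
    then show False using s w P_prime by blast
  qed
  then have "uniformizes \<pi> \<tau>" unfolding uniformizes_def bad_def \<pi>_kernel by blast
  then show ?thesis using that \<tau> by (simp add: \<pi>_kernel)
qed

text \<open>
  As in Gauss's lemma, extract the smallest power of \<open>\<tau>\<close> from the
  coefficients.
\<close>

lemma uniformizes_poly:
  fixes h :: "'a::idom \<Rightarrow> 'b::idom"
  assumes "subring_hom UNIV h" and u: "uniformizes h \<tau>"
  shows "uniformizes (map_poly h) [:\<tau>:]"
proof -
  interpret subring_hom UNIV h by fact
  have "\<exists>l s c. map_poly h [:s:] \<noteq> 0 \<and> map_poly h c \<noteq> 0 \<and> [:s:] * p = [:\<tau>:] ^ l * c" if "p \<noteq> 0" for p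
    using that
  proof (induction p)
    case (pCons a p)
    have pw: "[:\<tau>:] ^ l = [:\<tau> ^ l:]" for l by (induction l) (simp_all add: pCons_one)
    consider "a = 0" "p \<noteq> 0" | "a \<noteq> 0" "p = 0" | "a \<noteq> 0" "p \<noteq> 0" using pCons.hyps by blast
    then show ?case
    proof cases
      case 1
      then obtain l s c where "map_poly h [:s:] \<noteq> 0" "map_poly h c \<noteq> 0" "[:s:] * p = [:\<tau>:] ^ l * c"
        using pCons.IH by blast
      then show ?thesis using 1
        by (intro exI[of _ l] exI[of _ s] exI[of _ "pCons 0 c"]) (simp add: map_poly_pCons_zero pw)
    next
      case 2
      then obtain l s c where "h s \<noteq> 0" "h c \<noteq> 0" "s * a = \<tau> ^ l * c" using u unfolding uniformizes_def by blast
      then show ?thesis using 2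
        by (intro exI[of _ l] exI[of _ s] exI[of _ "[:c:]"]) (simp add: map_poly_pCons_zero pw mult.commute)
    next
      case 3
      then obtain l s c where 1: "h s \<noteq> 0" "h c \<noteq> 0" "s * a = \<tau> ^ l * c" using u unfolding uniformizes_def by blast
      from 3 obtain k t q where 2: "map_poly h [:t:] \<noteq> 0" "map_poly h q \<noteq> 0" "[:t:] * p = [:\<tau>:] ^ k * q"
        using pCons.IH by blast
      then have t: "h t \<noteq> 0" "smult t p = smult (\<tau> ^ k) q" by (simp_all add: map_poly_pCons_zero pw)
      have st: "map_poly h [:s * t:] \<noteq> 0" using 1 t by (simp add: map_poly_pCons_zero h_mult)
      define c' where "c' = (if l \<le> k then pCons (t * c) (smult (s * \<tau> ^ (k - l)) q) else pCons (\<tau> ^ (l - k) * t * c) (smult s q))"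
      have eq: "[:s * t:] * pCons a p = [:\<tau>:] ^ (min l k) * c'"
      proof -
        have "s * t * a = \<tau> ^ l * (t * c)" using 1 by (metis mult.assoc mult.commute)
        moreover have "smult (s * t) p = smult s (smult (\<tau> ^ k) q)" using t by (metis smult_smult)
        moreover have "l \<le> k \<Longrightarrow> \<tau> ^ k = \<tau> ^ l * \<tau> ^ (k - l)" "k \<le> l \<Longrightarrow> \<tau> ^ l = \<tau> ^ k * \<tau> ^ (l - k)"
          by (simp_all flip: power_add)
        ultimately show ?thesis by (auto simp: c'_def pw min_def mult_ac)
      qed
      have "map_poly h c' \<noteq> 0"
      proof (cases "l \<le> k")
        case True
        then show ?thesis using 1 t by (simp add: c'_def map_poly_pCons_zero h_mult)
      next
        case False
        have "map_poly h (smult s q) = smult (h s) (map_poly h q)" by (intro poly_eqI) (simp add: h_mult)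
        then show ?thesis using False 1 2(2) by (simp add: c'_def map_poly_pCons_zero)
      qed
      then show ?thesis using st eq by blast
    qed
  qed simp
  then show ?thesis unfolding uniformizes_def by blast
qed

section \<open>A place that extends the reduction of coefficients\<close>

definition in_ac :: "'r::idom \<Rightarrow> 'r fract alg_closure" where
  "in_ac r = to_ac (to_fract r)"

lemma in_ac_simps [simp]: "in_ac 0 = 0" "in_ac 1 = 1" "in_ac (a + b) = in_ac a + in_ac b"
  "in_ac (a * b) = in_ac a * in_ac b" "in_ac (- a) = - in_ac a" "in_ac (a - b) = in_ac a - in_ac b"
  "in_ac (a ^ k) = in_ac a ^ k" "in_ac a = 0 \<longleftrightarrow> a = 0"
  by (simp_all add: in_ac_def)
  (induction k; simp)

lemma subring_hom_in_ac: "subring_hom UNIV in_ac"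
  by unfold_locales auto

lemma clear_denominators:
  fixes q :: "'r::idom fract poly"
  obtains c p where "c \<noteq> 0" "map_poly to_fract p = smult (to_fract c) q"
proof -
  have "\<exists>c p. c \<noteq> 0 \<and> map_poly to_fract p = smult (to_fract c) q"
  proof (induction q)
    case 0
    show ?case by (intro exI[of _ 1] exI[of _ 0]) simp
  next
    case (pCons a q)
    then obtain c p where c: "c \<noteq> 0" "map_poly to_fract p = smult (to_fract c) q" by blast
    obtain u v where uv: "a = Fract u v" "v \<noteq> 0" by (cases a) auto
    have "map_poly to_fract (pCons (c * u) (smult v p)) = smult (to_fract (c * v)) (pCons a q)"
    proof -
      have "map_poly to_fract (smult v p) = smult (to_fract v) (map_poly to_fract p)"
        by (intro poly_eqI) (simp add: coeff_map_poly)
      then show ?thesis using uv c by (simp add: map_poly_pCons_zero Fract_conv_to_fract mult.commute)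
    qed
    then show ?case using c uv by (intro exI[of _ "c * v"] exI) auto
  qed
  then show ?thesis using that by blast
qed

lemma algebraic_relation:
  fixes x :: "'r::idom fract alg_closure"
  obtains p where "p \<noteq> 0" "poly (map_poly in_ac p) x = 0"
proof -
  obtain q where q: "q \<noteq> 0" "poly (map_poly to_ac q) x = 0" by (rule alg_closure_algebraic)
  obtain c p where c: "c \<noteq> 0" "map_poly to_fract p = smult (to_fract c) q" by (rule clear_denominators)
  have "p \<noteq> 0" using c q(1) by auto
  moreover have "map_poly in_ac p = smult (in_ac c) (map_poly to_ac q)"
  proof (rule poly_eqI)
    fix i
    have "to_fract (coeff p i) = to_fract c * coeff q i"
      using arg_cong[OF c(2), of "\<lambda>p. coeff p i"] by (simp add: coeff_map_poly)
    then show "coeff (map_poly in_ac p) i = coeff (smult (in_ac c) (map_poly to_ac q)) i"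
      by (simp add: coeff_map_poly in_ac_def)
  qed
  ultimately show ?thesis using that q(2) by simp
qed

lemma root_closed_UNIV:
  fixes I :: "'f::field alg_closure set"
  assumes "range to_ac \<subseteq> I"
    and root: "\<And>q c. (\<And>i. coeff q i \<in> I) \<Longrightarrow> lead_coeff q = 1 \<Longrightarrow> poly q c = 0 \<Longrightarrow> c \<in> I"
  shows "I = UNIV"
proof -
  have "c \<in> I" for c
  proof -
    obtain q where q: "q \<noteq> 0" "poly (map_poly to_ac q) c = 0" by (rule alg_closure_algebraic)
    define r where "r = smult (inverse (lead_coeff q)) q"
    have "lead_coeff r = 1" using q(1) by (simp add: r_def)
    then have "lead_coeff (map_poly to_ac r) = 1" by (simp add: coeff_map_poly map_poly_degree_eq)
    moreover have "map_poly to_ac r = smult (to_ac (inverse (lead_coeff q))) (map_poly to_ac q)"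
      by (intro poly_eqI) (simp add: r_def coeff_map_poly)
    then have "poly (map_poly to_ac r) c = 0" using q(2) by simp
    moreover have "coeff (map_poly to_ac r) i \<in> I" for i
      using subsetD[OF assms(1) rangeI[of to_ac "coeff r i"]] by (simp only: coeff_map_poly to_ac_0)
    ultimately show ?thesis using root[of "map_poly to_ac r" c] by simp
  qed
  then show ?thesis by blast
qed

lemma (in place) residues_closed:
  "0 \<in> \<phi> ` T" "a \<in> \<phi> ` T \<Longrightarrow> b \<in> \<phi> ` T \<Longrightarrow> a + b \<in> \<phi> ` T"
  "a \<in> \<phi> ` T \<Longrightarrow> b \<in> \<phi> ` T \<Longrightarrow> a * b \<in> \<phi> ` T" "a \<in> \<phi> ` T \<Longrightarrow> inverse a \<in> \<phi> ` T"
proof -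
  show 0: "0 \<in> \<phi> ` T" by (rule image_eqI[of _ _ 0]) auto
  show "a + b \<in> \<phi> ` T" "a * b \<in> \<phi> ` T" if ab: "a \<in> \<phi> ` T" "b \<in> \<phi> ` T"
  proof -
    obtain s where s: "s \<in> T" "a = \<phi> s" using ab(1) by (rule imageE) auto
    obtain t where t: "t \<in> T" "b = \<phi> t" using ab(2) by (rule imageE) auto
    show "a + b \<in> \<phi> ` T" by (rule image_eqI[of _ _ "s + t"]) (use s t in \<open>auto simp: h_add\<close>)
    show "a * b \<in> \<phi> ` T" by (rule image_eqI[of _ _ "s * t"]) (use s t in \<open>auto simp: h_mult\<close>)
  qed
  show "inverse a \<in> \<phi> ` T" if a: "a \<in> \<phi> ` T"
  proof (cases "a = 0")
    case False
    obtain s where s: "s \<in> T" "a = \<phi> s" using a by (rule imageE) auto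
    then have iT: "inverse s \<in> T" using unit_closed False by simp
    have "s \<noteq> 0" using False s(2) by auto
    then have "\<phi> s * \<phi> (inverse s) = 1" using h_mult[OF s(1) iT] by simp
    then have "inverse a = \<phi> (inverse s)" using s(2) by (simp add: inverse_unique)
    then show ?thesis using iT by (rule image_eqI)
  qed (use 0 in simp)
qed

context dedekind_prime
begin

lemma subring_hom_\<pi>: "subring_hom UNIV \<pi>"
  by unfold_locales (auto simp: \<pi>_hom)

text \<open>
  The reduction \<open>A[\<lambda>] \<rightarrow> k[\<lambda>]\<close>, with values in an
  algebraic closure of the field of rational functions over the algebraic closure of
  \<open>k\<close>.
\<close>

definition \<rho> :: "'a poly \<Rightarrow> 'k alg_closure poly fract alg_closure" where
  "\<rho> p = in_ac (map_poly (\<lambda>a. to_ac (\<pi> a)) p)"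

lemma \<rho>_eq_0: "\<rho> p = 0 \<longleftrightarrow> map_poly \<pi> p = 0"
proof -
  interpret subring_hom UNIV \<pi> by (rule subring_hom_\<pi>)
  show ?thesis by (simp add: \<rho>_def poly_eq_iff coeff_map_poly)
qed

lemma subring_hom_\<rho>: "subring_hom UNIV \<rho>"
proof -
  interpret subring_hom UNIV \<pi> by (rule subring_hom_\<pi>)
  interpret a: subring_hom UNIV "\<lambda>a. to_ac (\<pi> a)" by unfold_locales (auto simp: h_add h_mult)
  interpret subring_hom UNIV "map_poly (\<lambda>a. to_ac (\<pi> a))" using a.subring_hom_poly by (simp add: polys_over_def)
  show ?thesis by unfold_locales (auto simp: \<rho>_def h_add h_mult)
qed

lemma place_extending_reduction:
  obtains T \<phi> where "place T \<phi>" "\<And>p. in_ac p \<in> T" "\<And>p. \<phi> (in_ac p) = \<rho> p"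
proof -
  interpret \<rho>: subring_hom UNIV \<rho> by (rule subring_hom_\<rho>)
  define h0 where "h0 x = \<rho> (inv_into UNIV in_ac x)" for x
  have "inj (in_ac :: 'a poly \<Rightarrow> _)" by (auto simp: inj_on_def in_ac_def)
  then have h0: "h0 (in_ac p) = \<rho> p" for p by (simp add: h0_def)
  have "subring_hom (range in_ac) h0"
  proof
    show "1 \<in> range (in_ac :: 'a poly \<Rightarrow> _)" by (rule range_eqI[of _ _ 1]) simp
    show "h0 1 = 1" using h0[of 1] by simp
    fix a b assume "a \<in> range (in_ac :: 'a poly \<Rightarrow> _)" "b \<in> range (in_ac :: 'a poly \<Rightarrow> _)"
    then obtain p q where pq: "a = in_ac p" "b = in_ac q" by blast
    show "a + b \<in> range in_ac" by (rule range_eqI[of _ _ "p + q"]) (simp add: pq)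
    show "a * b \<in> range in_ac" by (rule range_eqI[of _ _ "p * q"]) (simp add: pq)
    show "- a \<in> range in_ac" by (rule range_eqI[of _ _ "- p"]) (simp add: pq)
    show "h0 (a + b) = h0 a + h0 b" using h0[of "p + q"] by (simp add: pq h0 \<rho>.h_add)
    show "h0 (a * b) = h0 a * h0 b" using h0[of "p * q"] by (simp add: pq h0 \<rho>.h_mult)
  qed
  then obtain T \<phi> where *: "place T \<phi>" "range in_ac \<subseteq> T" "\<And>a. a \<in> range in_ac \<Longrightarrow> \<phi> a = h0 a"
    by (rule place_extension) blast
  show ?thesis
  proof (rule that[OF *(1)])
    show "in_ac p \<in> T" for p using *(2) by blast
    show "\<phi> (in_ac p) = \<rho> p" for p using *(3)[OF rangeI, of p] h0 by simp
  qed
qed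

context
  fixes T and \<phi> :: "'a poly fract alg_closure \<Rightarrow> 'k alg_closure poly fract alg_closure"
  assumes pl: "place T \<phi>" and T: "\<And>p. in_ac p \<in> T" and \<phi>: "\<And>p. \<phi> (in_ac p) = \<rho> p"
begin

interpretation place T \<phi> by (rule pl)

text \<open>
  The image of the place is an algebraically closed field that contains \<open>k\<close> and
  \<open>\<lambda>\<close>.
\<close>

lemma residue_field_surj: "\<phi> ` T = UNIV"
proof -
  let ?I = "\<phi> ` T"
  have closed: "a + b \<in> ?I \<and> a * b \<in> ?I" if "a \<in> ?I" "b \<in> ?I" for a b
    using residues_closed(2,3)[OF that] by blast
  note inv = residues_closed(4)
  have root: "c \<in> ?I" if "\<And>i. coeff q i \<in> ?I" "lead_coeff q = 1" "poly q c = 0" for q c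
    by (rule image_algebraically_closed[OF pl that])
  have \<rho>: "\<rho> p \<in> ?I" for p by (metis T \<phi> imageI)
  interpret \<pi>: subring_hom UNIV \<pi> by (rule subring_hom_\<pi>)
  have const: "in_ac [:c:] \<in> ?I" for c :: "'k alg_closure"
  proof -
    define J where "J = {c :: 'k alg_closure. in_ac [:c:] \<in> ?I}"
    have "J = UNIV"
    proof (rule root_closed_UNIV)
      show "range to_ac \<subseteq> J"
      proof
        fix c :: "'k alg_closure" assume "c \<in> range to_ac"
        then obtain a where "c = to_ac (\<pi> a)" using \<pi>_surj by (metis image_iff surj_def)
        then have "in_ac [:c:] = \<rho> [:a:]" by (simp add: \<rho>_def map_poly_pCons_zero)
        then show "c \<in> J" using \<rho> by (simp add: J_def)
      qed
      fix q :: "'k alg_closure poly" and c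
      assume q: "\<And>i. coeff q i \<in> J" "lead_coeff q = 1" "poly q c = 0"
      let ?q = "map_poly (\<lambda>c. in_ac [:c:]) q"
      have ev: "poly (map_poly (\<lambda>c. in_ac [:c:]) q) (in_ac [:x:]) = in_ac [:poly q x:]" for q :: "'k alg_closure poly" and x
      proof (induction q)
        case (pCons a q)
        have "[:a + x * poly q x:] = [:a:] + [:x:] * [:poly q x:]" by simp
        then have "in_ac [:a + x * poly q x:] = in_ac [:a:] + in_ac [:x:] * in_ac [:poly q x:]" by (simp only: in_ac_simps)
        then show ?case using pCons by (simp add: map_poly_pCons_zero)
      qed simp
      have "in_ac [:c:] \<in> ?I"
      proof (rule root)
        show "coeff ?q i \<in> ?I" for i using q(1)[of i] by (simp add: J_def coeff_map_poly)
        show "lead_coeff ?q = 1" using q(2) by (simp add: map_poly_degree_eq coeff_map_poly pCons_one)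
        show "poly ?q (in_ac [:c:]) = 0" by (simp add: ev q(3))
      qed
      then show "c \<in> J" by (simp add: J_def)
    qed
    then show ?thesis by (auto simp: J_def)
  qed
  have polys: "in_ac p \<in> ?I" for p :: "'k alg_closure poly"
  proof (induction p)
    case (pCons c p)
    have "pCons c p = [:c:] + [:0, 1:] * p" by simp
    then have "in_ac (pCons c p) = in_ac [:c:] + in_ac [:0, 1:] * in_ac p" by (simp only: in_ac_simps)
    moreover have "in_ac [:0, 1:] \<in> ?I"
      using \<rho>[of "[:0, 1:]"] by (simp add: \<rho>_def map_poly_pCons_zero map_poly_1)
    ultimately show ?case using closed const pCons.IH by metis
  qed (simp add: residues_closed)
  show ?thesis
  proof (rule root_closed_UNIV)
    show "range to_ac \<subseteq> ?I"
    proof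
      fix x :: "'k alg_closure poly fract alg_closure" assume "x \<in> range to_ac"
      then obtain z where z: "x = to_ac z" by blast
      obtain u v where "z = Fract u v" "v \<noteq> 0" by (cases z) auto
      then have "x = in_ac u * inverse (in_ac v)" by (simp add: z Fract_conv_to_fract in_ac_def divide_inverse)
      then show "x \<in> ?I" using closed polys inv by metis
    qed
  qed (use root in blast)
qed

text \<open>
  The elements \<open>a \<noteq> 0\<close> and \<open>\<delta>\<close> are algebraic over
  \<open>K(\<lambda>)\<close>, where the place is a discrete valuation with uniformiser
  \<open>\<tau>\<close>. It follows that \<open>a\<close> divides a power of
  \<open>\<tau>\<close>, and that \<open>\<tau>\<close> divides a power of
  \<open>\<delta>\<close>. So \<open>a\<close> cannot be divisible by all powers of
  \<open>\<delta>\<close>.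
\<close>

lemma separated:
  assumes \<delta>: "\<delta> \<in> T" "\<phi> \<delta> = 0" and a: "\<And>k. a \<in> multiples (\<delta> ^ k) T"
  shows "a = 0"
proof (rule ccontr)
  assume a0: "a \<noteq> 0"
  have aT: "a \<in> T" using a[of 0] by simp
  obtain \<tau>0 where \<tau>0: "\<pi> \<tau>0 = 0" "\<tau>0 \<noteq> 0" "uniformizes \<pi> \<tau>0" by (rule uniformizer_exists)
  have u1: "uniformizes (map_poly \<pi>) [:\<tau>0:]" by (rule uniformizes_poly[OF subring_hom_\<pi> \<tau>0(3)])
  interpret \<pi>: subring_hom UNIV \<pi> by (rule subring_hom_\<pi>)
  have sp: "subring_hom UNIV (map_poly \<pi>)" using \<pi>.subring_hom_poly by (simp add: polys_over_def)
  interpret \<pi>p: subring_hom UNIV "map_poly \<pi>" by (rule sp)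
  have u2: "uniformizes (map_poly (map_poly \<pi>)) [:[:\<tau>0:]:]" by (rule uniformizes_poly[OF sp u1])
  interpret ia: subring_hom UNIV "in_ac :: 'a poly \<Rightarrow> _" by (rule subring_hom_in_ac)
  interpret iap: subring_hom UNIV "map_poly (in_ac :: 'a poly \<Rightarrow> _)" using ia.subring_hom_poly by (simp add: polys_over_def)
  define \<tau> where "\<tau> = in_ac [:\<tau>0:]"
  have \<tau>: "\<tau> \<in> T" "\<phi> \<tau> = 0" "\<tau> \<noteq> 0"
    using T \<phi> \<tau>0 by (simp_all add: \<tau>_def \<rho>_eq_0 map_poly_pCons_zero)
  have unit: "inverse (in_ac s) \<in> T" if "map_poly \<pi> s \<noteq> 0" for s
    by (rule unit_closed[OF T]) (use that in \<open>simp add: \<phi> \<rho>_eq_0\<close>)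
  have power_of_\<tau>: "\<exists>l. \<exists>t\<in>T. \<exists>t'\<in>T. in_ac p = \<tau> ^ l * t \<and> \<tau> ^ l = in_ac p * t' \<and> (l = 0 \<longrightarrow> map_poly \<pi> p \<noteq> 0)"
    if p: "p \<noteq> 0" for p
  proof -
    obtain l s c where lsc: "map_poly \<pi> s \<noteq> 0" "map_poly \<pi> c \<noteq> 0" "s * p = [:\<tau>0:] ^ l * c"
      using u1 p unfolding uniformizes_def by blast
    have eq: "in_ac s * in_ac p = \<tau> ^ l * in_ac c"
      using arg_cong[OF lsc(3), of in_ac] by (simp only: in_ac_simps \<tau>_def)
    have nz: "in_ac s \<noteq> 0" "in_ac c \<noteq> 0" using lsc by auto
    have "in_ac p = \<tau> ^ l * (in_ac c * inverse (in_ac s))" "\<tau> ^ l = in_ac p * (in_ac s * inverse (in_ac c))"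
      using eq nz by (simp_all add: field_simps)
    moreover have "in_ac c * inverse (in_ac s) \<in> T" "in_ac s * inverse (in_ac c) \<in> T"
      using unit lsc T by (auto intro: mult_closed)
    moreover have "map_poly \<pi> p \<noteq> 0" if "l = 0"
    proof
      assume "map_poly \<pi> p = 0"
      then have "map_poly \<pi> (s * p) = 0" by (simp add: \<pi>p.h_mult)
      then show False using lsc that by simp
    qed
    ultimately show ?thesis by blast
  qed
  \<comment> \<open>The constant coefficient of a polynomial relation for \<open>a\<close> is a multiple of \<open>a\<close>.\<close>
  obtain l where l: "\<exists>t\<in>T. \<tau> ^ l = a * t"
  proof -
    obtain p where p: "p \<noteq> 0" "poly (map_poly in_ac p) a = 0" by (rule algebraic_relation)
    have "\<exists>q. coeff q 0 \<noteq> 0 \<and> poly (map_poly in_ac q) a = 0"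
      using p
    proof (induction p)
      case (pCons c p)
      show ?case
      proof (cases "c = 0")
        case True
        then have "poly (map_poly in_ac p) a = 0" "p \<noteq> 0" using pCons a0 by (auto simp: map_poly_pCons_zero)
        then show ?thesis using pCons by blast
      qed (use pCons in \<open>auto intro!: exI[of _ "pCons c p"]\<close>)
    qed simp
    then obtain q where q: "coeff q 0 \<noteq> 0" "poly (map_poly in_ac q) a = 0" by blast
    obtain c r where cr: "q = pCons c r" by (cases q)
    have "in_ac c = a * (- poly (map_poly in_ac r) a)"
      using q(2) by (simp add: cr map_poly_pCons_zero eq_neg_iff_add_eq_0)
    moreover have "poly (map_poly in_ac r) a \<in> T"
      by (rule poly_closed[OF _ aT]) (simp add: polys_over_def coeff_map_poly T)
    moreover obtain l t' where "t' \<in> T" "\<tau> ^ l = in_ac c * t'" using power_of_\<tau>[of c] q(1) cr by auto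
    ultimately have "\<tau> ^ l = a * (- poly (map_poly in_ac r) a * t')" "- poly (map_poly in_ac r) a * t' \<in> T"
      by (simp_all add: mult.assoc mult_closed uminus_closed)
    then show ?thesis using that by blast
  qed
  \<comment> \<open>In a relation for \<open>\<delta>\<close> with a unit among its coefficients, let \<open>m\<close> be the index of the first unit: the terms
    before it are divisible by \<open>\<tau>\<close>, and the others sum to \<open>\<delta>\<^sup>m\<close> times a unit.\<close>
  obtain m where m: "\<exists>t\<in>T. \<delta> ^ m = \<tau> * t"
  proof -
    obtain p where p: "p \<noteq> 0" "poly (map_poly in_ac p) \<delta> = 0" by (rule algebraic_relation)
    obtain l s q where q: "map_poly (map_poly \<pi>) q \<noteq> 0" "s * p = [:[:\<tau>0:]:] ^ l * q"
      using u2 p(1) unfolding uniformizes_def by blast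
    have "poly (map_poly in_ac (s * p)) \<delta> = 0" using p(2) by (simp add: iap.h_mult)
    moreover have "poly (map_poly in_ac ([:[:\<tau>0:]:] ^ l * q)) \<delta> = \<tau> ^ l * poly (map_poly in_ac q) \<delta>"
      by (simp add: iap.h_mult iap.h_power map_poly_pCons_zero \<tau>_def)
    ultimately have q0: "poly (map_poly in_ac q) \<delta> = 0" using q(2) \<tau>(3) by simp
    have "(\<exists>m. \<exists>t\<in>T. \<delta> ^ m = \<tau> * t)" if "map_poly (map_poly \<pi>) q \<noteq> 0" "poly (map_poly in_ac q) \<delta> * \<delta> ^ i \<in> multiples \<tau> T" for q i
      using that
    proof (induction q arbitrary: i)
      case (pCons c q)
      let ?r = "poly (map_poly in_ac q) \<delta>"
      have r: "?r \<in> T" by (rule poly_closed[OF _ \<delta>(1)]) (simp add: polys_over_def coeff_map_poly T)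
      have eq: "poly (map_poly in_ac (pCons c q)) \<delta> = in_ac c + \<delta> * ?r" by (simp add: map_poly_pCons_zero)
      show ?case
      proof (cases "map_poly \<pi> c = 0")
        case True
        have "in_ac c \<in> multiples \<tau> T"
        proof (cases "c = 0")
          case False
          then obtain l t where l: "t \<in> T" "in_ac c = \<tau> ^ l * t" "l \<noteq> 0" using power_of_\<tau>[of c] True by blast
          then obtain l' where "l = Suc l'" by (cases l) auto
          then show ?thesis using l \<tau> by (intro multiplesI[of "\<tau> ^ l' * t"]) (auto intro: mult_closed power_closed)
        qed simp
        then have "in_ac c * \<delta> ^ i \<in> multiples (\<tau> * 1) T" by (rule mult_multiples) (simp add: \<delta> power_closed)
        then have "- (in_ac c * \<delta> ^ i) \<in> multiples \<tau> T" by (simp add: uminus_multiples)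
        from add_multiples[OF pCons.prems(2)[unfolded eq] this]
        have "?r * \<delta> ^ Suc i \<in> multiples \<tau> T" by (simp add: algebra_simps)
        moreover have "map_poly (map_poly \<pi>) q \<noteq> 0" using pCons.prems(1) True by (simp add: map_poly_pCons_zero)
        ultimately show ?thesis using pCons.IH by blast
      next
        case False
        have u: "in_ac c + \<delta> * ?r \<in> T" using T \<delta> r by (intro add_closed mult_closed) auto
        have "\<phi> (in_ac c + \<delta> * ?r) = \<phi> (in_ac c)"
          using T \<delta> r by (simp add: h_add h_mult mult_closed)
        then have "\<phi> (in_ac c + \<delta> * ?r) \<noteq> 0" using False by (simp add: \<phi> \<rho>_eq_0)
        then have inv: "inverse (in_ac c + \<delta> * ?r) \<in> T" "in_ac c + \<delta> * ?r \<noteq> 0" using unit_closed[OF u] by auto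
        obtain t where "t \<in> T" "(in_ac c + \<delta> * ?r) * \<delta> ^ i = \<tau> * t"
          using pCons.prems(2) unfolding eq by (auto simp: multiples_def)
        then have "\<delta> ^ i = \<tau> * (t * inverse (in_ac c + \<delta> * ?r))" using inv(2) by (simp add: field_simps)
        then show ?thesis using \<open>t \<in> T\<close> inv(1) by (blast intro: mult_closed)
      qed
    qed simp
    from this[OF q(1), of 0] q0 show ?thesis using that by auto
  qed
  obtain t where t: "t \<in> T" "\<tau> ^ l = a * t" using l by blast
  obtain t1 where t1: "t1 \<in> T" "\<delta> ^ m = \<tau> * t1" using m by blast
  obtain t2 where t2: "t2 \<in> T" "a = \<delta> ^ (m * Suc l) * t2" using a[of "m * Suc l"] by (auto simp: multiples_def)
  have "\<delta> ^ (m * Suc l) = \<tau> ^ Suc l * t1 ^ Suc l" by (simp only: power_mult t1(2) power_mult_distrib)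
  then have "a * t = (\<tau> ^ Suc l * t1 ^ Suc l) * t2 * t" using t2(2) by simp
  then have "\<tau> ^ l = \<tau> ^ l * (\<tau> * (t1 ^ Suc l * t2 * t))" using t(2) by (simp add: mult_ac)
  then have "1 = \<tau> * (t1 ^ Suc l * t2 * t)" using \<tau>(3) by simp
  then have "\<phi> 1 = \<phi> \<tau> * \<phi> (t1 ^ Suc l * t2 * t)"
    using h_mult[OF \<tau>(1), of "t1 ^ Suc l * t2 * t"] t t1 t2 by (simp only: mult_closed power_closed)
  then show False using \<tau>(2) by simp
qed

end

end

section \<open>The kernel of the Jacobian derivation\<close>

lemma coeff_mult_top:
  fixes p q :: "'a::comm_semiring_0 poly"
  assumes "degree p \<le> m" "degree q \<le> k"
  shows "coeff (p * q) (m + k) = coeff p m * coeff q k"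
proof -
  have "coeff (p * q) (m + k) = (\<Sum>i\<le>m + k. coeff p i * coeff q (m + k - i))"
    by (simp add: coeff_mult)
  also have "\<dots> = (\<Sum>i\<in>{m}. coeff p i * coeff q (m + k - i))"
  proof (rule sum.mono_neutral_right)
    show "\<forall>i\<in>{..m + k} - {m}. coeff p i * coeff q (m + k - i) = 0"
    proof
      fix i assume i: "i \<in> {..m + k} - {m}"
      then consider "i > m" | "m + k - i > k" by force
      then show "coeff p i * coeff q (m + k - i) = 0"
        using assms by cases (auto simp: coeff_eq_0)
    qed
  qed auto
  finally show ?thesis by simp
qed

locale derivation =
  fixes d :: "'r::idom \<Rightarrow> 'r"
  assumes d_add: "d (a + b) = d a + d b"
    and d_mult: "d (a * b) = d a * b + a * d b"
begin

lemma d_0 [simp]: "d 0 = 0" using d_add[of 0 0] by (metis add.right_neutral add_left_cancel)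
lemma d_1 [simp]: "d 1 = 0" using d_mult[of 1 1] by (metis add.right_neutral add_left_cancel mult_1 mult_1_right)
lemma d_uminus: "d (- a) = - d a" using d_add[of a "- a"] by (simp add: eq_neg_iff_add_eq_0 add.commute)
lemma d_minus: "d (a - b) = d a - d b" using d_add[of a "- b"] by (simp add: d_uminus)
lemma d_sum: "d (sum f A) = (\<Sum>x\<in>A. d (f x))"
  by (induction A rule: infinite_finite_induct) (auto simp: d_add)

lemma coeff_map_d [simp]: "coeff (map_poly d p) i = d (coeff p i)"
  by (simp add: coeff_map_poly)

lemma derivation_map_poly: "derivation (map_poly d)"
proof
  fix p q :: "'r poly"
  show "map_poly d (p + q) = map_poly d p + map_poly d q"
    by (intro poly_eqI) (simp add: d_add)
  show "map_poly d (p * q) = map_poly d p * q + p * map_poly d q"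
    by (intro poly_eqI) (simp add: coeff_mult d_sum d_mult sum.distrib)
qed

lemma d_poly: "d (poly p a) = poly (map_poly d p) a + poly (pderiv p) a * d a"
  by (induction p) (simp_all add: d_add d_mult map_poly_pCons_zero pderiv_pCons algebra_simps)

end

lemma derivation_pderiv: "derivation (pderiv :: 'a::idom poly \<Rightarrow> 'a poly)"
  by unfold_locales (simp_all add: pderiv_add pderiv_mult algebra_simps)

lemma pderiv_eq_0_CHAR_0:
  fixes p :: "'a::idom poly"
  assumes "CHAR('a) = 0" "pderiv p = 0"
  shows "degree p = 0"
proof (rule ccontr)
  assume d: "degree p \<noteq> 0"
  then obtain n where n: "degree p = Suc n" by (cases "degree p") auto
  have "coeff (pderiv p) n = 0" using assms(2) by simp
  then have "of_nat (Suc n) * lead_coeff p = 0" by (simp add: coeff_pderiv n)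
  moreover have "of_nat (Suc n) \<noteq> (0 :: 'a)"
    using assms(1) by (simp add: of_nat_eq_0_iff_char_dvd del: of_nat_Suc)
  ultimately show False using d by auto
qed

text \<open>
  For \<open>p\<close> with coefficients in the kernel of \<open>d\<close>, the equation
  \<open>d(p(x)) = p'(x) d(x)\<close> shows that \<open>x\<close> is also a root of
  \<open>p'\<close>, which has smaller degree.
\<close>

lemma (in derivation) transcendental_over_kernel:
  assumes char: "CHAR('r) = 0" and x: "d x \<noteq> 0"
    and "map_poly d p = 0" "poly p x = 0"
  shows "p = 0"
  using assms(3,4)
proof (induction "degree p" arbitrary: p rule: less_induct)
  case less
  have "poly (pderiv p) x = 0"
    using d_poly[of p x] less.prems x by simp
  moreover have "map_poly d (pderiv p) = 0"
  proof (rule poly_eqI)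
    fix i
    have "d (of_nat (Suc i)) = 0" for i
      by (induction "Suc i" arbitrary: i) (metis add.left_neutral d_0 d_1 d_add of_nat_Suc of_nat_0 not0_implies_Suc)
    moreover have "d (coeff p (Suc i)) = 0"
      using less.prems(1) coeff_map_d[of p "Suc i"] by simp
    ultimately show "coeff (map_poly d (pderiv p)) i = coeff 0 i"
      by (simp add: coeff_pderiv d_mult del: of_nat_Suc)
  qed
  ultimately have *: "degree p \<noteq> 0 \<Longrightarrow> pderiv p = 0"
    using less.hyps[of "pderiv p"] degree_pderiv_le[of p] by force
  then have "degree p = 0" using pderiv_eq_0_CHAR_0[OF char] by auto
  then obtain c where "p = [:c:]" by (metis degree_eq_zeroE)
  with less.prems(2) show ?case by simp
qed

definition jacobian :: "'a::idom poly poly \<Rightarrow> 'a poly poly \<Rightarrow> 'a poly poly" where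
  "jacobian F w = pderiv F * map_poly pderiv w - map_poly pderiv F * pderiv w"

lemma derivation_jacobian: "derivation (jacobian F)"
proof -
  interpret x: derivation "map_poly pderiv :: 'a poly poly \<Rightarrow> _"
    by (rule derivation.derivation_map_poly[OF derivation_pderiv])
  interpret y: derivation "pderiv :: 'a poly poly \<Rightarrow> _" by (rule derivation_pderiv)
  show ?thesis
    by unfold_locales (simp_all add: jacobian_def x.d_add y.d_add x.d_mult y.d_mult algebra_simps)
qed

lemma jacobian_self [simp]: "jacobian F F = 0"
  by (simp add: jacobian_def)

lemma jacobian_const [simp]: "jacobian F [:[:c:]:] = 0"
  by (simp add: jacobian_def map_poly_pCons_zero pderiv_pCons)

lemma jacobian_const_y: "jacobian F [:c:] = smult (pderiv c) (pderiv F)"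
  by (simp add: jacobian_def map_poly_pCons_zero pderiv_pCons)

text \<open>
  The copy of \<open>a(x,y)\<close> in two new variables \<open>X\<close> and \<open>Y\<close>,
  as a polynomial with coefficients in \<open>K[x,y]\<close>. A polynomial \<open>a\<close> in
  the kernel of the Jacobian derivation is studied through \<open>a(X,Y) - a(x,y)\<close>, which
  has coefficients in that kernel and vanishes on the diagonal \<open>X = x, Y = y\<close>.
\<close>

definition fresh :: "'b::comm_ring_1 poly poly \<Rightarrow> 'b poly poly poly poly" where
  "fresh a = map_poly (map_poly (\<lambda>c. [:[:c:]:])) a"

definition diff_fresh :: "'b::comm_ring_1 poly poly \<Rightarrow> 'b poly poly poly poly" where
  "diff_fresh a = fresh a - [:[:a:]:]"

definition diag :: "'b::comm_ring_1 poly poly poly poly \<Rightarrow> 'b poly poly" where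
  "diag G = poly (map_poly (\<lambda>c. poly c [:[:0, 1:]:]) G) [:0, 1:]"

lemma coeff_fresh [simp]: "coeff (coeff (fresh a) j) i = [:[:coeff (coeff a j) i:]:]"
  by (simp add: fresh_def coeff_map_poly)

lemma diag_mult: "diag (G * H) = diag G * diag H"
  and diag_minus: "diag (G - H) = diag G - diag H"
proof -
  interpret m: map_poly_comm_ring_hom "\<lambda>c :: 'a poly poly poly. poly c [:[:0, 1:]:]"
    by unfold_locales auto
  show "diag (G * H) = diag G * diag H" "diag (G - H) = diag G - diag H"
    by (simp_all only: diag_def m.hom_mult m.hom_minus poly_mult poly_diff)
qed

lemma diag_const [simp]: "diag [:[:a:]:] = a"
  by (simp add: diag_def map_poly_pCons_zero)

lemma diag_fresh [simp]: "diag (fresh a) = a"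
proof -
  have 1: "poly (map_poly (\<lambda>c. [:[:c:]:]) q) [:[:0, 1:]:] = [:q:]" for q :: "'a poly"
    by (induction q) (simp_all add: map_poly_pCons_zero)
  have "map_poly (\<lambda>c. poly c [:[:0, 1:]:]) (fresh a) = map_poly (\<lambda>c. [:c:]) a"
    by (rule poly_eqI) (simp only: fresh_def coeff_map_poly map_poly_0 poly_0 1 pCons_0_0)
  moreover have "poly (map_poly (\<lambda>c. [:c:]) a) [:0, 1:] = a"
    by (induction a) (simp_all add: map_poly_pCons_zero)
  ultimately show ?thesis by (simp add: diag_def)
qed

lemma diag_diff_fresh [simp]: "diag (diff_fresh a) = 0"
  by (simp add: diff_fresh_def diag_minus)

lemma jacobian_coeff_diff_fresh:
  assumes "jacobian F a = 0"
  shows "map_poly (map_poly (jacobian F)) (diff_fresh a) = 0"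
proof -
  interpret d: derivation "jacobian F" by (rule derivation_jacobian)
  interpret dx: derivation "map_poly (jacobian F)" by (rule d.derivation_map_poly)
  show ?thesis
  proof (rule poly_eqI, rule poly_eqI)
    fix j i
    show "coeff (coeff (map_poly (map_poly (jacobian F)) (diff_fresh a)) j) i = coeff (coeff 0 j) i"
      using assms by (cases j; cases i) (simp_all add: diff_fresh_def d.d_minus coeff_pCons)
  qed
qed

locale monic_in_y =
  fixes F :: "'b::field poly poly"
  assumes char_0: "CHAR('b) = 0"
    and monic: "lead_coeff F = 1"
    and degree_pos: "degree F > 0"
begin

sublocale D: derivation "jacobian F" by (rule derivation_jacobian)
sublocale DX: derivation "map_poly (jacobian F)" by (rule D.derivation_map_poly)
sublocale DXT: derivation "map_poly (map_poly (jacobian F))" by (rule DX.derivation_map_poly)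

lemma CHAR_0_poly: "CHAR('b poly) = 0" "CHAR('b poly poly) = 0"
  using char_0 by simp_all

lemma pderiv_F_nonzero: "pderiv F \<noteq> 0"
  using pderiv_eq_0_CHAR_0[OF CHAR_0_poly(1), of F] degree_pos by auto

text \<open>
  The coefficient of \<open>y\<^bsup>n-1+l\<^esup>\<close> in the Jacobian comes from
  \<open>F\<^sub>y a\<^sub>x\<close> only.
\<close>

lemma lead_coeff_kernel:
  assumes "jacobian F a = 0"
  shows "degree (lead_coeff a) = 0"
proof -
  define n l where "n = degree F" and "l = degree a"
  have 1: "coeff (pderiv F * map_poly pderiv a) (n - 1 + l) = of_nat n * pderiv (lead_coeff a)"
  proof -
    have "coeff (pderiv F * map_poly pderiv a) (n - 1 + l) =
        coeff (pderiv F) (n - 1) * coeff (map_poly pderiv a) l"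
      using degree_pderiv_le[of F] degree_map_poly_le[of pderiv a]
      by (intro coeff_mult_top) (auto simp: n_def l_def)
    then show ?thesis
      using degree_pos monic by (simp add: coeff_map_poly coeff_pderiv n_def l_def)
  qed
  have "coeff (map_poly pderiv F * pderiv a) (n - 1 + l) = 0"
  proof (cases "l = 0")
    case True
    then have "pderiv a = 0" by (auto simp: l_def pderiv_eq_0_iff elim!: degree_eq_zeroE)
    then show ?thesis by simp
  next
    case False
    have "degree (map_poly pderiv F) < n"
    proof -
      have "coeff (map_poly pderiv F) i = 0" if "i \<ge> n" for i
        using that monic by (cases "i = n") (auto simp: coeff_map_poly n_def coeff_eq_0)
      then show ?thesis
        using degree_pos by (metis leading_coeff_0_iff linorder_not_le n_def degree_0)
    qed
    moreover have "degree (pderiv a) < l"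
      using False degree_pderiv_le[of a] by (simp add: l_def)
    ultimately have "degree (map_poly pderiv F * pderiv a) < n - 1 + l"
      using degree_mult_le[of "map_poly pderiv F" "pderiv a"] by linarith
    then show ?thesis by (rule coeff_eq_0)
  qed
  with 1 assms have "of_nat n * pderiv (lead_coeff a) = 0"
    by (metis coeff_0 coeff_diff diff_zero jacobian_def)
  moreover have "of_nat n \<noteq> (0 :: 'b poly)"
    using degree_pos CHAR_0_poly by (simp add: of_nat_eq_0_iff_char_dvd n_def)
  ultimately have "pderiv (lead_coeff a) = 0" by simp
  then show ?thesis by (rule pderiv_eq_0_CHAR_0[OF char_0])
qed

lemma kernel_degree_0:
  assumes "jacobian F a = 0" "degree a = 0"
  obtains c where "a = [:[:c:]:]"
  using lead_coeff_kernel[OF assms(1)] assms(2) by (metis degree_eq_zeroE lead_coeff_pCons(2) coeff_pCons_0)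

lemma x_transcendental:
  assumes "map_poly (jacobian F) p = 0" "poly p [:[:0, 1:]:] = 0"
  shows "p = 0"
  by (rule D.transcendental_over_kernel[OF CHAR_0_poly(2) _ assms])
    (use pderiv_F_nonzero in \<open>simp add: jacobian_const_y pderiv_pCons\<close>)

text \<open>
  Take a prime factor \<open>g\<close> of \<open>F(X,Y) - F(x,y)\<close> that vanishes on the
  diagonal. It is a simple factor, as \<open>F\<^sub>y \<noteq> 0\<close>. The derivation,
  applied to coefficients, kills the product; so it maps \<open>g\<close> to a multiple of
  \<open>g\<close>. This multiple has smaller degree, because \<open>g\<close> is monic.
\<close>

lemma prime_factor_on_diagonal:
  obtains g where "prime_elem g" "lead_coeff g = 1" "degree g > 0" "diag g = 0"
    "map_poly (map_poly (jacobian F)) g = 0"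
proof -
  let ?D = "map_poly (map_poly (jacobian F))"
  define Fh where "Fh = diff_fresh F"
  have co: "coeff Fh j = map_poly (\<lambda>c. [:[:c:]:]) (coeff F j)" if "j > 0" for j
    using that by (simp add: Fh_def diff_fresh_def fresh_def coeff_map_poly coeff_pCons split: nat.split)
  have "map_poly (\<lambda>c. [:[:c:]:]) (1 :: 'b poly) = 1"
  proof (rule poly_eqI)
    show "coeff (map_poly (\<lambda>c. [:[:c:]:]) (1 :: 'b poly)) i = coeff 1 i" for i
      by (cases i) (simp_all add: coeff_map_poly pCons_one)
  qed
  then have lcF: "coeff Fh (degree F) = 1"
    using co[OF degree_pos] monic by metis
  have degF: "degree Fh = degree F"
  proof (rule antisym)
    show "degree Fh \<le> degree F"
    proof (rule degree_le, intro allI impI)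
      fix i assume "i > degree F"
      then show "coeff Fh i = 0" using co[of i] by (simp add: coeff_eq_0)
    qed
    show "degree F \<le> degree Fh" using lcF by (intro le_degree) auto
  qed
  have lc: "lead_coeff Fh = 1" using lcF degF by simp
  have "Fh \<noteq> 0" "\<not> Fh dvd 1"
    using degF degree_pos lc by (auto dest!: dvd_imp_degree_le)
  then obtain fs where fs: "mset_factors fs Fh" using mset_factors_exist by blast
  have prod: "prod_mset fs = Fh" using fs by (simp add: mset_factors_def)
  have "diag (prod_mset M) = prod_mset (image_mset diag M)" for M :: "'b poly poly poly poly multiset"
  proof (induction M)
    case empty
    have "diag 1 = (1 :: 'b poly poly)" using diag_const[of 1] by (simp only: pCons_one)
    then show ?case by simp
  qed (simp add: diag_mult)
  then have "prod_mset (image_mset diag fs) = 0"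
    by (metis prod Fh_def diag_diff_fresh)
  then obtain g0 where g0: "g0 \<in># fs" "diag g0 = 0" by (auto simp: prod_mset_zero_iff)
  have irr: "Factorial_Ring.irreducible g0" using fs g0 by (auto simp: mset_factors_def)
  obtain h0 where h0: "Fh = g0 * h0"
    using fs g0 mset_factors_imp_dvd by (metis dvdE)
  have "lead_coeff g0 * lead_coeff h0 = 1" using lc h0 by (simp add: lead_coeff_mult)
  define g h where "g = smult (lead_coeff h0) g0" and "h = smult (lead_coeff g0) h0"
  have gh: "Fh = g * h" using h0 \<open>lead_coeff g0 * lead_coeff h0 = 1\<close>
    by (simp add: g_def h_def mult.commute)
  have u: "lead_coeff h0 dvd 1" using \<open>lead_coeff g0 * lead_coeff h0 = 1\<close> by (metis dvd_triv_right)
  have g_u: "g = [:lead_coeff h0:] * g0" by (simp add: g_def)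
  have "[:lead_coeff h0:] dvd 1" using u by (metis is_unit_const_poly_iff)
  then have "Factorial_Ring.irreducible g"
    using irr by (simp only: g_u irreducible_mult_unit_left)
  then have prime: "prime_elem g" by simp
  have monic_g: "lead_coeff g = 1" using \<open>lead_coeff g0 * lead_coeff h0 = 1\<close>
    by (simp only: g_def lead_coeff_smult mult.commute)
  have diag_g: "diag g = 0" by (simp only: g_u diag_mult g0 mult_zero_right)
  have "degree g > 0"
  proof (rule ccontr)
    assume "\<not> degree g > 0"
    then have "g = 1" using monic_g by (metis gr_zeroI monic_degree_0)
    then show False using prime by auto
  qed
  have "\<not> g dvd h"
  proof
    assume "g dvd h"
    then obtain k where k: "h = g * k" by (elim dvdE)
    have "pderiv Fh = g * (pderiv h + pderiv g * k)"
      unfolding gh k by (simp add: pderiv_mult algebra_simps)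
    then have "diag (pderiv Fh) = 0" by (simp add: diag_mult diag_g)
    moreover have "pderiv Fh = fresh (pderiv F)"
    proof -
      interpret m: map_poly_comm_ring_hom "\<lambda>c :: 'b. [:[:c:]:]"
        by unfold_locales (simp_all add: pCons_one)
      show ?thesis
      proof (rule poly_eqI)
        fix j
        have "coeff (pderiv Fh) j = of_nat (Suc j) * map_poly (\<lambda>c. [:[:c:]:]) (coeff F (Suc j))"
          by (simp only: coeff_pderiv co[of "Suc j"] zero_less_Suc)
        also have "\<dots> = map_poly (\<lambda>c. [:[:c:]:]) (coeff (pderiv F) j)"
          by (simp only: coeff_pderiv m.hom_mult m.hom_of_nat)
        finally show "coeff (pderiv Fh) j = coeff (fresh (pderiv F)) j"
          by (simp only: fresh_def coeff_map_poly m.hom_zero)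
      qed
    qed
    ultimately show False using pderiv_F_nonzero by simp
  qed
  moreover have "g dvd ?D g * h"
  proof -
    have "?D Fh = 0" unfolding Fh_def by (rule jacobian_coeff_diff_fresh) simp
    then have "?D g * h = g * - ?D h" unfolding gh DXT.d_mult by (simp add: eq_neg_iff_add_eq_0)
    then show ?thesis by (metis dvd_triv_left)
  qed
  ultimately have "g dvd ?D g" using prime by (auto simp: prime_elem_dvd_mult_iff)
  moreover have "degree (?D g) < degree g"
  proof -
    have "coeff (?D g) (degree g) = 0" using monic_g by (simp)
    moreover have "degree (?D g) \<le> degree g" by (rule degree_map_poly_le)
    ultimately show ?thesis
      using \<open>degree g > 0\<close> by (metis leading_coeff_0_iff degree_0 le_neq_implies_less)
  qed
  ultimately have "?D g = 0" by (meson dvd_imp_degree_le linorder_not_le)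
  then show ?thesis by (rule that[OF prime monic_g \<open>degree g > 0\<close> diag_g])
qed

text \<open>
  Pseudo-division stays among the polynomials over the kernel that vanish on the diagonal.
\<close>

lemma pseudo_division_by_minimal:
  assumes P: "map_poly (map_poly (jacobian F)) P = 0" "diag P = 0" "P \<noteq> 0"
    and min: "\<And>G. map_poly (map_poly (jacobian F)) G = 0 \<Longrightarrow> diag G = 0 \<Longrightarrow> G \<noteq> 0 \<Longrightarrow> degree P \<le> degree G"
    and G: "map_poly (map_poly (jacobian F)) G = 0" "diag G = 0"
  shows "\<exists>k Q. [:lead_coeff P ^ k:] * G = P * Q"
  using G
proof (induction "degree G" arbitrary: G rule: less_induct)
  case less
  let ?D = "map_poly (map_poly (jacobian F))"
  show ?case
  proof (cases "G = 0")
    case True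
    then show ?thesis by (intro exI[of _ 0]) simp
  next
    case False
    define e where "e = degree G - degree P"
    have le: "degree P \<le> degree G" using min less.prems False by blast
    define G' where "G' = [:lead_coeff P:] * G - monom (lead_coeff G) e * P"
    have lcP: "map_poly (jacobian F) (lead_coeff P) = 0"
      using P(1) DX.coeff_map_d[of P "degree P"] by simp
    have lcG: "map_poly (jacobian F) (lead_coeff G) = 0"
      using less.prems(1) DX.coeff_map_d[of G "degree G"] by simp
    have 1: "?D [:lead_coeff P:] = 0" using lcP by (simp add: map_poly_pCons_zero)
    have 2: "?D (monom (lead_coeff G) e) = 0"
    proof (rule poly_eqI)
      fix i
      show "coeff (?D (monom (lead_coeff G) e)) i = coeff 0 i"
        by (simp only: DX.coeff_map_d coeff_monom coeff_0) (simp add: lcG)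
    qed
    have DG': "?D G' = 0"
      unfolding G'_def DXT.d_minus DXT.d_mult 1 2 less.prems P by simp
    have dG': "diag G' = 0" unfolding G'_def diag_minus diag_mult less.prems P by simp
    have "degree G' \<le> degree G"
      unfolding G'_def
    proof (rule degree_diff_le)
      show "degree ([:lead_coeff P:] * G) \<le> degree G" by (simp add: degree_smult_le)
      show "degree (monom (lead_coeff G) e * P) \<le> degree G"
        using degree_mult_le[of "monom (lead_coeff G) e" P] degree_monom_le[of "lead_coeff G" e] le
        by (simp add: e_def)
    qed
    moreover have "coeff G' (degree G) = 0"
      unfolding G'_def using le by (simp add: coeff_monom_mult e_def)
    ultimately have "degree G' < degree G \<or> G' = 0"
      by (metis le_neq_implies_less leading_coeff_0_iff)
    then obtain k Q where kQ: "[:lead_coeff P ^ k:] * G' = P * Q"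
      using less.hyps[OF _ DG' dG'] by (metis mult_zero_right)
    have "[:lead_coeff P ^ Suc k:] * G = [:lead_coeff P ^ k:] * ([:lead_coeff P:] * G)"
      by (simp add: mult.commute)
    also have "\<dots> = [:lead_coeff P ^ k:] * G' + P * ([:lead_coeff P ^ k:] * monom (lead_coeff G) e)"
      unfolding G'_def by (simp add: algebra_simps)
    also have "\<dots> = P * (Q + [:lead_coeff P ^ k:] * monom (lead_coeff G) e)"
      unfolding kQ by (simp only: distrib_left)
    finally show ?thesis by blast
  qed
qed

text \<open>
  The prime \<open>g\<close> is essentially the minimal polynomial of \<open>y\<close> over the
  field generated by \<open>x\<close> and the kernel. It divides a polynomial \<open>P\<close>
  of least degree over the kernel that vanishes on the diagonal; pseudo-division by
  \<open>P\<close> then gives the divisibility for all others, as \<open>g\<close> does not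
  divide the leading coefficient of \<open>P\<close>.
\<close>

lemma minimal_polynomial_on_diagonal:
  obtains g where "degree g > 0" "lead_coeff g = 1" "diag g = 0"
    "map_poly (map_poly (jacobian F)) g = 0"
    "\<And>a. jacobian F a = 0 \<Longrightarrow> g dvd diff_fresh a"
proof -
  let ?D = "map_poly (map_poly (jacobian F))"
  obtain g where g: "prime_elem g" "lead_coeff g = 1" "degree g > 0" "diag g = 0" "?D g = 0"
    by (rule prime_factor_on_diagonal)
  let ?R = "\<lambda>P. ?D P = 0 \<and> diag P = 0 \<and> P \<noteq> 0"
  have "?R g" using g by auto
  then obtain P where P: "?R P" and min: "\<And>G. ?R G \<Longrightarrow> degree P \<le> degree G"
    using ex_has_least_nat[of ?R g degree] by blast
  have degP: "degree P > 0"
  proof (rule ccontr)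
    assume "\<not> degree P > 0"
    then obtain c where c: "P = [:c:]" by (metis degree_eq_zeroE gr_zeroI)
    have "map_poly (jacobian F) c = 0"
      using P DX.coeff_map_d[of P 0] by (simp add: c)
    moreover have "poly c [:[:0, 1:]:] = 0"
    proof -
      have "diag P = poly c [:[:0, 1:]:]"
        unfolding c diag_def by (subst map_poly_pCons_zero) (simp_all only: poly_0 map_poly_0 poly_pCons mult_zero_right add_0_right)
      then show ?thesis using P by simp
    qed
    ultimately have "c = 0" by (rule x_transcendental)
    then show False using P c by simp
  qed
  have main: "\<exists>k Q. [:lead_coeff P ^ k:] * G = P * Q" if "?D G = 0" "diag G = 0" for G
    by (rule pseudo_division_by_minimal) (use P min that in blast)+
  obtain k Q where kQ: "[:lead_coeff P ^ k:] * g = P * Q" using main[OF g(5,4)] by (elim exE)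
  have "g dvd P * Q" unfolding kQ[symmetric] by (rule dvd_triv_right)
  then have "g dvd P \<or> g dvd Q" using g(1) by (simp add: prime_elem_dvd_mult_iff)
  moreover have "\<not> g dvd Q"
  proof
    assume "g dvd Q"
    then obtain R where "Q = g * R" by (elim dvdE)
    then have "g * [:lead_coeff P ^ k:] = g * (P * R)" using kQ by (simp only: mult_ac)
    then have *: "[:lead_coeff P ^ k:] = P * R" using g(3) by (subst (asm) mult_cancel_left) auto
    moreover have "[:lead_coeff P ^ k:] \<noteq> 0" using P by simp
    ultimately have "degree P \<le> degree [:lead_coeff P ^ k:]"
      by (metis dvd_triv_left dvd_imp_degree_le)
    then show False using degP by simp
  qed
  ultimately have gP: "g dvd P" by blast
  have "g dvd diff_fresh a" if a: "jacobian F a = 0" for a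
  proof -
    obtain k Q where "[:lead_coeff P ^ k:] * diff_fresh a = P * Q"
      using main[OF jacobian_coeff_diff_fresh[OF a] diag_diff_fresh] by blast
    then have "g dvd [:lead_coeff P ^ k:] * diff_fresh a" using gP by (metis dvd_mult2)
    then have "g dvd [:lead_coeff P ^ k:] \<or> g dvd diff_fresh a"
      using g(1) by (simp only: prime_elem_dvd_mult_iff)
    moreover have "\<not> g dvd [:lead_coeff P ^ k:]"
    proof
      assume "g dvd [:lead_coeff P ^ k:]"
      moreover have "[:lead_coeff P ^ k:] \<noteq> 0" using P by simp
      ultimately have "degree g \<le> degree [:lead_coeff P ^ k:]" by (metis dvd_imp_degree_le)
      then show False using g(3) by simp
    qed
    ultimately show ?thesis by blast
  qed
  then show ?thesis by (rule that[OF g(3,2,4,5)])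
qed

text \<open>
  The leading coefficient with respect to the old variable \<open>y\<close>, which occurs in the
  coefficients of \<open>G\<close>.
\<close>

definition y_top :: "nat \<Rightarrow> 'b poly poly poly poly \<Rightarrow> 'b poly poly poly" where
  "y_top e G = map_poly (map_poly (\<lambda>s. coeff s e)) G"

definition y_bounded :: "nat \<Rightarrow> 'b poly poly poly poly \<Rightarrow> bool" where
  "y_bounded e G \<longleftrightarrow> (\<forall>i j. degree (coeff (coeff G j) i) \<le> e)"

lemma coeff_y_top [simp]: "coeff (coeff (y_top e G) j) i = coeff (coeff (coeff G j) i) e"
  by (simp add: y_top_def coeff_map_poly)

lemma y_top_mult:
  assumes "y_bounded m G" "y_bounded k H"
  shows "y_top (m + k) (G * H) = y_top m G * y_top k H"
proof (rule poly_eqI, rule poly_eqI)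
  fix j i
  have "coeff (coeff (G * H) j) i = (\<Sum>a\<le>j. \<Sum>b\<le>i. coeff (coeff G a) b * coeff (coeff H (j - a)) (i - b))"
    by (simp add: coeff_mult coeff_sum)
  then have "coeff (coeff (coeff (G * H) j) i) (m + k) =
      (\<Sum>a\<le>j. \<Sum>b\<le>i. coeff (coeff (coeff G a) b) m * coeff (coeff (coeff H (j - a)) (i - b)) k)"
    using assms by (simp add: coeff_sum coeff_mult_top y_bounded_def)
  then show "coeff (coeff (y_top (m + k) (G * H)) j) i = coeff (coeff (y_top m G * y_top k H) j) i"
    by (simp add: coeff_mult coeff_sum)
qed

lemma y_bounded_exists:
  assumes "G \<noteq> 0"
  obtains e i j where "y_bounded e G" "degree (coeff (coeff G j) i) = e" "coeff (coeff G j) i \<noteq> 0"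
proof -
  let ?A = "\<Union>j\<in>{..degree G}. \<Union>i\<in>{..degree (coeff G j)}. {degree (coeff (coeff G j) i)}"
  let ?e = "Max ?A"
  have fin: "finite ?A" by auto
  have ne: "?A \<noteq> {}" by auto
  have b: "y_bounded ?e G" unfolding y_bounded_def
  proof (intro allI)
    fix i j
    show "degree (coeff (coeff G j) i) \<le> ?e"
    proof (cases "j \<le> degree G \<and> i \<le> degree (coeff G j)")
      case True
      then show ?thesis by (intro Max_ge[OF fin]) auto
    next
      case False
      then have "coeff (coeff G j) i = 0" by (metis coeff_0 coeff_eq_0 linorder_not_le)
      then show ?thesis by simp
    qed
  qed
  show ?thesis
  proof (cases "?e = 0")
    case True
    obtain j i where "coeff (coeff G j) i \<noteq> 0"
      using assms by (metis leading_coeff_0_iff)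
    then show ?thesis using b True that[of 0 j i] by (auto simp: y_bounded_def)
  next
    case False
    obtain j i where "degree (coeff (coeff G j) i) = ?e"
      using Max_in[OF fin ne] by auto
    then show ?thesis using b False that[of ?e j i] by force
  qed
qed

text \<open>
  Among the coefficients of \<open>g\<close>, which lie in the kernel, let
  \<open>\<theta>\<close> be one of the largest degree \<open>m\<close> in \<open>y\<close>.
  Then \<open>g\<close> divides \<open>\<theta>(X,Y) - \<theta>(x,y)\<close>. Both have degree
  \<open>m\<close> in \<open>y\<close>, and the leading coefficient of the second one is
  constant; so they agree up to a constant.
\<close>

lemma kernel_generator:
  obtains \<theta> where "jacobian F \<theta> = 0" "degree \<theta> > 0"
    "\<And>a. jacobian F a = 0 \<Longrightarrow> diff_fresh \<theta> dvd diff_fresh a"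
proof -
  obtain g where g: "degree g > 0" "lead_coeff g = 1" "diag g = 0"
      "map_poly (map_poly (jacobian F)) g = 0"
    and dvd: "\<And>a. jacobian F a = 0 \<Longrightarrow> g dvd diff_fresh a"
    by (rule minimal_polynomial_on_diagonal) blast
  have g0: "g \<noteq> 0" using g(1) by auto
  then obtain m i j where m: "y_bounded m g" "degree (coeff (coeff g j) i) = m" "coeff (coeff g j) i \<noteq> 0"
    by (rule y_bounded_exists)
  have Dcoeff: "jacobian F (coeff (coeff g j) i) = 0" for i j
  proof -
    have "coeff (coeff (map_poly (map_poly (jacobian F)) g) j) i = 0" by (simp only: g(4) coeff_0)
    then show ?thesis by simp
  qed
  define \<theta> where "\<theta> = coeff (coeff g j) i"
  have D\<theta>: "jacobian F \<theta> = 0" by (simp add: \<theta>_def Dcoeff)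
  have deg\<theta>: "degree \<theta> = m" and \<theta>0: "\<theta> \<noteq> 0" using m by (simp_all add: \<theta>_def)
  have "m > 0"
  proof (rule ccontr)
    assume "\<not> m > 0"
    then have "degree (coeff (coeff g j) i) = 0" for i j using m(1) by (simp add: y_bounded_def)
    then have "\<exists>c. coeff (coeff g j) i = [:[:c:]:]" for i j
      using kernel_degree_0[OF Dcoeff] by metis
    then have c: "coeff (coeff g j) i = [:[:coeff (coeff (coeff (coeff g j) i) 0) 0:]:]" for i j
      by (metis coeff_pCons_0)
    define q where "q = map_poly (map_poly (\<lambda>s. coeff (coeff s 0) 0)) g"
    have "g = fresh q"
    proof (rule poly_eqI, rule poly_eqI)
      show "coeff (coeff g j) i = coeff (coeff (fresh q) j) i" for j i
        using c[of j i] by (simp add: q_def coeff_map_poly)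
    qed
    then have "q = 0" using g(3) by simp
    then show False using \<open>g = fresh q\<close> g0 by (simp add: fresh_def)
  qed
  obtain k where k: "diff_fresh \<theta> = g * k" using dvd[OF D\<theta>] by (elim dvdE)
  obtain c where c: "lead_coeff \<theta> = [:c:]"
    using lead_coeff_kernel[OF D\<theta>] by (elim degree_eq_zeroE)
  have "c \<noteq> 0" using c \<theta>0 by (metis leading_coeff_0_iff pCons_0_0)
  have top: "y_top m (diff_fresh \<theta>) = [:[:[:- c:]:]:]"
  proof (rule poly_eqI, rule poly_eqI)
    fix b a
    have 1: "coeff \<theta> m = [:c:]" using c deg\<theta> by simp
    obtain m' where m': "m = Suc m'" using \<open>m > 0\<close> by (cases m) auto
    show "coeff (coeff (y_top m (diff_fresh \<theta>)) b) a = coeff (coeff [:[:[:- c:]:]:] b) a"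
      using 1 by (cases a; cases b) (simp_all add: diff_fresh_def m')
  qed
  have top0: "y_top l (diff_fresh \<theta>) = 0" if "l > m" for l
  proof (rule poly_eqI, rule poly_eqI)
    fix b a
    have 1: "coeff \<theta> l = 0" using that deg\<theta> by (simp add: coeff_eq_0)
    obtain l' where l': "l = Suc l'" using \<open>l > m\<close> by (cases l) auto
    show "coeff (coeff (y_top l (diff_fresh \<theta>)) b) a = coeff (coeff 0 b) a"
      using 1 by (cases a; cases b) (simp_all add: diff_fresh_def l')
  qed
  have "diff_fresh \<theta> \<noteq> 0" using top \<open>c \<noteq> 0\<close> by (auto simp: y_top_def)
  then have k0: "k \<noteq> 0" using k by auto
  then obtain e i' j' where e: "y_bounded e k" "degree (coeff (coeff k j') i') = e" "coeff (coeff k j') i' \<noteq> 0"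
    by (rule y_bounded_exists)
  have nz: "y_top d G \<noteq> 0" if "degree (coeff (coeff G b) a) = d" "coeff (coeff G b) a \<noteq> 0" for d G a b
  proof
    assume "y_top d G = 0"
    then have "coeff (coeff (y_top d G) b) a = 0" by (simp only: coeff_0)
    then show False using that by auto
  qed
  have prod: "y_top (m + e) (diff_fresh \<theta>) = y_top m g * y_top e k"
    unfolding k by (rule y_top_mult[OF m(1) e(1)])
  have "y_top m g * y_top e k \<noteq> 0" using nz[OF m(2,3)] nz[OF e(2,3)] by simp
  then have "e = 0" using top0[of "m + e"] prod by (cases "e = 0") auto
  then have "y_top m g * y_top 0 k = [:[:[:- c:]:]:]" using prod top by simp
  then have "[:[:[:- c:]:]:] = y_top 0 k * y_top m g" by (simp only: mult.commute)
  then have "y_top 0 k dvd [:[:[:- c:]:]:]" by (rule dvdI)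
  moreover have "[:[:[:- c:]:]:] dvd (1 :: 'b poly poly poly)"
    using \<open>c \<noteq> 0\<close> by (intro dvdI[of _ _ "[:[:[:- inverse c:]:]:]"]) (simp add: pCons_one)
  ultimately have "y_top 0 k dvd 1" by (rule dvd_trans)
  then obtain r1 where r1: "y_top 0 k = [:r1:]" "r1 dvd 1"
    using is_unit_poly_iff by blast
  then obtain r2 where r2: "r1 = [:r2:]" "r2 dvd 1"
    using is_unit_poly_iff by blast
  then obtain r where r: "r2 = [:r:]" "r dvd 1"
    using is_unit_poly_iff by blast
  have "k = [:[:[:[:r:]:]:]:]"
  proof (rule poly_eqI, rule poly_eqI)
    fix b a
    have "degree (coeff (coeff k b) a) = 0" using e(1) \<open>e = 0\<close> by (simp add: y_bounded_def)
    then have "coeff (coeff k b) a = [:coeff (coeff (coeff k b) a) 0:]"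
      by (metis degree_eq_zeroE coeff_pCons_0)
    also have "coeff (coeff (coeff k b) a) 0 = coeff (coeff (y_top 0 k) b) a" by simp
    also have "[:\<dots>:] = coeff (coeff [:[:[:[:r:]:]:]:] b) a"
      unfolding r1 r2 r by (cases a; cases b) simp_all
    finally show "coeff (coeff k b) a = coeff (coeff [:[:[:[:r:]:]:]:] b) a" .
  qed
  then have "k dvd 1"
    using r(2) by (auto intro!: dvdI[of _ _ "[:[:[:[:inverse r:]:]:]:]"] simp: pCons_one)
  then have "diff_fresh \<theta> dvd g" unfolding k
    by (metis dvd_refl mult_dvd_mono mult_1_right)
  then have "diff_fresh \<theta> dvd diff_fresh a" if "jacobian F a = 0" for a
    using dvd[OF that] dvd_trans by blast
  then show ?thesis using that D\<theta> deg\<theta> \<open>m > 0\<close> by simp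
qed

text \<open>
  If \<open>a(X,Y) - a(x,y) = (\<theta>(X,Y) - \<theta>(x,y)) k\<close>, the substitution
  \<open>X = Y = 0\<close> shows that \<open>a\<close> is a constant plus a constant translate
  of \<open>\<theta>\<close> times an element \<open>q\<close> of the kernel, of smaller degree.
\<close>

theorem kernel_of_jacobian:
  obtains \<theta> where "jacobian F \<theta> = 0" "degree \<theta> > 0"
    "\<And>a. jacobian F a = 0 \<Longrightarrow> \<exists>u. a = pcompose (map_poly (\<lambda>c. [:c:]) u) \<theta>"
proof -
  obtain \<theta> where \<theta>: "jacobian F \<theta> = 0" "degree \<theta> > 0"
    and dvd: "\<And>a. jacobian F a = 0 \<Longrightarrow> diff_fresh \<theta> dvd diff_fresh a"
    by (rule kernel_generator) blast
  let ?E = "\<lambda>G :: 'b poly poly poly poly. poly (poly G 0) 0"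
  have E: "?E (diff_fresh a) = [:[:coeff (coeff a 0) 0:]:] - a" for a
    by (simp add: diff_fresh_def poly_0_coeff_0)
  have "\<exists>u. a = pcompose (map_poly (\<lambda>c. [:c:]) u) \<theta>" if "jacobian F a = 0" for a
    using that
  proof (induction "degree a" arbitrary: a rule: less_induct)
    case less
    show ?case
    proof (cases "degree a = 0")
      case True
      then obtain c where "a = [:[:c:]:]" using kernel_degree_0[OF less.prems] by blast
      then have "a = pcompose (map_poly (\<lambda>c. [:c:]) [:c:]) \<theta>"
        by (simp add: map_poly_pCons_zero)
      then show ?thesis by blast
    next
      case False
      obtain k where k: "diff_fresh a = diff_fresh \<theta> * k" using dvd[OF less.prems] by (elim dvdE)
      define q where "q = ?E k"
      define a0 t0 where "a0 = coeff (coeff a 0) 0" and "t0 = coeff (coeff \<theta> 0) 0"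
      have eq: "[:[:a0:]:] - a = ([:[:t0:]:] - \<theta>) * q"
        using arg_cong[OF k, of ?E] by (simp add: E q_def a0_def t0_def)
      have degt: "degree ([:[:t0:]:] - \<theta>) = degree \<theta>"
        using \<theta>(2) degree_add_eq_left[of "[:[:t0:]:]" "- \<theta>"] by simp
      have dega: "degree ([:[:a0:]:] - a) = degree a"
        using False degree_add_eq_left[of "[:[:a0:]:]" "- a"] by simp
      have "q \<noteq> 0" using eq dega False by auto
      have nz: "[:[:t0:]:] - \<theta> \<noteq> 0" using degt \<theta>(2) by auto
      have "degree a = degree \<theta> + degree q"
        using degree_mult_eq[OF nz \<open>q \<noteq> 0\<close>] eq degt dega by simp
      then have lt: "degree q < degree a" using \<theta>(2) by simp
      have "jacobian F ([:[:a0:]:] - a) = 0"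
        using less.prems by (simp only: D.d_minus jacobian_const diff_0_right)
      then have "([:[:t0:]:] - \<theta>) * jacobian F q = 0"
        unfolding eq D.d_mult using \<theta>(1) by (simp only: D.d_minus jacobian_const mult_zero_left diff_0_right add_0_left)
      then have "jacobian F q = 0" using nz by simp
      then obtain u where u: "q = pcompose (map_poly (\<lambda>c. [:c:]) u) \<theta>" using less.hyps[OF lt] by blast
      interpret m: map_poly_comm_ring_hom "\<lambda>c :: 'b. [:c:]"
        by unfold_locales (simp_all add: pCons_one)
      have m1: "smult [:- 1:] q = - q" for q :: "'b poly poly"
        by (intro poly_eqI) simp
      have "pcompose (map_poly (\<lambda>c. [:c:]) ([:a0:] - [:t0, - 1:] * u)) \<theta> = [:[:a0:]:] - ([:[:t0:]:] - \<theta>) * q"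
        unfolding m.hom_minus m.hom_mult pcompose_diff pcompose_mult u
        by (simp add: map_poly_pCons_zero pcompose_pCons algebra_simps m1)
      then have "a = pcompose (map_poly (\<lambda>c. [:c:]) ([:a0:] - [:t0, - 1:] * u)) \<theta>"
        using eq by (simp add: algebra_simps)
      then show ?thesis by blast
    qed
  qed
  then show ?thesis using that \<theta> by blast
qed

text \<open>
  Both \<open>F\<close> and \<open>w\<close> are polynomials in \<open>\<theta>\<close>. If
  \<open>F\<close> were linear in \<open>\<theta>\<close>, then \<open>w\<close> would be a
  polynomial in \<open>F\<close>.
\<close>

lemma decomposition_from_kernel:
  assumes "jacobian F w = 0" "\<And>u. w \<noteq> pcompose (map_poly (\<lambda>c. [:c:]) u) F"
  shows "\<exists>u H. degree u \<ge> 2 \<and> F = pcompose (map_poly (\<lambda>c. [:c:]) u) H"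
proof -
  obtain \<theta> where \<theta>: "jacobian F \<theta> = 0" "degree \<theta> > 0"
    and gen: "\<And>a. jacobian F a = 0 \<Longrightarrow> \<exists>u. a = pcompose (map_poly (\<lambda>c. [:c:]) u) \<theta>"
    by (rule kernel_of_jacobian) blast
  obtain u where u: "F = pcompose (map_poly (\<lambda>c. [:c:]) u) \<theta>" using gen jacobian_self by blast
  obtain v where v: "w = pcompose (map_poly (\<lambda>c. [:c:]) v) \<theta>" using gen assms(1) by blast
  interpret m: map_poly_comm_ring_hom "\<lambda>c :: 'b. [:c:]"
    by unfold_locales (simp_all add: pCons_one)
  have "degree u \<ge> 2"
  proof (rule ccontr)
    assume "\<not> degree u \<ge> 2"
    then have "degree u \<le> 1" by simp
    then have "u = [:coeff u 0, coeff u 1:]"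
      by (intro poly_eqI) (auto simp: coeff_pCons coeff_eq_0 split: nat.split)
    then obtain a b where ab: "u = [:a, b:]" by blast
    have "b \<noteq> 0"
      using degree_pos u ab by (auto simp: map_poly_pCons_zero)
    define l where "l = [:- a / b, 1 / b:]"
    have "pcompose (map_poly (\<lambda>c. [:c:]) l) F = \<theta>"
      unfolding u ab l_def using \<open>b \<noteq> 0\<close>
      by (simp add: map_poly_pCons_zero pcompose_pCons algebra_simps)
    moreover have "pcompose (map_poly (\<lambda>c. [:c:]) (pcompose v l)) F =
        pcompose (map_poly (\<lambda>c. [:c:]) v) (pcompose (map_poly (\<lambda>c. [:c:]) l) F)"
    proof -
      have "map_poly (\<lambda>c. [:c:]) (pcompose v l) = pcompose (map_poly (\<lambda>c. [:c:]) v) (map_poly (\<lambda>c. [:c:]) l)"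
        by (induction v) (simp_all only: pcompose_0 pcompose_pCons m.hom_add m.hom_mult map_poly_0, simp_all add: map_poly_pCons_zero pcompose_pCons)
      then show ?thesis by (simp only: pcompose_assoc)
    qed
    ultimately show False using assms(2) v by metis
  qed
  then show ?thesis using u by blast
qed

end

section \<open>From an idempotent on the generic fibre to a decomposition\<close>

lemma subring_hom_eval:
  assumes "subring_hom UNIV h"
  shows "subring_hom UNIV (\<lambda>p. poly (map_poly h p) x)"
proof -
  interpret subring_hom UNIV h by fact
  interpret P: subring_hom UNIV "map_poly h" using subring_hom_poly by (simp add: polys_over_def)
  show ?thesis by unfold_locales (auto simp: P.h_add P.h_mult)
qed

lemma bivariate_induct [case_names const x y add mult]:
  fixes w :: "'c::comm_ring_1 poly poly"
  assumes const: "\<And>c. Q [:[:c:]:]" and x: "Q [:[:0, 1:]:]" and y: "Q [:0, 1:]"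
    and add: "\<And>v w. Q v \<Longrightarrow> Q w \<Longrightarrow> Q (v + w)" and mult: "\<And>v w. Q v \<Longrightarrow> Q w \<Longrightarrow> Q (v * w)"
  shows "Q w"
proof -
  have Q0: "Q 0" using const[of 0] by simp
  have coeffs: "Q [:p:]" for p
  proof (induction p)
    case (pCons c p)
    have "[:pCons c p:] = [:[:c:]:] + [:[:0, 1:]:] * [:p:]" by simp
    then show ?case using const x pCons.IH add mult by metis
  qed (use Q0 in simp)
  show ?thesis
  proof (induction w)
    case (pCons p w)
    have "pCons p w = [:p:] + [:0, 1:] * w" by simp
    then show ?case using coeffs y pCons.IH add mult by metis
  qed (use Q0 in simp)
qed

definition lift_coeffs :: "'b::idom poly poly \<Rightarrow> 'b poly poly poly" where
  "lift_coeffs = map_poly (map_poly (\<lambda>a. [:a:]))"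

lemma minus_lambda_lift: "minus_lambda F = lift_coeffs F - [:[:[:0, 1:]:]:]"
  by (simp add: minus_lambda_def lift_coeffs_def)

lemma degree_map_poly_inj:
  assumes "\<And>x. f x = 0 \<longleftrightarrow> x = 0"
  shows "degree (map_poly f p) = degree p"
  using assms by (cases "p = 0") (auto intro!: map_poly_degree_eq)

lemma map_poly_eq_0_inj:
  assumes "\<And>x. f x = 0 \<longleftrightarrow> x = 0"
  shows "map_poly f p = 0 \<longleftrightarrow> p = 0"
  using assms by (simp add: poly_eq_iff coeff_map_poly)

lemma subring_hom_lift_coeffs: "subring_hom UNIV (lift_coeffs :: 'b::idom poly poly \<Rightarrow> _)"
proof -
  interpret c: subring_hom UNIV "\<lambda>a :: 'b. [:a:]" by unfold_locales (auto simp: pCons_one)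
  interpret p: subring_hom UNIV "map_poly (\<lambda>a :: 'b. [:a:])" using c.subring_hom_poly by (simp add: polys_over_def)
  show ?thesis using p.subring_hom_poly by (simp add: polys_over_def lift_coeffs_def)
qed

lemma lift_coeffs_simps [simp]:
  fixes F :: "'b::idom poly poly"
  shows "lift_coeffs [:[:c:]:] = [:[:[:c:]:]:]" "lift_coeffs [:[:0, 1:]:] = [:[:0, 1:]:]"
  "lift_coeffs [:0, 1:] = [:0, 1:]" "degree (lift_coeffs F) = degree F"
  "lift_coeffs (pderiv F) = pderiv (lift_coeffs F)"
  "lift_coeffs (map_poly pderiv F) = map_poly pderiv (lift_coeffs F)"
proof -
  interpret c: subring_hom UNIV "\<lambda>a :: 'b. [:a:]" by unfold_locales (auto simp: pCons_one)
  have cp: "subring_hom UNIV (map_poly (\<lambda>a :: 'b. [:a:]))" using c.subring_hom_poly by (simp add: polys_over_def)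
  show "lift_coeffs [:[:c:]:] = [:[:[:c:]:]:]" "lift_coeffs [:[:0, 1:]:] = [:[:0, 1:]:]" "lift_coeffs [:0, 1:] = [:0, 1:]"
    by (simp_all add: lift_coeffs_def map_poly_pCons_zero map_poly_1 pCons_one)
  show "degree (lift_coeffs F) = degree F"
    unfolding lift_coeffs_def by (intro degree_map_poly_inj map_poly_eq_0_inj) simp
  show "lift_coeffs (pderiv F) = pderiv (lift_coeffs F)"
    unfolding lift_coeffs_def by (rule pderiv_subring_hom(2)[OF cp]) (simp add: polys_over_def)
  show "lift_coeffs (map_poly pderiv F) = map_poly pderiv (lift_coeffs F)"
  proof (rule poly_eqI)
    fix i
    have "map_poly (\<lambda>a. [:a:]) (pderiv (coeff F i)) = pderiv (map_poly (\<lambda>a. [:a:]) (coeff F i))"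
      by (rule pderiv_subring_hom(2)[OF c.subring_hom_axioms]) (simp add: polys_over_def)
    then show "coeff (lift_coeffs (map_poly pderiv F)) i = coeff (map_poly pderiv (lift_coeffs F)) i"
      by (simp add: coeff_map_poly lift_coeffs_def)
  qed
qed

lemmas [simp] = lift_coeffs_simps(2,3)[unfolded pCons_one]

lemma minus_lambda_monic:
  assumes "lead_coeff F = 1" "degree F > 0"
  shows "degree (minus_lambda F) = degree F" "lead_coeff (minus_lambda F) = 1"
proof -
  have "degree (- [:[:[:0, 1:]:]:] :: 'a poly poly poly) < degree (lift_coeffs F)" using assms by simp
  then show d: "degree (minus_lambda F) = degree F"
    unfolding minus_lambda_lift diff_conv_add_uminus by (subst degree_add_eq_left) auto
  show "lead_coeff (minus_lambda F) = 1"
    unfolding d using assms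
    by (simp add: minus_lambda_lift lift_coeffs_def coeff_map_poly coeff_pCons map_poly_1 pCons_one split: nat.split)
qed

definition subst_lambda :: "'b::idom poly poly \<Rightarrow> 'b poly poly poly \<Rightarrow> 'b poly poly" where
  "subst_lambda F w =
     poly (map_poly (\<lambda>p. poly (map_poly (\<lambda>c. poly (map_poly (\<lambda>a. [:[:a:]:]) c) F) p) [:[:0, 1:]:]) w) [:0, 1:]"

lemma subring_hom_subst_lambda: "subring_hom UNIV (subst_lambda F)"
proof -
  have "subring_hom UNIV (\<lambda>a :: 'a. [:[:a:]:])" by unfold_locales (auto simp: pCons_one)
  then show ?thesis unfolding subst_lambda_def by (intro subring_hom_eval)
qed

lemma subst_lambda_const: "subst_lambda F [:[:c:]:] = poly (map_poly (\<lambda>a. [:[:a:]:]) c) F"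
  by (simp add: subst_lambda_def map_poly_pCons_zero)

lemma subst_lambda_simps [simp]:
  "subst_lambda F [:[:[:a:]:]:] = [:[:a:]:]" "subst_lambda F [:[:[:0, 1:]:]:] = F"
  "subst_lambda F [:[:0, 1:]:] = [:[:0, 1:]:]" "subst_lambda F [:0, 1:] = [:0, 1:]"
  by (simp_all add: subst_lambda_def map_poly_pCons_zero map_poly_1 pCons_one)

lemmas [simp] = subst_lambda_simps(2-4)[unfolded pCons_one]

lemma subst_lambda_lift [simp]: "subst_lambda F (lift_coeffs H) = H"
proof -
  interpret s: subring_hom UNIV "subst_lambda F" by (rule subring_hom_subst_lambda)
  interpret l: subring_hom UNIV "lift_coeffs :: 'a poly poly \<Rightarrow> _" by (rule subring_hom_lift_coeffs)
  show ?thesis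
  proof (induction H rule: bivariate_induct)
    case (const c)
    then show ?case by simp
  next
    case x
    then show ?case by simp
  qed (simp_all add: s.h_add s.h_mult l.h_add l.h_mult)
qed

lemma subst_lambda_minus_lambda: "subst_lambda F (minus_lambda F) = 0"
proof -
  interpret s: subring_hom UNIV "subst_lambda F" by (rule subring_hom_subst_lambda)
  show ?thesis by (simp add: minus_lambda_lift s.h_minus)
qed

text \<open>
  Modulo \<open>F - \<lambda>\<close>, the substitution \<open>\<lambda> := F\<close> changes
  nothing.
\<close>

lemma subst_lambda_cong: "minus_lambda F dvd w - lift_coeffs (subst_lambda F w)"
proof -
  interpret s: subring_hom UNIV "subst_lambda F" by (rule subring_hom_subst_lambda)
  interpret l: subring_hom UNIV "lift_coeffs :: 'a poly poly \<Rightarrow> _" by (rule subring_hom_lift_coeffs)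
  let ?r = "\<lambda>w. lift_coeffs (subst_lambda F w)"
  have add: "minus_lambda F dvd (v + w) - ?r (v + w)" if "minus_lambda F dvd v - ?r v" "minus_lambda F dvd w - ?r w" for v w
  proof -
    have "(v + w) - ?r (v + w) = (v - ?r v) + (w - ?r w)" by (simp add: s.h_add l.h_add)
    then show ?thesis by (simp only: dvd_add that)
  qed
  have mult: "minus_lambda F dvd (v * w) - ?r (v * w)" if "minus_lambda F dvd v - ?r v" "minus_lambda F dvd w - ?r w" for v w
  proof -
    have "(v * w) - ?r (v * w) = v * (w - ?r w) + (v - ?r v) * ?r w" by (simp add: s.h_mult l.h_mult algebra_simps)
    then show ?thesis using that by (simp add: dvd_add)
  qed
  show ?thesis
  proof (induction w rule: bivariate_induct)
    case (const c)
    show ?case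
    proof (induction c)
      case (pCons a c)
      have eq: "[:[:pCons a c:]:] = [:[:[:a:]:]:] + [:[:[:0, 1:]:]:] * [:[:c:]:]" by simp
      have 1: "minus_lambda F dvd [:[:[:a:]:]:] - ?r [:[:[:a:]:]:]" by simp
      have "[:[:[:0, 1:]:]:] - ?r [:[:[:0, 1:]:]:] = - minus_lambda F" by (simp add: minus_lambda_lift)
      then have 2: "minus_lambda F dvd [:[:[:0, 1:]:]:] - ?r [:[:[:0, 1:]:]:]" by simp
      show ?case unfolding eq by (intro add 1 mult 2 pCons.IH)
    qed (simp add: s.h_zero l.h_zero)
  next
    case x
    then show ?case by simp
  next
    case y
    then show ?case by simp
  qed (use add mult in blast)+
qed

lemma jacobian_y: "jacobian F [:0, 1:] = - map_poly pderiv F"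
proof -
  have "map_poly pderiv [:0, 1 :: 'a poly:] = 0"
    by (intro poly_eqI) (simp add: coeff_map_poly coeff_pCons split: nat.split)
  then show ?thesis by (simp add: jacobian_def pderiv_pCons)
qed

text \<open>
  The derivation kills \<open>F\<close> as well as \<open>\<lambda>\<close>, so it commutes with
  the substitution.
\<close>

lemma subst_lambda_jacobian: "subst_lambda F (jacobian (lift_coeffs F) w) = jacobian F (subst_lambda F w)"
proof -
  interpret s: subring_hom UNIV "subst_lambda F" by (rule subring_hom_subst_lambda)
  interpret D: derivation "jacobian F" by (rule derivation_jacobian)
  interpret E: derivation "jacobian (lift_coeffs F)" by (rule derivation_jacobian)
  have dF: "subst_lambda F (pderiv (lift_coeffs F)) = pderiv F"
    "subst_lambda F (map_poly pderiv (lift_coeffs F)) = map_poly pderiv F"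
    by (simp_all only: lift_coeffs_simps(5,6)[symmetric] subst_lambda_lift)
  show ?thesis
  proof (induction w rule: bivariate_induct)
    case (const c)
    have "map_poly (jacobian F) (map_poly (\<lambda>a. [:[:a:]:]) c) = 0"
      by (intro poly_eqI) (simp add: coeff_map_poly)
    then show ?case using D.d_poly[of "map_poly (\<lambda>a. [:[:a:]:]) c" F] by (simp add: s.h_zero subst_lambda_const)
  next
    case x
    show ?case by (simp only: subst_lambda_simps jacobian_const_y) (simp only: pderiv_pCons pderiv_0 pderiv_1 pCons_0_0 add_0_right pCons_one smult_1_left dF)
  next
    case y
    show ?case by (simp only: subst_lambda_simps jacobian_y s.h_uminus UNIV_I dF)
  next
    case (add v w)
    then show ?case by (simp add: s.h_add D.d_add E.d_add)
  next
    case (mult v w)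
    then show ?case by (simp add: s.h_add s.h_mult D.d_mult E.d_mult)
  qed
qed

text \<open>
  The substitution \<open>\<lambda> := F\<close> turns \<open>w\<close> into an element
  \<open>\<omega>\<close> of \<open>K[x,y]\<close> that the derivation kills. If \<open>\<omega>
  = u(F)\<close>, then \<open>w - u(\<lambda>)\<close> would be divisible by \<open>F -
  \<lambda>\<close>, which has larger degree in \<open>y\<close>; so \<open>w =
  u(\<lambda>)\<close>.
\<close>

lemma (in monic_in_y) decomposition_from_first_integral:
  assumes w: "minus_lambda F dvd jacobian (lift_coeffs F) w" "degree w < degree F" "\<And>u. w \<noteq> [:[:u:]:]"
  shows "\<exists>u H. degree u \<ge> 2 \<and> F = pcompose (map_poly (\<lambda>c. [:c:]) u) H"
proof (rule decomposition_from_kernel)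
  interpret s: subring_hom UNIV "subst_lambda F" by (rule subring_hom_subst_lambda)
  interpret l: subring_hom UNIV "lift_coeffs :: 'b poly poly \<Rightarrow> _" by (rule subring_hom_lift_coeffs)
  from w(1) obtain q where "jacobian (lift_coeffs F) w = minus_lambda F * q" by (elim dvdE)
  then show "jacobian F (subst_lambda F w) = 0"
    by (simp add: subst_lambda_minus_lambda s.h_mult flip: subst_lambda_jacobian)
  fix u
  show "subst_lambda F w \<noteq> pcompose (map_poly (\<lambda>c. [:c:]) u) F"
  proof
    assume eq: "subst_lambda F w = pcompose (map_poly (\<lambda>c. [:c:]) u) F"
    have "pcompose (map_poly (\<lambda>c. [:c:]) u) F = poly (map_poly (\<lambda>a. [:[:a:]:]) u) F"
      by (induction u) (simp_all add: map_poly_pCons_zero pcompose_pCons)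
    then have "subst_lambda F (w - [:[:u:]:]) = 0" using eq by (simp add: s.h_minus subst_lambda_const)
    then have "minus_lambda F dvd w - [:[:u:]:]"
      using subst_lambda_cong[of F "w - [:[:u:]:]"] by (simp add: l.h_zero)
    moreover have "degree (w - [:[:u:]:]) < degree F"
      using w(2) by (intro degree_diff_less) auto
    ultimately have "w - [:[:u:]:] = 0"
      using minus_lambda_monic[OF monic degree_pos] by (metis dvd_imp_degree_le not_le)
    then show False using w(3)[of u] by simp
  qed
qed

text \<open>
  A functional over the smaller ring carries divisibility by polynomials with coefficients in
  that ring from the larger ring down to the smaller one.
\<close>

locale linear_functional =
  fixes h :: "'a::comm_ring_1 \<Rightarrow> 'b::comm_ring_1" and \<psi> :: "'b \<Rightarrow> 'a"
  assumes h_0 [simp]: "h 0 = 0" and \<psi>_add: "\<psi> (x + y) = \<psi> x + \<psi> y" and \<psi>_scale: "\<psi> (h a * x) = a * \<psi> x"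
begin

lemma \<psi>_0 [simp]: "\<psi> 0 = 0" using \<psi>_scale[of 0 0] by simp
lemma \<psi>_diff: "\<psi> (x - y) = \<psi> x - \<psi> y"
  using \<psi>_add[of "x - y" y] by simp
lemma \<psi>_sum: "\<psi> (sum g A) = (\<Sum>x\<in>A. \<psi> (g x))"
  by (induction A rule: infinite_finite_induct) (auto simp: \<psi>_add)
lemma \<psi>_of_nat: "\<psi> (of_nat k * x) = of_nat k * \<psi> x"
  by (induction k) (simp_all add: \<psi>_add distrib_right)

lemma linear_functional_poly: "linear_functional (map_poly h) (map_poly \<psi>)"
proof
  show "map_poly \<psi> (x + y) = map_poly \<psi> x + map_poly \<psi> y" for x y
    by (intro poly_eqI) (simp add: coeff_map_poly \<psi>_add)
  show "map_poly \<psi> (map_poly h a * x) = a * map_poly \<psi> x" for a x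
    by (intro poly_eqI) (simp add: coeff_map_poly coeff_mult \<psi>_sum \<psi>_scale)
qed simp

end

lemma linear_functional_pderiv:
  fixes h :: "'a::idom \<Rightarrow> 'b::idom"
  assumes "linear_functional h \<psi>"
  shows "map_poly \<psi> (pderiv p) = pderiv (map_poly \<psi> p)"
proof -
  interpret linear_functional h \<psi> by fact
  show ?thesis by (intro poly_eqI) (simp add: coeff_map_poly coeff_pderiv \<psi>_of_nat del: of_nat_Suc)
qed

lemma linear_functional_exists:
  fixes v :: "'f::field alg_closure"
  assumes "v \<noteq> 0"
  obtains \<psi> where "linear_functional to_ac \<psi>" "\<psi> v = 1"
proof -
  interpret vector_space_pair "\<lambda>(c :: 'f) (x :: 'f alg_closure). to_ac c * x" "(*)"
    by unfold_locales (simp_all add: algebra_simps)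
  have "vs1.independent {v}" using assms by simp
  then obtain \<psi> where \<psi>: "Vector_Spaces.linear (\<lambda>c x. to_ac c * x) (*) \<psi>" "\<psi> v = 1"
    using linear_independent_extend[of "{v}" "\<lambda>_. 1"] by auto
  then have "linear_functional to_ac \<psi>"
    by unfold_locales (auto simp: linear_add linear_scale)
  then show ?thesis using that \<psi>(2) by blast
qed

lemma clear_denominators_poly:
  fixes q :: "'r::idom fract poly poly"
  obtains c p where "c \<noteq> 0" "map_poly (map_poly to_fract) p = smult [:to_fract c:] q"
proof -
  have "\<exists>c p. c \<noteq> 0 \<and> map_poly (map_poly to_fract) p = smult [:to_fract c:] q"
  proof (induction q)
    case 0
    show ?case by (intro exI[of _ 1] exI[of _ 0]) simp
  next
    case (pCons a q)
    then obtain c p where c: "c \<noteq> 0" "map_poly (map_poly to_fract) p = smult [:to_fract c:] q" by blast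
    obtain v u where uv: "v \<noteq> 0" "map_poly to_fract u = smult (to_fract v) a" by (rule clear_denominators)
    have sm: "map_poly to_fract (smult c p) = smult (to_fract c) (map_poly to_fract p)" for c :: 'r and p
      by (intro poly_eqI) (simp add: coeff_map_poly)
    have "map_poly (map_poly to_fract) (smult [:v:] p) = smult [:to_fract v:] (map_poly (map_poly to_fract) p)"
      by (intro poly_eqI) (simp add: coeff_map_poly sm)
    then have "map_poly (map_poly to_fract) (pCons (smult c u) (smult [:v:] p)) = smult [:to_fract (c * v):] (pCons a q)"
      using uv c by (simp add: map_poly_pCons_zero sm mult.commute)
    then show ?case using c uv by (intro exI[of _ "c * v"] exI) auto
  qed
  then show ?thesis using that by blast
qed

lemma jacobian_scale: "jacobian F ([:[:c:]:] * w) = [:[:c:]:] * jacobian F w"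
  by (simp only: derivation.d_mult[OF derivation_jacobian] jacobian_const mult_zero_left add_0_left)

lemma jacobian_map:
  fixes h :: "'a::idom \<Rightarrow> 'b::idom"
  assumes "subring_hom UNIV h"
  shows "map_poly (map_poly h) (jacobian F w) = jacobian (map_poly (map_poly h) F) (map_poly (map_poly h) w)"
proof -
  interpret h: subring_hom UNIV h by fact
  have hp: "subring_hom UNIV (map_poly h)" using h.subring_hom_poly by (simp add: polys_over_def)
  interpret hp: subring_hom UNIV "map_poly h" by (rule hp)
  interpret hpp: subring_hom UNIV "map_poly (map_poly h)" using hp.subring_hom_poly by (simp add: polys_over_def)
  have y: "map_poly (map_poly h) (pderiv H) = pderiv (map_poly (map_poly h) H)" for H
    by (rule pderiv_subring_hom(2)[OF hp]) (simp add: polys_over_def)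
  have "map_poly h (pderiv p) = pderiv (map_poly h p)" for p
    by (rule pderiv_subring_hom(2)[OF h.subring_hom_axioms]) (simp add: polys_over_def)
  then have x: "map_poly (map_poly h) (map_poly pderiv H) = map_poly pderiv (map_poly (map_poly h) H)" for H
    by (intro poly_eqI) (simp add: coeff_map_poly)
  show ?thesis by (simp add: jacobian_def hpp.h_minus hpp.h_mult x y)
qed

text \<open>
  Apply a functional to the coefficients of \<open>e\<close> that does not vanish at some
  coefficient of a nonconstant monomial, and clear denominators. Both the Jacobian derivation
  and the divisibility by \<open>G\<close> are defined over the smaller ring.
\<close>

lemma first_integral_descent:
  fixes F G :: "'r::idom poly poly" and e :: "'r fract alg_closure poly poly"
  assumes G: "lead_coeff G = 1" "degree G = n" "n > 0"
    and e: "map_poly (map_poly in_ac) G dvd jacobian (map_poly (map_poly in_ac) F) e" "degree e < n" "\<And>c. e \<noteq> [:[:c:]:]"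
  obtains w where "G dvd jacobian F w" "degree w < n" "\<And>u. w \<noteq> [:[:u:]:]"
proof -
  have "\<exists>j i. (j \<noteq> 0 \<or> i \<noteq> 0) \<and> coeff (coeff e j) i \<noteq> 0"
  proof (rule ccontr)
    assume *: "\<not> ?thesis"
    have "e = [:[:coeff (coeff e 0) 0:]:]"
    proof (intro poly_eqI)
      fix j i show "coeff (coeff e j) i = coeff (coeff [:[:coeff (coeff e 0) 0:]:] j) i"
        using * by (cases j; cases i) auto
    qed
    then show False using e(3) by blast
  qed
  then obtain j i where ji: "j \<noteq> 0 \<or> i \<noteq> 0" "coeff (coeff e j) i \<noteq> 0" by blast
  obtain \<psi> where \<psi>: "linear_functional to_ac \<psi>" "\<psi> (coeff (coeff e j) i) = 1"
    by (rule linear_functional_exists[OF ji(2)])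
  interpret l: linear_functional to_ac \<psi> by (rule \<psi>(1))
  interpret lp: linear_functional "map_poly to_ac" "map_poly \<psi>" by (rule l.linear_functional_poly)
  interpret lpp: linear_functional "map_poly (map_poly to_ac)" "map_poly (map_poly \<psi>)" by (rule lp.linear_functional_poly)
  define Gf where "Gf = map_poly (map_poly to_fract) G"
  define Ff where "Ff = map_poly (map_poly to_fract) F"
  have ac: "map_poly (map_poly in_ac) H = map_poly (map_poly to_ac) (map_poly (map_poly to_fract) H)" for H :: "'r poly poly"
    by (intro poly_eqI) (simp add: coeff_map_poly in_ac_def)
  have to_ac_hom: "subring_hom UNIV (to_ac :: 'r fract \<Rightarrow> _)" by unfold_locales auto
  interpret ta: subring_hom UNIV "to_ac :: 'r fract \<Rightarrow> _" by (rule to_ac_hom)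
  have tap_hom: "subring_hom UNIV (map_poly (to_ac :: 'r fract \<Rightarrow> _))" using ta.subring_hom_poly by (simp add: polys_over_def)
  have to_fract_hom: "subring_hom UNIV (to_fract :: 'r \<Rightarrow> _)" by unfold_locales auto
  interpret tf: subring_hom UNIV "to_fract :: 'r \<Rightarrow> _" by (rule to_fract_hom)
  have tfp_hom: "subring_hom UNIV (map_poly (to_fract :: 'r \<Rightarrow> _))" using tf.subring_hom_poly by (simp add: polys_over_def)
  interpret tfp: subring_hom UNIV "map_poly (to_fract :: 'r \<Rightarrow> _)" by (rule tfp_hom)
  interpret tfpp: subring_hom UNIV "map_poly (map_poly (to_fract :: 'r \<Rightarrow> _))" using tfp.subring_hom_poly by (simp add: polys_over_def)
  have pd_y: "pderiv (map_poly (map_poly to_ac) H) = map_poly (map_poly to_ac) (pderiv H)" for H :: "'r fract poly poly"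
    using pderiv_subring_hom(2)[OF tap_hom, of H] by (simp add: polys_over_def)
  have pd_x: "map_poly pderiv (map_poly (map_poly to_ac) H) = map_poly (map_poly to_ac) (map_poly pderiv H)" for H :: "'r fract poly poly"
    using pderiv_subring_hom(2)[OF to_ac_hom] by (intro poly_eqI) (simp add: coeff_map_poly polys_over_def)
  define w' where "w' = map_poly (map_poly \<psi>) e"
  have \<psi>_y: "map_poly (map_poly \<psi>) (pderiv e) = pderiv w'"
    unfolding w'_def by (rule linear_functional_pderiv[OF lp.linear_functional_axioms])
  have \<psi>_x: "map_poly (map_poly \<psi>) (map_poly pderiv e) = map_poly pderiv w'"
    unfolding w'_def using linear_functional_pderiv[OF \<psi>(1)] by (intro poly_eqI) (simp add: coeff_map_poly)
  have "map_poly (map_poly \<psi>) (jacobian (map_poly (map_poly to_ac) Ff) e) = jacobian Ff w'"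
    unfolding jacobian_def pd_y pd_x lpp.\<psi>_diff lpp.\<psi>_scale \<psi>_y \<psi>_x ..
  moreover obtain b where "jacobian (map_poly (map_poly to_ac) Ff) e = map_poly (map_poly to_ac) Gf * b"
    using e(1) unfolding ac Ff_def[symmetric] Gf_def[symmetric] by (elim dvdE)
  ultimately have w'_dvd: "Gf dvd jacobian Ff w'" by (metis lpp.\<psi>_scale dvd_triv_left)
  obtain c w where c: "c \<noteq> 0" "map_poly (map_poly to_fract) w = smult [:to_fract c:] w'" by (rule clear_denominators_poly)
  have deg_tf: "degree (map_poly (map_poly to_fract) H) = degree H" for H :: "'r poly poly"
    by (intro degree_map_poly_inj map_poly_eq_0_inj) simp
  have "Gf dvd jacobian Ff (map_poly (map_poly to_fract) w)"
    using w'_dvd jacobian_scale[of Ff "to_fract c" w'] by (simp add: c(2) dvd_smult)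
  also have "jacobian Ff (map_poly (map_poly to_fract) w) = map_poly (map_poly to_fract) (jacobian F w)"
    unfolding Ff_def by (rule jacobian_map[OF to_fract_hom, symmetric])
  finally have dvd: "Gf dvd map_poly (map_poly to_fract) (jacobian F w)" .
  obtain q r where qr: "jacobian F w = q * G + r" "degree r < degree G" using monic_division G by metis
  have "Gf dvd map_poly (map_poly to_fract) r"
    using dvd by (simp add: qr(1) tfpp.h_add tfpp.h_mult Gf_def dvd_add_right_iff)
  moreover have "degree (map_poly (map_poly to_fract) r) < degree Gf" using qr(2) by (simp add: Gf_def deg_tf)
  ultimately have "map_poly (map_poly to_fract) r = 0" by (metis dvd_imp_degree_le not_le)
  then have "r = 0" by (auto simp: poly_eq_iff coeff_map_poly)
  then have "G dvd jacobian F w" using qr(1) by simp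
  moreover have "degree w < n"
  proof -
    have "degree (map_poly (map_poly to_fract) w) \<le> degree e"
      unfolding c(2) w'_def by (intro order.trans[OF degree_smult_le] degree_map_poly_le)
    then show ?thesis using e(2) by (simp add: deg_tf)
  qed
  moreover have "w \<noteq> [:[:u:]:]" for u
  proof
    assume w: "w = [:[:u:]:]"
    have "coeff (coeff w j) i = 0" using ji(1) by (cases j; cases i) (simp_all add: w)
    moreover have "to_fract (coeff (coeff w j) i) = to_fract c * \<psi> (coeff (coeff e j) i)"
      using arg_cong[OF c(2), of "\<lambda>p. coeff (coeff p j) i"] by (simp add: coeff_map_poly w'_def)
    ultimately show False using c(1) \<psi>(2) by simp
  qed
  ultimately show ?thesis using that by blast
qed

text \<open>
  Modulo \<open>G\<close> the derivation \<open>D\<close> is well defined, and \<open>e\<^sup>2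
  = e\<close> gives \<open>(2e - 1) D(e) = 0\<close>. As \<open>(2e - 1)\<^sup>2 = 1\<close>,
  also \<open>D(e) = 0\<close>.
\<close>

lemma idempotent_first_integral:
  assumes G: "G = F - [:[:c:]:]" and e: "G dvd e ^ 2 - e"
  shows "G dvd jacobian F e"
proof -
  interpret D: derivation "jacobian F" by (rule derivation_jacobian)
  have DG: "jacobian F G = 0" unfolding G by (simp only: D.d_minus jacobian_self jacobian_const diff_0_right)
  obtain a where a: "e ^ 2 - e = G * a" using e by (elim dvdE)
  have "jacobian F (e ^ 2 - e) = G * jacobian F a" unfolding a by (simp add: D.d_mult DG)
  moreover have "jacobian F (e ^ 2 - e) = (e + e - 1) * jacobian F e"
    by (simp add: D.d_minus power2_eq_square D.d_mult algebra_simps)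
  ultimately have "(e + e - 1) * ((e + e - 1) * jacobian F e) = (e + e - 1) * (G * jacobian F a)" by simp
  moreover have "(e + e - 1) * ((e + e - 1) * jacobian F e) = 4 * (e ^ 2 - e) * jacobian F e + jacobian F e"
    by (simp add: power2_eq_square algebra_simps)
  ultimately have "jacobian F e = G * ((e + e - 1) * jacobian F a - 4 * a * jacobian F e)"
    unfolding a by (simp add: algebra_simps)
  then show ?thesis by (metis dvd_triv_left)
qed

section \<open>Reduction of indecomposable polynomials\<close>

lemma decomposition_map:
  fixes h :: "'a::idom \<Rightarrow> 'b::idom"
  assumes "subring_hom UNIV h"
  shows "map_poly (map_poly h) (pcompose (map_poly (\<lambda>c. [:c:]) u) H) =
    pcompose (map_poly (\<lambda>c. [:c:]) (map_poly h u)) (map_poly (map_poly h) H)"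
proof -
  interpret h: subring_hom UNIV h by fact
  interpret hp: subring_hom UNIV "map_poly h" using h.subring_hom_poly by (simp add: polys_over_def)
  interpret hpp: subring_hom UNIV "map_poly (map_poly h)" using hp.subring_hom_poly by (simp add: polys_over_def)
  show ?thesis
    by (induction u) (simp_all add: map_poly_pCons_zero pcompose_pCons hpp.h_add hpp.h_mult)
qed

lemma finite_exponents:
  fixes F :: "'a::zero poly poly"
  shows "finite {i + j | i j. coeff (coeff F j) i \<noteq> 0}"
proof -
  have "{i + j | i j. coeff (coeff F j) i \<noteq> 0} \<subseteq> (\<lambda>(j, i). i + j) ` Sigma {..degree F} (\<lambda>j. {..degree (coeff F j)})"
  proof
    fix s assume "s \<in> {i + j | i j. coeff (coeff F j) i \<noteq> 0}"
    then obtain i j where ij: "s = i + j" "coeff (coeff F j) i \<noteq> 0" by blast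
    then have "coeff F j \<noteq> 0" by auto
    then have "j \<le> degree F" "i \<le> degree (coeff F j)" using ij(2) by (auto intro: le_degree)
    then show "s \<in> (\<lambda>(j, i). i + j) ` Sigma {..degree F} (\<lambda>j. {..degree (coeff F j)})"
      by (intro image_eqI[of _ _ "(j, i)"]) (auto simp: ij)
  qed
  then show ?thesis by (rule finite_subset) auto
qed

lemma total_degree_ge_degree:
  assumes "lead_coeff F = 1"
  shows "total_degree F \<ge> degree F"
  unfolding total_degree_def
proof (rule Max_ge)
  show "finite (insert 0 {i + j | i j. coeff (coeff F j) i \<noteq> 0})" using finite_exponents[of F] by simp
  have "degree F = 0 + degree F \<and> coeff (coeff F (degree F)) 0 \<noteq> 0" using assms by simp
  then show "degree F \<in> insert 0 {i + j | i j. coeff (coeff F j) i \<noteq> 0}" by blast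
qed

lemma root_algebraic:
  fixes h :: "'b::alg_closed_field \<Rightarrow> 'q::field"
  assumes "subring_hom UNIV h" "\<And>c. h c = 0 \<longleftrightarrow> c = 0" "p \<noteq> 0" "poly (map_poly h p) t = 0"
  shows "t \<in> range h"
  using assms(3,4)
proof (induction "degree p" arbitrary: p)
  interpret h: subring_hom UNIV h by fact
  {
    case 0
    then obtain c where "p = [:c:]" by (metis degree_eq_zeroE)
    then show ?case using 0 assms(2) by (simp add: map_poly_pCons_zero)
  next
    case (Suc d)
    interpret hp: subring_hom UNIV "map_poly h" using h.subring_hom_poly by (simp add: polys_over_def)
    obtain c where "poly p c = 0" using alg_closed_imp_poly_has_root[of p] Suc(2) by auto
    then obtain q where q: "p = [:- c, 1:] * q" by (auto simp: poly_eq_0_iff_dvd elim: dvdE)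
    have q0: "q \<noteq> 0" using q Suc.prems by auto
    have "degree p = Suc (degree q)" unfolding q using q0 by (subst degree_mult_eq) auto
    then have d: "d = degree q" using Suc(2) by simp
    have "map_poly h p = [:- h c, 1:] * map_poly h q"
      unfolding q hp.h_mult[OF UNIV_I UNIV_I] by (simp add: map_poly_pCons_zero map_poly_1 h.h_uminus)
    then have "poly (map_poly h p) t = (t - h c) * poly (map_poly h q) t" by (simp only: poly_mult) simp
    then have "(t - h c) * poly (map_poly h q) t = 0" using Suc.prems(2) by simp
    then show ?case using Suc(1)[OF d q0] by auto
  }
qed

text \<open>
  Write \<open>u - m = (z - t) v(z)\<close>. Then \<open>v(t) = u'(t) \<noteq> 0\<close>, so
  \<open>z - t\<close> and \<open>v\<close> are coprime, and \<open>e = v(H) / v(t)\<close> is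
  congruent to 0 modulo \<open>v(H)\<close> and to 1 modulo \<open>H - t\<close>.
\<close>

lemma idempotent_of_decomposition:
  fixes u :: "'q::field poly" and H :: "'q poly poly"
  assumes u: "degree u \<ge> 2" "poly u t = m" "poly (pderiv u) t \<noteq> 0" and H: "degree H > 0"
    and G: "G = pcompose (map_poly (\<lambda>c. [:c:]) u) H - [:[:m:]:]"
  obtains e where "G dvd e ^ 2 - e" "\<not> G dvd e" "\<not> G dvd e - 1"
proof -
  define s where "s p = pcompose (map_poly (\<lambda>c. [:c:]) p) H" for p
  interpret c: subring_hom UNIV "\<lambda>c :: 'q. [:c:]" by unfold_locales (auto simp: pCons_one)
  interpret cp: subring_hom UNIV "map_poly (\<lambda>c :: 'q. [:c:])" using c.subring_hom_poly by (simp add: polys_over_def)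
  interpret s: subring_hom UNIV s
    by unfold_locales (auto simp: s_def cp.h_add cp.h_mult cp.h_uminus pcompose_add pcompose_mult pcompose_1)
  have s_const: "s [:a:] = [:[:a:]:]" for a by (simp add: s_def map_poly_pCons_zero)
  have deg_s: "degree (s p) = degree p * degree H" for p
    unfolding s_def degree_pcompose by (subst degree_map_poly_inj) auto
  have "poly (u - [:m:]) t = 0" using u by simp
  then obtain v where v: "u - [:m:] = [:- t, 1:] * v" unfolding poly_eq_0_iff_dvd by (elim dvdE)
  have Gs: "G = s [:- t, 1:] * s v"
  proof -
    have "G = s u - [:[:m:]:]" by (simp only: G s_def)
    also have "\<dots> = s (u - [:m:])" by (simp only: s.h_minus UNIV_I s_const)
    finally have "G = s (u - [:m:])" .
    then show ?thesis by (simp only: v s.h_mult UNIV_I)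
  qed
  have "pderiv u = pderiv (u - [:m:])" by (simp add: pderiv_diff pderiv_pCons)
  also have "\<dots> = [:- t, 1:] * pderiv v + v * pderiv [:- t, 1:]" unfolding v by (rule pderiv_mult)
  finally have "poly (pderiv u) t = poly v t" by (simp add: pderiv_pCons)
  then have vt: "poly v t \<noteq> 0" using u by simp
  have dv: "degree v \<ge> 1"
  proof -
    have "degree (u - [:m:]) = degree u" unfolding diff_conv_add_uminus using u(1) by (intro degree_add_eq_left) simp
    moreover have "v \<noteq> 0" using vt by auto
    then have "degree (u - [:m:]) = Suc (degree v)" unfolding v by (subst degree_mult_eq) auto
    ultimately show ?thesis using u(1) by simp
  qed
  define e where "e = s (smult (inverse (poly v t)) v)"
  have ev: "smult (inverse (poly v t)) v = [:inverse (poly v t):] * v" by simp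
  have unit: "[:[:poly v t:]:] * [:[:inverse (poly v t):]:] = 1" using vt by (simp add: pCons_one)
  have e: "e = [:[:inverse (poly v t):]:] * s v" unfolding e_def ev by (simp only: s.h_mult UNIV_I s_const)
  have e1: "e - 1 = [:[:inverse (poly v t):]:] * (s v - [:[:poly v t:]:])"
    unfolding e right_diff_distrib using unit by (simp add: mult.commute)
  have sv: "s v = [:[:poly v t:]:] * e" unfolding e mult.assoc[symmetric] unit by simp
  have "poly (v - [:poly v t:]) t = 0" by simp
  then obtain q where q: "v - [:poly v t:] = [:- t, 1:] * q" unfolding poly_eq_0_iff_dvd by (elim dvdE)
  have sq: "s v - [:[:poly v t:]:] = s [:- t, 1:] * s q"
    using arg_cong[OF q, of s] by (simp only: s.h_minus s.h_mult UNIV_I s_const)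
  have G0: "degree G > 0"
  proof -
    have "degree G = degree (s ([:- t, 1:] * v))" by (simp only: Gs s.h_mult UNIV_I)
    also have "\<dots> = degree (u - [:m:]) * degree H" unfolding deg_s v ..
    also have "degree (u - [:m:]) = Suc (degree v)" unfolding v using vt by (subst degree_mult_eq) auto
    finally show ?thesis using H by simp
  qed
  have nz: "s v \<noteq> 0" "s [:- t, 1:] \<noteq> 0" using G0 Gs by auto
  show ?thesis
  proof (rule that)
    have "e ^ 2 - e = e * (e - 1)" by (simp add: power2_eq_square algebra_simps)
    also have "\<dots> = G * ([:[:inverse (poly v t):]:] * [:[:inverse (poly v t):]:] * s q)"
      unfolding e1 sq Gs by (subst e) (simp only: mult_ac)
    finally show "G dvd e ^ 2 - e" by (rule dvdI)
    show "\<not> G dvd e"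
    proof
      assume "G dvd e"
      then have "G dvd s v" unfolding sv by (rule dvd_mult)
      then have "degree G \<le> degree (s v)" using nz by (intro dvd_imp_degree_le)
      moreover have "degree G = degree (s [:- t, 1:]) + degree (s v)" unfolding Gs using nz by (intro degree_mult_eq)
      ultimately show False using H by (simp add: deg_s)
    qed
    show "\<not> G dvd e - 1"
    proof
      assume "G dvd e - 1"
      then have "G dvd [:[:poly v t:]:] * (e - 1)" by (rule dvd_mult)
      also have "[:[:poly v t:]:] * (e - 1) = s v - [:[:poly v t:]:]" by (simp only: sv right_diff_distrib mult_1_right)
      finally have "s v dvd s v - [:[:poly v t:]:]" unfolding Gs by (rule dvd_mult_right)
      from dvd_diff[OF dvd_refl this] have "s v dvd [:[:poly v t:]:]" by simp
      then have "degree (s v) \<le> degree [:[:poly v t:]:]" using vt by (intro dvd_imp_degree_le) auto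
      then show False using dv H by (simp add: deg_s)
    qed
  qed
qed

context dedekind_prime
begin

text \<open>
  The decomposition gives an idempotent on the generic fibre of the reduction: choose
  \<open>t\<close> with \<open>u(t) = \<lambda>\<close>. As \<open>\<lambda>\<close> is
  transcendental over the residue field, \<open>t\<close> is transcendental as well, and it is
  not a root of \<open>u'\<close>, which is nonzero since the degree of \<open>u\<close> divides
  that of \<open>F\<close>. The idempotent lifts, and the lift gives a decomposition.
\<close>

lemma decomposition_of_reduction_lifts:
  fixes F :: "'a poly poly"
  assumes char_0: "CHAR('a fract) = 0" and F: "lead_coeff F = 1" "degree F > 0"
    and tame: "\<And>i. 0 < i \<Longrightarrow> i \<le> degree F \<Longrightarrow> of_nat i \<noteq> (0 :: 'k)"
    and Delta0: "map_poly \<pi> (Delta0 F) \<noteq> 0"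
    and u: "degree u \<ge> 2" "map_poly (map_poly (\<lambda>a. to_ac (\<pi> a))) F = pcompose (map_poly (\<lambda>c. [:c:]) u) H"
  obtains U W where "degree U \<ge> 2"
    "map_poly (map_poly to_fract) F = pcompose (map_poly (\<lambda>c. [:c:]) U) W"
proof -
  define n where "n = degree F"
  obtain T \<phi> where pl: "place T \<phi>" and T: "\<And>p :: 'a poly. in_ac p \<in> T" and \<phi>: "\<And>p. \<phi> (in_ac p) = \<rho> p"
    by (rule place_extending_reduction) blast
  interpret place T \<phi> by (rule pl)
  interpret ia: subring_hom UNIV "in_ac :: 'a poly \<Rightarrow> _" by (rule subring_hom_in_ac)
  have iap: "subring_hom UNIV (map_poly (in_ac :: 'a poly \<Rightarrow> _))" using ia.subring_hom_poly by (simp add: polys_over_def)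
  interpret iap: subring_hom UNIV "map_poly (in_ac :: 'a poly \<Rightarrow> _)" by (rule iap)
  interpret iapp: subring_hom UNIV "map_poly (map_poly (in_ac :: 'a poly \<Rightarrow> _))" using iap.subring_hom_poly by (simp add: polys_over_def)
  interpret \<pi>: subring_hom UNIV \<pi> by (rule subring_hom_\<pi>)
  define G where "G = map_poly (map_poly in_ac) (minus_lambda F)"
  note ml = minus_lambda_monic[OF F]
  have G: "lead_coeff G = 1" "degree G = n"
  proof -
    show "degree G = n"
      unfolding G_def n_def ml(1)[symmetric] by (intro degree_map_poly_inj map_poly_eq_0_inj) simp
    then show "lead_coeff G = 1" using ml by (simp add: G_def n_def coeff_map_poly map_poly_1)
  qed

  define \<kappa> :: "'k alg_closure \<Rightarrow> 'k alg_closure poly fract alg_closure" where "\<kappa> c = in_ac [:c:]" for c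
  have \<kappa>: "subring_hom UNIV \<kappa>"
  proof
    fix a b :: "'k alg_closure"
    have "[:a * b:] = [:a:] * [:b:]" "[:a + b:] = [:a:] + [:b:]" by simp_all
    then show "\<kappa> (a + b) = \<kappa> a + \<kappa> b" "\<kappa> (a * b) = \<kappa> a * \<kappa> b" unfolding \<kappa>_def by (simp_all only: in_ac_simps)
  qed (auto simp: \<kappa>_def pCons_one)
  interpret \<kappa>: subring_hom UNIV \<kappa> by (rule \<kappa>)
  have \<kappa>_0: "\<kappa> c = 0 \<longleftrightarrow> c = 0" for c by (simp add: \<kappa>_def)
  have \<kappa>p: "subring_hom UNIV (map_poly \<kappa>)" using \<kappa>.subring_hom_poly by (simp add: polys_over_def)
  interpret \<kappa>p: subring_hom UNIV "map_poly \<kappa>" by (rule \<kappa>p)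
  have char_i: "of_nat i \<noteq> (0 :: 'k alg_closure)" if "0 < i" "i \<le> n" for i
    using tame[of i] that by (metis n_def to_ac_of_nat to_ac_eq_0_iff)

  define m where "m = (in_ac [:0, 1:] :: 'k alg_closure poly fract alg_closure)"
  have \<rho>_const: "\<rho> [:a:] = \<kappa> (to_ac (\<pi> a))" for a by (simp add: \<rho>_def \<kappa>_def map_poly_pCons_zero)
  have \<rho>_lambda: "\<rho> [:0, 1:] = m" by (simp add: \<rho>_def m_def map_poly_pCons_zero map_poly_1)
  have G': "map_poly (map_poly \<phi>) G = pcompose (map_poly (\<lambda>c. [:c:]) (map_poly \<kappa> u)) (map_poly (map_poly \<kappa>) H) - [:[:m:]:]"
  proof -
    interpret \<rho>: subring_hom UNIV \<rho> by (rule subring_hom_\<rho>)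
    interpret \<rho>p: subring_hom UNIV "map_poly \<rho>" using \<rho>.subring_hom_poly by (simp add: polys_over_def)
    interpret \<rho>pp: subring_hom UNIV "map_poly (map_poly \<rho>)" using \<rho>p.subring_hom_poly by (simp add: polys_over_def)
    have "map_poly (map_poly \<phi>) G = map_poly (map_poly \<rho>) (minus_lambda F)"
      unfolding G_def by (intro poly_eqI) (simp add: coeff_map_poly \<phi>)
    also have "\<dots> = map_poly (map_poly \<rho>) (lift_coeffs F) - map_poly (map_poly \<rho>) [:[:[:0, 1:]:]:]"
      by (simp add: minus_lambda_lift \<rho>pp.h_minus)
    also have "map_poly (map_poly \<rho>) [:[:[:0, 1:]:]:] = [:[:m:]:]"
      using \<rho>_lambda by (simp add: map_poly_pCons_zero)
    also have "map_poly (map_poly \<rho>) (lift_coeffs F) = map_poly (map_poly \<kappa>) (map_poly (map_poly (\<lambda>a. to_ac (\<pi> a))) F)"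
      unfolding lift_coeffs_def by (intro poly_eqI) (simp add: coeff_map_poly \<rho>_const)
    also have "\<dots> = pcompose (map_poly (\<lambda>c. [:c:]) (map_poly \<kappa> u)) (map_poly (map_poly \<kappa>) H)"
      unfolding u(2) by (rule decomposition_map[OF \<kappa>])
    finally show ?thesis .
  qed
  have deg_u: "degree (map_poly \<kappa> u) = degree u" using \<kappa>_0 by (rule degree_map_poly_inj)
  have deg_H: "degree (map_poly (map_poly \<kappa>) H) = degree H"
    using \<kappa>_0 by (intro degree_map_poly_inj map_poly_eq_0_inj)
  have n: "n = degree u * degree H"
  proof -
    have "degree (map_poly (map_poly (\<lambda>a. to_ac (\<pi> a))) F) = n"
      unfolding n_def using F by (intro map_poly_degree_eq) (simp add: map_poly_1)
    then show ?thesis unfolding u(2) degree_pcompose by (subst (asm) degree_map_poly_inj) auto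
  qed
  obtain t where t: "poly (map_poly \<kappa> u) t = m"
  proof -
    have "degree (map_poly \<kappa> u - [:m:]) = degree (map_poly \<kappa> u)"
      unfolding diff_conv_add_uminus using u(1) deg_u by (intro degree_add_eq_left) simp
    then have "degree (map_poly \<kappa> u - [:m:]) > 0" using u(1) deg_u by simp
    then obtain t where "poly (map_poly \<kappa> u - [:m:]) t = 0" using alg_closed_imp_poly_has_root by blast
    then show ?thesis using that by simp
  qed
  have "poly (pderiv (map_poly \<kappa> u)) t \<noteq> 0"
  proof
    assume "poly (pderiv (map_poly \<kappa> u)) t = 0"
    then have "poly (map_poly \<kappa> (pderiv u)) t = 0"
      using pderiv_subring_hom(2)[OF \<kappa>, of u] by (simp add: polys_over_def)
    moreover have "pderiv u \<noteq> 0"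
    proof
      assume "pderiv u = 0"
      then have "coeff (pderiv u) (degree u - 1) = 0" by simp
      then have "of_nat (degree u) * lead_coeff u = 0" using u(1) by (simp add: coeff_pderiv)
      moreover have "degree u \<le> n" using n F(2) n_def by (cases "degree H") auto
      then have "of_nat (degree u) \<noteq> (0 :: 'k alg_closure)" using char_i u(1) by simp
      ultimately show False using u(1) by auto
    qed
    ultimately have "t \<in> range \<kappa>" by (intro root_algebraic[OF \<kappa> \<kappa>_0])
    then obtain c where "t = \<kappa> c" by blast
    then have "m = \<kappa> (poly u c)" using t \<kappa>.h_poly[of u c] by (simp add: polys_over_def)
    then have "in_ac ([:0, 1:] - [:poly u c:]) = (0 :: 'k alg_closure poly fract alg_closure)"
      by (simp only: m_def \<kappa>_def in_ac_simps(6)) simp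
    then show False by simp
  qed
  then obtain e' where e': "map_poly (map_poly \<phi>) G dvd e' ^ 2 - e'" "\<not> map_poly (map_poly \<phi>) G dvd e'"
    "\<not> map_poly (map_poly \<phi>) G dvd e' - 1"
    using idempotent_of_decomposition[OF _ t _ _ G'] u(1) deg_u deg_H n F(2) n_def
    by (metis gr_zeroI mult_0_right)

  define D where "D = resultant_sub n (n - 1) (minus_lambda F) (pderiv (minus_lambda F))"
  have Delta: "Delta F = (-1) ^ (n * (n - 1) div 2) * D"
    using discriminant_eq[OF ml(1) F(2)] by (simp add: Delta_def ml(2) n_def D_def)
  then have "Delta F = D \<or> Delta F = - D" by (cases "even (n * (n - 1) div 2)") auto
  then have lcD: "Delta0 F = lead_coeff D \<or> Delta0 F = - lead_coeff D" unfolding Delta0_def by auto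
  have resG: "resultant_sub n (n - 1) G (pderiv G) = map_poly in_ac D"
  proof -
    have "pderiv G = map_poly (map_poly in_ac) (pderiv (minus_lambda F))"
      unfolding G_def by (rule pderiv_subring_hom(2)[OF iap, symmetric]) (simp add: polys_over_def)
    then show ?thesis unfolding D_def G_def by (simp add: iap.h_resultant_sub polys_over_def)
  qed
  have lc: "lead_coeff (resultant_sub n (n - 1) G (pderiv G)) = in_ac (lead_coeff D)"
    unfolding resG by (simp add: degree_map_poly_inj coeff_map_poly)
  have disc: "\<phi> (lead_coeff (resultant_sub n (n - 1) G (pderiv G))) \<noteq> 0"
  proof -
    interpret \<pi>p: subring_hom UNIV "map_poly \<pi>" using \<pi>.subring_hom_poly by (simp add: polys_over_def)
    have "map_poly \<pi> (lead_coeff D) \<noteq> 0" using Delta0 lcD by (auto simp: \<pi>p.h_uminus)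
    then show ?thesis by (simp only: lc \<phi> \<rho>_eq_0 not_False_eq_True)
  qed
  interpret good_reduction T \<phi> n G
  proof
    show "G \<in> polys_over (polys_over T)" using T by (simp add: G_def polys_over_def coeff_map_poly)
    show "n > 0" using F(2) by (simp add: n_def)
    show "\<phi> ` T = UNIV" by (rule residue_field_surj[OF pl T \<phi>])
    show "of_nat i \<noteq> (0 :: 'k alg_closure poly fract alg_closure)" if "0 < i" "i \<le> n" for i
      using char_i[OF that] \<kappa>_0[of "of_nat i"] by simp
    show "a = 0" if "\<delta> \<in> T" "\<phi> \<delta> = 0" "\<And>k. a \<in> multiples (\<delta> ^ k) T" for \<delta> a
      by (rule separated[OF pl T \<phi> that])
  qed (use G disc in auto)
  obtain e where e: "degree e < n" "G dvd e ^ 2 - e" "\<not> G dvd e" "\<not> G dvd e - 1"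
    by (rule idempotent_lifting[OF e'])

  have GF: "G = map_poly (map_poly in_ac) (lift_coeffs F) - [:[:in_ac [:0, 1:]:]:]"
    unfolding G_def minus_lambda_lift iapp.h_minus[OF UNIV_I UNIV_I] by (simp add: map_poly_pCons_zero)
  have "e \<noteq> [:[:c:]:]" for c
  proof
    assume c: "e = [:[:c:]:]"
    have "e ^ 2 - e = [:[:c ^ 2 - c:]:]" unfolding c by (simp add: power2_eq_square)
    then have "G dvd [:[:c ^ 2 - c:]:]" using e(2) by simp
    then have "c ^ 2 - c = 0" using dvd_imp_degree_le[of G "[:[:c ^ 2 - c:]:]"] G(2) n_pos by auto
    then have "c * (c - 1) = 0" by (simp add: power2_eq_square algebra_simps)
    then have "e = 0 \<or> e - 1 = 0" by (auto simp: c pCons_one)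
    then show False using e(3,4) by auto
  qed
  then obtain w where w: "minus_lambda F dvd jacobian (lift_coeffs F) w" "degree w < n" "\<And>u. w \<noteq> [:[:u:]:]"
    using first_integral_descent[of "minus_lambda F" n "lift_coeffs F" e] ml n_pos n_def
      idempotent_first_integral[OF GF e(2)] e(1) unfolding G_def by metis

  define FK where "FK = map_poly (map_poly to_fract) F"
  interpret tf: subring_hom UNIV "to_fract :: 'a \<Rightarrow> _" by unfold_locales auto
  have tfp: "subring_hom UNIV (map_poly (to_fract :: 'a \<Rightarrow> _))" using tf.subring_hom_poly by (simp add: polys_over_def)
  interpret tfp: subring_hom UNIV "map_poly (to_fract :: 'a \<Rightarrow> _)" by (rule tfp)
  interpret tfpp: subring_hom UNIV "map_poly (map_poly (to_fract :: 'a \<Rightarrow> _))" using tfp.subring_hom_poly by (simp add: polys_over_def)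
  interpret tfppp: subring_hom UNIV "map_poly (map_poly (map_poly (to_fract :: 'a \<Rightarrow> _)))" using tfpp.subring_hom_poly by (simp add: polys_over_def)
  let ?m = "map_poly (map_poly (map_poly (to_fract :: 'a \<Rightarrow> _)))"
  have lift: "?m (lift_coeffs F) = lift_coeffs FK"
    unfolding lift_coeffs_def FK_def by (intro poly_eqI) (simp add: coeff_map_poly map_poly_pCons_zero)
  have "?m (minus_lambda F) = lift_coeffs FK - ?m [:[:[:0, 1:]:]:]"
    unfolding minus_lambda_lift tfppp.h_minus[OF UNIV_I UNIV_I] lift ..
  then have minus: "?m (minus_lambda F) = minus_lambda FK"
    by (simp add: minus_lambda_lift map_poly_pCons_zero map_poly_1)
  interpret FK: monic_in_y FK
  proof
    show "degree FK > 0" unfolding FK_def using F(2) by (subst degree_map_poly_inj) (auto intro: map_poly_eq_0_inj)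
    show "lead_coeff FK = 1" unfolding FK_def using F(1)
      by (subst degree_map_poly_inj) (auto intro: map_poly_eq_0_inj simp: coeff_map_poly map_poly_1)
  qed (rule char_0)
  have "\<exists>u H. degree u \<ge> 2 \<and> FK = pcompose (map_poly (\<lambda>c. [:c:]) u) H"
  proof (rule FK.decomposition_from_first_integral)
    from w(1) obtain q where "jacobian (lift_coeffs F) w = minus_lambda F * q" by (elim dvdE)
    from arg_cong[OF this, of ?m] show "minus_lambda FK dvd jacobian (lift_coeffs FK) (?m w)"
      by (simp add: jacobian_map[OF tfp] tfppp.h_mult lift minus)
    show "degree (?m w) < degree FK"
      using w(2) unfolding FK_def n_def
      by (subst degree_map_poly_inj, (intro map_poly_eq_0_inj, simp)[1], subst degree_map_poly_inj, (intro map_poly_eq_0_inj, simp)[1])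
    fix u
    show "?m w \<noteq> [:[:u:]:]"
    proof
      assume u: "?m w = [:[:u:]:]"
      have *: "map_poly to_fract (coeff (coeff w j) i) = coeff (coeff [:[:u:]:] j) i" for i j
        using arg_cong[OF u, of "\<lambda>p. coeff (coeff p j) i"] by (simp add: coeff_map_poly)
      have "coeff (coeff w j) i = 0" if "j \<noteq> 0 \<or> i \<noteq> 0" for i j
      proof -
        have "map_poly to_fract (coeff (coeff w j) i) = 0" using *[of j i] that by (cases j; cases i) auto
        then show ?thesis by (simp add: map_poly_eq_0_inj)
      qed
      then have "coeff (coeff w j) i = coeff (coeff [:[:coeff (coeff w 0) 0:]:] j) i" for i j
        by (cases j; cases i) auto
      then have "w = [:[:coeff (coeff w 0) 0:]:]" by (intro poly_eqI[of w] poly_eqI[of "coeff w _"])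
      then show False using w(3) by blast
    qed
  qed
  then show ?thesis using that unfolding FK_def by blast
qed

end

theorem theorem3p1:
  fixes F :: "'a::idom poly poly"
    and P :: "'a set"
    and \<pi> :: "'a \<Rightarrow> 'k::field"
    and Delta_red :: "'a poly poly"
    and d p :: nat
  assumes "dedekind_domain TYPE('a)"
    and "CHAR('a fract) = 0"
    and "primeideal P (ring_of_type_algebra :: 'a ring)" and "P \<noteq> {0}"
    and "residue_map P \<pi>"
    and "CHAR('k) = p" and "p > 0"
    and "total_degree F = d" and "d \<ge> 1"
    and "lead_coeff F = 1"
    and "indecomposable (map_poly (map_poly (\<lambda>a. to_ac (to_fract a))) F)"
    and "is_Delta_red F Delta_red"
    and "map_poly \<pi> (Delta0 F) * map_poly \<pi> (discriminant Delta_red) \<noteq> 0"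
    and "p > degree F"
  shows "indecomposable (map_poly (map_poly (\<lambda>a. to_ac (\<pi> a))) F)"
proof -
  interpret dedekind_prime P \<pi>
    using assms(1,3,4,5) by (intro dedekind_prime.intro)
  have n: "degree F > 0"
  proof (rule ccontr)
    assume "\<not> degree F > 0"
    then have "F = 1" using assms(10) by (simp add: monic_degree_0)
    then have "total_degree F = 0" by (simp add: total_degree_def)
    then show False using assms(8,9) by simp
  qed
  let ?F = "map_poly (map_poly (\<lambda>a. to_ac (\<pi> a))) F"
  have pi0: "\<pi> 0 = 0" "\<pi> 1 = 1" using \<pi>_hom(1) \<pi>_kernel P_closed(1) by auto
  have "degree ?F = degree F" using assms(10) pi0 by (intro map_poly_degree_eq) (simp add: map_poly_1)
  moreover from this have "lead_coeff ?F = 1" using assms(10) pi0 by (simp add: coeff_map_poly map_poly_1)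
  ultimately have "total_degree ?F > 0" using total_degree_ge_degree[of ?F] n by simp
  moreover have False if u: "degree u \<ge> 2" "?F = pcompose (map_poly (\<lambda>c. [:c:]) u) H" for u H
  proof -
    have tame: "of_nat i \<noteq> (0 :: 'k)" if "0 < i" "i \<le> degree F" for i
      using that assms(6,14) by (auto simp: of_nat_eq_0_iff_char_dvd dest: dvd_imp_le)
    have "map_poly \<pi> (Delta0 F) \<noteq> 0" using assms(13) by auto
    then obtain U W where UW: "degree U \<ge> 2" "map_poly (map_poly to_fract) F = pcompose (map_poly (\<lambda>c. [:c:]) U) W"
      using decomposition_of_reduction_lifts[OF assms(2,10) n tame _ u] by blast
    have "map_poly (map_poly (\<lambda>a. to_ac (to_fract a))) F = map_poly (map_poly to_ac) (map_poly (map_poly to_fract) F)"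
      by (intro poly_eqI) (simp add: coeff_map_poly)
    also have "\<dots> = pcompose (map_poly (\<lambda>c. [:c:]) (map_poly to_ac U)) (map_poly (map_poly to_ac) W)"
      unfolding UW(2) by (rule decomposition_map) (unfold_locales; simp)
    finally have "map_poly (map_poly (\<lambda>a. to_ac (to_fract a))) F =
      pcompose (map_poly (\<lambda>c. [:c:]) (map_poly to_ac U)) (map_poly (map_poly to_ac) W)" .
    moreover have "degree (map_poly to_ac U) \<ge> 2" using UW(1) by (simp add: degree_map_poly_inj)
    ultimately show False using assms(11) unfolding indecomposable_def by blast
  qed
  ultimately show ?thesis unfolding indecomposable_def by blast
qed

end
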